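(* Let $A$ be the preprojective algebra of type $\mathrm{D}_n$ ($n\geq4$) over a field $\mathbb{F}$. (i) If $\mathrm{char}(\mathbb{F})=2$, then $\mathrm{HK}^\bullet_{hi}(A)=\mathrm{HK}^\bullet(A)$. (ii) If $\mathrm{char}(\mathbb{F})\neq2$, then $\mathrm{HK}^0_{hi}(A)=\mathrm{HK}^0(A)_{2(n-2)}$ has as basis the $\pi_i$ that are in the centre $Z(A)$, $\mathrm{HK}^2_{hi}(A)=\mathrm{HK}^2(A)$, and $\mathrm{HK}^p_{hi}(A)=0$ if $p\neq0$ and $p\neq2$.
   Context: The algebra. $\overline{Q}$ is the quiver with vertices $0,\ldots,n-1$ and arrows $a_0:0\to2$, $a_1:1\to2$, $a_i:i\to i+1$ for $2\leq i\leq n-2$, together with reversed arrows $a_i^*$; paths are written from right to left. $k=\bigoplus_i\mathbb{F}e_i$, $V=\mathbb{F}\overline{Q}_1$, $k^e=k\otimes_{\mathbb{F}}k$, $A=\mathbb{F}\overline{Q}/(R)$ with $R\subseteq V\otimes_kV$ spanned by $\sigma_0=-a_0^*a_0$, $\sigma_1=-a_1^*a_1$, $\sigma_2=a_0a_0^*+a_1a_1^*-a_2^*a_2$, $\sigma_i=a_{i-1}a_{i-1}^*-a_i^*a_i$ ($3\leq i\leq n-2$), $\sigma_{n-1}=a_{n-2}a_{n-2}^*$. $A$ is graded by path length. Koszul cohomology. $W_0=k$, $W_1=V$, $W_p=\bigcap_{i+2+j=p}V^{\otimes_k i}\otimes_kR\otimes_kV^{\otimes_k j}$ for $p\geq2$;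 elements of $W_p$ are written $x_1\ldots x_p$ (a sum is understood). $\mathrm{HK}^\bullet(A)=H^\bullet(\mathrm{Hom}_{k^e}(W_\bullet,A),b_K)$ with $b_K(f)(x_1\ldots x_{p+1})=f(x_1\ldots x_p)x_{p+1}-(-1)^px_1f(x_2\ldots x_{p+1})$ for $f:W_p\to A$; $\mathrm{HK}^p(A)_r$ is the part represented by cocycles $W_p\to A_r$. The Koszul cup product is induced by $(f\smile g)(x_1\ldots x_{p+q})=(-1)^{pq}f(x_1\ldots x_p)g(x_{p+1}\ldots x_{p+q})$. $\mathrm{HK}^0(A)$ is identified with $Z(A)$. Higher Koszul cohomology. Let $\overline{\mathfrak{e}}_A\in\mathrm{HK}^1(A)$ be the class of the cocycle $\mathfrak{e}_A:V\to A$, $x\mapsto x$; it satisfies $\mathfrak{e}_A\smile\mathfrak{e}_A=0$. $\mathrm{HK}^\bullet_{hi}(A)$ is the cohomology of $(\mathrm{HK}^\bullet(A),\overline{\mathfrak{e}}_A\smile-)$. Equalities such as $\mathrm{HK}^2_{hi}(A)=\mathrm{HK}^2(A)$ are canonical. Socle elements. For each vertex $i$, $\pi_i$ spans the (one-dimensional) weight $2(n-2)$ part of $Ae_i$: $\pi_i=(a_i^*a_i)^{n-i-1}a_{i-1}\cdots a_2a_1a_1^*a_2^*\cdots a_{i-1}^*$ for $2\leq i\leq n-2$, $\pi_{n-1}=a_{n-2}a_{n-3}\cdots a_2a_1a_1^*a_2^*\cdots a_{n-2}^*$, and, with $m=\lfloor\frac{n-2}{2}\rfloor$, $\pi_0=-(a_0^*a_1a_1^*a_0)^m$,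 $\pi_1=(a_1^*a_0a_0^*a_1)^m$ if $n$ is even, $\pi_0=-a_1^*a_0(a_0^*a_1a_1^*a_0)^m$, $\pi_1=a_0^*a_1(a_1^*a_0a_0^*a_1)^m$ if $n$ is odd. The $\pi_i$ in $Z(A)$ are all of them if $n$ is even, and those with $i\geq2$ if $n$ is odd. *)

theory Defs
  imports
    "HOL-Algebra.QuotRing"
    "Jordan_Normal_Form.VS_Connect"
begin

text \<open>
  Vector spaces and algebras over a field type \<open>'f\<close> are \<open>('f, 'a) module\<close> records over
  \<^term>\<open>class_ring\<close>.  Records that are only vector spaces carry meaningless
  \<open>mult\<close> and \<open>one\<close> fields.  In \<open>quot_mod M N\<close> the subset \<open>N\<close> is a two-sided ideal if
  \<open>M\<close> is an algebra, and a subspace otherwise.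
\<close>

definition quot_mod :: "('f, 'a) module \<Rightarrow> 'a set \<Rightarrow> ('f, 'a set) module" where
  "quot_mod M N = ring.extend (M Quot N)
     (module.fields (\<lambda>c X. \<Union>x\<in>X. N +>\<^bsub>M\<^esub> (c \<odot>\<^bsub>M\<^esub> x)))"

abbreviation lin_span :: "('f::field, 'a) module \<Rightarrow> 'a set \<Rightarrow> 'a set" where
  "lin_span M S \<equiv> LinearCombinations.module.span class_ring M S"

abbreviation lin_basis :: "('f::field, 'a) module \<Rightarrow> 'a set \<Rightarrow> bool" where
  "lin_basis M S \<equiv> vectorspace.basis class_ring M S"


section \<open>The double quiver and its path algebra\<close>

text \<open>\<open>Arr i\<close> is $a_i$ and \<open>Star i\<close> is $a_i^*$, for $0 \le i \le n-2$.\<close>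

datatype arrow = Arr nat | Star nat

fun arrow_index :: "arrow \<Rightarrow> nat" where
  "arrow_index (Arr i) = i"
| "arrow_index (Star i) = i"

fun arrow_src :: "arrow \<Rightarrow> nat" where
  "arrow_src (Arr i) = i"
| "arrow_src (Star i) = (if i = 0 then 2 else i + 1)"

fun arrow_tgt :: "arrow \<Rightarrow> nat" where
  "arrow_tgt (Arr i) = (if i = 0 then 2 else i + 1)"
| "arrow_tgt (Star i) = i"

text \<open>
  The path $x_1 x_2 \cdots x_p$, written from right to left (so that it traverses $x_p$ first),
  is the pair of the list \<open>[x\<^sub>1, \<dots>, x\<^sub>p]\<close> and its source vertex; \<open>([], v)\<close> is $e_v$.
\<close>

type_synonym path = "arrow list \<times> nat"

fun path_tgt :: "path \<Rightarrow> nat" where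
  "path_tgt ([], v) = v"
| "path_tgt (x # xs, v) = arrow_tgt x"

fun is_path :: "nat \<Rightarrow> path \<Rightarrow> bool" where
  "is_path n ([], v) \<longleftrightarrow> v < n"
| "is_path n (x # xs, v) \<longleftrightarrow>
     arrow_index x \<le> n - 2 \<and> arrow_src x = path_tgt (xs, v) \<and> is_path n (xs, v)"

definition path_alg :: "nat \<Rightarrow> ('f::field, path \<Rightarrow> 'f) module" where
  "path_alg n =
    \<lparr>carrier = {f. finite {p. f p \<noteq> 0} \<and> (\<forall>p. f p \<noteq> 0 \<longrightarrow> is_path n p)},
     mult = (\<lambda>f g (xs, v). \<Sum>k\<le>length xs.
               f (take k xs, path_tgt (drop k xs, v)) * g (drop k xs, v)),
     one = (\<lambda>(xs, v). if xs = [] \<and> v < n then 1 else 0),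
     zero = (\<lambda>p. 0),
     add = (\<lambda>f g p. f p + g p),
     smult = (\<lambda>c f p. c * f p)\<rparr>"

definition path_elem :: "path \<Rightarrow> path \<Rightarrow> 'f::field" where
  "path_elem q = (\<lambda>p. if p = q then 1 else 0)"

text \<open>
  Since the path algebra is the tensor algebra of $V$ over $k$, its part of degree \<open>d\<close> is
  $V^{\otimes_k d}$, and the tensor product over $k$ of subbimodules of
  $V^{\otimes_k i}$ and $V^{\otimes_k j}$ is the span of the products.
\<close>

definition path_alg_deg :: "nat \<Rightarrow> nat \<Rightarrow> (path \<Rightarrow> 'f::field) set" where
  "path_alg_deg n d = {f \<in> carrier (path_alg n). \<forall>xs v. f (xs, v) \<noteq> 0 \<longrightarrow> length xs = d}"


section \<open>The preprojective algebra\<close>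

definition sigma :: "nat \<Rightarrow> nat \<Rightarrow> path \<Rightarrow> 'f::field" where
  "sigma n i =
    (if i \<le> 1 then \<ominus>\<^bsub>path_alg n\<^esub> path_elem ([Star i, Arr i], i)
     else if i = 2 then
       path_elem ([Arr 0, Star 0], 2) \<oplus>\<^bsub>path_alg n\<^esub> path_elem ([Arr 1, Star 1], 2)
         \<ominus>\<^bsub>path_alg n\<^esub> path_elem ([Star 2, Arr 2], 2)
     else if i \<le> n - 2 then
       path_elem ([Arr (i - 1), Star (i - 1)], i) \<ominus>\<^bsub>path_alg n\<^esub> path_elem ([Star i, Arr i], i)
     else path_elem ([Arr (n - 2), Star (n - 2)], n - 1))"

definition relations :: "nat \<Rightarrow> (path \<Rightarrow> 'f::field) set" where
  "relations n = lin_span (path_alg n) (sigma n ` {..<n})"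

definition rel_ideal :: "nat \<Rightarrow> (path \<Rightarrow> 'f::field) set" where
  "rel_ideal n = Idl\<^bsub>path_alg n\<^esub> (relations n)"

definition preproj :: "nat \<Rightarrow> ('f::field, (path \<Rightarrow> 'f) set) module" where
  "preproj n = quot_mod (path_alg n) (rel_ideal n)"

definition cls :: "nat \<Rightarrow> (path \<Rightarrow> 'f::field) \<Rightarrow> (path \<Rightarrow> 'f) set" where
  "cls n x = rel_ideal n +>\<^bsub>path_alg n\<^esub> x"

definition preproj_deg :: "nat \<Rightarrow> nat \<Rightarrow> (path \<Rightarrow> 'f::field) set set" where
  "preproj_deg n r = cls n ` path_alg_deg n r"

definition centre :: "nat \<Rightarrow> (path \<Rightarrow> 'f::field) set set" where
  "centre n = {z \<in> carrier (preproj n). \<forall>a\<in>carrier (preproj n).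
     z \<otimes>\<^bsub>preproj n\<^esub> a = a \<otimes>\<^bsub>preproj n\<^esub> z}"

text \<open>Each $\pi_i$ is, up to sign, the class of a path with source \<open>i\<close>.\<close>

definition socle_word :: "nat \<Rightarrow> nat \<Rightarrow> arrow list" where
  "socle_word n i = (let m = (n - 2) div 2 in
    if i = 0 then
      (if even n then [] else [Star 1, Arr 0]) @
      concat (replicate m [Star 0, Arr 1, Star 1, Arr 0])
    else if i = 1 then
      (if even n then [] else [Star 0, Arr 1]) @
      concat (replicate m [Star 1, Arr 0, Star 0, Arr 1])
    else if i \<le> n - 2 then
      concat (replicate (n - i - 1) [Star i, Arr i]) @ map Arr (rev [1..<i]) @ map Star [1..<i]
    else map Arr (rev [1..<n - 1]) @ map Star [1..<n - 1])"

definition socle_elem :: "nat \<Rightarrow> nat \<Rightarrow> (path \<Rightarrow> 'f::field) set" where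
  "socle_elem n i =
    (if i = 0 then \<ominus>\<^bsub>preproj n\<^esub> cls n (path_elem (socle_word n i, i))
     else cls n (path_elem (socle_word n i, i)))"


section \<open>Koszul cohomology\<close>

definition W :: "nat \<Rightarrow> nat \<Rightarrow> (path \<Rightarrow> 'f::field) set" where
  "W n p = (if p \<le> 1 then path_alg_deg n p
    else \<Inter>(i, j)\<in>{(i, j). i + 2 + j = p}. lin_span (path_alg n)
      {x \<otimes>\<^bsub>path_alg n\<^esub> r \<otimes>\<^bsub>path_alg n\<^esub> y | x r y.
        x \<in> path_alg_deg n i \<and> r \<in> relations n \<and> y \<in> path_alg_deg n j})"

type_synonym 'f cochain = "(path \<Rightarrow> 'f) \<Rightarrow> (path \<Rightarrow> 'f) set"

text \<open>
  The space $\mathrm{Hom}_{k^e}(W_p, A)$.  Linearity over $k = W_0$ on both sides includes linearity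
  over the field, which acts through the scalar multiples of $1 \in k$.
\<close>

definition cochains :: "nat \<Rightarrow> nat \<Rightarrow> ('f::field, 'f cochain) module" where
  "cochains n p =
    \<lparr>carrier = {f \<in> W n p \<rightarrow>\<^sub>E carrier (preproj n).
       (\<forall>x\<in>W n p. \<forall>y\<in>W n p. f (x \<oplus>\<^bsub>path_alg n\<^esub> y) = f x \<oplus>\<^bsub>preproj n\<^esub> f y) \<and>
       (\<forall>u\<in>W n 0. \<forall>x\<in>W n p.
          f (u \<otimes>\<^bsub>path_alg n\<^esub> x) = cls n u \<otimes>\<^bsub>preproj n\<^esub> f x \<and>
          f (x \<otimes>\<^bsub>path_alg n\<^esub> u) = f x \<otimes>\<^bsub>preproj n\<^esub> cls n u)},
     mult = (\<lambda>f g. \<lambda>w\<in>W n p. \<zero>\<^bsub>preproj n\<^esub>),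
     one = (\<lambda>w\<in>W n p. \<zero>\<^bsub>preproj n\<^esub>),
     zero = (\<lambda>w\<in>W n p. \<zero>\<^bsub>preproj n\<^esub>),
     add = (\<lambda>f g. \<lambda>w\<in>W n p. f w \<oplus>\<^bsub>preproj n\<^esub> g w),
     smult = (\<lambda>c f. \<lambda>w\<in>W n p. c \<odot>\<^bsub>preproj n\<^esub> f w)\<rparr>"

text \<open>
  \<open>split_apply n p q f g w\<close> is the value $f(x_1 \ldots x_p)\, g(x_{p+1} \ldots x_{p+q})$ at
  $w = x_1 \ldots x_{p+q} \in W_{p+q} \subseteq W_p \otimes_k W_q$, where a sum is understood;
  it does not depend on how \<open>w\<close> is written as a sum of products, because \<open>f\<close> and \<open>g\<close> are
  \<open>k\<close>-bimodule maps.
\<close>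

definition split_apply ::
  "nat \<Rightarrow> nat \<Rightarrow> nat \<Rightarrow> 'f::field cochain \<Rightarrow> 'f cochain \<Rightarrow> 'f cochain" where
  "split_apply n p q f g w = (THE y. \<exists>m u v.
     (\<forall>j<m::nat. u j \<in> W n p \<and> v j \<in> W n q) \<and>
     w = (\<Oplus>\<^bsub>path_alg n\<^esub>j\<in>{..<m}. u j \<otimes>\<^bsub>path_alg n\<^esub> v j) \<and>
     y = (\<Oplus>\<^bsub>preproj n\<^esub>j\<in>{..<m}. f (u j) \<otimes>\<^bsub>preproj n\<^esub> g (v j)))"

definition euler :: "nat \<Rightarrow> 'f::field cochain" where
  "euler n = (\<lambda>x\<in>W n 1. cls n x)"

definition koszul_d :: "nat \<Rightarrow> nat \<Rightarrow> 'f::field cochain \<Rightarrow> 'f cochain" where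
  "koszul_d n p f = (\<lambda>w\<in>W n (p + 1). split_apply n p 1 f (euler n) w
     \<ominus>\<^bsub>preproj n\<^esub> ((- 1) ^ p \<odot>\<^bsub>preproj n\<^esub> split_apply n 1 p (euler n) f w))"

definition cup :: "nat \<Rightarrow> nat \<Rightarrow> nat \<Rightarrow> 'f::field cochain \<Rightarrow> 'f cochain \<Rightarrow> 'f cochain" where
  "cup n p q f g =
     (\<lambda>w\<in>W n (p + q). (- 1) ^ (p * q) \<odot>\<^bsub>preproj n\<^esub> split_apply n p q f g w)"

definition cocycles :: "nat \<Rightarrow> nat \<Rightarrow> 'f::field cochain set" where
  "cocycles n p = {f \<in> carrier (cochains n p). koszul_d n p f = \<zero>\<^bsub>cochains n (p + 1)\<^esub>}"

definition coboundaries :: "nat \<Rightarrow> nat \<Rightarrow> 'f::field cochain set" where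
  "coboundaries n p = (case p of
     0 \<Rightarrow> {\<zero>\<^bsub>cochains n 0\<^esub>}
   | Suc q \<Rightarrow> koszul_d n q ` carrier (cochains n q))"

definition HK :: "nat \<Rightarrow> nat \<Rightarrow> ('f::field, 'f cochain set) module" where
  "HK n p = quot_mod ((cochains n p)\<lparr>carrier := cocycles n p\<rparr>) (coboundaries n p)"

definition HK_class :: "nat \<Rightarrow> nat \<Rightarrow> 'f::field cochain \<Rightarrow> 'f cochain set" where
  "HK_class n p f = coboundaries n p +>\<^bsub>cochains n p\<^esub> f"

definition HK_deg :: "nat \<Rightarrow> nat \<Rightarrow> nat \<Rightarrow> 'f::field cochain set set" where
  "HK_deg n p r = HK_class n p ` {f \<in> cocycles n p. f ` W n p \<subseteq> preproj_deg n r}"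

definition HK_cup ::
  "nat \<Rightarrow> nat \<Rightarrow> nat \<Rightarrow> 'f::field cochain set \<Rightarrow> 'f cochain set \<Rightarrow> 'f cochain set" where
  "HK_cup n p q X Y = (\<Union>f\<in>X. \<Union>g\<in>Y. HK_class n (p + q) (cup n p q f g))"

text \<open>The identification of $Z(A)$ with $\mathrm{HK}^0(A)$: a cochain $f : k \to A$ corresponds
  to the element $f(1)$.\<close>

definition HK0_of_central :: "nat \<Rightarrow> (path \<Rightarrow> 'f::field) set \<Rightarrow> 'f cochain set" where
  "HK0_of_central n z = HK_class n 0 (\<lambda>u\<in>W n 0. z \<otimes>\<^bsub>preproj n\<^esub> cls n u)"


section \<open>Higher Koszul cohomology\<close>

definition higher_d :: "nat \<Rightarrow> nat \<Rightarrow> 'f::field cochain set \<Rightarrow> 'f cochain set" where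
  "higher_d n p X = HK_cup n 1 p (HK_class n 1 (euler n)) X"

definition higher_cocycles :: "nat \<Rightarrow> nat \<Rightarrow> 'f::field cochain set set" where
  "higher_cocycles n p = {X \<in> carrier (HK n p). higher_d n p X = \<zero>\<^bsub>HK n (1 + p)\<^esub>}"

definition higher_coboundaries :: "nat \<Rightarrow> nat \<Rightarrow> 'f::field cochain set set" where
  "higher_coboundaries n p = (case p of
     0 \<Rightarrow> {\<zero>\<^bsub>HK n 0\<^esub>}
   | Suc q \<Rightarrow> higher_d n q ` carrier (HK n q))"

definition HK_hi :: "nat \<Rightarrow> nat \<Rightarrow> ('f::field, 'f cochain set set) module" where
  "HK_hi n p =
     quot_mod ((HK n p)\<lparr>carrier := higher_cocycles n p\<rparr>) (higher_coboundaries n p)"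

text \<open>
  The canonical equality $\mathrm{HK}^p_{hi}(A) = U$ for a subspace $U \subseteq \mathrm{HK}^p(A)$:
  the elements of $U$ are cocycles for the higher differential, and sending an element of $U$
  to its higher class is a bijection (it is linear in any case).
\<close>

definition HK_hi_eq :: "nat \<Rightarrow> nat \<Rightarrow> 'f::field cochain set set \<Rightarrow> bool" where
  "HK_hi_eq n p U \<longleftrightarrow> U \<subseteq> higher_cocycles n p \<and>
     bij_betw (\<lambda>X. higher_coboundaries n p +>\<^bsub>HK n p\<^esub> X) U (carrier (HK_hi n p))"

end

(*
  Write P = a_0 a_0^* and Q = a_1 a_1^*.  Modulo the relations, a path of given length and end
  points is a combination of at most two alternating words in P and Q; this gives coordinates on A
  in which the ideal of relations is explicit.  Since W_p = 0 for p >= 3, only HK^0, HK^1 and HK^2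
  matter.  The quiver is bipartite, so in characteristic 2 the Euler derivation e is the commutator
  with the sum of the vertices of one colour: its class, and with it the higher differential,
  vanishes.

  Otherwise the coordinates show that every derivation is Z e plus an inner derivation, with Z
  central.  Hence the cup product with e maps HK^0 onto HK^1, and it vanishes on HK^1 because the
  cup product of e with Z e is zero on the relations and that of inner derivations with cocycles is
  a coboundary.  Finally Z e is inner exactly if Z has top degree 2(n-2), and the top degree of the
  centre is spanned by those pi_i that are loops.
*)
theory Submission
  imports Defs "HOL-Library.Function_Algebras"
begin

section \<open>The path algebra\<close>

text \<open>A cell consists of a target, a source and a length. The relations at all vertices except
  \<open>n - 1\<close> leave the two coordinates of a cell unchanged: they only let loops slide
  along the arm. So normal forms are reached without the last relation, whose effect is measured
  afterwards. It puts the vector (1, 1) into the ideal once a path is long enough to be pushed up to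
  \<open>n - 1\<close>; multiplying by an arrow at 0 or 1 cuts (1, 1) down to a single coordinate.
  Hence a cell is first free, then taken modulo (1, 1), then zero; for loops the last stage begins
  beyond length 2(n-2), which is where this number comes from. Division by 2 is needed in two
  places. The arrows at 0 and at 1 prescribe the same unknown, and the relation at 2 only shows that
  twice the difference vanishes. And the Euler derivation has value 1 on both arrows of an opposite
  pair, where commutators with vertices produce opposite values, so half of a sum has to be taken.
  Cochains are handled through lifts with values in the path algebra, compared up to congruence: a
  lift is linear only modulo the ideal, but sums and products become plain functions.\<close>

declare plus_fun_apply [simp del] zero_fun_apply [simp del] minus_apply [simp del]
  uminus_apply [simp del]

lemmas fun_app = plus_fun_apply zero_fun_apply minus_apply uminus_apply fun_eq_iff

text \<open>The product makes sense for arbitrary functions on paths, so associativity and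
  distributivity need no carrier hypotheses; only closure and the unit laws refer to
  \<open>PC n\<close>.\<close>

definition pmul :: "(path \<Rightarrow> 'f::field) \<Rightarrow> (path \<Rightarrow> 'f) \<Rightarrow> path \<Rightarrow> 'f" (infixl "\<star>" 70) where
  "f \<star> g = (\<lambda>(xs, v). \<Sum>k\<le>length xs. f (take k xs, path_tgt (drop k xs, v)) * g (drop k xs, v))"

definition scl :: "'f::field \<Rightarrow> (path \<Rightarrow> 'f) \<Rightarrow> path \<Rightarrow> 'f" where
  "scl c f = (\<lambda>p. c * f p)"

definition pone :: "nat \<Rightarrow> path \<Rightarrow> 'f::field" where
  "pone n = (\<lambda>(xs, v). if xs = [] \<and> v < n then 1 else 0)"

abbreviation PC :: "nat \<Rightarrow> (path \<Rightarrow> 'f::field) set" where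
  "PC n \<equiv> carrier (path_alg n)"

lemma path_alg_simps [simp]:
  "mult (path_alg n) = (\<star>)"
  "add (path_alg n) = (+)"
  "zero (path_alg n) = 0"
  "one (path_alg n) = pone n"
  "module.smult (path_alg n) = scl"
  by (auto simp: path_alg_def pmul_def scl_def pone_def fun_app)

lemma PC_iff: "x \<in> PC n \<longleftrightarrow> finite {p. x p \<noteq> 0} \<and> (\<forall>p. x p \<noteq> 0 \<longrightarrow> is_path n p)"
  by (simp add: path_alg_def)

lemma path_tgt_append: "path_tgt (xs @ ys, v) = path_tgt (xs, path_tgt (ys, v))"
  by (cases xs) auto

lemma arrow_tgt_less: "3 \<le> n \<Longrightarrow> arrow_index a \<le> n - 2 \<Longrightarrow> arrow_tgt a < n"
  by (cases a) auto

lemma path_tgt_less: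
  assumes "3 \<le> n" "is_path n p" shows "path_tgt p < n"
  using assms by (induction n p rule: is_path.induct) (auto simp: arrow_tgt_less)

lemma is_path_append:
  assumes "3 \<le> n"
  shows "is_path n (xs @ ys, v) \<longleftrightarrow> is_path n (xs, path_tgt (ys, v)) \<and> is_path n (ys, v)"
  by (induction xs) (use assms path_tgt_less in \<open>auto simp: path_tgt_append\<close>)

text \<open>Both sides sum over the ways to cut a list into three pieces; one side chooses the later
  cut first, the other the earlier cut first, and the two triangular index sets are in
  bijection.\<close>

lemma pmul_assoc: "(f \<star> g) \<star> h = f \<star> (g \<star> h)"
proof (intro ext, safe)
  fix xs :: "arrow list" and v
  let ?N = "length xs"
  let ?A = "\<lambda>l k. f (take l xs, path_tgt (drop l xs, v)) *
      g (take (k - l) (drop l xs), path_tgt (drop k xs, v)) * h (drop k xs, v)"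
  have "((f \<star> g) \<star> h) (xs, v) = (\<Sum>k\<le>?N. \<Sum>l\<le>k. ?A l k)"
  proof -
    have "f (take l (take k xs), path_tgt (drop l (take k xs), path_tgt (drop k xs, v))) *
        g (drop l (take k xs), path_tgt (drop k xs, v)) * h (drop k xs, v) = ?A l k"
      if "k \<le> ?N" "l \<le> k" for k l
    proof -
      have "path_tgt (drop l (take k xs), path_tgt (drop k xs, v)) = path_tgt (drop l xs, v)"
        using that by (metis append_take_drop_id drop_append length_take min.absorb2 path_tgt_append
            diff_is_0_eq drop0)
      thus ?thesis using that by (simp add: drop_take min_absorb1)
    qed
    thus ?thesis by (auto simp: pmul_def sum_distrib_right min_absorb2 intro!: sum.cong)
  qed
  also have "\<dots> = (\<Sum>l\<le>?N. \<Sum>k\<le>?N - l. ?A l (l + k))"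
    by (simp add: sum.Sigma)
       (rule sum.reindex_bij_witness[where i = "\<lambda>(l, k). (l + k, l)" and j = "\<lambda>(k, l). (l, k - l)"],
         auto)
  also have "\<dots> = (f \<star> (g \<star> h)) (xs, v)"
    by (auto simp: pmul_def sum_distrib_left mult.assoc add.commute intro!: sum.cong)
  finally show "((f \<star> g) \<star> h) (xs, v) = (f \<star> (g \<star> h)) (xs, v)" .
qed

lemma pmul_add_left: "(f + g) \<star> h = f \<star> h + g \<star> h"
  by (auto simp: pmul_def fun_app distrib_right sum.distrib)

lemma pmul_add_right: "f \<star> (g + h) = f \<star> g + f \<star> h"
  by (auto simp: pmul_def fun_app distrib_left sum.distrib)

lemma pmul_diff_left: "(f - g) \<star> h = f \<star> h - g \<star> h"
  by (auto simp: pmul_def fun_app left_diff_distrib sum_subtractf)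

lemma pmul_diff_right: "f \<star> (g - h) = f \<star> g - f \<star> h"
  by (auto simp: pmul_def fun_app right_diff_distrib sum_subtractf)

lemma pmul_zero_left [simp]: "0 \<star> f = 0"
  by (auto simp: pmul_def fun_app)

lemma pmul_zero_right [simp]: "f \<star> 0 = 0"
  by (auto simp: pmul_def fun_app)

lemma pmul_minus_left: "(- f) \<star> g = - (f \<star> g)"
  by (auto simp: pmul_def fun_app sum_negf)

lemma pmul_minus_right: "f \<star> (- g) = - (f \<star> g)"
  by (auto simp: pmul_def fun_app sum_negf)

lemma pmul_scl_left: "scl c f \<star> g = scl c (f \<star> g)"
  by (auto simp: pmul_def scl_def fun_app sum_distrib_left mult_ac)

lemma pmul_scl_right: "f \<star> scl c g = scl c (f \<star> g)"
  by (auto simp: pmul_def scl_def fun_app sum_distrib_left mult_ac)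

lemma pmul_sum_left: "(\<Sum>s\<in>S. f s) \<star> g = (\<Sum>s\<in>S. f s \<star> g)"
  by (induction S rule: infinite_finite_induct) (simp_all add: pmul_add_left)

lemma pmul_sum_right: "g \<star> (\<Sum>s\<in>S. f s) = (\<Sum>s\<in>S. g \<star> f s)"
  by (induction S rule: infinite_finite_induct) (simp_all add: pmul_add_right)

lemma scl_simps:
  "scl c (f + g) = scl c f + scl c g"
  "scl c (f - g) = scl c f - scl c g"
  "scl (c + d) f = scl c f + scl d f"
  "scl (c * d) f = scl c (scl d f)"
  "scl (- c) f = - scl c f"
  by (auto simp: scl_def fun_app algebra_simps)

lemma scl_basic [simp]: "scl 0 f = 0" "scl 1 f = f" "scl c 0 = 0"
  by (auto simp: scl_def fun_app)

lemma scl_apply: "scl c f p = c * f p"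
  by (simp add: scl_def)

lemma scl_sum: "scl c (\<Sum>s\<in>S. f s) = (\<Sum>s\<in>S. scl c (f s))"
  by (induction S rule: infinite_finite_induct) (simp_all add: scl_simps)

lemma sum_fun_apply: "(\<Sum>s\<in>S. f s) p = (\<Sum>s\<in>S. f s p)"
  by (induction S rule: infinite_finite_induct) (auto simp: fun_app)

lemma path_elem_same [simp]: "path_elem p p = 1"
  by (simp add: path_elem_def)

lemma path_elem_mult:
  "path_elem (xs, v) \<star> path_elem (ys, w) =
    (if v = path_tgt (ys, w) then path_elem (xs @ ys, w) else (0 :: path \<Rightarrow> 'f::field))"
proof (intro ext, safe)
  fix zs u
  have "(path_elem (xs, v) \<star> path_elem (ys, w)) (zs, u) =
    (\<Sum>k\<le>length zs. if k = length xs then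
      (if zs = xs @ ys \<and> u = w \<and> v = path_tgt (ys, w) then 1 else 0) else (0::'f))"
    unfolding pmul_def prod.case
  proof (intro sum.cong refl)
    fix k assume "k \<in> {..length zs}"
    hence len: "length (take k zs) = k" by simp
    have split: "zs = take k zs @ drop k zs" by simp
    show "path_elem (xs, v) (take k zs, path_tgt (drop k zs, u)) * path_elem (ys, w) (drop k zs, u) =
      (if k = length xs then
      (if zs = xs @ ys \<and> u = w \<and> v = path_tgt (ys, w) then 1 else 0) else (0::'f))"
    proof (cases "k = length xs \<and> zs = xs @ ys")
      case True
      thus ?thesis by (simp add: path_elem_def)
    next
      case False
      hence "\<not> (take k zs = xs \<and> drop k zs = ys)" using len split by metis
      thus ?thesis using False by (auto simp: path_elem_def)
    qed
  qed
  also have "\<dots> = (if v = path_tgt (ys, w) then path_elem (xs @ ys, w) else (0 :: path \<Rightarrow> 'f)) (zs, u)"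
    by (simp add: path_elem_def zero_fun_apply)
  finally show "(path_elem (xs, v) \<star> path_elem (ys, w)) (zs, u) =
    (if v = path_tgt (ys, w) then path_elem (xs @ ys, w) else (0 :: path \<Rightarrow> 'f)) (zs, u)" .
qed

lemma PC_add [intro, simp]: assumes "x \<in> PC n" "y \<in> PC n" shows "x + y \<in> PC n"
proof -
  have "{p. (x + y) p \<noteq> 0} \<subseteq> {p. x p \<noteq> 0} \<union> {p. y p \<noteq> 0}" by (auto simp: fun_app)
  thus ?thesis using assms by (auto simp: PC_iff intro: finite_subset)
qed

lemma PC_zero [intro, simp]: "0 \<in> PC n"
  by (simp add: PC_iff fun_app)

lemma PC_scl [intro, simp]: "x \<in> PC n \<Longrightarrow> scl c x \<in> PC n"
  by (auto simp: PC_iff scl_apply elim: rev_finite_subset)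

lemma scl_minus_one: "scl (- 1) x = - x"
  by (auto simp: scl_def fun_app)

lemma PC_minus [intro, simp]: "x \<in> PC n \<Longrightarrow> - x \<in> PC n"
  using PC_scl[of x n "- 1"] by (simp add: scl_minus_one)

lemma PC_diff [intro, simp]: "x \<in> PC n \<Longrightarrow> y \<in> PC n \<Longrightarrow> x - y \<in> PC n"
  using PC_add[OF _ PC_minus, of x n y] by simp

lemma PC_sum [intro, simp]: "(\<And>s. s \<in> S \<Longrightarrow> f s \<in> PC n) \<Longrightarrow> (\<Sum>s\<in>S. f s) \<in> PC n"
  by (induction S rule: infinite_finite_induct) auto

lemma PC_path_elem [intro, simp]: "is_path n p \<Longrightarrow> path_elem p \<in> PC n"
  by (auto simp: PC_iff path_elem_def)

text \<open>Induction over a finite set that covers the support, removing one path at a time. The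
  step has the shape of one scaled path plus a remainder, so linear identities reduce to their
  validity on paths.\<close>

lemma PC_induct [consumes 1, case_names zero step]:
  assumes "x \<in> PC n" "P 0"
    "\<And>c p x. is_path n p \<Longrightarrow> x \<in> PC n \<Longrightarrow> P x \<Longrightarrow> P (scl c (path_elem p) + x)"
  shows "P x"
proof -
  have "\<forall>x \<in> PC n. {p. x p \<noteq> 0} \<subseteq> S \<longrightarrow> P x" if "finite S" for S
    using that
  proof induction
    case empty
    have "x = 0" if "{p. x p \<noteq> 0} = {}" for x :: "path \<Rightarrow> 'a" using that by (auto simp: fun_app)
    thus ?case using assms(2) by auto
  next
    case (insert q S)
    show ?case
    proof safe
      fix x :: "path \<Rightarrow> 'a" assume x: "x \<in> PC n" "{p. x p \<noteq> 0} \<subseteq> insert q S"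
      let ?y = "x(q := 0)"
      have eq: "x = scl (x q) (path_elem q) + ?y"
        by (auto simp: fun_app path_elem_def scl_apply)
      have "{p. ?y p \<noteq> 0} \<subseteq> {p. x p \<noteq> 0}" by auto
      with x have y: "?y \<in> PC n" by (auto simp: PC_iff intro: finite_subset)
      have "{p. ?y p \<noteq> 0} \<subseteq> S" using x by auto
      with y insert.IH have "P ?y" by blast
      \<comment> \<open>A member of the covering set that is not a path has coefficient 0, so
        removing it changes nothing and no step is made.\<close>
      moreover have "x = ?y" if "\<not> is_path n q" using that x by (auto simp: PC_iff fun_app)
      ultimately show "P x" using eq assms(3)[of q ?y "x q"] y by metis
    qed
  qed
  moreover have "finite {p. x p \<noteq> 0}" using assms(1) by (simp add: PC_iff)
  ultimately show ?thesis using assms(1) by blast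
qed

lemma PC_mult [intro, simp]:
  assumes "3 \<le> n" "x \<in> PC n" "y \<in> PC n" shows "x \<star> y \<in> PC n"
  using assms(2)
proof (induction rule: PC_induct)
  case (step c p x)
  have "path_elem p \<star> y \<in> PC n" using assms(3)
  proof (induction rule: PC_induct)
    case (step d q y)
    have "path_elem p \<star> path_elem q \<in> (PC n :: (path \<Rightarrow> 'a) set)"
    proof -
      obtain xs v ys w where pq: "p = (xs, v)" "q = (ys, w)" by (cases p; cases q)
      have "v = path_tgt (ys, w) \<Longrightarrow> is_path n (xs @ ys, w)"
        using \<open>is_path n p\<close> \<open>is_path n q\<close> assms(1) by (simp add: pq is_path_append)
      thus ?thesis by (simp add: pq path_elem_mult)
    qed
    thus ?case using step by (simp add: pmul_add_right pmul_scl_right)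
  qed simp
  with step show ?case by (simp add: pmul_add_left pmul_scl_left)
qed simp

lemma pone_eq: "pone n = (\<Sum>v<n. path_elem ([], v))"
  by (auto simp: pone_def path_elem_def sum_fun_apply fun_app)

lemma PC_pone [intro, simp]: "pone n \<in> PC n"
  by (auto simp: pone_eq)

lemma pone_left [simp]:
  assumes "3 \<le> n" "x \<in> PC n" shows "pone n \<star> x = x"
  using assms(2)
proof (induction rule: PC_induct)
  case (step c p x)
  have "(\<Sum>v<n. path_elem ([], v) \<star> path_elem p) = (path_elem p :: path \<Rightarrow> 'a)"
    using path_tgt_less[OF assms(1) step(1)]
    by (cases p) (simp add: path_elem_mult)
  thus ?case using step by (simp add: pmul_add_right pmul_scl_right pone_eq pmul_sum_left scl_sum [symmetric])
qed simp

lemma is_path_source: "is_path n (xs, v) \<Longrightarrow> v < n"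
  by (induction xs) auto

lemma pone_right [simp]:
  assumes "3 \<le> n" "x \<in> PC n" shows "x \<star> pone n = x"
  using assms(2)
proof (induction rule: PC_induct)
  case (step c p x)
  obtain xs v where p: "p = (xs, v)" by (cases p)
  have "(\<Sum>v<n. path_elem p \<star> path_elem ([], v)) = (path_elem p :: path \<Rightarrow> 'a)"
    using is_path_source step(1) by (simp add: p path_elem_mult)
  thus ?case using step by (simp add: pmul_add_left pmul_scl_left pone_eq pmul_sum_right scl_sum [symmetric])
qed simp

lemma path_alg_abelian_group: "abelian_group (path_alg n)"
proof (rule abelian_groupI)
  fix x :: "path \<Rightarrow> 'a" assume "x \<in> PC n"
  thus "\<exists>y\<in>PC n. y \<oplus>\<^bsub>path_alg n\<^esub> x = \<zero>\<^bsub>path_alg n\<^esub>"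
    by (intro bexI[of _ "- x"]) auto
qed (auto simp: add_ac)

lemma path_alg_ring: assumes "3 \<le> n" shows "ring (path_alg n)"
proof (rule ringI)
  show "abelian_group (path_alg n)" by (rule path_alg_abelian_group)
  show "Group.monoid (path_alg n)"
    by (rule monoidI) (use assms in \<open>simp_all add: pmul_assoc\<close>)
qed (simp_all add: pmul_add_left pmul_add_right)

lemma path_alg_module: "module class_ring (path_alg n)"
  by (rule moduleI) (auto simp: scl_simps class_cring.is_cring path_alg_abelian_group)

lemma path_alg_uminus: "x \<in> PC n \<Longrightarrow> \<ominus>\<^bsub>path_alg n\<^esub> x = - x"
proof -
  interpret abelian_group "path_alg n" by (rule path_alg_abelian_group)
  assume "x \<in> PC n"
  thus ?thesis by (intro minus_equality) auto
qed

lemma path_alg_minus: "x \<in> PC n \<Longrightarrow> y \<in> PC n \<Longrightarrow> x \<ominus>\<^bsub>path_alg n\<^esub> y = x - y"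
  by (simp add: a_minus_def path_alg_uminus)

lemma path_alg_finsum:
  assumes "\<And>s. s \<in> S \<Longrightarrow> f s \<in> PC n"
  shows "(\<Oplus>\<^bsub>path_alg n\<^esub>s\<in>S. f s) = (\<Sum>s\<in>S. f s)"
proof -
  interpret abelian_group "path_alg n" by (rule path_alg_abelian_group)
  show ?thesis using assms
    by (induction S rule: infinite_finite_induct) (simp_all add: finsum_insert)
qed

section \<open>Coordinates\<close>

text \<open>A height for which every \<open>Arr\<close> goes up by one and every \<open>Star\<close>
  goes down by one. Vertices 0 and 1 must share height 1, as both are joined to 2.\<close>

definition lev :: "nat \<Rightarrow> nat" where
  "lev i = max 1 i"

text \<open>The colour \<open>False\<close> belongs to vertex 0 and to P, the colour
  \<open>True\<close> to vertex 1 and to Q; vertices on the arm admit both.\<close>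

definition compat :: "nat \<Rightarrow> bool \<Rightarrow> bool" where
  "compat i c \<longleftrightarrow> 2 \<le> i \<or> c = (i = 1)"

text \<open>
  At the vertex 2 the relations read $P^2 = Q^2 = 0$ and $P + Q = a_2^* a_2$, where
  $P = a_0 a_0^*$ and $Q = a_1 a_1^*$.  The two coordinates \<open>val p False\<close> and \<open>val p True\<close> of a path
  \<open>p\<close> refer to the alternating words $PQP\cdots$ and $QPQ\cdots$ with as many factors as
  \<open>p\<close> has starred arrows; the empty word counts as the sum of both.
\<close>

fun val :: "path \<Rightarrow> bool \<Rightarrow> 'f::field" where
  "val ([], v) c = of_bool (compat v c)"
| "val (Arr i # xs, v) c = val (xs, v) c"
| "val (Star i # xs, v) c = (if compat i c then val (xs, v) (\<not> c) else 0)"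

fun stars :: "arrow list \<Rightarrow> nat" where
  "stars [] = 0"
| "stars (Arr i # xs) = stars xs"
| "stars (Star i # xs) = Suc (stars xs)"

text \<open>The number of starred arrows on a path from \<open>j\<close> to \<open>i\<close> of
  length \<open>l\<close>, obtained by balancing ascents and descents of the height.\<close>

definition nstars :: "nat \<Rightarrow> nat \<Rightarrow> nat \<Rightarrow> nat" where
  "nstars i j l = (l + lev j - lev i) div 2"

lemma lev_tgt_Arr [simp]: "lev (arrow_tgt (Arr i)) = lev i + 1"
  by (auto simp: lev_def)

lemma lev_src_Star [simp]: "lev (arrow_src (Star i)) = lev i + 1"
  by (auto simp: lev_def)

lemma stars_path: "is_path n (xs, j) \<Longrightarrow> 2 * stars xs + lev (path_tgt (xs, j)) = length xs + lev j"
proof (induction xs)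
  case (Cons a xs)
  hence IH: "2 * stars xs + lev (arrow_src a) = length xs + lev j" by simp
  show ?case
  proof (cases a)
    case (Arr i)
    show ?thesis using IH lev_tgt_Arr[of i] unfolding Arr by (simp del: lev_tgt_Arr arrow_tgt.simps)
  next
    case (Star i)
    show ?thesis using IH lev_src_Star[of i] unfolding Star by (simp del: lev_src_Star arrow_src.simps)
  qed
qed simp

lemma nstars_path:
  assumes "is_path n (xs, j)"
  shows "nstars (path_tgt (xs, j)) j (length xs) = stars xs"
  using stars_path[OF assms] by (simp add: nstars_def)

definition paths :: "nat \<Rightarrow> nat \<Rightarrow> nat \<Rightarrow> nat \<Rightarrow> path set" where
  "paths n i j l = {(xs, v). v = j \<and> is_path n (xs, v) \<and> path_tgt (xs, v) = i \<and> length xs = l}"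

lemma arrow_index_path: "is_path n (xs, v) \<Longrightarrow> set xs \<subseteq> {a. arrow_index a \<le> n - 2}"
  by (induction xs) auto

lemma finite_arrows: "finite {a. arrow_index a \<le> m}"
proof -
  have "{a. arrow_index a \<le> m} \<subseteq> Arr ` {..m} \<union> Star ` {..m}"
  proof
    fix a assume "a \<in> {a. arrow_index a \<le> m}"
    thus "a \<in> Arr ` {..m} \<union> Star ` {..m}" by (cases a) auto
  qed
  thus ?thesis by (rule finite_subset) auto
qed

lemma finite_paths [simp, intro]: "finite (paths n i j l)"
proof -
  have "paths n i j l \<subseteq> (\<lambda>xs. (xs, j)) ` {xs. set xs \<subseteq> {a. arrow_index a \<le> n - 2} \<and> length xs = l}"
    using arrow_index_path by (fastforce simp: paths_def)
  thus ?thesis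
    using finite_lists_length_eq[OF finite_arrows] by (meson finite_imageI finite_subset)
qed

text \<open>Paths with the same ends and length have the same number of starred arrows, so their
  values refer to the same two alternating words and may be added up.\<close>

definition coord :: "nat \<Rightarrow> (path \<Rightarrow> 'f::field) \<Rightarrow> nat \<Rightarrow> nat \<Rightarrow> nat \<Rightarrow> bool \<Rightarrow> 'f" where
  "coord n x i j l = (\<lambda>c. \<Sum>p\<in>paths n i j l. x p * val p c)"

lemma coord_zero [simp]: "coord n 0 i j l = 0"
  by (simp add: coord_def fun_app)

lemma coord_add: "coord n (x + y) i j l = coord n x i j l + coord n y i j l"
  by (simp add: coord_def fun_app distrib_right sum.distrib)

lemma coord_minus: "coord n (- x) i j l = - coord n x i j l"
  by (simp add: coord_def fun_app sum_negf)

lemma coord_diff: "coord n (x - y) i j l = coord n x i j l - coord n y i j l"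
  by (simp add: coord_def fun_app left_diff_distrib sum_subtractf)

lemma coord_scl: "coord n (scl c x) i j l = (\<lambda>b. c * coord n x i j l b)"
  by (simp add: coord_def fun_app scl_apply sum_distrib_left mult.assoc)

lemma coord_sum: "coord n (\<Sum>s\<in>S. f s) i j l = (\<Sum>s\<in>S. coord n (f s) i j l)"
  by (induction S rule: infinite_finite_induct) (simp_all add: coord_add)

lemma coord_path_elem:
  "coord n (path_elem p) i j l = (if p \<in> paths n i j l then val p else 0)"
proof -
  have "(\<Sum>q\<in>paths n i j l. path_elem p q * val q c) =
    (\<Sum>q\<in>paths n i j l. if q = p then val p c else (0::'f::field))" for c
    by (rule sum.cong) (auto simp: path_elem_def)
  thus ?thesis by (auto simp: coord_def fun_app)
qed

lemma vscl_zero [simp]: "(\<lambda>b. c * (0 :: bool \<Rightarrow> 'f::field) b) = 0"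
  by (simp add: fun_app)

text \<open>Left multiplication in coordinates. A \<open>Star\<close> prepends a letter, which must
  differ from the first letter of the rest because P P and Q Q vanish, and which is prescribed if
  the arrow ends at 0 or 1. An \<open>Arr\<close> prepends none.\<close>

definition Lmap :: "arrow \<Rightarrow> (bool \<Rightarrow> 'f::field) \<Rightarrow> bool \<Rightarrow> 'f" where
  "Lmap a v = (case a of Arr i \<Rightarrow> v | Star i \<Rightarrow> (\<lambda>c. if compat i c then v (\<not> c) else 0))"

text \<open>Right multiplication is not the mirror image of \<open>Lmap\<close>, because coordinates
  are indexed by the first letter. Appending \<open>Star\<close> leaves that letter alone; appending
  \<open>Arr j\<close> at 0 or 1 constrains the letter that would come next, whose colour is the
  first one flipped once per starred arrow.\<close>

definition Rmap :: "arrow \<Rightarrow> nat \<Rightarrow> nat \<Rightarrow> (bool \<Rightarrow> 'f::field) \<Rightarrow> bool \<Rightarrow> 'f" where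
  "Rmap a i l v = (case a of Star j \<Rightarrow> v
     | Arr j \<Rightarrow> (\<lambda>c. if compat j (c \<noteq> odd (nstars i j l)) then v c else 0))"

lemma Lmap_linear:
  "Lmap a (v + w) = Lmap a v + Lmap a w" "Lmap a (\<lambda>b. c * v b) = (\<lambda>b. c * Lmap a v b)" "Lmap a 0 = 0"
  by (auto simp: Lmap_def fun_app split: arrow.splits)

lemma Rmap_linear:
  "Rmap a i l (v + w) = Rmap a i l v + Rmap a i l w"
  "Rmap a i l (\<lambda>b. c * v b) = (\<lambda>b. c * Rmap a i l v b)" "Rmap a i l 0 = 0"
  by (auto simp: Rmap_def fun_app split: arrow.splits)

lemma val_Cons: "val (a # xs, v) = Lmap a (val (xs, v))"
  by (cases a) (auto simp: Lmap_def fun_eq_iff)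

lemma val_snoc_Star: "val (xs @ [Star j], arrow_src (Star j)) = val (xs, j)"
proof (induction xs)
  case Nil
  show ?case by (auto simp: fun_eq_iff compat_def)
qed (simp only: append_Cons val_Cons)

lemma val_snoc_Arr:
  "val (xs @ [Arr j], j) c =
    (if compat j (c \<noteq> odd (stars xs)) then val (xs, arrow_tgt (Arr j)) c else 0)"
proof (induction xs arbitrary: c)
  case Nil
  show ?case by (auto simp: compat_def)
next
  case (Cons a xs)
  show ?case by (cases a; cases c; cases "even (stars xs)") (simp_all add: Cons)
qed

abbreviation arr :: "arrow \<Rightarrow> path \<Rightarrow> 'f::field" where
  "arr a \<equiv> path_elem ([a], arrow_src a)"

abbreviation vtx :: "nat \<Rightarrow> path \<Rightarrow> 'f::field" where
  "vtx v \<equiv> path_elem ([], v)"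

lemma is_path_snoc:
  assumes "3 \<le> n"
  shows "is_path n (xs @ [a], v) \<longleftrightarrow>
    is_path n (xs, arrow_tgt a) \<and> arrow_index a \<le> n - 2 \<and> arrow_src a = v \<and> v < n"
  using assms by (auto simp: is_path_append)

lemma coord_left:
  assumes "x \<in> PC n" "arrow_index a \<le> n - 2"
  shows "coord n (arr a \<star> x) i j l =
    (if i = arrow_tgt a \<and> 0 < l then Lmap a (coord n x (arrow_src a) j (l - 1)) else 0)"
  using assms(1)
proof (induction rule: PC_induct)
  case zero
  show ?case by (simp add: Lmap_linear)
next
  case (step c p x)
  obtain xs v where p: "p = (xs, v)" by (cases p)
  have "coord n (arr a \<star> path_elem p) i j l =
    (if i = arrow_tgt a \<and> 0 < l then
      Lmap a (coord n (path_elem p :: path \<Rightarrow> 'a) (arrow_src a) j (l - 1)) else 0)"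
    using step(1) assms(2)
    by (auto simp: p path_elem_mult coord_path_elem paths_def val_Cons Lmap_linear)
  thus ?case using step(3)
    by (simp add: pmul_add_right pmul_scl_right coord_add coord_scl Lmap_linear)
qed

lemma arrow_src_less: "3 \<le> n \<Longrightarrow> arrow_index a \<le> n - 2 \<Longrightarrow> arrow_src a < n"
  by (cases a) auto

lemma coord_right:
  assumes "x \<in> PC n" "arrow_index a \<le> n - 2" "3 \<le> n"
  shows "coord n (x \<star> arr a) i j l =
    (if j = arrow_src a \<and> 0 < l then Rmap a i l (coord n x i (arrow_tgt a) (l - 1)) else 0)"
  using assms(1)
proof (induction rule: PC_induct)
  case zero
  show ?case by (simp add: Rmap_linear)
next
  case (step c p x)
  obtain xs v where p: "p = (xs, v)" by (cases p)
  have "val (xs @ [a], arrow_src a) = Rmap a (path_tgt (xs, v)) (Suc (length xs)) (val (xs, v))"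
    if "v = arrow_tgt a"
  proof (cases a)
    case (Star k)
    thus ?thesis using val_snoc_Star[of xs k] that by (simp add: Rmap_def)
  next
    case (Arr k)
    have "nstars (path_tgt (xs, v)) k (Suc (length xs)) = nstars (path_tgt (xs, v)) v (length xs)"
      using Arr that lev_tgt_Arr[of k] by (simp add: nstars_def del: lev_tgt_Arr)
    also have "\<dots> = stars xs" using step(1) by (simp add: p nstars_path)
    finally show ?thesis using Arr that by (auto simp: Rmap_def val_snoc_Arr)
  qed
  hence "coord n (path_elem p \<star> arr a) i j l =
    (if j = arrow_src a \<and> 0 < l then
      Rmap a i l (coord n (path_elem p :: path \<Rightarrow> 'a) i (arrow_tgt a) (l - 1)) else 0)"
    using step(1) assms(2,3) arrow_src_less[OF assms(3,2)]
    by (auto simp: p path_elem_mult coord_path_elem paths_def Rmap_linear is_path_snoc path_tgt_append)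
  thus ?case using step(3)
    by (simp add: pmul_add_left pmul_scl_left coord_add coord_scl Rmap_linear)
qed

lemma coord_vtx_left:
  assumes "x \<in> PC n"
  shows "coord n (vtx v \<star> x) i j l = (if i = v then coord n x i j l else 0)"
  using assms
proof (induction rule: PC_induct)
  case (step c p x)
  obtain xs w where p: "p = (xs, w)" by (cases p)
  have "coord n (vtx v \<star> path_elem p) i j l =
    (if i = v then coord n (path_elem p :: path \<Rightarrow> 'a) i j l else 0)"
    by (auto simp: p path_elem_mult coord_path_elem paths_def)
  thus ?case using step(3)
    by (simp add: pmul_add_right pmul_scl_right coord_add coord_scl)
qed simp

lemma coord_vtx_right:
  assumes "x \<in> PC n"
  shows "coord n (x \<star> vtx v) i j l = (if j = v then coord n x i j l else 0)"
  using assms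
proof (induction rule: PC_induct)
  case (step c p x)
  obtain xs w where p: "p = (xs, w)" by (cases p)
  have "coord n (path_elem p \<star> vtx v) i j l =
    (if j = v then coord n (path_elem p :: path \<Rightarrow> 'a) i j l else 0)"
    by (auto simp: p path_elem_mult coord_path_elem paths_def)
  thus ?case using step(3)
    by (simp add: pmul_add_left pmul_scl_left coord_add coord_scl)
qed simp

text \<open>The possible values of the coordinates of an element of the ideal at \<open>(i, j, l)\<close>.\<close>

definition quo :: "nat \<Rightarrow> nat \<Rightarrow> nat \<Rightarrow> nat \<Rightarrow> (bool \<Rightarrow> 'f::field) \<Rightarrow> bool" where
  "quo n i j l v \<longleftrightarrow> 2 * n + lev j < l + lev i + 4 \<or> 2 * n + lev i < l + lev j + 4 \<or>
     v True = v False \<and> (2 * n < l + lev i + lev j + 2 \<or> v False = 0)"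

lemma quo_zero [simp]: "quo n i j l 0"
  by (simp add: quo_def fun_app)

lemma quo_add: "quo n i j l v \<Longrightarrow> quo n i j l w \<Longrightarrow> quo n i j l (v + w)"
  by (auto simp: quo_def fun_app)

lemma quo_minus: "quo n i j l v \<Longrightarrow> quo n i j l (- v)"
  by (auto simp: quo_def fun_app)

lemma quo_scl: "quo n i j l v \<Longrightarrow> quo n i j l (\<lambda>b. c * v b)"
  by (auto simp: quo_def)

lemma lev_ge: "1 \<le> lev i"
  by (simp add: lev_def)

lemma compat_lev: "compat i b \<or> lev i = 1" "lev i \<noteq> 1 \<Longrightarrow> compat i b"
  by (auto simp: compat_def lev_def max_def split: if_splits)

text \<open>The delicate case is \<open>Star i\<close> ending at height 1: it keeps one coordinate
  of a diagonal vector and so leaves the diagonal. The bound that admits the diagonal in the old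
  cell is then exactly the bound that makes the new cell full.\<close>

lemma quo_Lmap:
  assumes "quo n (arrow_src a) j l v"
  shows "quo n (arrow_tgt a) j (Suc l) (Lmap a v)"
proof (cases a)
  case (Arr i)
  show ?thesis using assms lev_tgt_Arr[of i] unfolding Arr
    by (auto simp: quo_def Lmap_def simp del: lev_tgt_Arr)
next
  case (Star i)
  have "lev i = 1 \<or> (\<forall>b. compat i b)" using compat_lev by blast
  thus ?thesis using assms lev_src_Star[of i] lev_ge[of j] unfolding Star
    by (auto simp: quo_def Lmap_def simp del: lev_src_Star)
qed

lemma quo_Rmap:
  assumes "quo n i (arrow_tgt a) l v"
  shows "quo n i (arrow_src a) (Suc l) (Rmap a i (Suc l) v)"
proof (cases a)
  case (Star j)
  show ?thesis using assms lev_src_Star[of j] unfolding Star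
    by (auto simp: quo_def Rmap_def simp del: lev_src_Star)
next
  case (Arr j)
  have "lev j = 1 \<or> (\<forall>b. compat j b)" using compat_lev by blast
  thus ?thesis using assms lev_tgt_Arr[of j] lev_ge[of i] unfolding Arr
    by (auto simp: quo_def Rmap_def simp del: lev_tgt_Arr)
qed

text \<open>The ideal as predicted by the coordinates. That it is an ideal containing the relations
  follows from \<open>quo_Lmap\<close>, \<open>quo_Rmap\<close> and the values of the relations; the
  reverse inclusion needs normal forms.\<close>

definition Jset :: "nat \<Rightarrow> (path \<Rightarrow> 'f::field) set" where
  "Jset n = {x \<in> PC n. \<forall>i j l. quo n i j l (coord n x i j l)}"

locale type_D =
  fixes n :: nat
  assumes n4: "4 \<le> n"
begin

lemma n3 [simp]: "3 \<le> n"
  using n4 by simp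

lemma J_add: "x \<in> Jset n \<Longrightarrow> y \<in> Jset n \<Longrightarrow> x + y \<in> Jset n"
  by (auto simp: Jset_def coord_add intro: quo_add)

lemma J_zero: "0 \<in> Jset n"
  by (auto simp: Jset_def)

lemma J_minus: "x \<in> Jset n \<Longrightarrow> - x \<in> Jset n"
  by (auto simp: Jset_def coord_minus intro: quo_minus)

lemma J_scl: "x \<in> Jset n \<Longrightarrow> scl c x \<in> Jset n"
  by (auto simp: Jset_def coord_scl intro: quo_scl)

lemma PC_arr [simp, intro]: "arrow_index a \<le> n - 2 \<Longrightarrow> arr a \<in> PC n"
  by (rule PC_path_elem) (use arrow_src_less[of n a] in auto)

lemma PC_vtx [simp, intro]: "v < n \<Longrightarrow> vtx v \<in> PC n"
  by (rule PC_path_elem) auto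

lemma J_arr_left:
  assumes "x \<in> Jset n" "arrow_index a \<le> n - 2" shows "arr a \<star> x \<in> Jset n"
proof -
  have x: "x \<in> PC n" "\<And>i j l. quo n i j l (coord n x i j l)" using assms by (auto simp: Jset_def)
  have "quo n i j l (coord n (arr a \<star> x) i j l)" for i j l
    using quo_Lmap[of n a j "l - 1", OF x(2)] by (cases l) (simp_all add: coord_left[OF x(1) assms(2)])
  thus ?thesis using x assms by (simp add: Jset_def)
qed

lemma J_arr_right:
  assumes "x \<in> Jset n" "arrow_index a \<le> n - 2" shows "x \<star> arr a \<in> Jset n"
proof -
  have x: "x \<in> PC n" "\<And>i j l. quo n i j l (coord n x i j l)" using assms by (auto simp: Jset_def)
  have "quo n i j l (coord n (x \<star> arr a) i j l)" for i j l
    using quo_Rmap[of n i a "l - 1", OF x(2)] by (cases l) (simp_all add: coord_right[OF x(1) assms(2)])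
  thus ?thesis using x assms by (simp add: Jset_def)
qed

lemma J_vtx: "x \<in> Jset n \<Longrightarrow> v < n \<Longrightarrow> vtx v \<star> x \<in> Jset n" "x \<in> Jset n \<Longrightarrow> v < n \<Longrightarrow> x \<star> vtx v \<in> Jset n"
  by (auto simp: Jset_def coord_vtx_left coord_vtx_right)

lemma J_PC: "x \<in> Jset n \<Longrightarrow> x \<in> PC n"
  by (simp add: Jset_def)

lemma J_left:
  assumes "x \<in> Jset n" "y \<in> PC n" shows "y \<star> x \<in> Jset n"
  using assms(2)
proof (induction rule: PC_induct)
  case (step c p y)
  have "path_elem (xs, v) \<star> x \<in> Jset n" if "is_path n (xs, v)" for xs v
    using that
  proof (induction xs)
    case (Cons a xs)
    thus ?case using J_arr_left[of "path_elem (xs, v) \<star> x" a] by (simp add: path_elem_mult flip: pmul_assoc)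
  qed (use assms J_vtx in auto)
  hence "path_elem p \<star> x \<in> Jset n" using step(1) by (cases p) auto
  with step show ?case by (simp add: pmul_add_left pmul_scl_left J_add J_scl)
qed (simp add: J_zero)

lemma path_elem_snoc:
  "is_path n (xs @ [a], v) \<Longrightarrow> path_elem (xs @ [a], v) = path_elem (xs, arrow_tgt a) \<star> arr a"
  by (simp add: path_elem_mult is_path_snoc)

lemma J_right:
  assumes "x \<in> Jset n" "y \<in> PC n" shows "x \<star> y \<in> Jset n"
  using assms(2)
proof (induction rule: PC_induct)
  case (step c p y)
  have "x \<star> path_elem (xs, v) \<in> Jset n" if "is_path n (xs, v)" for xs v
    using that
  proof (induction xs arbitrary: v rule: rev_induct)
    case Nil
    thus ?case using assms J_vtx by simp
  next
    case (snoc a xs)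
    hence p: "is_path n (xs, arrow_tgt a)" "arrow_index a \<le> n - 2" by (simp_all add: is_path_snoc)
    show ?case
      using J_arr_right[OF snoc.IH[OF p(1)] p(2)] snoc.prems by (simp add: path_elem_snoc pmul_assoc)
  qed
  hence "x \<star> path_elem p \<in> Jset n" using step(1) by (cases p) auto
  with step show ?case by (simp add: pmul_add_right pmul_scl_right J_add J_scl)
qed (simp add: J_zero)

lemma J_ideal: "ideal (Jset n :: (path \<Rightarrow> 'f::field) set) (path_alg n)"
proof (rule idealI)
  show "ring (path_alg n :: ('f, path \<Rightarrow> 'f) module)" by (rule path_alg_ring) simp
  interpret abelian_group "path_alg n :: ('f, path \<Rightarrow> 'f) module" by (rule path_alg_abelian_group)
  show "subgroup (Jset n :: (path \<Rightarrow> 'f) set) (add_monoid (path_alg n))"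
  proof (rule group.subgroupI)
    show "Group.group (add_monoid (path_alg n :: ('f, path \<Rightarrow> 'f) module))" by (rule a_group)
    show "Jset n \<noteq> ({} :: (path \<Rightarrow> 'f) set)" using J_zero by auto
    fix x :: "path \<Rightarrow> 'f" assume x: "x \<in> Jset n"
    hence "x \<in> PC n" by (simp add: Jset_def)
    hence "inv\<^bsub>add_monoid (path_alg n)\<^esub> x = - x"
      using path_alg_uminus[of x n] by (simp add: a_inv_def)
    thus "inv\<^bsub>add_monoid (path_alg n)\<^esub> x \<in> Jset n" using x by (simp add: J_minus)
  qed (auto simp: J_add J_PC)
qed (auto intro: J_left J_right)

lemma sigma_eq:
  assumes "i < n"
  shows "sigma n i = (if i \<le> 1 then - path_elem ([Star i, Arr i], i)
     else if i = 2 then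
       path_elem ([Arr 0, Star 0], 2) + path_elem ([Arr 1, Star 1], 2) - path_elem ([Star 2, Arr 2], 2)
     else if i \<le> n - 2 then
       path_elem ([Arr (i - 1), Star (i - 1)], i) - path_elem ([Star i, Arr i], i)
     else path_elem ([Arr (n - 2), Star (n - 2)], n - 1))"
proof -
  have p: "is_path n ([Star i, Arr i], i)" if "i \<le> n - 2" for i using that n4 by auto
  have q: "is_path n ([Arr i, Star i], i + 1)" if "i \<le> n - 2" "1 \<le> i" for i using that n4 by auto
  have q': "is_path n ([Arr i, Star i], 2)" if "i \<le> 1" for i using that n4 by auto
  show ?thesis using assms n4 p q[of "i - 1"] q[of 1] q'
    by (auto simp: sigma_def path_alg_uminus path_alg_minus PC_path_elem)
qed

lemma sigma_PC: assumes "i < n" shows "sigma n i \<in> PC n"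
proof -
  have p: "is_path n ([Star i, Arr i], i)" if "i \<le> n - 2" for i using that n4 by auto
  have q: "is_path n ([Arr i, Star i], i + 1)" if "i \<le> n - 2" "1 \<le> i" for i using that n4 by auto
  have q': "is_path n ([Arr i, Star i], 2)" if "i \<le> 1" for i using that n4 by auto
  have "Suc (n - 2) = n - 1" using n4 by simp
  thus ?thesis using assms n4 p q[of "i - 1"] q[of "n - 2"] q'
    by (auto simp: sigma_eq intro!: PC_add PC_diff PC_minus PC_path_elem simp del: is_path.simps)
qed

lemma coord_loop:
  assumes "is_path n (xs, i)" "path_tgt (xs, i) = i" "length xs = 2"
  shows "coord n (path_elem (xs, i)) i' j l = (if i' = i \<and> j = i \<and> l = 2 then val (xs, i) else 0)"
  using assms by (auto simp: coord_path_elem paths_def)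

text \<open>All relations but the last have zero coordinates. The last one has coordinates (1, 1),
  in the shortest cell of loops at \<open>n - 1\<close> where \<open>quo\<close> admits the
  diagonal.\<close>

lemma sigma_J: assumes "i < n" shows "sigma n i \<in> (Jset n :: (path \<Rightarrow> 'a::field) set)"
proof -
  have p: "is_path n ([Star i, Arr i], i)" if "i \<le> n - 2" for i using that n4 by auto
  have q: "is_path n ([Arr i, Star i], i + 1)" if "i \<le> n - 2" "1 \<le> i" for i using that n4 by auto
  have q': "is_path n ([Arr i, Star i], 2)" if "i \<le> 1" for i using that n4 by auto
  have "quo n i' j l (coord n (sigma n i :: path \<Rightarrow> 'a) i' j l)" for i' j l
  proof -
    consider "i \<le> 1" | "i = 2" | "3 \<le> i" "i \<le> n - 2" | "i = n - 1" using assms by linarith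
    thus ?thesis
    proof cases
      case 1
      have v: "val ([Star i, Arr i], i) = (0 :: bool \<Rightarrow> 'a)"
        using 1 by (auto simp: fun_app compat_def)
      show ?thesis using 1 p[of i] n4 assms
        by (simp add: sigma_eq coord_minus coord_loop v del: is_path.simps val.simps)
    next
      case 2
      have "val ([Arr 0, Star 0], 2) + val ([Arr 1, Star 1], 2) - val ([Star 2, Arr 2], 2) = (0 :: bool \<Rightarrow> 'a)"
        by (auto simp: fun_app compat_def)
      thus ?thesis using 2 n4 p q' assms
        by (simp add: sigma_eq coord_add coord_diff coord_loop del: is_path.simps val.simps)
    next
      case 3
      have "val ([Arr (i - 1), Star (i - 1)], i) - val ([Star i, Arr i], i) = (0 :: bool \<Rightarrow> 'a)"
        using 3 by (auto simp: fun_app compat_def)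
      thus ?thesis using 3 n4 p q[of "i - 1"] assms
        by (simp add: sigma_eq coord_diff coord_loop del: is_path.simps val.simps)
    next
      case 4
      have q: "is_path n ([Arr (n - 2), Star (n - 2)], n - 1)" using n4 by auto
      have v: "val ([Arr (n - 2), Star (n - 2)], n - 1) = (\<lambda>c. 1 :: 'a)"
        using n4 by (auto simp: fun_app compat_def)
      have "quo n (n - 1) (n - 1) 2 (\<lambda>c. 1 :: 'a)"
        using n4 by (auto simp: quo_def lev_def)
      moreover have "\<not> n - 1 \<le> n - 2" "n - 1 \<noteq> 2" "\<not> n - 1 \<le> 1" using n4 by auto
      hence "sigma n i = (path_elem ([Arr (n - 2), Star (n - 2)], n - 1) :: path \<Rightarrow> 'a)"
        using sigma_eq[OF assms] 4 by simp
      moreover have "path_tgt ([Arr (n - 2), Star (n - 2)], n - 1) = n - 1" using n4 by simp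
      ultimately show ?thesis using v
        by (simp add: coord_loop[OF q] del: is_path.simps val.simps path_tgt.simps One_nat_def)
    qed
  qed
  thus ?thesis using sigma_PC assms by (simp add: Jset_def)
qed

section \<open>Spans of relations and the ideal they generate\<close>

lemma lin_span_subset:
  assumes "S \<subseteq> N" "N \<subseteq> PC n" "0 \<in> N" "\<And>x y. x \<in> N \<Longrightarrow> y \<in> N \<Longrightarrow> x + y \<in> N"
    "\<And>c x. x \<in> N \<Longrightarrow> scl c x \<in> N"
  shows "lin_span (path_alg n) S \<subseteq> N"
proof -
  interpret M: Module.module class_ring "path_alg n" by (rule path_alg_module)
  have "submodule class_ring N (path_alg n)"
    by (rule submodule.intro) (use assms path_alg_module in auto)
  thus ?thesis using M.span_is_subset assms(1) by blast
qed

lemma lin_span_incl: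
  assumes "S \<subseteq> PC n" shows "S \<subseteq> lin_span (path_alg n) S"
proof -
  interpret M: Module.module class_ring "path_alg n" by (rule path_alg_module)
  show ?thesis using M.in_own_span[of S] assms by simp
qed

lemma lin_span_closed:
  assumes "S \<subseteq> PC n"
  shows "lin_span (path_alg n) S \<subseteq> PC n" "0 \<in> lin_span (path_alg n) S"
    "x \<in> lin_span (path_alg n) S \<Longrightarrow> y \<in> lin_span (path_alg n) S \<Longrightarrow> x + y \<in> lin_span (path_alg n) S"
    "x \<in> lin_span (path_alg n) S \<Longrightarrow> scl c x \<in> lin_span (path_alg n) S"
proof -
  interpret M: Module.module class_ring "path_alg n" by (rule path_alg_module)
  interpret submodule class_ring "lin_span (path_alg n) S" "path_alg n"
    by (rule M.span_is_submodule) (use assms in simp)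
  show "lin_span (path_alg n) S \<subseteq> PC n" using subset .
  show "0 \<in> lin_span (path_alg n) S" using zero_closed by simp
  show "x \<in> lin_span (path_alg n) S \<Longrightarrow> y \<in> lin_span (path_alg n) S \<Longrightarrow> x + y \<in> lin_span (path_alg n) S"
    using m_closed[of x y] by simp
  show "x \<in> lin_span (path_alg n) S \<Longrightarrow> scl c x \<in> lin_span (path_alg n) S"
    using smult_closed[of c x] by simp
qed

lemma sigma_subset: "sigma n ` {..<n} \<subseteq> PC n"
  using sigma_PC by auto

lemma relations_subset_J: "relations n \<subseteq> Jset n"
  unfolding relations_def
  by (rule lin_span_subset) (use sigma_J J_zero J_add J_scl J_PC in auto)

lemma relations_PC: "relations n \<subseteq> PC n"
  using relations_subset_J by (auto simp: Jset_def)

lemma rel_ideal_subset_J: "rel_ideal n \<subseteq> Jset n"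
  unfolding rel_ideal_def
  using ring.genideal_minimal[OF path_alg_ring[OF n3] J_ideal relations_subset_J] .

lemma rel_ideal_ideal: "ideal (rel_ideal n) (path_alg n)"
  unfolding rel_ideal_def
  using ring.genideal_ideal[OF path_alg_ring[OF n3]] relations_PC by auto

lemma I_PC: "x \<in> rel_ideal n \<Longrightarrow> x \<in> PC n"
  using rel_ideal_subset_J by (auto simp: Jset_def)

lemma sigma_I: "i < n \<Longrightarrow> sigma n i \<in> rel_ideal n"
  unfolding rel_ideal_def relations_def
  using ring.genideal_self[OF path_alg_ring[OF n3] relations_PC[unfolded relations_def]]
    lin_span_incl[OF sigma_subset] by auto

lemma relations_I: "x \<in> relations n \<Longrightarrow> x \<in> rel_ideal n"
  unfolding rel_ideal_def
  using ring.genideal_self[OF path_alg_ring[OF n3] relations_PC] by auto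

lemma I_add: "x \<in> rel_ideal n \<Longrightarrow> y \<in> rel_ideal n \<Longrightarrow> x + y \<in> rel_ideal n"
  using additive_subgroup.a_closed[OF ideal.axioms(1)[OF rel_ideal_ideal]] by simp

lemma I_zero: "0 \<in> rel_ideal n"
  using additive_subgroup.zero_closed[OF ideal.axioms(1)[OF rel_ideal_ideal]] by simp

lemma I_left: "x \<in> rel_ideal n \<Longrightarrow> y \<in> PC n \<Longrightarrow> y \<star> x \<in> rel_ideal n"
  using ideal.I_l_closed[OF rel_ideal_ideal] by simp

lemma I_right: "x \<in> rel_ideal n \<Longrightarrow> y \<in> PC n \<Longrightarrow> x \<star> y \<in> rel_ideal n"
  using ideal.I_r_closed[OF rel_ideal_ideal] by simp

lemma I_scl: "x \<in> rel_ideal n \<Longrightarrow> scl c x \<in> rel_ideal n"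
  using I_left[of x "scl c (pone n)"] I_PC[of x] by (simp add: pmul_scl_left)

lemma I_minus: "x \<in> rel_ideal n \<Longrightarrow> - x \<in> rel_ideal n"
  using I_scl[of x "- 1"] by (simp add: scl_minus_one)

lemma I_diff: "x \<in> rel_ideal n \<Longrightarrow> y \<in> rel_ideal n \<Longrightarrow> x - y \<in> rel_ideal n"
  using I_add[OF _ I_minus, of x y] by simp

lemma I_sum: "(\<And>s. s \<in> S \<Longrightarrow> f s \<in> rel_ideal n) \<Longrightarrow> (\<Sum>s\<in>S. f s) \<in> rel_ideal n"
  by (induction S rule: infinite_finite_induct) (simp_all add: I_zero I_add)

end

section \<open>Normal forms\<close>

text \<open>The vectors that combinations of paths can have in a cell: parity and heights must fit,
  ends of height 1 prescribe the first letter and the letter after the last one, and a path too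
  short to come down to height 1 does not distinguish the two words. A cell without paths may
  violate the parity condition even for the zero vector, hence the alternative in
  \<open>coord_sub\<close>.\<close>

definition sub :: "nat \<Rightarrow> nat \<Rightarrow> nat \<Rightarrow> (bool \<Rightarrow> 'f::field) \<Rightarrow> bool" where
  "sub i j l v \<longleftrightarrow> even (l + lev i + lev j) \<and> lev i \<le> l + lev j \<and> lev j \<le> l + lev i \<and>
     (\<forall>c. \<not> compat i c \<longrightarrow> v c = 0) \<and>
     (\<forall>c. \<not> compat j (c \<noteq> odd (nstars i j l)) \<longrightarrow> v c = 0) \<and>
     (l + 2 < lev i + lev j \<longrightarrow> v True = v False)"

lemma sub_tgt: "sub i j l v \<Longrightarrow> \<not> compat i c \<Longrightarrow> v c = 0"
  by (simp add: sub_def)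

lemma sub_src: "sub i j l v \<Longrightarrow> \<not> compat j (c \<noteq> odd (nstars i j l)) \<Longrightarrow> v c = 0"
  unfolding sub_def by blast

lemma lev_2 [simp]: "2 \<le> i \<Longrightarrow> lev i = i" "i \<le> 1 \<Longrightarrow> lev i = 1"
  by (auto simp: lev_def)

lemma compat_2 [simp]: "2 \<le> i \<Longrightarrow> compat i c"
  by (simp add: compat_def)

lemma compat_1: "i \<le> 1 \<Longrightarrow> compat i c \<longleftrightarrow> c = (i = 1)"
  by (auto simp: compat_def)

lemma sub_add: "sub i j l v \<Longrightarrow> sub i j l w \<Longrightarrow> sub i j l (v + w)"
  by (auto simp: sub_def fun_app)

lemma sub_scl: "sub i j l v \<Longrightarrow> sub i j l (\<lambda>b. c * v b)"
  by (auto simp: sub_def fun_app)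

lemma sub_Lmap:
  assumes "sub (arrow_src a) j l v"
  shows "sub (arrow_tgt a) j (Suc l) (Lmap a v)"
proof (cases a)
  case (Arr i)
  have c: "compat (arrow_tgt (Arr i)) c" for c by (auto simp: compat_def)
  have "nstars (arrow_tgt (Arr i)) j (Suc l) = nstars i j l" by (simp add: nstars_def del: arrow_tgt.simps)
  thus ?thesis using assms c unfolding Arr
    by (auto simp: sub_def Lmap_def simp del: arrow_tgt.simps)
next
  case (Star i)
  have "nstars i j (Suc l) = Suc (nstars (arrow_src (Star i)) j l)"
    using assms unfolding Star sub_def nstars_def lev_src_Star by linarith
  \<comment> \<open>A path this short cannot end at height 1, so no coordinate is cut off and
    equality of the two coordinates survives.\<close>
  moreover have c: "compat i c" if "Suc l + 2 < lev i + lev j" for c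
    using assms that compat_lev(2)[of i c] unfolding Star sub_def lev_src_Star by linarith
  moreover have "((\<not> c) \<noteq> odd k) = (c \<noteq> odd (Suc k))" for c k by auto
  ultimately have "Lmap (Star i) v c = 0" if "\<not> compat j (c \<noteq> odd (nstars i j (Suc l)))" for c
    using assms that unfolding Star Lmap_def sub_def by (simp del: arrow_src.simps) metis
  moreover have "Lmap (Star i) v c = 0" if "\<not> compat i c" for c
    using that by (simp add: Lmap_def)
  moreover have "Lmap (Star i) v True = Lmap (Star i) v False" if "Suc l + 2 < lev i + lev j"
    using assms that c unfolding Star by (simp add: sub_def Lmap_def del: arrow_src.simps)
  moreover have "even (Suc l + lev i + lev j) \<and> lev i \<le> Suc l + lev j \<and> lev j \<le> Suc l + lev i"
    using assms unfolding Star sub_def lev_src_Star by auto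
  ultimately show ?thesis unfolding Star sub_def arrow_tgt.simps by blast
qed

lemma sub_vtx: "sub j j 0 (\<lambda>c. of_bool (compat j c))"
  by (cases "2 \<le> j") (auto simp: sub_def nstars_def)

lemma sub_path: "is_path n (xs, j) \<Longrightarrow> sub (path_tgt (xs, j)) j (length xs) (val (xs, j))"
proof (induction xs)
  case Nil
  show ?case using sub_vtx[of j] by (simp add: val.simps[abs_def])
next
  case (Cons a xs)
  thus ?case using sub_Lmap[of a j "length xs" "val (xs, j)"] by (simp add: val_Cons)
qed

lemma coord_sub:
  assumes "x \<in> PC n"
  shows "coord n x i j l = 0 \<or> sub i j l (coord n x i j l)"
  using assms
proof (induction rule: PC_induct)
  case (step c p x)
  obtain xs v where p: "p = (xs, v)" by (cases p)
  have "coord n (path_elem p) i j l = (0 :: bool \<Rightarrow> 'a) \<or> sub i j l (coord n (path_elem p :: path \<Rightarrow> 'a) i j l)"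
    using sub_path[of n xs v] step(1) by (auto simp: coord_path_elem p paths_def)
  with step(3) show ?case
    unfolding coord_add coord_scl by (auto intro: sub_add sub_scl simp: vscl_zero)
qed simp

lemma coord_range:
  assumes "x \<in> PC n" "coord n x i j l \<noteq> 0" "3 \<le> n" shows "i < n" "j < n"
proof -
  obtain p where "p \<in> paths n i j l"
    using assms(2) by (fastforce simp: coord_def fun_app)
  thus "i < n" "j < n" using path_tgt_less[OF assms(3)] is_path_source by (auto simp: paths_def)
qed

text \<open>The vertex of height 1 with a given colour, so that statements about 0 and 1 can be made
  once for both.\<close>

definition col :: "bool \<Rightarrow> nat" where
  "col c = (if c then 1 else 0)"

lemma col_simps [simp]: "col True = 1" "col False = 0" "col c \<le> 1" "col c = 1 \<longleftrightarrow> c" "col c \<le> Suc 0"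
    "col c = Suc 0 \<longleftrightarrow> c" "lev (col c) = 1"
  by (auto simp: col_def)

lemma col_inv: "i \<le> 1 \<Longrightarrow> col (i = 1) = i" "i \<le> 1 \<Longrightarrow> col (i = Suc 0) = i"
  by (auto simp: col_def)

lemma compat_col [simp]: "compat (col c) b \<longleftrightarrow> b = c"
  by (auto simp: col_def compat_def)

lemma arrow_col [simp]:
  "arrow_src (Star (col c)) = 2" "arrow_tgt (Arr (col c)) = 2"
  by (auto simp: col_def)

section \<open>Explicit elements with prescribed coordinates\<close>

fun upm :: "nat \<Rightarrow> nat \<Rightarrow> (path \<Rightarrow> 'f::field) \<Rightarrow> path \<Rightarrow> 'f" where
  "upm v 0 x = x"
| "upm v (Suc k) x = arr (Arr (v + k)) \<star> upm v k x"

fun dn :: "nat \<Rightarrow> nat \<Rightarrow> path \<Rightarrow> 'f::field" where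
  "dn j 0 = vtx j"
| "dn j (Suc k) = arr (Star (j - Suc k)) \<star> dn j k"

text \<open>An alternating word from \<open>j\<close> to the vertex of colour \<open>c\<close>, with
  \<open>d\<close> changes of colour after the descent from \<open>j\<close>. When no change is
  left, a source of height 1 must already be the end point; this is the reason for the default
  0.\<close>

fun alt :: "bool \<Rightarrow> nat \<Rightarrow> nat \<Rightarrow> path \<Rightarrow> 'f::field" where
  "alt c 0 j = (if 2 \<le> j then arr (Star (col c)) \<star> dn j (j - 2) else if compat j c then vtx j else 0)"
| "alt c (Suc d) j = arr (Star (col c)) \<star> (arr (Arr (col (\<not> c))) \<star> alt (\<not> c) d j)"

definition alt_sum :: "nat \<Rightarrow> nat \<Rightarrow> (bool \<Rightarrow> 'f) \<Rightarrow> path \<Rightarrow> 'f::field" where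
  "alt_sum d j v = (\<Sum>c\<in>UNIV. scl (v c) (arr (Arr (col c)) \<star> alt c d j))"

text \<open>
  The normal form at \<open>(i, j, l)\<close> with coordinates \<open>v\<close>.  A path from \<open>j\<close> to \<open>i\<close> of length \<open>l\<close>
  that is too short to visit the vertices 0 and 1 is pushed down to
  its valley \<open>(i + j - l) div 2\<close>; otherwise the path is a combination of alternating words in
  $a_0 a_0^*$ and $a_1 a_1^*$.
\<close>

definition nf :: "nat \<Rightarrow> nat \<Rightarrow> nat \<Rightarrow> (bool \<Rightarrow> 'f) \<Rightarrow> path \<Rightarrow> 'f::field" where
  "nf i j l v =
    (if lev i + lev j \<le> l + 2 then
       (let d = (l + 2 - lev i - lev j) div 2 in
        if 2 \<le> i then upm 2 (i - 2) (alt_sum d j v) else scl (v (i = 1)) (alt (i = 1) d j))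
     else scl (v False) (let w = (i + j - l) div 2 in upm w (i - w) (dn j (j - w))))"

lemma alt_sum_eq: "alt_sum d j v = scl (v False) (arr (Arr 0) \<star> alt False d j) + scl (v True) (arr (Arr 1) \<star> alt True d j)"
  by (simp add: alt_sum_def UNIV_bool)

lemma upm_add: "upm v k (x + y) = upm v k x + upm v k y"
  by (induction k) (simp_all add: pmul_add_right)

lemma upm_scl: "upm v k (scl c x) = scl c (upm v k x)"
  by (induction k) (simp_all add: pmul_scl_right)

lemma upm_zero [simp]: "upm v k 0 = 0"
  by (induction k) simp_all

lemma upm_Suc: "upm v (Suc k) x = upm (Suc v) k (arr (Arr v) \<star> x)"
  by (induction k) simp_all

lemma alt_sum_add: "alt_sum d j (v + w) = alt_sum d j v + alt_sum d j w"
  by (simp add: alt_sum_eq plus_fun_apply scl_simps add_ac)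

lemma alt_sum_scl: "alt_sum d j (\<lambda>b. c * v b) = scl c (alt_sum d j v)"
  by (simp add: alt_sum_eq scl_simps)

lemma nf_add: "nf i j l (v + w) = nf i j l v + nf i j l w"
  by (simp add: nf_def Let_def alt_sum_add upm_add plus_fun_apply scl_simps)

lemma nf_scl: "nf i j l (\<lambda>b. c * v b) = scl c (nf i j l v)"
  by (simp add: nf_def Let_def alt_sum_scl upm_scl scl_simps)

lemma nf_zero [simp]: "nf i j l 0 = 0"
  using nf_scl[of i j l 0 "0 :: bool \<Rightarrow> 'a"] by (simp add: zero_fun_def)

text \<open>Elements concentrated in one cell. Multiplication by an arrow moves them to one other
  cell, so the coordinates of long products can be followed factor by factor.\<close>

definition conc :: "nat \<Rightarrow> (path \<Rightarrow> 'f::field) \<Rightarrow> nat \<Rightarrow> nat \<Rightarrow> nat \<Rightarrow> (bool \<Rightarrow> 'f) \<Rightarrow> bool" where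
  "conc n x i j l w \<longleftrightarrow> x \<in> PC n \<and>
     (\<forall>i' j' l'. coord n x i' j' l' = (if i' = i \<and> j' = j \<and> l' = l then w else 0))"

lemma conc_add: "conc n x i j l v \<Longrightarrow> conc n y i j l w \<Longrightarrow> conc n (x + y) i j l (v + w)"
  by (auto simp: conc_def coord_add)

lemma conc_scl: "conc n x i j l v \<Longrightarrow> conc n (scl c x) i j l (\<lambda>b. c * v b)"
  by (auto simp: conc_def coord_scl)

lemma conc_zero [simp, intro]: "conc n 0 i j l 0"
  by (auto simp: conc_def)

context type_D
begin

lemma conc_vtx: "j < n \<Longrightarrow> conc n (vtx j) j j 0 (\<lambda>c. of_bool (compat j c))"
  by (auto simp: conc_def coord_path_elem paths_def fun_app)

lemma conc_left:
  assumes "conc n x (arrow_src a) j l v" "arrow_index a \<le> n - 2"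
  shows "conc n (arr a \<star> x) (arrow_tgt a) j (Suc l) (Lmap a v)"
proof -
  have x: "x \<in> PC n" using assms by (simp add: conc_def)
  show ?thesis using assms x by (auto simp: conc_def coord_left Lmap_linear)
qed

lemma conc_right:
  assumes "conc n x i (arrow_tgt a) l v" "arrow_index a \<le> n - 2"
  shows "conc n (x \<star> arr a) i (arrow_src a) (Suc l) (Rmap a i (Suc l) v)"
proof -
  have x: "x \<in> PC n" using assms by (simp add: conc_def)
  have e: "Suc (l' - Suc 0) = l'" if "0 < l'" for l' using that by simp
  show ?thesis using assms x by (auto simp: conc_def coord_right Rmap_linear e)
qed

lemma conc_upm:
  assumes "conc n x v j l w" "v + k < n" "1 \<le> v"
  shows "conc n (upm v k x) (v + k) j (l + k) w"
  using assms(2)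
proof (induction k)
  case (Suc k)
  have "arrow_tgt (Arr (v + k)) = v + Suc k" using assms(3) by simp
  moreover have "conc n (upm v k x) (arrow_src (Arr (v + k))) j (l + k) w"
    using Suc.IH Suc.prems by simp
  ultimately show ?case using conc_left[of "upm v k x" "Arr (v + k)"] Suc.prems
    by (simp add: Lmap_def del: arrow_tgt.simps)
qed (use assms in simp)

lemma conc_dn:
  assumes "k + 2 \<le> j" "j < n"
  shows "conc n (dn j k) (j - k) j k (\<lambda>c. 1)"
  using assms(1)
proof (induction k)
  case 0
  thus ?case using conc_vtx[OF assms(2)] by simp
next
  case (Suc k)
  have "arrow_src (Star (j - Suc k)) = j - k" using Suc.prems by auto
  moreover have "Lmap (Star (j - Suc k)) (\<lambda>c. 1 :: 'a) = (\<lambda>c. 1)"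
    using Suc.prems by (simp add: Lmap_def)
  ultimately show ?case using conc_left[of "dn j k" "Star (j - Suc k)" j k "\<lambda>c. 1 :: 'a"] Suc assms(2)
    by (simp del: arrow_src.simps)
qed

text \<open>The colour reached after \<open>d\<close> changes has to fit the source; otherwise
  \<open>alt c d j\<close> has zero coordinates.\<close>

definition ok :: "bool \<Rightarrow> nat \<Rightarrow> nat \<Rightarrow> bool" where
  "ok c d j \<longleftrightarrow> compat j (c \<noteq> odd d)"

lemma idx_col [simp]: "col c < n" "col c \<le> n - 2" "Suc 0 \<le> n - 2" "2 \<le> n - 2" "2 < n" "Suc 0 < n" "0 < n" "Suc (Suc 0) < n"
  using n4 by (auto simp: col_def)

lemma conc_alt:
  assumes "j < n"
  shows "conc n (alt c d j) (col c) j (lev j - 1 + 2 * d) (\<lambda>b. of_bool (b = c \<and> ok c d j))"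
proof (induction d arbitrary: c)
  case 0
  show ?case
  proof (cases "2 \<le> j")
    case True
    have "conc n (arr (Star (col c)) \<star> dn j (j - 2)) (col c) j (Suc (j - 2))
        (Lmap (Star (col c)) (\<lambda>c. 1 :: 'a))"
      using conc_left[of "dn j (j - 2)" "Star (col c)" j "j - 2" "\<lambda>c. 1 :: 'a"]
        conc_dn[of "j - 2" j] True assms le_add_diff_inverse[of 2 j]
      by (simp del: arrow_src.simps)
    moreover have "Lmap (Star (col c)) (\<lambda>c. 1 :: 'a) = (\<lambda>b. of_bool (b = c \<and> ok c 0 j))"
      using True by (auto simp: Lmap_def ok_def)
    moreover have "Suc (j - 2) = lev j - 1 + 2 * 0" using True by simp
    ultimately show ?thesis using True by simp
  next
    case False
    hence j: "j \<le> 1" by simp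
    have "(\<lambda>b. of_bool (compat j b)) = (\<lambda>b. of_bool (b = c \<and> ok c 0 j) :: 'a)" if "compat j c"
      using that j by (auto simp: compat_1 ok_def)
    moreover have "(\<lambda>b. of_bool (b = c \<and> ok c 0 j) :: 'a) = 0" if "\<not> compat j c"
      using that j by (auto simp: ok_def fun_app)
    ultimately show ?thesis
      using j conc_vtx[OF assms] by (auto simp: col_inv compat_1)
  qed
next
  case (Suc d)
  let ?y = "arr (Arr (col (\<not> c))) \<star> (alt (\<not> c) d j :: path \<Rightarrow> 'a)"
  have "conc n ?y 2 j (Suc (lev j - 1 + 2 * d)) (\<lambda>b. of_bool (b = (\<not> c) \<and> ok (\<not> c) d j))"
    using conc_left[of "alt (\<not> c) d j" "Arr (col (\<not> c))"] Suc.IH[of "\<not> c"]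
    by (simp add: Lmap_def del: arrow_tgt.simps)
  hence "conc n (arr (Star (col c)) \<star> ?y) (col c) j (Suc (Suc (lev j - 1 + 2 * d)))
    (Lmap (Star (col c)) (\<lambda>b. of_bool (b = (\<not> c) \<and> ok (\<not> c) d j)))"
    using conc_left[of ?y "Star (col c)"] by (simp del: arrow_src.simps)
  moreover have "Lmap (Star (col c)) (\<lambda>b. of_bool (b = (\<not> c) \<and> ok (\<not> c) d j) :: 'a) =
    (\<lambda>b. of_bool (b = c \<and> ok c (Suc d) j))"
  proof -
    have "((\<not> c) \<noteq> odd d) = (c \<noteq> odd (Suc d))" by auto
    thus ?thesis unfolding Lmap_def ok_def by auto
  qed
  ultimately show ?case by simp
qed

lemma conc_alt_sum:
  assumes "j < n" "\<And>c. \<not> ok c d j \<Longrightarrow> v c = 0"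
  shows "conc n (alt_sum d j v) 2 j (lev j + 2 * d) v"
proof -
  let ?w = "\<lambda>c b. of_bool (b = c \<and> ok c d j) :: 'a"
  have *: "conc n (arr (Arr (col c)) \<star> alt c d j) 2 j (lev j + 2 * d) (?w c)" for c
  proof -
    have "Suc (lev j - 1 + 2 * d) = lev j + 2 * d" using lev_ge[of j] by simp
    thus ?thesis
      using conc_left[of "alt c d j" "Arr (col c)" j "lev j - 1 + 2 * d" "?w c"] conc_alt[OF assms(1), of c d]
      by (simp add: Lmap_def del: arrow_tgt.simps)
  qed
  have "conc n (alt_sum d j v) 2 j (lev j + 2 * d) ((\<lambda>b. v False * ?w False b) + (\<lambda>b. v True * ?w True b))"
    unfolding alt_sum_eq using conc_add[OF conc_scl[OF *[of False]] conc_scl[OF *[of True]]] by simp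
  moreover have "(\<lambda>b. v False * ?w False b) + (\<lambda>b. v True * ?w True b) = v"
  proof
    fix b show "((\<lambda>b. v False * ?w False b) + (\<lambda>b. v True * ?w True b)) b = v b"
      using assms(2)[of b] by (cases b) (auto simp: fun_app)
  qed
  ultimately show ?thesis by simp
qed

lemma sub_ok:
  assumes "sub i j l v" "lev i + lev j \<le> l + 2" "\<not> ok c ((l + 2 - lev i - lev j) div 2) j"
  shows "v c = 0"
proof (cases "2 \<le> j")
  case True
  thus ?thesis using assms by (simp add: ok_def)
next
  case False
  hence "nstars i j l = (l + 2 - lev i - lev j) div 2" by (simp add: nstars_def)
  thus ?thesis using assms by (auto simp: sub_def ok_def)
qed

text \<open>So \<open>nf\<close> is a section of the coordinate map on admissible vectors. Besides
  the comparison of ideals, this is what allows elements with given coordinates to be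
  constructed.\<close>

lemma conc_nf:
  assumes "sub i j l v" "i < n" "j < n"
  shows "conc n (nf i j l v) i j l v"
proof (cases "lev i + lev j \<le> l + 2")
  case True
  define d where "d = (l + 2 - lev i - lev j) div 2"
  have ld: "l + 2 = lev i + lev j + 2 * d"
  proof -
    have "even (l + lev i + lev j)" using assms(1) by (simp add: sub_def)
    thus ?thesis using True unfolding d_def by presburger
  qed
  have ok: "v c = 0" if "\<not> ok c d j" for c using sub_ok[OF assms(1) True] that by (simp add: d_def)
  show ?thesis
  proof (cases "2 \<le> i")
    case True': True
    have "conc n (upm 2 (i - 2) (alt_sum d j v)) (2 + (i - 2)) j (lev j + 2 * d + (i - 2)) v"
      by (rule conc_upm) (use conc_alt_sum[OF assms(3) ok] True' assms in auto)
    moreover have "lev j + 2 * d + (i - 2) = l" "2 + (i - 2) = i" using ld True' by simp_all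
    ultimately have "conc n (upm 2 (i - 2) (alt_sum d j v)) i j l v" by (simp only:)
    thus ?thesis using True True' by (simp add: nf_def Let_def d_def)
  next
    case False
    hence i: "i \<le> 1" by simp
    have "conc n (scl (v (i = 1)) (alt (i = 1) d j)) i j (lev j - 1 + 2 * d)
      (\<lambda>b. v (i = 1) * of_bool (b = (i = 1) \<and> ok (i = 1) d j))"
      using conc_scl[OF conc_alt[OF assms(3), of "i = 1" d]] i by (simp add: col_inv)
    moreover have "lev j - 1 + 2 * d = l" using ld i lev_ge[of j] by simp
    moreover have "(\<lambda>b. v (i = 1) * of_bool (b = (i = 1) \<and> ok (i = 1) d j)) = v"
    proof
      fix b
      have "v b = 0" if "b \<noteq> (i = 1)" using that assms(1) i by (simp add: sub_def compat_1)
      thus "v (i = 1) * of_bool (b = (i = 1) \<and> ok (i = 1) d j) = v b"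
        using ok[of "i = 1"] by (cases "b = (i = 1)") auto
    qed
    ultimately show ?thesis using True False by (simp add: nf_def Let_def d_def)
  qed
next
  case False
  hence ij: "2 \<le> i" "2 \<le> j" using assms(1) by (auto simp: sub_def lev_def max_def split: if_splits)
  define w where "w = (i + j - l) div 2"
  have w: "2 * w = i + j - l" "2 \<le> w" "w \<le> i" "w \<le> j"
  proof -
    have "even (l + i + j)" "\<not> i + j \<le> l + 2" "i \<le> l + j" "j \<le> l + i"
      using False assms(1) ij by (simp_all add: sub_def)
    thus "2 * w = i + j - l" "2 \<le> w" "w \<le> i" "w \<le> j" unfolding w_def by presburger+
  qed
  have "conc n (upm w (i - w) (dn j (j - w))) (w + (i - w)) j (j - w + (i - w)) (\<lambda>c. 1)"
  proof (rule conc_upm)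
    have "j - w + 2 \<le> j" "j - (j - w) = w" using w by linarith+
    thus "conc n (dn j (j - w)) w j (j - w) (\<lambda>c. 1)" using conc_dn[of "j - w" j] assms(3) by simp
  qed (use w assms in auto)
  moreover have "j - w + (i - w) = l" using w False ij by simp
  ultimately have "conc n (scl (v False) (upm w (i - w) (dn j (j - w)))) i j l (\<lambda>c. v False * 1)"
    using conc_scl[of n "upm w (i - w) (dn j (j - w))" i j l "\<lambda>c. 1"] w by simp
  moreover have "(\<lambda>c. v False * 1) = v"
  proof
    fix c show "v False * 1 = v c" using assms(1) False by (cases c) (auto simp: sub_def)
  qed
  ultimately show ?thesis using False by (simp add: nf_def Let_def w_def)
qed

section \<open>Congruence modulo the ideal of relations\<close>

definition eqv :: "(path \<Rightarrow> 'f::field) \<Rightarrow> (path \<Rightarrow> 'f) \<Rightarrow> bool" (infix "\<approx>" 50) where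
  "x \<approx> y \<longleftrightarrow> x - y \<in> rel_ideal n"

lemma eqv_refl [simp, intro]: "x \<approx> x"
  by (simp add: eqv_def I_zero)

lemma eqv_sym: "x \<approx> y \<Longrightarrow> y \<approx> x"
  using I_minus[of "x - y"] by (simp add: eqv_def)

lemma eqv_trans [trans]: "x \<approx> y \<Longrightarrow> y \<approx> z \<Longrightarrow> x \<approx> z"
  using I_add[of "x - y" "y - z"] by (simp add: eqv_def)

lemma eq_eqv_trans [trans]: "x = y \<Longrightarrow> y \<approx> z \<Longrightarrow> x \<approx> z" "x \<approx> y \<Longrightarrow> y = z \<Longrightarrow> x \<approx> z"
  by simp_all

lemma eqv_add: "x \<approx> y \<Longrightarrow> x' \<approx> y' \<Longrightarrow> x + x' \<approx> y + y'"
  using I_add[of "x - y" "x' - y'"] by (simp add: eqv_def algebra_simps)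

lemma eqv_diff: "x \<approx> y \<Longrightarrow> x' \<approx> y' \<Longrightarrow> x - x' \<approx> y - y'"
  using I_diff[of "x - y" "x' - y'"] by (simp add: eqv_def algebra_simps)

lemma eqv_scl: "x \<approx> y \<Longrightarrow> scl c x \<approx> scl c y"
  using I_scl[of "x - y" c] by (simp add: eqv_def scl_simps)

lemma eqv_left: "x \<approx> y \<Longrightarrow> z \<in> PC n \<Longrightarrow> z \<star> x \<approx> z \<star> y"
  using I_left[of "x - y" z] by (simp add: eqv_def pmul_diff_right)

lemma eqv_right: "x \<approx> y \<Longrightarrow> z \<in> PC n \<Longrightarrow> x \<star> z \<approx> y \<star> z"
  using I_right[of "x - y" z] by (simp add: eqv_def pmul_diff_left)

lemma eqv_mult: "x \<approx> y \<Longrightarrow> x' \<approx> y' \<Longrightarrow> x' \<in> PC n \<Longrightarrow> y \<in> PC n \<Longrightarrow> x \<star> x' \<approx> y \<star> y'"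
  using eqv_right[of x y x'] eqv_left[of x' y' y] eqv_trans by blast

lemma eqv_sum: "(\<And>s. s \<in> S \<Longrightarrow> f s \<approx> g s) \<Longrightarrow> (\<Sum>s\<in>S. f s) \<approx> (\<Sum>s\<in>S. g s)"
  by (induction S rule: infinite_finite_induct) (simp_all add: eqv_add)

lemma eqv_zero: "x \<approx> 0 \<longleftrightarrow> x \<in> rel_ideal n"
  by (simp add: eqv_def)

lemma eqv_I: "x \<approx> y \<Longrightarrow> y \<in> rel_ideal n \<Longrightarrow> x \<in> rel_ideal n"
  using eqv_trans eqv_zero by blast

lemma eqv_I': "x \<approx> y \<Longrightarrow> x \<in> rel_ideal n \<Longrightarrow> y \<in> rel_ideal n"
  using eqv_I eqv_sym by blast

lemma upm_eqv: "x \<approx> y \<Longrightarrow> v + k < n \<Longrightarrow> upm v k x \<approx> upm v k y"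
  by (induction k) (auto intro!: eqv_left)

lemma upm_PC: "x \<in> PC n \<Longrightarrow> v + k < n \<Longrightarrow> upm v k x \<in> PC n"
  by (induction k) (auto intro!: PC_mult PC_arr simp del: arrow_src.simps)

section \<open>Rewriting with the relations\<close>

lemma sigma_left: "i < n \<Longrightarrow> x \<in> PC n \<Longrightarrow> sigma n i \<star> x \<in> rel_ideal n"
  using I_right sigma_I by blast

lemma rel_leaf:
  assumes "x \<in> PC n" shows "arr (Star (col c)) \<star> (arr (Arr (col c)) \<star> x) \<approx> 0"
proof -
  have "sigma n (col c) = - (arr (Star (col c)) \<star> arr (Arr (col c)) :: path \<Rightarrow> 'a)"
    using n4 by (cases c) (simp_all add: sigma_eq path_elem_mult)
  hence "- (arr (Star (col c)) \<star> (arr (Arr (col c)) \<star> x)) \<in> rel_ideal n"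
    using sigma_left[of "col c" x] assms n4 by (simp add: pmul_minus_left pmul_assoc del: arrow_src.simps)
  thus ?thesis using I_minus by (fastforce simp: eqv_zero)
qed

lemma rel_2:
  assumes "x \<in> PC n"
  shows "arr (Star 2) \<star> (arr (Arr 2) \<star> x) \<approx>
    arr (Arr 0) \<star> (arr (Star 0) \<star> x) + arr (Arr 1) \<star> (arr (Star 1) \<star> x)"
proof -
  have "sigma n 2 = arr (Arr 0) \<star> arr (Star 0) + arr (Arr 1) \<star> arr (Star 1)
      - (arr (Star 2) \<star> arr (Arr 2) :: path \<Rightarrow> 'a)"
    using n4 by (simp add: sigma_eq path_elem_mult numeral_2_eq_2)
  hence "arr (Arr 0) \<star> (arr (Star 0) \<star> x) + arr (Arr 1) \<star> (arr (Star 1) \<star> x)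
      - arr (Star 2) \<star> (arr (Arr 2) \<star> x) \<in> rel_ideal n"
    using sigma_left[of 2 x] assms n4
    by (simp add: pmul_diff_left pmul_add_left pmul_assoc del: arrow_src.simps)
  thus ?thesis by - (rule eqv_sym, simp add: eqv_def)
qed

lemma rel_arm:
  assumes "x \<in> PC n" "3 \<le> k" "k \<le> n - 2"
  shows "arr (Star k) \<star> (arr (Arr k) \<star> x) \<approx> arr (Arr (k - 1)) \<star> (arr (Star (k - 1)) \<star> x)"
proof -
  have "sigma n k = arr (Arr (k - 1)) \<star> arr (Star (k - 1)) - (arr (Star k) \<star> arr (Arr k) :: path \<Rightarrow> 'a)"
    using n4 assms by (simp add: sigma_eq path_elem_mult)
  hence "arr (Arr (k - 1)) \<star> (arr (Star (k - 1)) \<star> x) - arr (Star k) \<star> (arr (Arr k) \<star> x) \<in> rel_ideal n"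
    using sigma_left[of k x] assms n4 by (simp add: pmul_diff_left pmul_assoc del: arrow_src.simps)
  thus ?thesis by - (rule eqv_sym, simp add: eqv_def)
qed

lemma rel_end:
  assumes "x \<in> PC n"
  shows "arr (Arr (n - 2)) \<star> (arr (Star (n - 2)) \<star> x) \<approx> 0"
proof -
  have "\<not> n - 1 \<le> n - 2" "n - 1 \<noteq> 2" "\<not> n - 1 \<le> 1" "n - 2 + 1 = n - 1" "n - 2 \<noteq> 0" using n4 by auto
  hence "sigma n (n - 1) = (arr (Arr (n - 2)) \<star> arr (Star (n - 2)) :: path \<Rightarrow> 'a)"
    using n4 by (simp only: sigma_eq[of "n - 1"] path_elem_mult if_False arrow_src.simps path_tgt.simps
        arrow_tgt.simps) simp
  thus ?thesis using sigma_left[of "n - 1" x] assms n4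
    by (simp add: eqv_zero pmul_assoc del: arrow_src.simps)
qed

text \<open>A loop sitting on top of an ascending path slides down to its foot: the relation at an
  inner vertex of the arm exchanges the loop through the upper neighbour with the loop through the
  lower one.\<close>

lemma bubble:
  assumes "x \<in> PC n" "2 \<le> v" "v + k \<le> n - 2"
  shows "arr (Star (v + k)) \<star> (arr (Arr (v + k)) \<star> upm v k x) \<approx>
    upm v k (arr (Star v) \<star> (arr (Arr v) \<star> x))"
  using assms(3)
proof (induction k)
  case (Suc k)
  let ?y = "arr (Arr (v + k)) \<star> upm v k x"
  have y: "?y \<in> PC n" using upm_PC[OF assms(1), of v "Suc k"] Suc.prems by simp
  have "arr (Star (v + Suc k)) \<star> (arr (Arr (v + Suc k)) \<star> ?y) \<approx>
     arr (Arr (v + k)) \<star> (arr (Star (v + k)) \<star> ?y)"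
    using rel_arm[OF y, of "v + Suc k"] Suc.prems assms by (simp del: arrow_src.simps)
  also have "\<dots> \<approx> arr (Arr (v + k)) \<star> upm v k (arr (Star v) \<star> (arr (Arr v) \<star> x))"
    using Suc by (intro eqv_left PC_arr) (auto simp del: arrow_src.simps)
  finally show ?case by simp
qed simp

lemma alt_PC: "j < n \<Longrightarrow> alt c d j \<in> PC n"
  using conc_alt by (auto simp: conc_def)

lemma dn_PC: "k + 2 \<le> j \<Longrightarrow> j < n \<Longrightarrow> dn j k \<in> PC n"
  using conc_dn by (auto simp: conc_def)

lemma alt_sum_PC: "j < n \<Longrightarrow> alt_sum d j v \<in> PC n"
  unfolding alt_sum_eq using alt_PC[of j] by (intro PC_add PC_scl PC_mult PC_arr) auto

lemma nf_PC: "sub i j l v \<Longrightarrow> i < n \<Longrightarrow> j < n \<Longrightarrow> nf i j l v \<in> PC n"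
  using conc_nf by (auto simp: conc_def)

text \<open>The summand of colour \<open>c\<close> contains the zero loop at \<open>col c\<close>;
  the other summand becomes an alternating word with one more change of colour.\<close>

lemma star_alt_sum:
  assumes "j < n"
  shows "arr (Star (col c)) \<star> alt_sum d j v \<approx> scl (v (\<not> c)) (alt c (Suc d) j)"
proof -
  have "scl (v c) (arr (Star (col c)) \<star> (arr (Arr (col c)) \<star> alt c d j)) \<approx> scl (v c) 0"
    by (intro eqv_scl rel_leaf alt_PC assms)
  moreover have "arr (Star (col c)) \<star> alt_sum d j v =
    scl (v (\<not> c)) (alt c (Suc d) j) + scl (v c) (arr (Star (col c)) \<star> (arr (Arr (col c)) \<star> alt c d j))"
    by (cases c) (simp_all add: alt_sum_eq pmul_add_right pmul_scl_right add_ac)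
  ultimately show ?thesis
    using eqv_add[OF eqv_refl, of "scl (v c) (arr (Star (col c)) \<star> (arr (Arr (col c)) \<star> alt c d j))"
      "scl (v c) 0" "scl (v (\<not> c)) (alt c (Suc d) j)"] by simp
qed

lemma nf_pq:
  assumes "lev i + lev j + 2 * d = l + 2"
  shows "nf i j l v = (if 2 \<le> i then upm 2 (i - 2) (alt_sum d j v) else scl (v (i = 1)) (alt (i = 1) d j))"
proof -
  have "lev i + lev j \<le> l + 2" "(l + 2 - lev i - lev j) div 2 = d" using assms by auto
  thus ?thesis by (simp add: nf_def Let_def del: lev_2)
qed

lemma nf_valley:
  assumes "l + 2 * w = i + j" "2 \<le> w" "2 \<le> i" "2 \<le> j"
  shows "nf i j l v = scl (v False) (upm w (i - w) (dn j (j - w)))"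
proof -
  have "\<not> lev i + lev j \<le> l + 2" "(i + j - l) div 2 = w" using assms by auto
  thus ?thesis by (simp add: nf_def Let_def del: lev_2)
qed

text \<open>Either the path is long enough to pass height 1, with \<open>d\<close> counting the
  surplus of loops, or its lowest vertex \<open>w\<close> lies on the arm and both coordinates
  agree.\<close>

lemma sub_cases:
  assumes "sub i j l v"
  obtains d where "lev i + lev j + 2 * d = l + 2"
  | w where "l + 2 * w = i + j" "2 \<le> w" "2 \<le> i" "2 \<le> j" "w \<le> i" "w \<le> j" "v True = v False"
proof (cases "lev i + lev j \<le> l + 2")
  case True
  have "even (l + lev i + lev j)" using assms by (simp add: sub_def)
  hence "lev i + lev j + 2 * ((l + 2 - lev i - lev j) div 2) = l + 2" using True by presburger
  thus ?thesis using that(1) by blast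
next
  case False
  hence ij: "2 \<le> i" "2 \<le> j" using assms by (auto simp: sub_def lev_def max_def split: if_splits)
  have "even (l + i + j)" "i \<le> l + j" "j \<le> l + i" "v True = v False"
    using assms False ij by (simp_all add: sub_def)
  moreover from this have "l + 2 * ((i + j - l) div 2) = i + j"
  proof -
    have "\<not> i + j \<le> l + 2" using False ij by simp
    thus ?thesis using \<open>even (l + i + j)\<close> by presburger
  qed
  ultimately show ?thesis using that(2)[of "(i + j - l) div 2"] False ij by auto
qed

text \<open>An \<open>Arr\<close> prolongs the ascent of a normal form. A \<open>Star\<close> on top
  of an ascent creates a loop, which slides down by \<open>bubble\<close>. At the bottom it deepens
  the valley by one, or splits into P + Q at vertex 2, or prolongs the alternating words. The
  relation at \<open>n - 1\<close> never occurs in these steps.\<close>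

lemma nf_left:
  assumes "sub (arrow_src a) j l v" "arrow_index a \<le> n - 2" "j < n"
  shows "arr a \<star> nf (arrow_src a) j l v \<approx> nf (arrow_tgt a) j (Suc l) (Lmap a v)"
proof (cases a)
  case (Arr i)
  show ?thesis
  proof (cases "2 \<le> i")
    case True
    hence i: "arrow_tgt (Arr i) = Suc i" "Suc i - 2 = Suc (i - 2)" "2 + (i - 2) = i" by auto
    have "sub i j l v" using assms(1) Arr by simp
    thus ?thesis
    proof (cases rule: sub_cases)
      case (1 d)
      hence "lev (Suc i) + lev j + 2 * d = Suc l + 2" using True by simp
      thus ?thesis using nf_pq[OF 1, of v] nf_pq[of "Suc i" j d "Suc l" v] True i
        by (simp add: Lmap_def Arr)
    next
      case (2 w)
      hence "Suc l + 2 * w = Suc i + j" "Suc i - w = Suc (i - w)" "w + (i - w) = i" by simp_all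
      thus ?thesis using nf_valley[OF 2(1-4), of v] nf_valley[of "Suc l" w "Suc i" j v] 2 True i
        by (simp add: Lmap_def pmul_scl_right Arr)
    qed
  next
    case False
    hence i: "arrow_tgt (Arr i) = 2" "lev i = 1" "i \<le> 1" by auto
    have "sub i j l v" using assms(1) Arr by simp
    thus ?thesis
    proof (cases rule: sub_cases)
      case (1 d)
      hence "lev 2 + lev j + 2 * d = Suc l + 2" using i by simp
      moreover have "v (\<not> (i = 1)) = 0"
        using assms(1) i unfolding Arr by (auto simp: sub_def compat_1)
      moreover from this have "alt_sum d j v = scl (v (i = 1)) (arr (Arr i) \<star> alt (i = 1) d j)"
      proof -
        have "i = 0 \<or> i = 1" using i(3) by auto
        thus ?thesis using \<open>v (\<not> (i = 1)) = 0\<close> by (auto simp: alt_sum_eq)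
      qed
      ultimately show ?thesis using nf_pq[OF 1, of v] nf_pq[of 2 j d "Suc l" v] False i
        by (simp add: Lmap_def pmul_scl_right Arr)
    qed (use False in simp)
  qed
next
  case (Star i)
  show ?thesis
  proof (cases "2 \<le> i")
    case False
    define c where "c = (i = 1)"
    have i: "i = col c" "arrow_src (Star i) = 2" "lev i = 1" using False by (auto simp: c_def col_def)
    have "sub 2 j l v" using assms(1) Star i(2) by (simp del: arrow_src.simps)
    thus ?thesis
    proof (cases rule: sub_cases)
      case (1 d)
      hence "lev (col c) + lev j + 2 * Suc d = Suc l + 2" by simp
      hence "nf (col c) j (Suc l) (Lmap (Star (col c)) v) = scl (v (\<not> c)) (alt c (Suc d) j)"
        using nf_pq[of "col c" j "Suc d" "Suc l" "Lmap (Star (col c)) v"] col_simps(3)[of c]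
        by (simp add: Lmap_def del: alt.simps)
      moreover have "nf (arrow_src (Star (col c))) j l v = alt_sum d j v"
        using nf_pq[OF 1, of v] by (simp del: arrow_src.simps)
      ultimately show ?thesis using star_alt_sum[OF assms(3), of c d v] by (simp add: Star i(1) del: arrow_src.simps)
    next
      case (2 w)
      hence w: "w = 2" "l + 2 = j" by simp_all
      have "lev (col c) + lev j + 2 * 0 = Suc l + 2" using w 2 by simp
      hence "nf (col c) j (Suc l) (Lmap (Star (col c)) v) = scl (v (\<not> c)) (alt c 0 j)"
        using nf_pq[of "col c" j 0 "Suc l" "Lmap (Star (col c)) v"] col_simps(3)[of c]
        by (simp add: Lmap_def del: alt.simps)
      moreover have "nf (arrow_src (Star (col c))) j l v = scl (v False) (dn j (j - 2))"
        using nf_valley[OF 2(1-4), of v] w by (simp del: arrow_src.simps)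
      moreover have "v (\<not> c) = v False" using 2(7) by (cases c) simp_all
      ultimately show ?thesis using 2(4) by (simp add: pmul_scl_right Star i(1) del: arrow_src.simps)
    qed
  next
    case True
    hence i: "arrow_src (Star i) = Suc i" "lev i = i" "lev (Suc i) = Suc i" "2 + (i - 2) = i"
      "Suc i - 2 = Suc (i - 2)" "2 \<le> Suc i" "i \<le> n - 2" "i < n" "compat i c" for c
      using assms(2) Star n4 by auto
    have "sub (Suc i) j l v" using assms(1) Star i(1) by (simp del: arrow_src.simps)
    thus ?thesis
    proof (cases rule: sub_cases)
      case (1 d)
      let ?v = "Lmap (Star i) v"
      have e: "lev i + lev j + 2 * Suc d = Suc l + 2" using 1 i(2,3) by simp
      have b: "2 + (i - 2) \<le> n - 2" and b': "2 + (i - 2) < n" using i(4,7,8) by linarith+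
      have "arr (Star i) \<star> nf (Suc i) j l v = arr (Star (2 + (i - 2))) \<star> (arr (Arr (2 + (i - 2))) \<star> upm 2 (i - 2) (alt_sum d j v))"
        using nf_pq[OF 1, of v] by (simp only: i(4,5,6) if_True upm.simps)
      also have "\<dots> \<approx> upm 2 (i - 2) (arr (Star 2) \<star> (arr (Arr 2) \<star> alt_sum d j v))"
        by (rule bubble[OF alt_sum_PC[OF assms(3)] order_refl b])
      also have "\<dots> \<approx> upm 2 (i - 2) (arr (Arr 0) \<star> (arr (Star 0) \<star> alt_sum d j v) + arr (Arr 1) \<star> (arr (Star 1) \<star> alt_sum d j v))"
        by (rule upm_eqv[OF rel_2[OF alt_sum_PC[OF assms(3)]] b'])
      also have "\<dots> \<approx> upm 2 (i - 2) (arr (Arr 0) \<star> scl (v True) (alt False (Suc d) j) + arr (Arr 1) \<star> scl (v False) (alt True (Suc d) j))"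
        using star_alt_sum[OF assms(3), of True d v] star_alt_sum[OF assms(3), of False d v]
        by (intro upm_eqv[OF _ b'] eqv_add eqv_left PC_arr) simp_all
      also have "\<dots> = nf i j (Suc l) ?v"
        using nf_pq[OF e, of ?v] True i(9) by (simp add: alt_sum_eq Lmap_def pmul_scl_right del: alt.simps)
      finally show ?thesis by (simp only: i(1) Star arrow_tgt.simps)
    next
      case (2 w)
      let ?v = "Lmap (Star i) v"
      have v: "?v False = v False" using 2(7) i(9) by (simp add: Lmap_def)
      show ?thesis
      \<comment> \<open>If the lowest vertex is the end point itself, the new arrow just continues
        the descent and no relation is involved.\<close>
      proof (cases "w = Suc i")
        case w: True
        hence j: "j - i = Suc (j - Suc i)" "j - Suc (j - Suc i) = i" "Suc l + 2 * i = i + j"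
          using 2 by auto
        have "nf (Suc i) j l v = scl (v False) (dn j (j - Suc i))"
          using nf_valley[OF 2(1-4), of v] w by simp
        moreover have "nf i j (Suc l) ?v = scl (v False) (dn j (j - i))"
          using nf_valley[OF j(3) True True 2(4), of ?v] v by simp
        ultimately show ?thesis using j(1,2) True by (simp add: pmul_scl_right Star)
      next
        case False
        hence w: "w \<le> i" "w + (i - w) = i" "Suc i - w = Suc (i - w)" using 2 by auto
        have b: "w + (i - w) \<le> n - 2" and b': "w + (i - w) < n" using w(2) i(7,8) by linarith+
        let ?z = "dn j (j - w)"
        have z: "?z \<in> PC n" by (rule dn_PC) (use 2 assms in auto)
        have "arr (Star i) \<star> nf (Suc i) j l v =
            scl (v False) (arr (Star (w + (i - w))) \<star> (arr (Arr (w + (i - w))) \<star> upm w (i - w) ?z))"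
          using nf_valley[OF 2(1-4), of v] w by (simp add: pmul_scl_right)
        also have "\<dots> \<approx> scl (v False) (upm w (i - w) (arr (Star w) \<star> (arr (Arr w) \<star> ?z)))"
          by (rule eqv_scl[OF bubble[OF z 2(2) b]])
        also have "\<dots> \<approx> nf i j (Suc l) ?v"
        \<comment> \<open>From a valley at 2 the path drops to height 1 and its normal form changes
          type; a higher valley is replaced by the one below it.\<close>
        proof (cases "w = 2")
          case w2: True
          have e: "lev i + lev j + 2 * 0 = Suc l + 2" using 2(1,4) w2 i(2) by simp
          have "scl (v False) (upm w (i - w) (arr (Star w) \<star> (arr (Arr w) \<star> ?z))) \<approx>
             scl (v False) (upm 2 (i - 2) (arr (Arr 0) \<star> (arr (Star 0) \<star> ?z) + arr (Arr 1) \<star> (arr (Star 1) \<star> ?z)))"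
            unfolding w2 by (rule eqv_scl[OF upm_eqv[OF rel_2 b'[unfolded w2]]]) (use z w2 in simp)
          also have "\<dots> = upm 2 (i - 2) (alt_sum 0 j ?v)"
            using 2(4,7) w2 i(9) by (simp add: alt_sum_eq Lmap_def upm_add upm_scl scl_simps pmul_scl_right)
          also have "\<dots> = nf i j (Suc l) ?v" using nf_pq[OF e, of ?v] True by simp
          finally show ?thesis .
        next
          case w3: False
          hence e: "Suc l + 2 * (w - 1) = i + j" "2 \<le> w - 1" "i - (w - 1) = Suc (i - w)"
            "Suc (w - 1) = w" "j - (w - 1) = Suc (j - w)" "j - Suc (j - w) = w - 1" using 2 w by auto
          have "scl (v False) (upm w (i - w) (arr (Star w) \<star> (arr (Arr w) \<star> ?z))) \<approx>
             scl (v False) (upm w (i - w) (arr (Arr (w - 1)) \<star> (arr (Star (w - 1)) \<star> ?z)))"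
            by (rule eqv_scl[OF upm_eqv[OF rel_arm[OF z] b']]) (use w3 w(1) i(7) 2(2) in linarith)+
          also have "\<dots> = scl (v False) (upm (w - 1) (i - (w - 1)) (dn j (j - (w - 1))))"
            by (simp only: e(3-6) upm_Suc dn.simps(2))
          also have "\<dots> = nf i j (Suc l) ?v"
            using nf_valley[OF e(1,2) True 2(4), of ?v] v by simp
          finally show ?thesis .
        qed
        finally show ?thesis by (simp only: i(1) Star arrow_tgt.simps)
      qed
    qed
  qed
qed

lemma nf_path: "is_path n (xs, j) \<Longrightarrow> path_elem (xs, j) \<approx> nf (path_tgt (xs, j)) j (length xs) (val (xs, j))"
proof (induction xs)
  case Nil
  show ?case
  proof (cases "2 \<le> j")
    case True
    thus ?thesis using nf_valley[of 0 j j j "val ([], j) :: bool \<Rightarrow> 'a"] by (simp del: val.simps add: val.simps(1)[of j False])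
  next
    case False
    hence "lev j + lev j + 2 * 0 = 0 + 2" "compat j (j = 1)" by (auto simp: compat_1)
    thus ?thesis using nf_pq[of j j 0 0 "val ([], j) :: bool \<Rightarrow> 'a"] False
      by (simp del: val.simps add: val.simps(1)[of j "j = Suc 0"])
  qed
next
  case (Cons a xs)
  hence a: "is_path n (xs, j)" "arrow_index a \<le> n - 2" "arrow_src a = path_tgt (xs, j)" "j < n"
    using is_path_source[of n xs j] by auto
  have "path_elem (a # xs, j) = (arr a \<star> path_elem (xs, j) :: path \<Rightarrow> 'a)"
    using a by (simp add: path_elem_mult)
  moreover have "arr a \<star> path_elem (xs, j) \<approx> arr a \<star> nf (path_tgt (xs, j)) j (length xs) (val (xs, j) :: bool \<Rightarrow> 'a)"
    using Cons.IH a(1) PC_arr[OF a(2)] by (intro eqv_left) simp_all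
  moreover have "arr a \<star> nf (path_tgt (xs, j)) j (length xs) (val (xs, j)) \<approx>
      nf (arrow_tgt a) j (Suc (length xs)) (Lmap a (val (xs, j)) :: bool \<Rightarrow> 'a)"
    using nf_left[of a j "length xs" "val (xs, j)"] a sub_path[OF a(1)] by simp
  ultimately show ?case using eqv_trans by (fastforce simp: val_Cons)
qed

definition box :: "nat \<Rightarrow> (nat \<times> nat \<times> nat) set" where
  "box L = {..<n} \<times> {..<n} \<times> {..L}"

lemma finite_box [simp]: "finite (box L)"
  by (simp add: box_def)

text \<open>Lengths are unbounded over all elements, so the sum runs over a box of lengths. Asking
  for every sufficiently large box lets two summands be expanded over a common one.\<close>

lemma nf_decomp:
  assumes "x \<in> PC n"
  shows "\<exists>L0. \<forall>L\<ge>L0. x \<approx> (\<Sum>(i, j, l)\<in>box L. nf i j l (coord n x i j l))"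
  using assms
proof (induction rule: PC_induct)
  case zero
  show ?case by (simp add: case_prod_beta)
next
  case (step c p x)
  obtain xs j where p: "p = (xs, j)" by (cases p)
  obtain L0 where L0: "\<And>L. L \<ge> L0 \<Longrightarrow> x \<approx> (\<Sum>(i, j, l)\<in>box L. nf i j l (coord n x i j l))"
    using step by blast
  have "scl c (path_elem p) + x \<approx> (\<Sum>(i, j, l)\<in>box L. nf i j l (coord n (scl c (path_elem p) + x) i j l))"
    if L: "L \<ge> max L0 (length xs)" for L
  proof -
    let ?t = "(path_tgt (xs, j), j, length xs)"
    have t: "?t \<in> box L"
      using L step(1) path_tgt_less[OF n3] is_path_source[of n xs j] by (auto simp: box_def p)
    have e: "(case q of (i, j, l) \<Rightarrow> nf i j l (coord n (path_elem p) i j l)) =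
        (if q = ?t then nf (path_tgt (xs, j)) j (length xs) (val (xs, j)) else 0 :: path \<Rightarrow> 'a)"
      if "q \<in> box L" for q
      using step(1) by (auto simp: coord_path_elem paths_def p split: prod.splits)
    have "(\<Sum>(i, j, l)\<in>box L. nf i j l (coord n (path_elem p) i j l)) =
        (\<Sum>q\<in>box L. if q = ?t then nf (path_tgt (xs, j)) j (length xs) (val (xs, j)) else 0 :: path \<Rightarrow> 'a)"
      by (rule sum.cong[OF refl e])
    also have "\<dots> = nf (path_tgt (xs, j)) j (length xs) (val (xs, j))"
      using t by (simp add: sum.delta)
    finally have "path_elem p \<approx> (\<Sum>(i, j, l)\<in>box L. nf i j l (coord n (path_elem p :: path \<Rightarrow> 'a) i j l))"
      using nf_path[of xs j] step(1) by (simp add: p)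
    moreover have "(\<Sum>(i, j, l)\<in>box L. nf i j l (coord n (scl c (path_elem p) + x) i j l)) =
      scl c (\<Sum>(i, j, l)\<in>box L. nf i j l (coord n (path_elem p :: path \<Rightarrow> 'a) i j l)) +
      (\<Sum>(i, j, l)\<in>box L. nf i j l (coord n x i j l))"
      by (simp add: coord_add coord_scl nf_add nf_scl scl_sum sum.distrib case_prod_beta)
    ultimately show ?thesis using L0[of L] L by (simp add: eqv_add eqv_scl)
  qed
  thus ?case by blast
qed

text \<open>Normal forms are built from the left, and right multiplication does not visibly preserve
  them. Here the class of a product is identified from its coordinates alone, whichever side was
  multiplied.\<close>

lemma conc_nf_eqv:
  assumes "conc n x i j l v" "i < n" "j < n"
  shows "x \<approx> nf i j l v"
proof -
  have x: "x \<in> PC n" "coord n x i' j' l' = (if i' = i \<and> j' = j \<and> l' = l then v else 0)" for i' j' l'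
    using assms by (auto simp: conc_def)
  obtain L0 where L0: "\<And>L. L \<ge> L0 \<Longrightarrow> x \<approx> (\<Sum>(i, j, l)\<in>box L. nf i j l (coord n x i j l))"
    using nf_decomp[OF x(1)] by blast
  define L where "L = max L0 l"
  have t: "(i, j, l) \<in> box L" using assms by (simp add: box_def L_def)
  have "(\<Sum>(i, j, l)\<in>box L. nf i j l (coord n x i j l)) = (\<Sum>q\<in>box L. if q = (i, j, l) then nf i j l v else 0)"
    by (rule sum.cong) (auto simp: x)
  also have "\<dots> = nf i j l v" using t by (simp add: sum.delta)
  finally show ?thesis using L0[of L] by (simp add: L_def)
qed

section \<open>Cells emptied by the relation at the last vertex\<close>

lemma sub_one: "2 \<le> i \<Longrightarrow> 2 \<le> j \<Longrightarrow> even (l + i + j) \<Longrightarrow> i \<le> l + j \<Longrightarrow> j \<le> l + i \<Longrightarrow> sub i j l (\<lambda>c. 1)"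
  by (simp add: sub_def)

text \<open>At \<open>n - 1\<close> the normal form contains the last relation. Multiplying by
  \<open>Star\<close> then carries it down the arm; each step adds one to the length and lowers the
  end point by one, so the bound on \<open>l + i + j\<close> is inherited.\<close>

lemma nf_diag:
  assumes "2 \<le> i" "2 \<le> j" "i < n" "j < n" "even (l + i + j)" "2 * n \<le> l + i + j"
  shows "nf i j l (\<lambda>c. 1 :: 'a::field) \<in> rel_ideal n"
  using assms
proof (induction "n - 1 - i" arbitrary: i l)
  case 0
  hence i: "i = n - 1" by simp
  have s: "sub i j (l - 2) (\<lambda>c. 1 :: 'a)"
    by (rule sub_one) (use 0 in auto)
  have a: "arrow_src (Star (n - 2)) = i" "arrow_tgt (Arr (n - 2)) = i" "Suc (Suc (l - 2)) = l"
    "compat (n - 2) c" for c using i n4 0 by auto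
  have s': "sub (n - 2) j (Suc (l - 2)) (\<lambda>c. 1 :: 'a)"
    by (rule sub_one) (use 0 i n4 in auto)
  \<comment> \<open>The normal form of length \<open>l\<close> at \<open>n - 1\<close> is the last
    relation times the one of length \<open>l - 2\<close>; the bound on \<open>l + i + j\<close>
    makes the shorter cell admissible.\<close>
  have "0 \<approx> arr (Arr (n - 2)) \<star> (arr (Star (n - 2)) \<star> nf i j (l - 2) (\<lambda>c. 1 :: 'a))"
    by (rule eqv_sym, rule rel_end, rule nf_PC[OF s]) (use 0 in auto)
  also have "\<dots> \<approx> arr (Arr (n - 2)) \<star> nf (n - 2) j (Suc (l - 2)) (\<lambda>c. 1 :: 'a)"
    using nf_left[of "Star (n - 2)" j "l - 2" "\<lambda>c. 1 :: 'a"] a s 0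
    by (intro eqv_left PC_arr) (simp_all add: Lmap_def del: arrow_src.simps)
  also have "\<dots> \<approx> nf i j l (\<lambda>c. 1 :: 'a)"
    using nf_left[of "Arr (n - 2)" j "Suc (l - 2)" "\<lambda>c. 1 :: 'a"] a s' 0
    by (simp add: Lmap_def del: arrow_tgt.simps)
  finally show ?case by (rule eqv_I'[OF _ I_zero])
next
  case (Suc k)
  have "nf (Suc i) j (l - 1) (\<lambda>c. 1 :: 'a) \<in> rel_ideal n"
    by (rule Suc(1)) (use Suc in auto)
  hence "arr (Star i) \<star> nf (Suc i) j (l - 1) (\<lambda>c. 1 :: 'a) \<in> rel_ideal n"
    using Suc by (intro I_left PC_arr) auto
  moreover have "arrow_src (Star i) = Suc i" "compat i c" "Suc (l - 1) = l" "i \<le> n - 2" for c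
    using Suc by auto
  moreover have "sub (Suc i) j (l - 1) (\<lambda>c. 1 :: 'a)"
    by (rule sub_one) (use Suc in auto)
  moreover from calculation have
    "arr (Star i) \<star> nf (Suc i) j (l - 1) (\<lambda>c. 1 :: 'a) \<approx> nf i j l (\<lambda>c. 1 :: 'a)"
    using nf_left[of "Star i" j "l - 1" "\<lambda>c. 1 :: 'a"] Suc.prems(4)
    by (simp add: Lmap_def del: arrow_src.simps)
  ultimately show ?case by - (erule eqv_I', assumption)
qed

lemma sub_even: "sub i j l v \<Longrightarrow> even (l + lev i + lev j)"
  by (simp add: sub_def)

lemma nf_const:
  fixes v :: "bool \<Rightarrow> 'f::field"
  assumes "nf i j l (\<lambda>c. 1 :: 'f::field) \<in> rel_ideal n" "v True = v False"
  shows "nf i j l v \<in> rel_ideal n"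
proof -
  have "v = (\<lambda>c. v False * 1)"
  proof
    fix c show "v c = v False * 1" using assms(2) by (cases c) auto
  qed
  thus ?thesis using I_scl[OF assms(1), of "v False"] nf_scl[of i j l "v False" "\<lambda>c. 1"] by simp
qed

lemma nf_support:
  fixes v w :: "bool \<Rightarrow> 'f::field"
  assumes "nf i j l w \<in> rel_ideal n" "w c = 1" "\<And>b. b \<noteq> c \<Longrightarrow> w b = 0" "\<And>b. b \<noteq> c \<Longrightarrow> v b = 0"
  shows "nf i j l v \<in> rel_ideal n"
proof -
  have "v = (\<lambda>b. v c * w b)"
  proof
    fix b show "v b = v c * w b" using assms(2-) by (cases "b = c") auto
  qed
  thus ?thesis using I_scl[OF assms(1), of "v c"] nf_scl[of i j l "v c" w] by simp
qed

lemma nf_valley_I: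
  assumes "l + 2 * w = i + j" "2 \<le> i" "2 \<le> j" "i < n" "j < n" "v True = v False"
    "2 * n \<le> l + i + j"
  shows "nf i j l v \<in> rel_ideal n"
proof -
  have "even (l + i + j)" using assms(1) by presburger
  thus ?thesis using nf_const[OF nf_diag] assms by blast
qed

lemma src_low: "c \<le> 1 \<Longrightarrow> arrow_src (Star c) = 2" "c \<le> 1 \<Longrightarrow> arrow_tgt (Arr c) = 2"
  "c \<le> 1 \<Longrightarrow> c \<le> n - 2" "c \<le> 1 \<Longrightarrow> c < n"
  using n4 by auto

text \<open>Appending the arrow that starts at \<open>j\<close> cuts the diagonal vector, already in
  the ideal, down to one coordinate. This is the only coordinate that \<open>sub\<close> allows for
  a source of height 1, so the ideal fills the cell.\<close>

lemma nf_right_low: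
  assumes "2 \<le> i" "i < n" "j \<le> 1" "2 * n \<le> l + i + 1" "sub i j l v"
  shows "nf i j l (v :: bool \<Rightarrow> 'a::field) \<in> rel_ideal n"
proof -
  have ev: "odd (l + i)" using sub_even[OF assms(5)] assms by simp
  have s: "sub i 2 (l - 1) (\<lambda>c. 1 :: 'a)" by (rule sub_one) (use assms ev in auto)
  have "nf i 2 (l - 1) (\<lambda>c. 1 :: 'a) \<in> rel_ideal n"
    by (rule nf_diag) (use assms ev n4 in auto)
  hence I: "nf i 2 (l - 1) (\<lambda>c. 1 :: 'a) \<star> arr (Arr j) \<in> rel_ideal n"
    using assms src_low[of j] by (intro I_right PC_arr) auto
  have "conc n (nf i 2 (l - 1) (\<lambda>c. 1 :: 'a) \<star> arr (Arr j)) i j l (Rmap (Arr j) i l (\<lambda>c. 1 :: 'a))"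
    using conc_right[of "nf i 2 (l - 1) (\<lambda>c. 1 :: 'a)" i "Arr j" "l - 1"] conc_nf[OF s] assms src_low[of j]
    by (simp del: arrow_tgt.simps)
  from eqv_I'[OF conc_nf_eqv[OF this assms(2) src_low(4)[OF assms(3)]] I]
  have I: "nf i j l (Rmap (Arr j) i l (\<lambda>c. 1 :: 'a)) \<in> rel_ideal n" .
  define c where "c \<longleftrightarrow> (j = 1) \<noteq> odd (nstars i j l)"
  have c: "compat j (b \<noteq> odd (nstars i j l)) \<longleftrightarrow> b = c" for b
    unfolding compat_1[OF assms(3)] c_def
    by (cases b; cases "j = 1"; cases "odd (nstars i j l)") simp_all
  show ?thesis
  proof (rule nf_support[OF I])
    show "Rmap (Arr j) i l (\<lambda>c. 1 :: 'a) c = 1" by (simp only: Rmap_def arrow.case c) simp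
    fix b assume "b \<noteq> c"
    hence b: "\<not> compat j (b \<noteq> odd (nstars i j l))" using c by blast
    show "Rmap (Arr j) i l (\<lambda>c. 1 :: 'a) b = 0" by (simp only: Rmap_def arrow.case b if_False)
    show "v b = 0" by (rule sub_src[OF assms(5) b])
  qed
qed

text \<open>Reached from the cell of paths ending at 2, which \<open>nf_right_low\<close> has
  filled, by one further step down to \<open>i\<close>.\<close>

lemma nf_low_low:
  assumes "i \<le> 1" "j \<le> 1" "2 * n \<le> l + 2" "sub i j l v"
  shows "nf i j l (v :: bool \<Rightarrow> 'a::field) \<in> rel_ideal n"
proof -
  define w where "w = (\<lambda>c. of_bool (compat j (c \<noteq> odd (nstars 2 j (l - 1)))) :: 'a)"
  have ev: "even l" "0 < l" using sub_even[OF assms(4)] assms n4 by auto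
  have s: "sub 2 j (l - 1) w" using assms ev by (auto simp: sub_def w_def)
  have "nf 2 j (l - 1) w \<in> rel_ideal n"
    by (rule nf_right_low) (use assms s n4 in auto)
  hence "arr (Star i) \<star> nf 2 j (l - 1) w \<in> rel_ideal n"
    using assms src_low[of i] by (intro I_left PC_arr) auto
  moreover have "arr (Star i) \<star> nf 2 j (l - 1) w \<approx> nf i j l (Lmap (Star i) w)"
    using nf_left[of "Star i" j "l - 1" w] s assms src_low[of i] src_low[of j] ev
    by (simp del: arrow_src.simps)
  ultimately have I: "nf i j l (Lmap (Star i) w) \<in> rel_ideal n" by (rule eqv_I'[rotated])
  have ns: "nstars i j l = Suc (nstars 2 j (l - 1))"
    using assms ev by (auto simp: nstars_def elim!: evenE)
  show ?thesis
  \<comment> \<open>A nonzero \<open>v\<close> forces the colours of both ends to fit the number of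
    letters, and then the element just constructed has coordinate 1 at the colour of
    \<open>i\<close>.\<close>
  proof (cases "v (i = 1) = 0")
    case True
    have "v = 0"
    proof
      fix c show "v c = 0 c"
        using True sub_tgt[OF assms(4), of c] compat_1[OF assms(1), of c]
        by (cases "c = (i = 1)") (simp_all add: zero_fun_apply)
    qed
    thus ?thesis by (simp add: I_zero)
  next
    case False
    hence "compat j ((i = 1) \<noteq> odd (nstars i j l))" using sub_src[OF assms(4)] by blast
    moreover have "((i = 1) \<noteq> odd (nstars i j l)) = ((\<not> (i = 1)) \<noteq> odd (nstars 2 j (l - 1)))"
      unfolding ns by simp
    ultimately have "w (\<not> (i = 1)) = 1" unfolding w_def by (simp only: of_bool_eq)
    hence 1: "Lmap (Star i) w (i = 1) = 1" using assms(1) by (simp add: Lmap_def compat_1)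
    show ?thesis
    proof (rule nf_support[OF I 1])
      fix b assume "b \<noteq> (i = 1)"
      hence "\<not> compat i b" by (simp add: compat_1[OF assms(1)])
      thus "Lmap (Star i) w b = 0" "v b = 0" using sub_tgt[OF assms(4)] by (simp_all add: Lmap_def)
    qed
  qed
qed

lemma nf_left_low:
  assumes "i \<le> 1" "j < n" "2 * n + 1 \<le> l + lev j + 2" "sub i j l v"
  shows "nf i j l (v :: bool \<Rightarrow> 'a::field) \<in> rel_ideal n"
proof (cases "2 \<le> j")
  case True
  have ev: "odd (l + j)" using sub_even[OF assms(4)] assms True by simp
  have s: "sub 2 j (l - 1) (\<lambda>c. 1 :: 'a)" by (rule sub_one) (use assms ev True in auto)
  have "nf 2 j (l - 1) (\<lambda>c. 1 :: 'a) \<in> rel_ideal n"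
    by (rule nf_diag) (use assms ev n4 True in auto)
  hence "arr (Star i) \<star> nf 2 j (l - 1) (\<lambda>c. 1 :: 'a) \<in> rel_ideal n"
    using assms src_low[of i] by (intro I_left PC_arr) auto
  moreover have "arr (Star i) \<star> nf 2 j (l - 1) (\<lambda>c. 1 :: 'a) \<approx> nf i j l (Lmap (Star i) (\<lambda>c. 1 :: 'a))"
    using nf_left[of "Star i" j "l - 1" "\<lambda>c. 1 :: 'a"] s assms src_low[of i] True
    by (simp del: arrow_src.simps)
  ultimately have I: "nf i j l (Lmap (Star i) (\<lambda>c. 1 :: 'a)) \<in> rel_ideal n" by (rule eqv_I'[rotated])
  have 1: "Lmap (Star i) (\<lambda>c. 1 :: 'a) (i = 1) = 1" using assms(1) by (simp add: Lmap_def compat_1)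
  show ?thesis
  proof (rule nf_support[OF I 1])
    fix b assume "b \<noteq> (i = 1)"
    hence "\<not> compat i b" by (simp add: compat_1[OF assms(1)])
    thus "Lmap (Star i) (\<lambda>c. 1 :: 'a) b = 0" "v b = 0" using sub_tgt[OF assms(4)] by (simp_all add: Lmap_def)
  qed
next
  case False
  thus ?thesis using nf_low_low[of i j l v] assms by simp
qed

lemma alt_nf: "lev j + 2 * d = l + 1 \<Longrightarrow> alt c d j = nf (col c) j l (\<lambda>b. of_bool (b = c) :: 'a::field)"
  using nf_pq[of "col c" j d l "\<lambda>b. of_bool (b = c) :: 'a"] col_simps(3)[of c] by simp

lemma sub_alt:
  assumes "lev j + 2 * d = l + 1" "ok c d j"
  shows "sub (col c) j l (\<lambda>b. of_bool (b = c) :: 'a::field)"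
  unfolding sub_def
proof (intro conjI allI impI)
  have "compat j (c \<noteq> odd (nstars (col c) j l))"
  proof (cases "2 \<le> j")
    case False
    hence "lev j = 1" by simp
    hence "nstars (col c) j l = d" using assms by (simp add: nstars_def)
    thus ?thesis using assms(2) by (simp add: ok_def)
  qed simp
  thus "\<not> compat j (b \<noteq> odd (nstars (col c) j l)) \<Longrightarrow> of_bool (b = c) = (0 :: 'a)" for b
    by (cases "b = c") simp_all
qed (use assms(1) lev_ge[of j] in \<open>simp_all, presburger+\<close>)

text \<open>The two summands of \<open>alt_sum\<close> are themselves made from normal forms ending
  at 0 and at 1, where the cell is already filled; climbing the arm again stays in the ideal. Thus
  the two coordinates vanish separately.\<close>

lemma nf_full_left:
  assumes "i < n" "j < n" "2 * n + lev i \<le> l + lev j + 2" "sub i j l v"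
  shows "nf i j l v \<in> rel_ideal n"
proof (cases "2 \<le> i")
  case False
  thus ?thesis using nf_left_low[of i j l v] assms by simp
next
  case True
  from assms(4) show ?thesis
  proof (cases rule: sub_cases)
    case (2 w)
    thus ?thesis using nf_valley_I[of l w i j v] assms by simp
  next
    case (1 d)
    have "scl (v c) (alt c d j) \<in> rel_ideal n" for c
    proof (cases "ok c d j")
      case False
      hence "conc n (alt c d j) (col c) j (lev j - 1 + 2 * d) (0 :: bool \<Rightarrow> 'a)"
        using conc_alt[OF assms(2), of c d] by (simp add: zero_fun_def)
      hence "alt c d j \<approx> nf (col c) j (lev j - 1 + 2 * d) (0 :: bool \<Rightarrow> 'a)"
        by (rule conc_nf_eqv) (use assms in simp_all)
      thus ?thesis using I_scl by (simp add: eqv_zero)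
    next
      case ok: True
      have l: "lev j + 2 * d = lev j - 1 + 2 * d + 1" using lev_ge[of j] by simp
      have "alt c d j \<in> rel_ideal n"
        unfolding alt_nf[OF l]
        by (rule nf_left_low) (use l assms 1 True sub_alt[OF l ok] lev_ge[of j] in auto)
      thus ?thesis by (rule I_scl)
    qed
    hence "alt_sum d j v \<in> rel_ideal n"
      unfolding alt_sum_eq by (intro I_add) (auto simp flip: pmul_scl_right intro!: I_left PC_arr)
    hence "upm 2 (i - 2) (alt_sum d j v) \<in> rel_ideal n"
      using upm_eqv[of "alt_sum d j v" 0 2 "i - 2"] assms True by (simp add: eqv_zero)
    thus ?thesis using nf_pq[OF 1, of v] True by simp
  qed
qed

lemma conc_dn_right:
  assumes "conc n y i (j - k) l w" "k + 2 \<le> j" "j < n"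
  shows "conc n (y \<star> dn j k) i j (l + k) w"
  using assms
proof (induction k arbitrary: y l)
  case 0
  have "y \<in> PC n" using 0 by (simp add: conc_def)
  thus ?case using 0 by (auto simp: conc_def coord_vtx_right)
next
  case (Suc k)
  have "arrow_src (Star (j - Suc k)) = j - k" using Suc by auto
  hence "conc n (y \<star> arr (Star (j - Suc k))) i (j - k) (Suc l) w"
    using conc_right[of y i "Star (j - Suc k)" l w] Suc.prems by (simp add: Rmap_def del: arrow_src.simps)
  from Suc.IH[OF this] show ?case using Suc.prems by (simp add: pmul_assoc)
qed

text \<open>The mirror image of \<open>nf_full_left\<close>. As a normal form has no evident right
  factor, the vector is split by the colour of the last letter, and each part is recognized by its
  coordinates as a product that passes through \<open>col c\<close>.\<close>

lemma nf_full_right: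
  assumes "i < n" "j < n" "2 * n + lev j \<le> l + lev i + 2" "sub i j l v"
  shows "nf i j l v \<in> rel_ideal n"
proof (cases "2 \<le> j")
  case False
  thus ?thesis using nf_right_low[of i j l v] nf_low_low[of i j l v] assms by (cases "2 \<le> i") simp_all
next
  case True
  from assms(4) show ?thesis
  proof (cases rule: sub_cases)
    case (2 w)
    thus ?thesis using nf_valley_I[of l w i j v] assms by simp
  next
    case (1 d)
    have l: "Suc (l - (j - 1)) + (j - 2) = l" "j - 1 \<le> l"
      using 1 True lev_2(1)[OF True] lev_ge[of i] by linarith+
    \<comment> \<open>The parity of the number of letters before the last one. It is the same for
      both colours, because 0 and 1 have equal height; \<open>u c\<close> keeps the words whose last
      letter has colour \<open>c\<close>.\<close>
    define p where "p = odd ((l - (j - 1) + 1 - lev i) div 2)"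
    define u where "u c b = (if c = (b \<noteq> p) then v b else 0)" for c b
    have I: "nf i j l (u c) \<in> rel_ideal n" for c
    proof -
      let ?l = "l - (j - 1)"
      have p: "odd (nstars i (col c) ?l) = p" by (simp add: nstars_def p_def)
      have "even (l + lev i + j)" using assms(4) True by (simp add: sub_def)
      moreover have "l + lev i + j = (?l + lev i + 1) + 2 * (j - 1)" using l(2) True by linarith
      ultimately have ev: "even (?l + lev i + 1)" by simp
      have "lev i \<le> ?l + 1" using 1 lev_2(1)[OF True] l(2) True by linarith
      moreover have "u c b = 0" if "\<not> compat i b" for b
        using sub_tgt[OF assms(4) that] by (simp add: u_def)
      moreover have "u c b = 0" if "\<not> compat (col c) (b \<noteq> odd (nstars i (col c) ?l))" for b
        using that unfolding p by (simp add: u_def)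
      ultimately have s: "sub i (col c) ?l (u c)"
        using ev lev_ge[of i] unfolding sub_def col_simps(7) by auto
      let ?y = "nf i (col c) ?l (u c)"
      have y: "?y \<in> rel_ideal n"
      proof (cases "2 \<le> i")
        case i: True
        show ?thesis by (rule nf_right_low) (use i True assms l(2) s in auto)
      next
        case False
        thus ?thesis by (intro nf_low_low) (use True assms l(2) s in auto)
      qed
      have "conc n (?y \<star> arr (Star (col c))) i 2 (Suc ?l) (u c)"
        using conc_right[of ?y i "Star (col c)" ?l "u c"] conc_nf[OF s assms(1)]
        by (simp add: Rmap_def del: arrow_src.simps)
      hence "conc n (?y \<star> arr (Star (col c)) \<star> dn j (j - 2)) i j l (u c)"
        using conc_dn_right[of "?y \<star> arr (Star (col c))" i j "j - 2" "Suc ?l" "u c"] True assms(2) le_add_diff_inverse2[OF True]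
        unfolding l(1) by simp
      hence "?y \<star> arr (Star (col c)) \<star> dn j (j - 2) \<approx> nf i j l (u c)"
        by (rule conc_nf_eqv[OF _ assms(1,2)])
      moreover have "?y \<star> arr (Star (col c)) \<star> dn j (j - 2) \<in> rel_ideal n"
        using y True assms by (intro I_right PC_arr dn_PC) auto
      ultimately show ?thesis by (rule eqv_I')
    qed
    have "v = u True + u False"
    proof
      fix b show "v b = (u True + u False) b" by (cases "b \<noteq> p") (simp_all add: u_def plus_fun_apply)
    qed
    thus ?thesis using I_add[OF I[of True] I[of False]] nf_add[of i j l "u True" "u False"] by simp
  qed
qed

theorem J_subset_I: "Jset n \<subseteq> rel_ideal n"
proof
  fix x :: "path \<Rightarrow> 'a" assume x: "x \<in> Jset n"
  have xP: "x \<in> PC n" using x by (simp add: Jset_def)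
  obtain L where L: "x \<approx> (\<Sum>(i, j, l)\<in>box L. nf i j l (coord n x i j l))"
    using nf_decomp[OF xP] by blast
  have "nf i j l (coord n x i j l) \<in> rel_ideal n" if ij: "i < n" "j < n" for i j l
  proof (cases "coord n x i j l = 0")
    case False
    hence s: "sub i j l (coord n x i j l)" using coord_sub[OF xP] by blast
    have ev: "even (l + lev i + lev j)" using sub_even[OF s] .
    have q: "quo n i j l (coord n x i j l)" using x by (simp add: Jset_def)
    consider "2 * n + lev j < l + lev i + 4" | "2 * n + lev i < l + lev j + 4"
      | "coord n x i j l True = coord n x i j l False" "2 * n < l + lev i + lev j + 2 \<or> coord n x i j l False = 0"
      using q unfolding quo_def by blast
    thus ?thesis
    proof cases
      case 1
      \<comment> \<open>The parity of the cell gains one over the strict bound in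
        \<open>quo\<close>.\<close>
      hence "2 * n + lev j \<le> l + lev i + 2" using ev by presburger
      thus ?thesis using nf_full_right ij s by blast
    next
      case 2
      hence "2 * n + lev i \<le> l + lev j + 2" using ev by presburger
      thus ?thesis using nf_full_left ij s by blast
    next
      case 3
      \<comment> \<open>A nonzero diagonal vector uses both colours at both ends, so neither end can
        be 0 or 1.\<close>
      have nz: "coord n x i j l c \<noteq> 0" for c
      proof
        assume "coord n x i j l c = 0"
        hence "coord n x i j l b = 0" for b using 3(1) by (cases b; cases c) auto
        thus False using False by (auto simp: fun_app)
      qed
      have "compat i c" "compat j (c \<noteq> odd (nstars i j l))" for c
        using s nz unfolding sub_def by blast+
      hence "compat i True" "compat i False" "compat j True \<and> compat j False"
        by (auto, metis+)
      hence ij2: "2 \<le> i" "2 \<le> j" by (auto simp: compat_def)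
      have "2 * n < l + i + j + 2" using 3(2) nz ij2 by simp
      hence "2 * n \<le> l + i + j" using ev ij2 by simp presburger
      thus ?thesis using nf_const[OF nf_diag] ij2 ij ev 3(1) by simp
    qed
  qed (simp add: I_zero)
  hence "(\<Sum>(i, j, l)\<in>box L. nf i j l (coord n x i j l)) \<in> rel_ideal n"
    by (intro I_sum) (auto simp: box_def)
  thus "x \<in> rel_ideal n" by (rule eqv_I[OF L])
qed

theorem rel_ideal_eq: "rel_ideal n = Jset n"
  using J_subset_I rel_ideal_subset_J by blast

lemma eqv_iff:
  assumes "x \<in> PC n" "y \<in> PC n"
  shows "x \<approx> y \<longleftrightarrow> (\<forall>i j l. quo n i j l (coord n x i j l - coord n y i j l))"
  using assms by (simp add: eqv_def rel_ideal_eq Jset_def coord_diff)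

end

section \<open>Derivations and central elements in coordinates\<close>

lemma nstars_loop [simp]: "nstars i i (2 * m) = m" "nstars i i (m * 2) = m"
  by (simp_all add: nstars_def)

lemma nstars_Arr [simp]: "nstars (arrow_tgt (Arr i)) i (Suc (2 * m)) = m"
  by (simp add: nstars_def del: arrow_tgt.simps)

lemma compat_low: "compat 0 c \<longleftrightarrow> \<not> c" "compat 1 c \<longleftrightarrow> c" "compat (Suc 0) c \<longleftrightarrow> c"
  by (auto simp: compat_def)

lemma Rmap_Arr: "Rmap (Arr i) (arrow_tgt (Arr i)) (Suc (2 * m)) v = (\<lambda>c. if compat i (c \<noteq> odd m) then v c else 0)"
  by (simp add: Rmap_def del: arrow_tgt.simps)

lemma Rmap_Star: "Rmap (Star i) t l v = v"
  by (simp add: Rmap_def)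

lemma Lmap_Arr: "Lmap (Arr i) v = v"
  by (simp add: Lmap_def)

lemma Lmap_Star: "Lmap (Star i) v = (\<lambda>c. if compat i c then v (\<not> c) else 0)"
  by (simp add: Lmap_def)

context type_D
begin

text \<open>
  In coordinates, subtracting an inner derivation makes a derivation of degree \<open>2 m\<close> vanish on
  $a_i$ for $i \ge 2$; the relations then make it a multiple of \<open>(1, 1)\<close> on each $a_i^*$.
\<close>

lemma derivation_level:
  fixes f :: "arrow \<Rightarrow> bool \<Rightarrow> 'f::field"
  assumes two: "(2 :: 'f) \<noteq> 0" and m: "m + 3 \<le> n"
    and d: "\<And>i. 2 \<le> i \<Longrightarrow> i \<le> n - 2 \<Longrightarrow> m + 1 < i \<Longrightarrow> f (Arr i) True = f (Arr i) False"
    and sS: "\<And>i c. i \<le> 1 \<Longrightarrow> c \<noteq> (i = 1) \<Longrightarrow> f (Star i) c = 0"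
    and sA: "\<And>i c. i \<le> 1 \<Longrightarrow> (c \<noteq> odd m) \<noteq> (i = 1) \<Longrightarrow> f (Arr i) c = 0"
    and r1: "odd m \<Longrightarrow> f (Star 0) False + f (Arr 0) True = 0" "odd m \<Longrightarrow> f (Star 1) True + f (Arr 1) False = 0"
    and r2: "\<And>v. v = (\<lambda>c. f (Arr 0) c + f (Arr 1) c + f (Star 0) c + f (Star 1) c - f (Star 2) c - f (Arr 2) (\<not> c))
      \<Longrightarrow> v True = v False \<and> (m + 3 < n \<longrightarrow> v False = 0)"
    and r3: "\<And>i v. 3 \<le> i \<Longrightarrow> i \<le> n - 2 \<Longrightarrow>
      v = (\<lambda>c. f (Arr (i - 1)) c + f (Star (i - 1)) c - f (Star i) c - f (Arr i) (\<not> c)) \<Longrightarrow>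
      v True = v False \<and> (m + i + 1 < n \<longrightarrow> v False = 0)"
    and re: "f (Arr (n - 2)) True + f (Star (n - 2)) True = f (Arr (n - 2)) False + f (Star (n - 2)) False"
  shows "\<exists>u \<zeta>. (odd m \<longrightarrow> \<zeta> = 0) \<and> (\<forall>i<n. sub i i (2 * m) (u i)) \<and>
    (\<forall>a. arrow_index a \<le> n - 2 \<longrightarrow> quo n (arrow_tgt a) (arrow_src a) (Suc (2 * m))
      (\<lambda>c. f a c - \<zeta> * Rmap a (arrow_tgt a) (Suc (2 * m)) (\<lambda>c. of_bool (compat (arrow_tgt a) c)) c
        - (Rmap a (arrow_tgt a) (Suc (2 * m)) (u (arrow_tgt a)) c - Lmap a (u (arrow_src a)) c)))"
proof -
  define w where "w i c = - (\<Sum>k\<in>{i..<n - 1}. f (Arr k) c)" for i c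
  have w_Suc: "w i c = w (Suc i) c - f (Arr i) c" if "i \<le> n - 2" for i c
  proof -
    have "{i..<n - 1} = insert i {Suc i..<n - 1}" using that n4 by auto
    thus ?thesis by (simp add: w_def)
  qed
  have w_end: "w (n - 1) c = 0" for c by (simp add: w_def)
  have w_diag: "w i True = w i False" if "m + 1 < i" for i
    unfolding w_def using that n4 by (intro arg_cong[of _ _ uminus] sum.cong d) auto
  \<comment> \<open>What is left on \<open>Star i\<close> once that commutator has been subtracted.
    The relations along the arm make it diagonal and, as far as \<open>quo\<close> can see it,
    independent of \<open>i\<close>.\<close>
  define H where "H i c = f (Star i) c - w i c + w (Suc i) (\<not> c)" for i c
  have H_end: "H (n - 2) True = H (n - 2) False"
  proof -
    have e: "Suc (n - 2) = n - 1" using n4 by simp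
    have "w (n - 2) c = - f (Arr (n - 2)) c" for c
      using w_Suc[of "n - 2" c] w_end unfolding e by simp
    thus ?thesis using re unfolding H_def e w_end by (simp add: add.commute)
  qed
  have H_step: "H (i - 1) True - H i True = H (i - 1) False - H i False \<and>
      (m + i + 1 < n \<longrightarrow> H (i - 1) False - H i False = 0)" if i: "3 \<le> i" "i \<le> n - 2" for i
  proof -
    have e: "H (i - 1) c - H i c = f (Arr (i - 1)) c + f (Star (i - 1)) c - f (Star i) c - f (Arr i) (\<not> c)" for c
      using w_Suc[of "i - 1" c] w_Suc[of i "\<not> c"] i unfolding H_def by simp
    show ?thesis unfolding e using r3[OF i refl] by simp
  qed
  have H_diag: "H i True = H i False" if "2 \<le> i" "i \<le> n - 2" for i
    using that(2,1)
  proof (induction rule: inc_induct)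
    case base
    show ?case by (rule H_end)
  next
    case (step i)
    thus ?case using H_step[of "Suc i"] by simp
  qed
  have H_const: "H i False = H 2 False" if "2 \<le> i" "i \<le> n - 2" "m + i + 1 < n" for i
    using that
  proof (induction rule: dec_induct)
    case base
    show ?case ..
  next
    case (step i)
    thus ?case using H_step[of "Suc i"] by simp
  qed
  have S: "f (Arr 0) c + f (Arr 1) c + f (Star 0) c + f (Star 1) c - f (Star 2) c - f (Arr 2) (\<not> c) =
     f (Arr 0) c + f (Arr 1) c + f (Star 0) c + f (Star 1) c - H 2 c - w 2 c + w 2 (\<not> c)" for c
    using w_Suc[of 2 "\<not> c"] n4 unfolding H_def by (simp add: eval_nat_numeral)
  note R2 = r2[OF refl, unfolded S]
  note H2 = H_diag[of 2]
  have sub_i: "sub i i (2 * m) v \<longleftrightarrow> (m + 1 < i \<longrightarrow> v True = v False)" if "2 \<le> i" for i and v :: "bool \<Rightarrow> 'f"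
    using that by (auto simp: sub_def)
  have quo_star: "quo n i (arrow_src (Star i)) (Suc (2 * m)) v"
    if "2 \<le> i" "v True = v False" "m + i + 1 < n \<longrightarrow> v False = 0" for i and v :: "bool \<Rightarrow> 'f"
  proof -
    have "arrow_src (Star i) = Suc i" "2 \<le> Suc i" using that(1) by simp_all
    thus ?thesis using that by (auto simp: quo_def)
  qed
  show ?thesis
  proof (cases "odd m")
    case True
    \<comment> \<open>For odd \<open>m\<close> no loop of length \<open>2 * m\<close> at 0 or 1 is
      admissible, so the inner element is 0 there and only a common constant \<beta> on the arm is
      free. \<open>Arr 0\<close> and \<open>Arr 1\<close> both prescribe it; the relation at 2 shows
      that twice the difference of the two values is 0.\<close>
    define \<beta> where "\<beta> = f (Arr 0) True - w 2 True"
    define u where "u i = (if i \<le> 1 then 0 else (\<lambda>c. w i c + \<beta>))" for i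
    have S': "f (Arr 0) False = 0" "f (Arr 1) True = 0" "f (Star 0) True = 0" "f (Star 1) False = 0"
      using sA[of 0 False] sA[of 1 True] sS[of 0 True] sS[of 1 False] True by simp_all
    have b: "f (Star 0) False = - f (Arr 0) True" "f (Star 1) True = - f (Arr 1) False"
      using r1 True by (simp_all add: eq_neg_iff_add_eq_0)
    have "2 * (f (Arr 0) True - w 2 True - (f (Arr 1) False - w 2 False)) = 0"
      using R2 S' b H2 n4 by (simp add: algebra_simps)
    hence "f (Arr 0) True - w 2 True - (f (Arr 1) False - w 2 False) = 0"
      using two mult_eq_0_iff by blast
    hence beta: "\<beta> = f (Arr 1) False - w 2 False" by (simp add: \<beta>_def)
    have bb: "f (Arr 0) True = \<beta> + w 2 True" "f (Arr 1) False = \<beta> + w 2 False"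
    proof -
      show "f (Arr 0) True = \<beta> + w 2 True" by (simp add: \<beta>_def)
      show "f (Arr 1) False = \<beta> + w 2 False" unfolding beta by simp
    qed
    have lam: "H 2 False = 0" if "m + 3 < n"
      using R2 S' b H2 n4 that beta unfolding \<beta>_def by (simp add: algebra_simps)
    have su: "sub i i (2 * m) (u i)" for i
    proof (cases "2 \<le> i")
      case True
      thus ?thesis using w_diag by (simp add: sub_i u_def)
    next
      case False
      thus ?thesis by (simp add: u_def sub_def fun_app)
    qed
    have u2: "u 2 c = w 2 c + \<beta>" "u 0 c = 0" "u 1 c = 0" for c by (simp_all add: u_def fun_app)
    have q: "quo n (arrow_tgt a) (arrow_src a) (Suc (2 * m))
      (\<lambda>c. f a c - (Rmap a (arrow_tgt a) (Suc (2 * m)) (u (arrow_tgt a)) c - Lmap a (u (arrow_src a)) c))"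
      if a: "arrow_index a \<le> n - 2" for a
    proof (cases a)
      case (Arr i)
      have "f (Arr i) c - (Rmap (Arr i) (arrow_tgt (Arr i)) (Suc (2 * m)) (u (arrow_tgt (Arr i))) c - Lmap (Arr i) (u i) c) = 0" for c
      proof -
        consider "i = 0" | "i = 1" | "2 \<le> i" by linarith
        thus ?thesis
        proof cases
          case 1
          thus ?thesis unfolding Rmap_Arr Lmap_Arr using S' u2 \<beta>_def True
            by (cases c) (simp_all add: compat_low)
        next
          case 2
          thus ?thesis unfolding Rmap_Arr Lmap_Arr using S' u2 beta True
            by (cases c) (simp_all add: compat_low numeral_2_eq_2[symmetric])
        next
          case 3
          thus ?thesis unfolding Rmap_Arr Lmap_Arr using w_Suc[of i c] a Arr
            by (simp add: u_def)
        qed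
      qed
      hence "(\<lambda>c. f (Arr i) c - (Rmap (Arr i) (arrow_tgt (Arr i)) (Suc (2 * m)) (u (arrow_tgt (Arr i))) c - Lmap (Arr i) (u i) c)) = 0"
        by (simp add: fun_eq_iff zero_fun_apply)
      thus ?thesis unfolding Arr arrow_src.simps by (simp only: quo_zero)
    next
      case (Star i)
      let ?v = "\<lambda>c. f (Star i) c - (u i c - Lmap (Star i) (u (arrow_src (Star i))) c)"
      have "quo n i (arrow_src (Star i)) (Suc (2 * m)) ?v"
      proof (cases "2 \<le> i")
        case False
        hence "i = 0 \<or> i = 1" by auto
        hence "?v c = 0" for c
          using S' b u2 bb
          by (elim disjE; cases c) (simp_all add: Lmap_Star compat_low numeral_2_eq_2[symmetric])
        hence "?v = 0" by (simp add: fun_eq_iff zero_fun_apply)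
        thus ?thesis by (simp only: quo_zero)
      next
        case i: True
        have v: "?v c = H i c" for c
          using i unfolding H_def by (simp add: Lmap_Star u_def)
        show ?thesis
          by (rule quo_star) (use i v H_diag[of i] H_const[of i] lam a Star in auto)
      qed
      thus ?thesis unfolding Star arrow_tgt.simps Rmap_Star .
    qed
    show ?thesis
      by (intro exI[of _ u] exI[of _ 0]) (use su q in simp)
  next
    case False
    \<comment> \<open>The central multiple of the Euler derivation puts \<zeta> on both arrows of a
      pair, while shifting the inner element by multiples of the height gives opposite amounts.
      After \<open>Arr\<close> has been cleared, \<open>Star\<close> must therefore carry twice
      \<zeta>.\<close>
    define \<zeta> where "\<zeta> = (f (Star 0) False + f (Arr 0) False - w 2 False + w 2 True) / 2"
    \<comment> \<open>The commutator with the height is the arrow itself on \<open>Arr\<close> and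
      its negative on \<open>Star\<close>. Taken -\<zeta> times, it cancels the \<zeta> on
      \<open>Arr\<close> and doubles the one on \<open>Star\<close>.\<close>
    define t where "t i = - \<zeta> * of_nat (lev i)" for i
    define u where "u i = (if i = 0 then (\<lambda>c. if c then 0 else w 2 False - f (Arr 0) False + t 0)
       else if i = 1 then (\<lambda>c. if c then w 2 True - f (Arr 1) True + t 1 else 0)
       else (\<lambda>c. w i c + t i))" for i
    have S': "f (Arr 0) True = 0" "f (Arr 1) False = 0" "f (Star 0) True = 0" "f (Star 1) False = 0"
      using sA[of 0 True] sA[of 1 False] sS[of 0 True] sS[of 1 False] False by simp_all
    have z2: "2 * \<zeta> = f (Star 0) False + f (Arr 0) False - w 2 False + w 2 True"
      using two by (simp add: \<zeta>_def)
    have z2': "2 * \<zeta> = f (Star 1) True + f (Arr 1) True - w 2 True + w 2 False"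
      unfolding z2 using R2 S' H2 n4 by (simp add: algebra_simps)
    have fS: "f (Star 0) False = \<zeta> + \<zeta> - f (Arr 0) False + w 2 False - w 2 True"
        "f (Star 1) True = \<zeta> + \<zeta> - f (Arr 1) True + w 2 True - w 2 False"
      using z2 z2' by (simp_all add: algebra_simps)
    have lam: "H 2 False = 2 * \<zeta>" if "m + 3 < n"
      unfolding z2 using R2 S' H2 n4 that by (simp add: algebra_simps)
    have tt: "t 2 = - \<zeta> - \<zeta>" "t 0 = - \<zeta>" "t 1 = - \<zeta>"
      by (simp_all add: t_def)
    have tS: "t (Suc i) = t i - \<zeta>" if "2 \<le> i" for i
      using that by (simp add: t_def algebra_simps)
    have u0: "u 2 c = w 2 c + t 2" "u 0 c = (if c then 0 else w 2 False - f (Arr 0) False + t 0)"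
       "u 1 c = (if c then w 2 True - f (Arr 1) True + t 1 else 0)" for c
      by (simp_all add: u_def)
    have su: "sub i i (2 * m) (u i)" for i
    proof (cases "2 \<le> i")
      case True
      thus ?thesis using w_diag by (simp add: sub_i u_def)
    next
      case i: False
      hence "i = 0 \<or> i = 1" by auto
      thus ?thesis using False by (auto simp: u_def sub_def compat_low)
    qed
    have q: "quo n (arrow_tgt a) (arrow_src a) (Suc (2 * m))
      (\<lambda>c. f a c - \<zeta> * Rmap a (arrow_tgt a) (Suc (2 * m)) (\<lambda>c. of_bool (compat (arrow_tgt a) c)) c
         - (Rmap a (arrow_tgt a) (Suc (2 * m)) (u (arrow_tgt a)) c - Lmap a (u (arrow_src a)) c))"
      if a: "arrow_index a \<le> n - 2" for a
    proof (cases a)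
      case (Arr i)
      let ?v = "\<lambda>c. f (Arr i) c - \<zeta> * Rmap (Arr i) (arrow_tgt (Arr i)) (Suc (2 * m)) (\<lambda>c. of_bool (compat (arrow_tgt (Arr i)) c)) c
        - (Rmap (Arr i) (arrow_tgt (Arr i)) (Suc (2 * m)) (u (arrow_tgt (Arr i))) c - Lmap (Arr i) (u i) c)"
      have "?v c = 0" for c
      proof -
        consider "i = 0" | "i = 1" | "2 \<le> i" by linarith
        thus ?thesis
        proof cases
          case 1
          thus ?thesis unfolding Rmap_Arr Lmap_Arr using S' u0 tt False
            by (cases c) (simp_all add: compat_low)
        next
          case 2
          thus ?thesis unfolding Rmap_Arr Lmap_Arr using S' u0 tt False
            by (cases c) (simp_all add: compat_low numeral_2_eq_2[symmetric])
        next
          case 3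
          thus ?thesis unfolding Rmap_Arr Lmap_Arr using w_Suc[of i c] a Arr tS[of i]
            by (simp add: u_def)
        qed
      qed
      hence "?v = 0" by (simp add: fun_eq_iff zero_fun_apply)
      thus ?thesis unfolding Arr arrow_src.simps by (simp only: quo_zero)
    next
      case (Star i)
      let ?v = "\<lambda>c. f (Star i) c - \<zeta> * of_bool (compat i c) - (u i c - Lmap (Star i) (u (arrow_src (Star i))) c)"
      have "quo n i (arrow_src (Star i)) (Suc (2 * m)) ?v"
      proof (cases "2 \<le> i")
        case i: False
        have "?v c = 0" for c
        proof -
          have "i = 0 \<or> i = 1" using i by auto
          thus ?thesis
          proof
            assume "i = 0"
            thus ?thesis by (cases c) (simp_all add: Lmap_Star compat_low S' u0 tt fS algebra_simps)
          next
            assume "i = 1"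
            thus ?thesis
              by (cases c) (simp_all add: Lmap_Star compat_low numeral_2_eq_2[symmetric] S'[unfolded One_nat_def]
                  u0[unfolded One_nat_def] tt[unfolded One_nat_def] fS[unfolded One_nat_def] algebra_simps)
          qed
        qed
        hence "?v = 0" by (simp add: fun_eq_iff zero_fun_apply)
        thus ?thesis by (simp only: quo_zero)
      next
        case i: True
        have v: "?v c = H i c - 2 * \<zeta>" for c
          using i tS[of i] unfolding H_def by (simp add: Lmap_Star u_def algebra_simps)
        show ?thesis unfolding v
          by (rule quo_star) (use i H_diag[of i] H_const[of i] lam a Star in auto)
      qed
      thus ?thesis unfolding Star arrow_tgt.simps Rmap_Star .
    qed
    show ?thesis
      by (intro exI[of _ u] exI[of _ \<zeta>]) (use su q False in simp)
  qed
qed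

section \<open>From level-wise data to elements of the path algebra\<close>

lemma assemble:
  fixes V :: "nat \<Rightarrow> nat \<Rightarrow> bool \<Rightarrow> 'f::field"
  assumes "\<And>i l. i < n \<Longrightarrow> V i l = 0 \<or> sub i i l (V i l)"
  shows "\<exists>x\<in>PC n. \<forall>i j l. coord n x i j l = (if i = j \<and> i < n \<and> l \<le> 2 * n then V i l else 0)"
proof
  \<comment> \<open>The cut-off \<open>2 * n\<close> is merely a convenient bound above
    \<open>2 * (n - 2)\<close>, beyond which loops vanish in \<open>A\<close>.\<close>
  let ?x = "\<Sum>p\<in>{..<n} \<times> {..2 * n}. nf (fst p) (fst p) (snd p) (V (fst p) (snd p))"
  have c: "conc n (nf i i l (V i l)) i i l (V i l)" if "i < n" for i l
  proof (cases "V i l = 0")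
    case False
    thus ?thesis using assms[OF that, of l] conc_nf that by blast
  qed simp
  show "?x \<in> PC n" using c by (intro PC_sum) (auto simp: conc_def)
  show "\<forall>i j l. coord n ?x i j l = (if i = j \<and> i < n \<and> l \<le> 2 * n then V i l else 0)"
  proof (intro allI)
    fix i j l
    have "coord n ?x i j l = (\<Sum>p\<in>{..<n} \<times> {..2 * n}. if p = (i, l) \<and> i = j then V i l else 0)"
      unfolding coord_sum using c by (intro sum.cong) (auto simp: conc_def)
    also have "\<dots> = (if i = j \<and> i < n \<and> l \<le> 2 * n then V i l else 0)"
      by (cases "i = j") (simp_all add: sum.delta)
    finally show "coord n ?x i j l = (if i = j \<and> i < n \<and> l \<le> 2 * n then V i l else 0)" .
  qed
qed

lemma arrow_tgt_n: "arrow_index a \<le> n - 2 \<Longrightarrow> arrow_tgt a < n"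
  by (rule arrow_tgt_less) auto

lemma arrow_src_n: "arrow_index a \<le> n - 2 \<Longrightarrow> arrow_src a < n"
  by (rule arrow_src_less) auto

lemma lev_arrow: "lev (arrow_tgt a) = lev (arrow_src a) + 1 \<or> lev (arrow_src a) = lev (arrow_tgt a) + 1"
  by (cases a) (metis lev_tgt_Arr arrow_src.simps(1), metis lev_src_Star arrow_tgt.simps(2))

lemma quo_full: "2 * n + lev j < l + lev i + 4 \<or> 2 * n + lev i < l + lev j + 4 \<Longrightarrow> quo n i j l v"
  by (auto simp: quo_def)

lemma coord_odd_loop: "x \<in> PC n \<Longrightarrow> odd l \<Longrightarrow> coord n x i i l = 0"
  using coord_sub[of x n i i l] by (auto simp: sub_def)

lemma coord_even_arrow: "x \<in> PC n \<Longrightarrow> even l \<Longrightarrow> coord n x (arrow_tgt a) (arrow_src a) l = 0"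
  using coord_sub[of x n "arrow_tgt a" "arrow_src a" l] lev_arrow[of a] by (auto simp: sub_def)

lemma coord_comm:
  assumes "x \<in> PC n" "arrow_index a \<le> n - 2"
  shows "coord n (x \<star> arr a) (arrow_tgt a) (arrow_src a) (Suc l) =
      Rmap a (arrow_tgt a) (Suc l) (coord n x (arrow_tgt a) (arrow_tgt a) l)"
    "coord n (arr a \<star> x) (arrow_tgt a) (arrow_src a) (Suc l) = Lmap a (coord n x (arrow_src a) (arrow_src a) l)"
  using assms by (simp_all add: coord_right coord_left)

text \<open>The Leibniz rule: the value on the product of two arrows of a derivation that takes the
  values \<open>F\<close> on arrows.\<close>

definition leib :: "(arrow \<Rightarrow> path \<Rightarrow> 'f::field) \<Rightarrow> arrow \<Rightarrow> arrow \<Rightarrow> path \<Rightarrow> 'f" where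
  "leib F a b = F a \<star> arr b + arr a \<star> F b"

definition derivation_rels :: "(arrow \<Rightarrow> path \<Rightarrow> 'f::field) \<Rightarrow> bool" where
  "derivation_rels F \<longleftrightarrow>
     (\<forall>i\<le>1. leib F (Star i) (Arr i) \<in> rel_ideal n) \<and>
     leib F (Arr 0) (Star 0) + leib F (Arr 1) (Star 1) - leib F (Star 2) (Arr 2) \<in> rel_ideal n \<and>
     (\<forall>i. 3 \<le> i \<longrightarrow> i \<le> n - 2 \<longrightarrow> leib F (Arr (i - 1)) (Star (i - 1)) - leib F (Star i) (Arr i) \<in> rel_ideal n) \<and>
     leib F (Arr (n - 2)) (Star (n - 2)) \<in> rel_ideal n"

lemma coord_leib:
  assumes "F a \<in> PC n" "F b \<in> PC n" "arrow_index a \<le> n - 2" "arrow_index b \<le> n - 2"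
    "arrow_src b = arrow_tgt a" "arrow_tgt b = arrow_src a"
  shows "coord n (leib F a b) (arrow_tgt a) (arrow_tgt a) (Suc (Suc l)) =
    Rmap b (arrow_tgt a) (Suc (Suc l)) (coord n (F a) (arrow_tgt a) (arrow_src a) (Suc l)) +
    Lmap a (coord n (F b) (arrow_tgt b) (arrow_src b) (Suc l))"
  using coord_right[OF assms(1,4) n3, of "arrow_tgt a" "arrow_src b" "Suc (Suc l)"]
    coord_left[OF assms(2,3), of "arrow_tgt a" "arrow_tgt a" "Suc (Suc l)"]
  unfolding leib_def coord_add assms(5,6) by simp

text \<open>Length \<open>2 * m + 1\<close> is treated by \<open>derivation_level\<close> for each
  \<open>m\<close> separately and the resulting loops are put together. If \<open>m + 3 > n\<close>,
  the cell of an arrow is full, because its ends differ in height by one, and nothing has to be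
  checked.\<close>

lemma derivation_decomposition:
  fixes F :: "arrow \<Rightarrow> path \<Rightarrow> 'f::field"
  assumes two: "(2 :: 'f) \<noteq> 0" and F: "\<And>a. arrow_index a \<le> n - 2 \<Longrightarrow> F a \<in> PC n"
    and rels: "derivation_rels F"
  shows "\<exists>U\<in>PC n. \<exists>Z\<in>PC n. (\<forall>v<n. vtx v \<star> U \<approx> U \<star> vtx v) \<and> (\<forall>v<n. vtx v \<star> Z \<approx> Z \<star> vtx v) \<and>
    (\<forall>a. arrow_index a \<le> n - 2 \<longrightarrow> arr a \<star> Z \<approx> Z \<star> arr a \<and>
      (\<forall>l. quo n (arrow_tgt a) (arrow_src a) l
         (coord n (F a - Z \<star> arr a - (U \<star> arr a - arr a \<star> U)) (arrow_tgt a) (arrow_src a) l)))"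
proof -
  define f where "f m a = coord n (F a) (arrow_tgt a) (arrow_src a) (Suc (2 * m))" for m a
  have fs: "f m a = 0 \<or> sub (arrow_tgt a) (arrow_src a) (Suc (2 * m)) (f m a)"
    if "arrow_index a \<le> n - 2" for m a
    unfolding f_def by (rule coord_sub[OF F[OF that]])
  have q: "quo n i i (Suc (Suc (2 * m))) (coord n x i i (Suc (Suc (2 * m))))" if "x \<in> rel_ideal n"
    for i m and x :: "path \<Rightarrow> 'f"
    using that rel_ideal_subset_J by (auto simp: Jset_def)
  have ai: "i \<le> n - 2 \<Longrightarrow> arrow_index (Arr i) \<le> n - 2" "i \<le> n - 2 \<Longrightarrow> arrow_index (Star i) \<le> n - 2" for i
    by simp_all
  have lv: "\<exists>u \<zeta>. (odd m \<longrightarrow> \<zeta> = 0) \<and> (\<forall>i<n. sub i i (2 * m) (u i)) \<and>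
    (\<forall>a. arrow_index a \<le> n - 2 \<longrightarrow> quo n (arrow_tgt a) (arrow_src a) (Suc (2 * m))
      (\<lambda>c. f m a c - \<zeta> * Rmap a (arrow_tgt a) (Suc (2 * m)) (\<lambda>c. of_bool (compat (arrow_tgt a) c)) c
        - (Rmap a (arrow_tgt a) (Suc (2 * m)) (u (arrow_tgt a)) c - Lmap a (u (arrow_src a)) c)))"
    if m: "m + 3 \<le> n" for m
  proof (rule derivation_level[OF two m])
    fix i assume i: "2 \<le> i" "i \<le> n - 2" "m + 1 < i"
    have "sub (Suc i) i (Suc (2 * m)) (f m (Arr i)) \<or> f m (Arr i) = 0"
      using fs[of "Arr i" m] i by auto
    thus "f m (Arr i) True = f m (Arr i) False" using i by (auto simp: sub_def zero_fun_apply)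
  next
    fix i c assume i: "i \<le> 1" "c \<noteq> (i = (1::nat))"
    hence "\<not> compat i c" using compat_1 by blast
    thus "f m (Star i) c = 0"
      using fs[of "Star i" m] src_low(3)[OF i(1)] sub_tgt[of i _ _ "f m (Star i)" c]
      by (auto simp: zero_fun_apply)
  next
    fix i c assume i: "i \<le> 1" "(c \<noteq> odd m) \<noteq> (i = (1::nat))"
    have c: "\<not> compat i (c \<noteq> odd (nstars (arrow_tgt (Arr i)) i (Suc (2 * m))))"
      unfolding nstars_Arr compat_1[OF i(1)] by (rule i(2))
    show "f m (Arr i) c = 0"
      using fs[of "Arr i" m] src_low(3)[OF i(1)] sub_src[OF _ c, of "f m (Arr i)"]
      by (auto simp: zero_fun_apply)
  next
    \<comment> \<open>A loop at 0 or 1 has one admissible colour. The coordinate of the other colour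
      is zero, and membership in the ideal makes both coordinates equal at this length.\<close>
    have *: "Rmap (Arr i) i (Suc (Suc (2 * m))) (f m (Star i)) (i = 1) + Lmap (Star i) (f m (Arr i)) (i = 1) = 0"
      if "i \<le> 1" for i
    proof -
      let ?v = "Rmap (Arr i) i (Suc (Suc (2 * m))) (f m (Star i)) + Lmap (Star i) (f m (Arr i))"
      have "leib F (Star i) (Arr i) \<in> rel_ideal n" using rels that by (simp add: derivation_rels_def)
      moreover have "coord n (leib F (Star i) (Arr i)) i i (Suc (Suc (2 * m))) = ?v"
        using coord_leib[of F "Star i" "Arr i" "2 * m"] F ai src_low[OF that] unfolding f_def by simp
      ultimately have qv: "quo n i i (Suc (Suc (2 * m))) ?v" using q by metis
      have nc: "\<not> compat i (i \<noteq> 1)" using compat_1[OF that] by simp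
      have s: "f m (Star i) (i \<noteq> 1) = 0"
        using fs[of "Star i" m] src_low(3)[OF that] sub_tgt[OF _ nc] by (auto simp: zero_fun_apply)
      have "?v (i \<noteq> 1) = 0"
        using nc s by (simp add: plus_fun_apply Lmap_Star Rmap_def)
      moreover have "?v True = ?v False" using qv m lev_2(2)[OF that] by (auto simp: quo_def)
      ultimately have "?v (i = 1) = 0" by (cases "i = 1") simp_all
      thus ?thesis by (simp add: plus_fun_apply)
    qed
    have ns: "nstars i i (Suc (Suc (2 * m))) = Suc m" for i by (simp add: nstars_def)
    show "odd m \<Longrightarrow> f m (Star 0) False + f m (Arr 0) True = 0"
      "odd m \<Longrightarrow> f m (Star 1) True + f m (Arr 1) False = 0"
      using *[of 0] *[of 1] by (simp_all add: Rmap_def Lmap_Star ns compat_low)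
  next
    fix v assume v: "v = (\<lambda>c. f m (Arr 0) c + f m (Arr 1) c + f m (Star 0) c + f m (Star 1) c
       - f m (Star 2) c - f m (Arr 2) (\<not> c))"
    let ?x = "leib F (Arr 0) (Star 0) + leib F (Arr 1) (Star 1) - leib F (Star 2) (Arr 2)"
    have "coord n (leib F (Arr i) (Star i)) 2 2 (Suc (Suc (2 * m))) = f m (Arr i) + f m (Star i)" if "i \<le> 1" for i
      using coord_leib[of F "Arr i" "Star i" "2 * m"] F ai src_low[OF that] that
      unfolding f_def Rmap_Star Lmap_Arr by simp
    moreover have "coord n (leib F (Star 2) (Arr 2)) 2 2 (Suc (Suc (2 * m))) = f m (Star 2) + (\<lambda>c. f m (Arr 2) (\<not> c))"
      using coord_leib[of F "Star 2" "Arr 2" "2 * m"] F ai n4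
      unfolding f_def by (simp add: Rmap_def Lmap_Star)
    ultimately have "coord n ?x 2 2 (Suc (Suc (2 * m))) = v"
      unfolding v by (simp add: coord_add coord_diff fun_app)
    hence "quo n 2 2 (Suc (Suc (2 * m))) v"
      using q[of ?x 2 m] rels by (simp add: derivation_rels_def)
    thus "v True = v False \<and> (m + 3 < n \<longrightarrow> v False = 0)" using m by (auto simp: quo_def)
  next
    fix i v assume i: "3 \<le> i" "i \<le> n - 2" and v: "v = (\<lambda>c. f m (Arr (i - 1)) c + f m (Star (i - 1)) c
       - f m (Star i) c - f m (Arr i) (\<not> c))"
    let ?x = "leib F (Arr (i - 1)) (Star (i - 1)) - leib F (Star i) (Arr i)"
    have e: "arrow_tgt (Arr (i - 1)) = i" "arrow_src (Star (i - 1)) = i" using i by auto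
    have "coord n (leib F (Arr (i - 1)) (Star (i - 1))) i i (Suc (Suc (2 * m))) = f m (Arr (i - 1)) + f m (Star (i - 1))"
      using coord_leib[of F "Arr (i - 1)" "Star (i - 1)" "2 * m"] F ai[of "i - 1"] i
      unfolding f_def Rmap_Star Lmap_Arr e by simp
    moreover have "coord n (leib F (Star i) (Arr i)) i i (Suc (Suc (2 * m))) = f m (Star i) + (\<lambda>c. f m (Arr i) (\<not> c))"
      using coord_leib[of F "Star i" "Arr i" "2 * m"] F ai i
      unfolding f_def by (simp add: Rmap_def Lmap_Star)
    ultimately have "coord n ?x i i (Suc (Suc (2 * m))) = v"
      unfolding v by (simp add: coord_diff fun_app)
    hence "quo n i i (Suc (Suc (2 * m))) v"
      using q[of ?x i m] rels i by (simp add: derivation_rels_def)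
    thus "v True = v False \<and> (m + i + 1 < n \<longrightarrow> v False = 0)" using m i by (auto simp: quo_def)
  next
    have e: "arrow_tgt (Arr (n - 2)) = n - 1" "arrow_src (Star (n - 2)) = n - 1" using n4 by auto
    have "coord n (leib F (Arr (n - 2)) (Star (n - 2))) (n - 1) (n - 1) (Suc (Suc (2 * m))) = f m (Arr (n - 2)) + f m (Star (n - 2))"
      using coord_leib[of F "Arr (n - 2)" "Star (n - 2)" "2 * m"] F ai[of "n - 2"]
      unfolding f_def Rmap_Star Lmap_Arr e by simp
    hence "quo n (n - 1) (n - 1) (Suc (Suc (2 * m))) (f m (Arr (n - 2)) + f m (Star (n - 2)))"
      using q[of "leib F (Arr (n - 2)) (Star (n - 2))" "n - 1" m] rels by (simp add: derivation_rels_def)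
    thus "f m (Arr (n - 2)) True + f m (Star (n - 2)) True = f m (Arr (n - 2)) False + f m (Star (n - 2)) False"
      using m by (auto simp: quo_def plus_fun_apply)
  qed
  define P where "P m u \<zeta> \<longleftrightarrow> (odd m \<longrightarrow> \<zeta> = 0) \<and> (\<forall>i<n. sub i i (2 * m) (u i)) \<and>
    (\<forall>a. arrow_index a \<le> n - 2 \<longrightarrow> quo n (arrow_tgt a) (arrow_src a) (Suc (2 * m))
      (\<lambda>c. f m a c - \<zeta> * Rmap a (arrow_tgt a) (Suc (2 * m)) (\<lambda>c. of_bool (compat (arrow_tgt a) c)) c
        - (Rmap a (arrow_tgt a) (Suc (2 * m)) (u (arrow_tgt a)) c - Lmap a (u (arrow_src a)) c)))" for m u \<zeta>
  define u where "u m = (SOME u. \<exists>\<zeta>. P m u \<zeta>)" for m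
  define \<zeta> where "\<zeta> m = (SOME \<zeta>. P m (u m) \<zeta>)" for m
  have P: "P m (u m) (\<zeta> m)" if "m + 3 \<le> n" for m
  proof -
    have "\<exists>u \<zeta>. P m u \<zeta>" unfolding P_def by (rule lv[OF that])
    hence "\<exists>\<zeta>. P m (u m) \<zeta>" unfolding u_def by (rule someI_ex)
    thus ?thesis unfolding \<zeta>_def by (rule someI_ex)
  qed
  have z0: "m + 3 \<le> n \<Longrightarrow> odd m \<Longrightarrow> \<zeta> m = 0" for m
    using P[of m] by (simp add: P_def)
  have su: "m + 3 \<le> n \<Longrightarrow> i < n \<Longrightarrow> sub i i (2 * m) (u m i)" for m i
    using P[of m] by (simp add: P_def)
  have main: "m + 3 \<le> n \<Longrightarrow> arrow_index a \<le> n - 2 \<Longrightarrow> quo n (arrow_tgt a) (arrow_src a) (Suc (2 * m))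
      (\<lambda>c. f m a c - \<zeta> m * Rmap a (arrow_tgt a) (Suc (2 * m)) (\<lambda>c. of_bool (compat (arrow_tgt a) c)) c
        - (Rmap a (arrow_tgt a) (Suc (2 * m)) (u m (arrow_tgt a)) c - Lmap a (u m (arrow_src a)) c))" for m a
    using P[of m] unfolding P_def by blast
  define VU where "VU i l = (if even l \<and> l div 2 + 3 \<le> n then u (l div 2) i else 0)" for i l
  \<comment> \<open>At every vertex, \<zeta> times the sum of the words with \<open>l div 2\<close>
    letters allowed by the colour of the end. For an odd number of letters this would not be
    admissible at 0 and 1, but then \<zeta> is 0.\<close>
  define VZ where "VZ i l = (if even l \<and> l div 2 + 3 \<le> n then (\<lambda>c. \<zeta> (l div 2) * of_bool (compat i c)) else 0)" for i l
  have "\<exists>x\<in>PC n. \<forall>i j l. coord n x i j l = (if i = j \<and> i < n \<and> l \<le> 2 * n then VU i l else 0)"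
    by (rule assemble) (use su in \<open>auto simp: VU_def\<close>)
  then obtain U where U: "U \<in> PC n" "\<And>i j l. coord n U i j l = (if i = j \<and> i < n \<and> l \<le> 2 * n then VU i l else 0)"
    by blast
  have "\<exists>x\<in>PC n. \<forall>i j l. coord n x i j l = (if i = j \<and> i < n \<and> l \<le> 2 * n then VZ i l else 0)"
  proof (rule assemble)
    fix i l
    show "VZ i l = 0 \<or> sub i i l (VZ i l)"
    proof (cases "even l \<and> l div 2 + 3 \<le> n \<and> \<zeta> (l div 2) \<noteq> 0")
      case True
      then obtain m where m: "l = 2 * m" by blast
      hence "even m" using z0[of m] True by auto
      thus ?thesis using m by (cases "2 \<le> i") (auto simp: VZ_def sub_def)
    qed (auto simp: VZ_def fun_app)
  qed
  then obtain Z where Z: "Z \<in> PC n" "\<And>i j l. coord n Z i j l = (if i = j \<and> i < n \<and> l \<le> 2 * n then VZ i l else 0)"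
    by blast
  have vtx: "vtx v \<star> x \<approx> x \<star> vtx v"
    if "x \<in> PC n" "\<And>i j l. coord n x i j l = (if i = j \<and> i < n \<and> l \<le> 2 * n then V i l else 0)" "v < n"
    for x :: "path \<Rightarrow> 'f" and V v
  proof -
    have "coord n (vtx v \<star> x) i j l = coord n (x \<star> vtx v) i j l" for i j l
      using that by (simp add: coord_vtx_left coord_vtx_right)
    thus ?thesis using that by (subst eqv_iff) auto
  qed
  have VZ_comm: "Rmap a (arrow_tgt a) (Suc l) (VZ (arrow_tgt a) l) = Lmap a (VZ (arrow_src a) l)"
    if "arrow_index a \<le> n - 2" for a l
  proof (cases "even l \<and> l div 2 + 3 \<le> n \<and> \<zeta> (l div 2) \<noteq> 0")
    case True
    then obtain m where m: "l = 2 * m" by blast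
    hence em: "even m" using z0[of m] True by auto
    show ?thesis
    proof (cases a)
      case (Arr i)
      have "compat (arrow_tgt (Arr i)) c" for c by (auto simp: compat_def)
      thus ?thesis unfolding Arr m Rmap_Arr Lmap_Arr using em by (auto simp: VZ_def fun_app simp del: arrow_tgt.simps)
    next
      case (Star i)
      have "compat (arrow_src (Star i)) c" for c by (auto simp: compat_def)
      thus ?thesis unfolding Star m Rmap_Star Lmap_Star by (auto simp: VZ_def fun_app simp del: arrow_src.simps)
    qed
  next
    case False
    hence "VZ i l = 0" for i by (auto simp: VZ_def fun_app)
    thus ?thesis by (simp add: Lmap_linear Rmap_linear)
  qed
  have Zc: "arr a \<star> Z \<approx> Z \<star> arr a" if a: "arrow_index a \<le> n - 2" for a
  proof -
    have "coord n (arr a \<star> Z) i j l = coord n (Z \<star> arr a) i j l" for i j l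
    proof (cases l)
      case (Suc k)
      show ?thesis
        using VZ_comm[OF a, of k] arrow_src_n[OF a] arrow_tgt_n[OF a] Z
        by (auto simp: Suc coord_left[OF Z(1) a] coord_right[OF Z(1) a n3] Lmap_linear Rmap_linear)
    qed (simp add: coord_left[OF Z(1) a] coord_right[OF Z(1) a n3])
    thus ?thesis using Z(1) PC_arr[OF a] by (subst eqv_iff) auto
  qed
  have fin: "quo n (arrow_tgt a) (arrow_src a) l
      (coord n (F a - Z \<star> arr a - (U \<star> arr a - arr a \<star> U)) (arrow_tgt a) (arrow_src a) l)"
    if a: "arrow_index a \<le> n - 2" for a l
  proof (cases "odd l \<and> l div 2 + 3 \<le> n")
    case True
    then obtain m where m: "l = Suc (2 * m)" by (auto elim: oddE)
    with True have m3: "m + 3 \<le> n" by simp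
    have "Rmap a t l (\<lambda>c. \<zeta> m * v c) = (\<lambda>c. \<zeta> m * Rmap a t l v c)" for t v
      by (rule Rmap_linear)
    hence "coord n (F a - Z \<star> arr a - (U \<star> arr a - arr a \<star> U)) (arrow_tgt a) (arrow_src a) l =
      (\<lambda>c. f m a c - \<zeta> m * Rmap a (arrow_tgt a) (Suc (2 * m)) (\<lambda>c. of_bool (compat (arrow_tgt a) c)) c
        - (Rmap a (arrow_tgt a) (Suc (2 * m)) (u m (arrow_tgt a)) c - Lmap a (u m (arrow_src a)) c))"
      using arrow_src_n[OF a] arrow_tgt_n[OF a] m3
      by (simp add: m coord_diff coord_comm[OF U(1) a] coord_comm[OF Z(1) a] U(2) Z(2) VU_def VZ_def f_def fun_app)
    thus ?thesis using main[OF m3 a] by (simp add: m)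
  next
    case False
    show ?thesis
    proof (cases "even l")
      case True
      have "F a - Z \<star> arr a - (U \<star> arr a - arr a \<star> U) \<in> PC n"
        using F[OF a] U(1) Z(1) PC_arr[OF a] by (intro PC_diff PC_mult n3)
      from coord_even_arrow[OF this True] show ?thesis by simp
    next
      case False': False
      hence "2 * n < l + 5" using False by presburger
      thus ?thesis using lev_arrow[of a] by (intro quo_full) auto
    qed
  qed
  show ?thesis
    by (intro bexI[OF _ U(1)] bexI[OF _ Z(1)] conjI allI impI vtx[OF U] vtx[OF Z] Zc fin)
qed

text \<open>The Euler derivation times a central element is inner only if the element lies in the socle.\<close>

lemma inner_central:
  fixes Z U :: "path \<Rightarrow> 'f::field"
  assumes two: "(2 :: 'f) \<noteq> 0" and Z: "Z \<in> PC n" and U: "U \<in> PC n"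
    and Zv: "\<And>v. v < n \<Longrightarrow> vtx v \<star> Z \<approx> Z \<star> vtx v"
    and Zc: "\<And>a. arrow_index a \<le> n - 2 \<Longrightarrow> arr a \<star> Z \<approx> Z \<star> arr a"
    and inner: "\<And>a. arrow_index a \<le> n - 2 \<Longrightarrow> arr a \<star> Z \<approx> U \<star> arr a - arr a \<star> U"
    and l: "l \<noteq> 2 * (n - 2)"
  shows "quo n i j l (coord n Z i j l)"
proof (cases "i = j \<and> even l \<and> l div 2 + 3 \<le> n \<and> i < n")
  case False
  consider "i \<noteq> j" | "odd l" "i = j" | "i = j" "n \<le> i" | "i = j" "even l" "n < l div 2 + 3" using False by linarith
  thus ?thesis
  proof cases
    case 1
    show ?thesis
    proof (cases "i < n")
      case True
      have "quo n i j l (coord n (vtx i \<star> Z) i j l - coord n (Z \<star> vtx i) i j l)"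
        using Zv[OF True] Z True by (subst (asm) eqv_iff) auto
      thus ?thesis using 1 Z by (simp add: coord_vtx_left coord_vtx_right)
    next
      case False
      thus ?thesis using coord_range[OF Z, of i j l] by fastforce
    qed
  next
    case 2
    thus ?thesis using coord_odd_loop[OF Z] by simp
  next
    case 3
    thus ?thesis using coord_range[OF Z, of i j l] by fastforce
  next
    case 4
    hence "2 * n < l + 6" by presburger
    \<comment> \<open>Among the even lengths satisfying the previous bound, the excluded
      \<open>2 * (n - 2)\<close> is the only one at which loops are not yet zero.\<close>
    hence "2 * n < l + 4" using l 4(2) by presburger
    thus ?thesis using 4(1) by (intro quo_full) auto
  qed
next
  case True
  then obtain m where m: "l = 2 * m" "m + 3 \<le> n" "i = j" "i < n" by auto
  define z where "z i = coord n Z i i l" for i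
  define u where "u i = coord n U i i l" for i
  have zs: "z i = 0 \<or> sub i i l (z i)" for i unfolding z_def by (rule coord_sub[OF Z])
  have us: "u i = 0 \<or> sub i i l (u i)" for i unfolding u_def by (rule coord_sub[OF U])
  have c: "quo n (arrow_tgt a) (arrow_src a) (Suc l) (Lmap a (z (arrow_src a)) - Rmap a (arrow_tgt a) (Suc l) (z (arrow_tgt a)))"
    if a: "arrow_index a \<le> n - 2" for a
    using Zc[OF a] Z PC_arr[OF a] unfolding z_def
    by (subst (asm) eqv_iff) (auto simp flip: coord_comm[OF Z a])
  have in': "quo n (arrow_tgt a) (arrow_src a) (Suc l)
      (Lmap a (z (arrow_src a)) - (Rmap a (arrow_tgt a) (Suc l) (u (arrow_tgt a)) - Lmap a (u (arrow_src a))))"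
    if a: "arrow_index a \<le> n - 2" for a
    using inner[OF a] Z U PC_arr[OF a] unfolding z_def u_def
    by (subst (asm) eqv_iff) (auto simp flip: coord_comm[OF Z a] coord_comm[OF U a] coord_diff)
  \<comment> \<open>Between heights 1 and 2 the ideal contains at most the diagonal at these
    lengths, so one vanishing coordinate forces the other to vanish.\<close>
  have low: "v c = 0" if "quo n (arrow_tgt a) (arrow_src a) (Suc l) v" "lev (arrow_tgt a) + lev (arrow_src a) = 3" "v b = 0"
    for v :: "bool \<Rightarrow> 'f" and a b c
  proof -
    have "v True = v False"
      using that(1,2) m lev_arrow[of a] by (auto simp: quo_def)
    thus ?thesis using that(3) by (cases b; cases c) auto
  qed
  have ns: "nstars 2 i (Suc l) = m" if "i \<le> 1" for i
    using nstars_Arr[of i m] src_low(2)[OF that] m(1) by simp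
  have tgt0: "v c = 0" if "v = 0 \<or> sub i i l v" "\<not> compat i c" for i c and v :: "bool \<Rightarrow> 'f"
    using that sub_tgt[of i i l v c] by (auto simp: zero_fun_apply)
  have src0: "v c = 0" if "v = 0 \<or> sub i i l v" "\<not> compat i (c \<noteq> odd m)" for i c and v :: "bool \<Rightarrow> 'f"
    using that(1)
  proof
    assume "sub i i l v"
    moreover have "\<not> compat i (c \<noteq> odd (nstars i i l))" using that(2) by (simp only: m(1) nstars_loop not_False_eq_True)
    ultimately show ?thesis by (rule sub_src)
  qed (simp add: zero_fun_apply)
  have z01: "z 0 True = 0" "u 0 True = 0" "z 1 False = 0" "u 1 False = 0"
    by (rule tgt0[OF zs] tgt0[OF us]; simp add: compat_low)+
  have z01': "z 0 False = 0" "z 1 True = 0" if "odd m"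
    by (rule src0[OF zs]; use that in \<open>simp add: compat_low\<close>)+
  have ai: "arrow_index (Arr i) \<le> n - 2" "arrow_index (Star i) \<le> n - 2"
    "lev (arrow_tgt (Arr i)) + lev (arrow_src (Arr i)) = 3"
    "lev (arrow_tgt (Star i)) + lev (arrow_src (Star i)) = 3" if "i \<le> 1" for i
    using src_low[OF that] that by simp_all
  have A: "Lmap (Arr i) (z i) b - Rmap (Arr i) 2 (Suc l) (z 2) b = 0"
    "Lmap (Arr i) (z i) b - (Rmap (Arr i) 2 (Suc l) (u 2) b - Lmap (Arr i) (u i) b) = 0"
    if "i \<le> 1" "b = (i = 1)" "even m" for i b
  proof -
    have nc: "\<not> compat i (\<not> b)" using compat_1[OF that(1)] that(2) by simp
    have R: "Rmap (Arr i) 2 (Suc l) v = (\<lambda>c. if compat i c then v c else 0)" for v :: "bool \<Rightarrow> 'f"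
      using that(3) by (simp add: Rmap_def ns[OF that(1)])
    have "z i (\<not> b) = 0" "u i (\<not> b) = 0" by (rule tgt0[OF zs nc], rule tgt0[OF us nc])
    thus "Lmap (Arr i) (z i) b - Rmap (Arr i) 2 (Suc l) (z 2) b = 0"
      "Lmap (Arr i) (z i) b - (Rmap (Arr i) 2 (Suc l) (u 2) b - Lmap (Arr i) (u i) b) = 0"
      using low[OF c[OF ai(1)[OF that(1)]] ai(3)[OF that(1)], of "\<not> b" b]
        low[OF in'[OF ai(1)[OF that(1)]] ai(3)[OF that(1)], of "\<not> b" b] nc src_low(2)[OF that(1)]
      by (simp_all add: R Lmap_Arr fun_app del: arrow_tgt.simps)
  qed
  have S: "Lmap (Star i) (z 2) b - z i b = 0"
    "Lmap (Star i) (z 2) b - (u i b - Lmap (Star i) (u 2) b) = 0"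
    if "i \<le> 1" "b = (i = 1)" for i b
  proof -
    have nc: "\<not> compat i (\<not> b)" using compat_1[OF that(1)] that(2) by simp
    have "z i (\<not> b) = 0" "u i (\<not> b) = 0" by (rule tgt0[OF zs nc(1)], rule tgt0[OF us nc(1)])
    thus "Lmap (Star i) (z 2) b - z i b = 0"
      "Lmap (Star i) (z 2) b - (u i b - Lmap (Star i) (u 2) b) = 0"
      using low[OF c[OF ai(2)[OF that(1)]] ai(4)[OF that(1)], of "\<not> b" b]
        low[OF in'[OF ai(2)[OF that(1)]] ai(4)[OF that(1)], of "\<not> b" b] nc src_low(1)[OF that(1)]
      by (simp_all add: Rmap_Star Lmap_Star fun_app del: arrow_src.simps)
  qed
  have z2: "z 2 = 0 \<and> z 0 = 0 \<and> z 1 = 0"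
  proof (cases "even m")
    case True
    have R: "Rmap (Arr 0) 2 (Suc l) v False = v False" "Rmap (Arr 1) 2 (Suc l) v True = v True"
      for v :: "bool \<Rightarrow> 'f" using True ns[of 0] ns[of 1] by (simp_all add: Rmap_def compat_low)
    have L: "Lmap (Star 0) v False = v True" "Lmap (Star 1) v True = v False" for v :: "bool \<Rightarrow> 'f"
      by (simp_all add: Lmap_Star compat_low)
    have e: "z 2 False = z 0 False" "z 2 True = z 1 True" "z 2 True = z 0 False"
      using A(1)[of 0 False] A(1)[of 1 True] S(1)[of 0 False] True by (simp_all add: Lmap_Arr R L del: One_nat_def)
    have f1: "z 0 False = u 2 False - u 0 False" using A(2)[of 0 False] True by (simp add: Lmap_Arr R)
    have f2: "z 1 True = u 2 True - u 1 True" using A(2)[of 1 True] True by (simp add: Lmap_Arr R del: One_nat_def)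
    have f3: "z 2 True = u 0 False - u 2 True" using S(2)[of 0 False] by (simp add: L)
    have f4: "z 2 False = u 1 True - u 2 False" using S(2)[of 1 True] by (simp add: L del: One_nat_def)
    \<comment> \<open>On the closed walk 0, 2, 1, 2, 0 the values of the inner derivation telescope
      to 0, whereas centrality makes the four terms equal: four times the coordinate is 0.\<close>
    have "z 0 False + z 1 True + z 2 True + z 2 False = 0" unfolding f1 f2 f3 f4 by simp
    hence "2 * (2 * z 0 False) = 0" using e by simp
    hence "z 0 False = 0" using two by (metis mult_eq_0_iff)
    moreover from this e have "z 1 True = 0" "z 2 True = 0" "z 2 False = 0" by simp_all
    ultimately have "z 2 c = 0 \<and> z 0 c = 0 \<and> z 1 c = 0" for c using z01 by (cases c) simp_all
    thus ?thesis by (simp add: fun_app)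
  next
    case False
    \<comment> \<open>For odd \<open>m\<close> loops of this length at 0 and 1 have no admissible
      colour, so they vanish outright and the starred arrows carry this over to vertex 2.\<close>
    hence z0: "z 0 c = 0" "z 1 c = 0" for c using z01 z01' by (cases c; simp)+
    have "z 2 True = 0" "z 2 False = 0"
      using S(1)[of 0 False] S(1)[of 1 True] z0 by (simp_all add: Lmap_Star compat_low)
    hence "z 2 c = 0" for c by (cases c) simp_all
    thus ?thesis using z0 by (simp add: fun_app)
  qed
  \<comment> \<open>Centrality with respect to \<open>Arr k\<close> compares the loops at
    \<open>k\<close> and \<open>Suc k\<close>; the bound for the diagonal in the cell of
    \<open>Arr k\<close> is the one for loops at \<open>Suc k\<close>.\<close>
  have "quo n k k l (z k)" if "2 \<le> k" "k < n" for k
    using that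
  proof (induction k rule: dec_induct)
    case base
    show ?case using z2 by simp
  next
    case (step k)
    have "quo n (Suc k) k (Suc l) (z k - z (Suc k))"
      using c[of "Arr k"] step by (simp add: Lmap_Arr Rmap_def)
    moreover have "quo n k k l (z k)" using step by simp
    ultimately show ?case using step m by (auto simp: quo_def fun_app)
  qed
  moreover have "quo n k k l (z k)" if "k \<le> 1" for k
  proof -
    have "k = 0 \<or> k = 1" using that by auto
    thus ?thesis using z2 by auto
  qed
  ultimately show ?thesis using m unfolding z_def
    by (cases "2 \<le> i") auto
qed

section \<open>Coordinates of the socle paths\<close>

lemma is_path_down: "2 \<le> i \<Longrightarrow> i < n \<Longrightarrow> v \<le> i \<Longrightarrow> 1 \<le> v \<Longrightarrow>
    is_path n (map Star [v..<i], i) \<and> path_tgt (map Star [v..<i], i) = v"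
proof (induction "i - v" arbitrary: v)
  case 0
  thus ?case by simp
next
  case (Suc k)
  hence "is_path n (map Star [Suc v..<i], i) \<and> path_tgt (map Star [Suc v..<i], i) = Suc v" by simp
  thus ?case using Suc by (simp add: upt_conv_Cons)
qed

lemma is_path_up: "1 \<le> v \<Longrightarrow> v \<le> i \<Longrightarrow> i < n \<Longrightarrow>
    is_path n (map Arr (rev [v..<i]), v) \<and> path_tgt (map Arr (rev [v..<i]), v) = i"
proof (induction i rule: nat_induct)
  case (Suc i)
  thus ?case using n4 by (cases "v = Suc i") auto
qed auto

abbreviation unit_val :: "bool \<Rightarrow> bool \<Rightarrow> 'f::field" where
  "unit_val b \<equiv> (\<lambda>c. of_bool (c = b))"

lemma val_down: "1 \<le> v \<Longrightarrow> v \<le> i \<Longrightarrow> 2 \<le> i \<Longrightarrow>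
    val (map Star [v..<i], i) = (if v = 1 then unit_val True else (\<lambda>c. 1))"
proof (induction "i - v" arbitrary: v)
  case 0
  thus ?case by (auto simp: fun_eq_iff)
next
  case (Suc k)
  hence "val (map Star [Suc v..<i], i) = (\<lambda>c. 1 :: 'a)" by simp
  moreover have "[v..<i] = v # [Suc v..<i]" using Suc by (simp add: upt_conv_Cons)
  moreover have "compat v c \<longleftrightarrow> v = 1 \<longrightarrow> c" for c using Suc by (auto simp: compat_def)
  ultimately show ?case by (auto simp: val_Cons Lmap_Star fun_eq_iff)
qed

lemma val_Arrs: "val (map Arr is @ xs, v) = val (xs, v)"
  by (induction "is") (auto simp: fun_eq_iff)

text \<open>Each block interchanges the two coordinates, so a unit vector remains a unit
  vector.\<close>

lemma socle_block_arm:
  assumes "2 \<le> i" "i \<le> n - 2" "is_path n (xs, j)" "path_tgt (xs, j) = i" "\<exists>b. val (xs, j) = (unit_val b :: bool \<Rightarrow> 'f::field)"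
  shows "is_path n (concat (replicate k [Star i, Arr i]) @ xs, j) \<and>
    path_tgt (concat (replicate k [Star i, Arr i]) @ xs, j) = i \<and>
    (\<exists>b. val (concat (replicate k [Star i, Arr i]) @ xs, j) = (unit_val b :: bool \<Rightarrow> 'f))"
proof (induction k)
  case (Suc k)
  let ?ys = "concat (replicate k [Star i, Arr i]) @ xs"
  obtain b where "val (?ys, j) = (unit_val b :: bool \<Rightarrow> 'f)" using Suc by blast
  hence "val (Star i # Arr i # ?ys, j) = (unit_val (\<not> b) :: bool \<Rightarrow> 'f)"
    using assms(1) by (auto simp: fun_eq_iff)
  hence "\<exists>b. val (Star i # Arr i # ?ys, j) = (unit_val b :: bool \<Rightarrow> 'f)" by blast
  moreover have "is_path n (Star i # Arr i # ?ys, j)" "path_tgt (Star i # Arr i # ?ys, j) = i"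
    using Suc assms by auto
  ultimately show ?case by (simp del: val.simps)
qed (use assms in simp)

text \<open>Each block visits both vertices of height 1 and interchanges the coordinates twice, so
  the value returns to itself.\<close>

lemma socle_block_low:
  assumes "i \<le> 1" "j = 1 - i"
  shows "is_path n (concat (replicate k [Star i, Arr j, Star j, Arr i]), i) \<and>
    path_tgt (concat (replicate k [Star i, Arr j, Star j, Arr i]), i) = i \<and>
    val (concat (replicate k [Star i, Arr j, Star j, Arr i]), i) = (unit_val (i = 1) :: bool \<Rightarrow> 'f::field)"
proof (induction k)
  case 0
  thus ?case using assms n4 by (auto simp: fun_eq_iff compat_1)
next
  case (Suc k)
  have ij: "i = 0 \<and> j = 1 \<or> i = 1 \<and> j = 0" using assms by auto
  have "1 \<le> n - 2" using n4 by simp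
  with Suc ij show ?case by (auto simp: fun_eq_iff compat_low)
qed

text \<open>The unit vector is what makes the word nonzero in \<open>A\<close>, as for this length
  and these ends \<open>quo\<close> contains at most the diagonal. For odd \<open>n\<close> the
  words starting at 0 and 1 end at the opposite vertex; this separates the central socle elements
  from the others.\<close>

lemma socle_word_props:
  assumes "i < n"
  shows "is_path n (socle_word n i, i) \<and> length (socle_word n i) = 2 * (n - 2) \<and>
    path_tgt (socle_word n i, i) = (if i \<le> 1 \<and> odd n then 1 - i else i) \<and>
    (\<exists>b. val (socle_word n i, i) = (unit_val b :: bool \<Rightarrow> 'f::field))"
proof (cases "i \<le> 1")
  case True
  define j where "j = 1 - i"
  have ij: "i = 0 \<and> j = 1 \<or> i = 1 \<and> j = 0" using True by (auto simp: j_def)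
  define m where "m = (n - 2) div 2"
  let ?xs = "concat (replicate m [Star i, Arr j, Star j, Arr i])"
  have w: "socle_word n i = (if even n then [] else [Star j, Arr i]) @ ?xs"
    using ij by (auto simp: socle_word_def Let_def m_def)
  have l: "length ?xs = 4 * m" by (induction m) auto
  have B: "is_path n (?xs, i) \<and> path_tgt (?xs, i) = i \<and> val (?xs, i) = (unit_val (i = 1) :: bool \<Rightarrow> 'f)"
    by (rule socle_block_low[OF True j_def])
  show ?thesis
  proof (cases "even n")
    case e: True
    have "4 * m = 2 * (n - 2)" using e n4 unfolding m_def by presburger
    thus ?thesis using B l e unfolding w by auto
  next
    case o: False
    have n2: "4 * m + 2 = 2 * (n - 2)" "1 \<le> n - 2" using o n4 unfolding m_def by presburger+
    have "is_path n (Star j # Arr i # ?xs, i)" "path_tgt (Star j # Arr i # ?xs, i) = 1 - i"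
      using B ij n2 by (auto simp: j_def)
    moreover have "val (Star j # Arr i # ?xs, i) = (unit_val (j = 1) :: bool \<Rightarrow> 'f)"
      using B ij by (auto simp: fun_eq_iff compat_low)
    hence "\<exists>b. val (Star j # Arr i # ?xs, i) = (unit_val b :: bool \<Rightarrow> 'f)" by blast
    moreover have "socle_word n i = Star j # Arr i # ?xs" using o unfolding w by simp
    moreover have "length (Star j # Arr i # ?xs) = 2 * (n - 2)" using l n2 by simp
    ultimately show ?thesis using o True by (simp only: simp_thms if_True)
  qed
next
  case False
  hence i: "2 \<le> i" by simp
  let ?ys = "map Arr (rev [1..<i]) @ map Star [1..<i]"
  have d: "is_path n (map Star [1..<i], i)" "path_tgt (map Star [1..<i], i) = 1"
    using is_path_down[of i 1] i assms by auto
  have u: "is_path n (map Arr (rev [1..<i]), 1)" "path_tgt (map Arr (rev [1..<i]), 1) = i"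
    using is_path_up[of 1 i] i assms by auto
  have ys: "is_path n (?ys, i)" "path_tgt (?ys, i) = i"
    using d u by (simp_all add: is_path_append path_tgt_append)
  have "val (map Star [1..<i], i) = (unit_val True :: bool \<Rightarrow> 'f)"
    using val_down[of 1 i] i by simp
  hence v: "\<exists>b. val (?ys, i) = (unit_val b :: bool \<Rightarrow> 'f)" unfolding val_Arrs by blast
  show ?thesis
  proof (cases "i \<le> n - 2")
    case True
    have w: "socle_word n i = concat (replicate (n - i - 1) [Star i, Arr i]) @ ?ys"
      using True i by (simp add: socle_word_def Let_def)
    have "length (concat (replicate k [Star i, Arr i])) = 2 * k" for k by (induction k) auto
    hence "length (socle_word n i) = 2 * (n - 2)" unfolding w using True i by simp
    thus ?thesis using socle_block_arm[OF i True ys v, of "n - i - 1"] i unfolding w by auto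
  next
    case False
    hence e: "i = n - 1" using assms by simp
    have w: "socle_word n i = ?ys"
      using False i by (simp add: socle_word_def Let_def e[symmetric] del: One_nat_def)
    have l: "length ?ys = 2 * (n - 2)" using e n4 by simp
    have ni: "\<not> (i \<le> 1 \<and> odd n)" using i by simp
    show ?thesis unfolding w if_not_P[OF ni] using ys v l by blast
  qed
qed

end

section \<open>The preprojective algebra\<close>

lemma a_coset_eq: "a_r_coset G H a = (\<lambda>h. h \<oplus>\<^bsub>G\<^esub> a) ` H"
  by (auto simp: a_r_coset_def r_coset_def)

lemma quot_mod_simps:
  "carrier (quot_mod M N) = (\<lambda>x. N +>\<^bsub>M\<^esub> x) ` carrier M"
  "zero (quot_mod M N) = N"
  "one (quot_mod M N) = N +>\<^bsub>M\<^esub> one M"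
  "add (quot_mod M N) = set_add M"
  "mult (quot_mod M N) = rcoset_mult M N"
  "module.smult (quot_mod M N) c X = (\<Union>x\<in>X. N +>\<^bsub>M\<^esub> (c \<odot>\<^bsub>M\<^esub> x))"
  by (auto simp: quot_mod_def ring.defs module.defs FactRing_def A_RCOSETS_def RCOSETS_def a_r_coset_def r_coset_def)

lemma set_add_eq: "set_add M X Y = (\<Union>x\<in>X. \<Union>y\<in>Y. {x \<oplus>\<^bsub>M\<^esub> y})"
  by (auto simp: set_add_def set_mult_def)

context type_D
begin

abbreviation A where "A \<equiv> preproj n"
abbreviation cl where "cl \<equiv> cls n"

lemma cl_eq: "cl x = (\<lambda>h. h + x) ` rel_ideal n"
  by (simp add: cls_def a_coset_eq)

lemma cl_self: "x \<in> cl x"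
  using I_zero by (force simp: cl_eq)

lemma cl_iff: "cl x = cl y \<longleftrightarrow> x \<approx> y"
proof
  assume "cl x = cl y"
  hence "x \<in> cl y" using cl_self by blast
  thus "x \<approx> y" by (auto simp: cl_eq eqv_def)
next
  have *: "cl x \<subseteq> cl y" if "x \<approx> y" for x y
  proof
    fix z assume "z \<in> cl x"
    then obtain h where h: "h \<in> rel_ideal n" "z = h + x" by (auto simp: cl_eq)
    hence "z = (h + (x - y)) + y" by simp
    moreover have "h + (x - y) \<in> rel_ideal n" using h that I_add by (simp add: eqv_def)
    ultimately show "z \<in> cl y" unfolding cl_eq by (rule image_eqI)
  qed
  assume "x \<approx> y"
  thus "cl x = cl y" using *[of x y] *[of y x] eqv_sym by blast
qed

lemma mem_cl: "z \<in> cl x \<longleftrightarrow> z \<approx> x"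
proof -
  have "z \<approx> x" if "z \<in> cl x"
    using that by (auto simp: cl_eq eqv_def)
  moreover have "z \<in> cl x" if "z \<approx> x"
    using that cl_self[of z] by (simp flip: cl_iff)
  ultimately show ?thesis by blast
qed

lemma A_carrier: "carrier A = cl ` PC n"
  by (simp add: preproj_def quot_mod_simps cls_def[abs_def])

lemma A_carrierI [simp, intro]: "x \<in> PC n \<Longrightarrow> cl x \<in> carrier A"
  by (simp add: A_carrier)

lemma A_carrierE: assumes "X \<in> carrier A" obtains x where "x \<in> PC n" "X = cl x"
  using assms by (auto simp: A_carrier)

lemma cl_PC: "z \<in> cl x \<Longrightarrow> x \<in> PC n \<Longrightarrow> z \<in> PC n"
  by (auto simp: cl_eq dest: I_PC)

lemma A_zero: "\<zero>\<^bsub>A\<^esub> = cl 0"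
  by (simp add: preproj_def quot_mod_simps cl_eq)

lemma A_one: "\<one>\<^bsub>A\<^esub> = cl (pone n)"
  by (simp add: preproj_def quot_mod_simps cls_def)

lemma A_add: "cl x \<oplus>\<^bsub>A\<^esub> cl y = cl (x + y)"
proof -
  have "cl x \<oplus>\<^bsub>A\<^esub> cl y = (\<Union>u\<in>cl x. \<Union>v\<in>cl y. {u + v})"
    by (simp add: preproj_def quot_mod_simps set_add_eq)
  also have "\<dots> = cl (x + y)"
  proof safe
    fix u v assume "u \<in> cl x" "v \<in> cl y"
    thus "u + v \<in> cl (x + y)" by (simp add: mem_cl eqv_add)
  next
    fix z assume "z \<in> cl (x + y)"
    hence "z - y \<in> cl x" by (simp add: mem_cl eqv_def algebra_simps)
    moreover have "z = (z - y) + y" by simp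
    ultimately show "z \<in> (\<Union>u\<in>cl x. \<Union>v\<in>cl y. {u + v})" using cl_self by blast
  qed
  finally show ?thesis .
qed

text \<open>The product in the quotient is a union over representatives; congruence makes all
  classes in the union equal.\<close>

lemma A_mult:
  assumes "x \<in> PC n" "y \<in> PC n" shows "cl x \<otimes>\<^bsub>A\<^esub> cl y = cl (x \<star> y)"
proof -
  have "cl x \<otimes>\<^bsub>A\<^esub> cl y = (\<Union>u\<in>cl x. \<Union>v\<in>cl y. cl (u \<star> v))"
    by (simp add: preproj_def quot_mod_simps rcoset_mult_def cls_def)
  also have "\<dots> = (\<Union>u\<in>cl x. \<Union>v\<in>cl y. cl (x \<star> y))"
  proof (intro SUP_cong refl)
    fix u v assume "u \<in> cl x" "v \<in> cl y"
    hence "u \<approx> x" "v \<approx> y" "v \<in> PC n" using assms cl_PC by (simp_all add: mem_cl)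
    thus "cl (u \<star> v) = cl (x \<star> y)" unfolding cl_iff using assms(1) by (intro eqv_mult)
  qed
  also have "\<dots> = cl (x \<star> y)" using cl_self by blast
  finally show ?thesis .
qed

lemma A_smult: assumes "x \<in> PC n" shows "c \<odot>\<^bsub>A\<^esub> cl x = cl (scl c x)"
proof -
  have "c \<odot>\<^bsub>A\<^esub> cl x = (\<Union>u\<in>cl x. cl (scl c u))"
    by (simp add: preproj_def quot_mod_simps cls_def)
  also have "\<dots> = (\<Union>u\<in>cl x. cl (scl c x))"
    by (intro SUP_cong refl) (simp add: mem_cl cl_iff eqv_scl)
  also have "\<dots> = cl (scl c x)" using cl_self by blast
  finally show ?thesis .
qed

lemma A_abelian_group: "abelian_group A"
proof (rule abelian_groupI)
  fix X assume "X \<in> carrier A"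
  then obtain x where x: "x \<in> PC n" "X = cl x" by (rule A_carrierE)
  thus "\<exists>Y\<in>carrier A. Y \<oplus>\<^bsub>A\<^esub> X = \<zero>\<^bsub>A\<^esub>"
    by (intro bexI[of _ "cl (- x)"]) (simp_all add: A_add A_zero)
qed (auto elim!: A_carrierE simp: A_add A_zero add_ac)

lemma A_ring: "ring A"
proof (rule ringI)
  show "abelian_group A" by (rule A_abelian_group)
  show "Group.monoid A"
    by (rule monoidI) (auto elim!: A_carrierE simp: A_mult A_one pmul_assoc)
qed (auto elim!: A_carrierE simp: A_add A_mult pmul_add_left pmul_add_right)

end

sublocale type_D \<subseteq> A: ring "preproj n"
  by (rule A_ring)

context type_D
begin

lemma A_uminus: "x \<in> PC n \<Longrightarrow> \<ominus>\<^bsub>A\<^esub> cl x = cl (- x)"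
  by (rule A.minus_equality) (auto simp: A_add A_zero)

lemma A_minus: "x \<in> PC n \<Longrightarrow> y \<in> PC n \<Longrightarrow> cl x \<ominus>\<^bsub>A\<^esub> cl y = cl (x - y)"
  by (simp add: a_minus_def A_uminus A_add)

lemma A_finsum: "(\<And>s. s \<in> S \<Longrightarrow> f s \<in> PC n) \<Longrightarrow> (\<Oplus>\<^bsub>A\<^esub>s\<in>S. cl (f s)) = cl (\<Sum>s\<in>S. f s)"
proof (induction S rule: infinite_finite_induct)
  case (insert s S)
  thus ?case by (simp add: A_add Pi_iff)
qed (simp_all add: A_zero)

section \<open>The spaces \<open>W\<close>\<close>

lemma degI: "x \<in> PC n \<Longrightarrow> (\<And>xs v. x (xs, v) \<noteq> 0 \<Longrightarrow> length xs = d) \<Longrightarrow> x \<in> path_alg_deg n d"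
  by (auto simp: path_alg_deg_def)

lemma deg_PC: "x \<in> path_alg_deg n d \<Longrightarrow> x \<in> PC n"
  by (simp add: path_alg_deg_def)

lemma deg_zero: "x \<in> path_alg_deg n d \<Longrightarrow> length xs \<noteq> d \<Longrightarrow> x (xs, v) = 0"
  by (auto simp: path_alg_deg_def)

lemma deg_add: "x \<in> path_alg_deg n d \<Longrightarrow> y \<in> path_alg_deg n d \<Longrightarrow> x + y \<in> path_alg_deg n d"
  by (rule degI) (auto simp: deg_PC plus_fun_apply, metis add.right_neutral deg_zero)

lemma deg_scl: "x \<in> path_alg_deg n d \<Longrightarrow> scl c x \<in> path_alg_deg n d"
  by (rule degI) (auto simp: deg_PC scl_apply dest: deg_zero)

lemma deg_0: "0 \<in> path_alg_deg n d"
  by (rule degI) (auto simp: zero_fun_apply)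

lemma deg_path: "is_path n (xs, v) \<Longrightarrow> path_elem (xs, v) \<in> path_alg_deg n (length xs)"
  by (rule degI[OF PC_path_elem]) (auto simp: path_elem_def split: if_splits)

lemma deg_path': "is_path n (xs, v) \<Longrightarrow> length xs = d \<Longrightarrow> path_elem (xs, v) \<in> path_alg_deg n d"
  using deg_path by blast

lemma pmul_deg_left:
  assumes "\<And>xs v. f (xs, v) \<noteq> 0 \<Longrightarrow> length xs = d"
  shows "(f \<star> g) (xs, v) = (if d \<le> length xs then f (take d xs, path_tgt (drop d xs, v)) * g (drop d xs, v) else 0)"
proof -
  have "(f \<star> g) (xs, v) = (\<Sum>k\<le>length xs. if k = d then f (take d xs, path_tgt (drop d xs, v)) * g (drop d xs, v) else 0)"
    unfolding pmul_def prod.case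
  proof (intro sum.cong refl)
    fix k assume k: "k \<in> {..length xs}"
    hence "f (take k xs, path_tgt (drop k xs, v)) = 0" if "k \<noteq> d" using assms that by fastforce
    thus "f (take k xs, path_tgt (drop k xs, v)) * g (drop k xs, v) =
      (if k = d then f (take d xs, path_tgt (drop d xs, v)) * g (drop d xs, v) else 0)" by auto
  qed
  thus ?thesis by auto
qed

lemma pmul_deg_right:
  assumes "\<And>xs v. g (xs, v) \<noteq> 0 \<Longrightarrow> length xs = d"
  shows "(f \<star> g) (xs @ ys, v) = (if length ys = d then f (xs, path_tgt (ys, v)) * g (ys, v) else (f \<star> g) (xs @ ys, v))"
proof (cases "length ys = d")
  case True
  have "(f \<star> g) (xs @ ys, v) = (\<Sum>k\<le>length (xs @ ys). if k = length xs then f (xs, path_tgt (ys, v)) * g (ys, v) else 0)"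
    unfolding pmul_def prod.case
  proof (intro sum.cong refl)
    fix k assume k: "k \<in> {..length (xs @ ys)}"
    have "g (drop k (xs @ ys), v) = 0" if "k \<noteq> length xs" using assms[of "drop k (xs @ ys)" v] that k True by fastforce
    thus "f (take k (xs @ ys), path_tgt (drop k (xs @ ys), v)) * g (drop k (xs @ ys), v) =
      (if k = length xs then f (xs, path_tgt (ys, v)) * g (ys, v) else 0)" by auto
  qed
  thus ?thesis using True by simp
qed simp

lemma deg_mult:
  assumes "x \<in> path_alg_deg n d" "y \<in> path_alg_deg n e"
  shows "x \<star> y \<in> path_alg_deg n (d + e)"
proof (rule degI)
  show "x \<star> y \<in> PC n" using assms by (simp add: deg_PC)
  fix xs v assume nz: "(x \<star> y) (xs, v) \<noteq> 0"
  have "(x \<star> y) (xs, v) = (if d \<le> length xs then x (take d xs, path_tgt (drop d xs, v)) * y (drop d xs, v) else 0)"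
    by (rule pmul_deg_left) (use assms in \<open>auto simp: path_alg_deg_def\<close>)
  hence "d \<le> length xs" "y (drop d xs, v) \<noteq> 0" using nz by (auto split: if_splits)
  moreover from this have "length (drop d xs) = e" using deg_zero[OF assms(2)] by blast
  ultimately show "length xs = d + e" by simp
qed

lemma pone_deg: "pone n \<in> path_alg_deg n 0"
  by (rule degI[OF PC_pone]) (auto simp: pone_def split: if_splits)

lemma vtx_deg: "v < n \<Longrightarrow> vtx v \<in> path_alg_deg n 0"
  by (rule deg_path') auto

lemma arr_deg: "arrow_index a \<le> n - 2 \<Longrightarrow> arr a \<in> path_alg_deg n 1"
  by (rule deg_path') (auto simp: arrow_src_n)

lemma deg0_eq:
  assumes "x \<in> path_alg_deg n 0"
  shows "x = (\<Sum>v<n. scl (x ([], v)) (vtx v))"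
proof (intro ext, safe)
  fix xs :: "arrow list" and v
  have "x (xs, v) = 0" if "xs \<noteq> [] \<or> \<not> v < n"
  proof (cases "xs = []")
    case True
    hence "\<not> is_path n (xs, v)" using that by simp
    thus ?thesis using deg_PC[OF assms] by (auto simp: PC_iff)
  qed (use deg_zero[OF assms] in auto)
  thus "x (xs, v) = (\<Sum>v<n. scl (x ([], v)) (vtx v)) (xs, v)"
    by (cases "xs = []") (auto simp: sum_fun_apply scl_apply path_elem_def if_distrib[of "(*) _"] cong: if_cong)
qed

lemma deg1_eq:
  assumes "x \<in> path_alg_deg n 1"
  shows "x = (\<Sum>a\<in>{a. arrow_index a \<le> n - 2}. scl (x ([a], arrow_src a)) (arr a))"
proof (intro ext, safe)
  fix xs :: "arrow list" and v
  have fin: "finite {a. arrow_index a \<le> n - 2}" by (rule finite_arrows)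
  have e: "(\<Sum>a\<in>{a. arrow_index a \<le> n - 2}. scl (x ([a], arrow_src a)) (arr a)) (xs, v) =
     (\<Sum>a\<in>{a. arrow_index a \<le> n - 2}. if xs = [a] \<and> v = arrow_src a then x (xs, v) else 0)"
    by (auto simp: sum_fun_apply scl_apply path_elem_def intro!: sum.cong)
  show "x (xs, v) = (\<Sum>a\<in>{a. arrow_index a \<le> n - 2}. scl (x ([a], arrow_src a)) (arr a)) (xs, v)"
  proof (cases "\<exists>a. arrow_index a \<le> n - 2 \<and> xs = [a] \<and> v = arrow_src a")
    case True
    then obtain a where a: "arrow_index a \<le> n - 2" "xs = [a]" "v = arrow_src a" by blast
    have "(\<Sum>b\<in>{a. arrow_index a \<le> n - 2}. if xs = [b] \<and> v = arrow_src b then x (xs, v) else 0) =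
       (\<Sum>b\<in>{a. arrow_index a \<le> n - 2}. if b = a then x (xs, v) else 0)"
      using a by (intro sum.cong) auto
    thus ?thesis unfolding e using fin a by simp
  next
    case False
    have "(\<Sum>a\<in>{a. arrow_index a \<le> n - 2}. if xs = [a] \<and> v = arrow_src a then x (xs, v) else 0) = 0"
      using False by (intro sum.neutral) auto
    moreover have "x (xs, v) = 0"
    proof (cases "length xs = 1")
      case True
      then obtain a where "xs = [a]" by (auto simp: length_Suc_conv)
      hence "\<not> is_path n (xs, v)" using False by auto
      thus ?thesis using deg_PC[OF assms] by (auto simp: PC_iff)
    qed (use deg_zero[OF assms] in auto)
    ultimately show ?thesis unfolding e by simp
  qed
qed

text \<open>The path that detects $\sigma_i$ among the other relations, and $\sigma_i$ scaled to have coefficient 1 there.\<close>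

definition sig_path :: "nat \<Rightarrow> path" where
  "sig_path i = (if i \<le> n - 2 then ([Star i, Arr i], i) else ([Arr (n - 2), Star (n - 2)], n - 1))"

definition sig :: "nat \<Rightarrow> path \<Rightarrow> 'f::field" where
  "sig i = (if i \<le> n - 2 then - sigma n i else sigma n i)"

lemma sigma_sig_path:
  assumes "i < n" "j < n"
  shows "sig i (sig_path j) = (if i = j then 1 else (0 :: 'f::field))"
proof -
  have e: "n - 1 = Suc (n - 2)" "\<not> Suc (n - 2) \<le> n - 2" using n4 by auto
  consider "j \<le> n - 2" | "j = n - 1" using assms by linarith
  thus ?thesis
  proof cases
    case 1
    thus ?thesis using assms n4 unfolding sig_def sig_path_def sigma_eq[OF assms(1)]
      by (auto simp: path_elem_def fun_app)
  next
    case 2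
    thus ?thesis using assms n4 unfolding sig_def sig_path_def sigma_eq[OF assms(1)] 2
      by (auto simp: path_elem_def fun_app)
  qed
qed

lemma sig_PC: "i < n \<Longrightarrow> sig i \<in> PC n"
  by (simp add: sig_def sigma_PC)

lemma sig_relations: "i < n \<Longrightarrow> sig i \<in> relations n"
  unfolding relations_def
  using lin_span_incl[OF sigma_subset] lin_span_closed(4)[OF sigma_subset, of "sigma n i" "- 1"]
  by (auto simp: sig_def scl_minus_one)

text \<open>The paths \<open>sig_path i\<close> are dual to the \<open>sig i\<close>, so the
  coefficients are values of \<open>x\<close> itself and no decomposition has to be chosen.\<close>

lemma relations_eq:
  assumes "x \<in> relations n"
  shows "x = (\<Sum>i<n. scl (x (sig_path i)) (sig i))"
proof -
  let ?N = "{x :: path \<Rightarrow> 'a. x \<in> PC n \<and> x = (\<Sum>i<n. scl (x (sig_path i)) (sig i))}"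
  have "relations n \<subseteq> ?N"
    unfolding relations_def
  proof (rule lin_span_subset)
    have *: "sig i = (\<Sum>j<n. scl (sig i (sig_path j)) (sig j) :: path \<Rightarrow> 'a)" if "i < n" for i
    proof -
      have "(\<Sum>j<n. scl (sig i (sig_path j)) (sig j)) = (\<Sum>j<n. if j = i then sig i else (0 :: path \<Rightarrow> 'a))"
        using that by (intro sum.cong) (auto simp: sigma_sig_path)
      thus ?thesis using that by simp
    qed
    have **: "- x = (\<Sum>j<n. scl ((- x) (sig_path j)) (sig j))"
      if "x = (\<Sum>j<n. scl (x (sig_path j)) (sig j))" for x :: "path \<Rightarrow> 'a"
      using arg_cong[OF that, of uminus] by (simp add: sum_negf uminus_apply scl_simps)
    show "sigma n ` {..<n} \<subseteq> ?N"
    proof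
      fix y :: "path \<Rightarrow> 'a" assume "y \<in> sigma n ` {..<n}"
      then obtain i where i: "i < n" "y = sigma n i" by auto
      have "sigma n i = (if i \<le> n - 2 then - sig i else sig i :: path \<Rightarrow> 'a)" by (simp add: sig_def)
      thus "y \<in> ?N" using i *[OF i(1)] **[OF *[OF i(1)]] sig_PC[OF i(1)] by (auto split: if_splits)
    qed
    show "x + y \<in> ?N" if "x \<in> ?N" "y \<in> ?N" for x y
    proof -
      have "x + y = (\<Sum>i<n. scl (x (sig_path i)) (sig i)) + (\<Sum>i<n. scl (y (sig_path i)) (sig i))"
        using that by auto
      also have "\<dots> = (\<Sum>i<n. scl ((x + y) (sig_path i)) (sig i))"
        by (simp add: sum.distrib scl_simps plus_fun_apply)
      finally show ?thesis using that by simp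
    qed
    show "scl c x \<in> ?N" if "x \<in> ?N" for c x
    proof -
      have "scl c x = scl c (\<Sum>i<n. scl (x (sig_path i)) (sig i))"
        using that by auto
      also have "\<dots> = (\<Sum>i<n. scl ((scl c x) (sig_path i)) (sig i))"
        by (simp add: scl_sum scl_simps scl_apply)
      finally show ?thesis using that by simp
    qed
  qed (auto simp: zero_fun_apply)
  thus ?thesis using assms by blast
qed

abbreviation arrows :: "arrow set" where
  "arrows \<equiv> {a. arrow_index a \<le> n - 2}"

lemma W_0: "W n 0 = path_alg_deg n 0" and W_1: "W n (Suc 0) = path_alg_deg n 1"
  by (simp_all add: W_def)

lemma relations_closed:
  "0 \<in> relations n" "x \<in> relations n \<Longrightarrow> y \<in> relations n \<Longrightarrow> x + y \<in> relations n"
  "x \<in> relations n \<Longrightarrow> scl c x \<in> relations n"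
  unfolding relations_def by (fact lin_span_closed[OF sigma_subset])+

lemma vtx_sig:
  assumes "i < n" "v < n"
  shows "vtx v \<star> sig i = (if v = i then sig i else (0 :: path \<Rightarrow> 'f::field))"
    "sig i \<star> vtx v = (if v = i then sig i else (0 :: path \<Rightarrow> 'f::field))"
proof -
  have e: "Suc (n - 2) = n - Suc 0" "n - 2 \<noteq> 0" using n4 by auto
  have "\<not> n - Suc 0 \<le> n - 2" "i = n - Suc 0" if "\<not> i \<le> n - 2" using that assms n4 by auto
  thus "vtx v \<star> sig i = (if v = i then sig i else (0 :: path \<Rightarrow> 'f::field))"
    "sig i \<star> vtx v = (if v = i then sig i else (0 :: path \<Rightarrow> 'f::field))"
    using e assms
    by (auto simp: sig_def sigma_eq pmul_add_right pmul_diff_right pmul_minus_right pmul_minus_left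
      pmul_add_left pmul_diff_left path_elem_mult)
qed

lemma relations_sum: "(\<And>s. s \<in> S \<Longrightarrow> f s \<in> relations n) \<Longrightarrow> (\<Sum>s\<in>S. f s) \<in> relations n"
  by (induction S rule: infinite_finite_induct) (simp_all add: relations_closed)

lemma relations_bimodule:
  assumes "x \<in> path_alg_deg n 0" "r \<in> relations n"
  shows "x \<star> r \<in> relations n" "r \<star> x \<in> relations n"
proof -
  have r: "r = (\<Sum>i<n. scl (r (sig_path i)) (sig i))" by (rule relations_eq[OF assms(2)])
  have x: "x = (\<Sum>v<n. scl (x ([], v)) (vtx v))" by (rule deg0_eq[OF assms(1)])
  have "vtx v \<star> sig i \<in> (relations n :: (path \<Rightarrow> 'a) set)" "sig i \<star> vtx v \<in> (relations n :: (path \<Rightarrow> 'a) set)"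
    if "i < n" "v < n" for i v
    using that by (simp_all add: vtx_sig sig_relations relations_closed)
  hence *: "(\<Sum>v<n. scl (x ([], v)) (vtx v)) \<star> (\<Sum>i<n. scl (r (sig_path i)) (sig i)) \<in> relations n"
    "(\<Sum>i<n. scl (r (sig_path i)) (sig i)) \<star> (\<Sum>v<n. scl (x ([], v)) (vtx v)) \<in> relations n"
    by (auto simp: pmul_sum_left pmul_sum_right pmul_scl_left pmul_scl_right intro!: relations_sum relations_closed)
  show "x \<star> r \<in> relations n" using *(1) x r by simp
  show "r \<star> x \<in> relations n" using *(2) x r by simp
qed

lemma W_2: "W n 2 = (relations n :: (path \<Rightarrow> 'f::field) set)"
proof -
  let ?S = "{x \<star> r \<star> y |x r y. x \<in> path_alg_deg n 0 \<and> r \<in> relations n \<and> y \<in> path_alg_deg n 0} :: (path \<Rightarrow> 'f) set"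
  have "{(i, j). i + 2 + j = (2::nat)} = {(0, 0)}" by auto
  hence "W n 2 = lin_span (path_alg n) ?S" by (simp add: W_def)
  also have "\<dots> = relations n"
  proof
    have "?S \<subseteq> relations n" by (auto intro: relations_bimodule(2)[OF _ relations_bimodule(1)])
    thus "lin_span (path_alg n) ?S \<subseteq> relations n"
      by (rule lin_span_subset) (use relations_PC relations_closed in auto)
    have "?S \<subseteq> PC n" using relations_bimodule relations_PC by blast
    moreover have "relations n \<subseteq> ?S"
    proof
      fix r :: "path \<Rightarrow> 'f" assume r: "r \<in> relations n"
      hence e: "r = pone n \<star> r \<star> pone n" using relations_PC by auto
      show "r \<in> ?S"
        by (rule CollectI, rule exI[of _ "pone n"], rule exI[of _ r], rule exI[of _ "pone n"])
           (intro conjI e r pone_deg)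
    qed
    ultimately show "relations n \<subseteq> lin_span (path_alg n) ?S"
      using lin_span_incl[of ?S] by (meson subset_trans)
  qed
  finally show ?thesis .
qed

section \<open>Vanishing of \<open>W n p\<close> from degree 3 on\<close>

fun opp :: "arrow \<Rightarrow> arrow" where
  "opp (Arr i) = Star i"
| "opp (Star i) = Arr i"

text \<open>Linear conditions on the coefficients of a relation: only opposite pairs occur, and at a
  vertex of the arm the loops through the lower and the upper neighbour have opposite coefficients.
  In this form they can be imposed on a two-letter window of a longer word.\<close>

definition rel_like :: "(arrow list \<Rightarrow> 'f::field) \<Rightarrow> bool" where
  "rel_like g \<longleftrightarrow> (\<forall>a b. b \<noteq> opp a \<longrightarrow> g [a, b] = 0) \<and>
     g [Arr 0, Star 0] = - g [Star 2, Arr 2] \<and> g [Arr 1, Star 1] = - g [Star 2, Arr 2] \<and>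
     (\<forall>i. 3 \<le> i \<longrightarrow> i \<le> n - 2 \<longrightarrow> g [Arr (i - 1), Star (i - 1)] = - g [Star i, Arr i])"

lemma rel_like_relations:
  assumes "r \<in> relations n" shows "rel_like (\<lambda>xs. r (xs, v))"
proof -
  let ?N = "{r \<in> PC n. rel_like (\<lambda>xs. r (xs, v))} :: (path \<Rightarrow> 'a) set"
  have "relations n \<subseteq> ?N"
    unfolding relations_def
  proof (rule lin_span_subset)
    show "sigma n ` {..<n} \<subseteq> ?N"
    proof
      fix y :: "path \<Rightarrow> 'a" assume "y \<in> sigma n ` {..<n}"
      then obtain i where i: "i < n" "y = sigma n i" by auto
      have e: "Suc (n - 2) = n - Suc 0" "n - 2 \<noteq> 0" using n4 by auto
      have "rel_like (\<lambda>xs. y (xs, v))"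
        unfolding i(2) sigma_eq[OF i(1)] rel_like_def using e i(1) n4
        by (auto simp: path_elem_def fun_app)
      thus "y \<in> ?N" using i sigma_PC by simp
    qed
  qed (auto simp: rel_like_def plus_fun_apply zero_fun_apply scl_apply)
  thus ?thesis using assms by blast
qed

text \<open>With the letters around a window of two fixed, membership in one of the intersected
  spaces becomes \<open>rel_like\<close> on that window, because homogeneous factors leave a single
  way to cut the word.\<close>

lemma W_zero_aux:
  assumes "w \<in> W n p" "3 \<le> p" "i + 2 + j = p" "length zs = i" "length zs' = j"
  shows "rel_like (\<lambda>xs. w (zs @ xs @ zs', v))"
proof -
  let ?S = "{x \<star> r \<star> y |x r y. x \<in> path_alg_deg n i \<and> r \<in> relations n \<and> y \<in> path_alg_deg n j} :: (path \<Rightarrow> 'a) set"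
  let ?N = "{w \<in> PC n. rel_like (\<lambda>xs. w (zs @ xs @ zs', v))} :: (path \<Rightarrow> 'a) set"
  have "w \<in> lin_span (path_alg n) ?S"
    using assms(1-3) by (auto simp: W_def)
  moreover have "lin_span (path_alg n) ?S \<subseteq> ?N"
  proof (rule lin_span_subset)
    show "?S \<subseteq> ?N"
    proof safe
      fix x r y :: "path \<Rightarrow> 'a" assume xry: "x \<in> path_alg_deg n i" "r \<in> relations n" "y \<in> path_alg_deg n j"
      show "x \<star> r \<star> y \<in> PC n" using xry relations_PC by (auto intro!: PC_mult dest: deg_PC)
      have e: "(x \<star> r \<star> y) (zs @ [a, b] @ zs', v) =
          x (zs, path_tgt ([a, b] @ zs', v)) * r ([a, b], path_tgt (zs', v)) * y (zs', v)" for a b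
      proof -
        have "(x \<star> r \<star> y) ((zs @ [a, b]) @ zs', v) = (x \<star> r) (zs @ [a, b], path_tgt (zs', v)) * y (zs', v)"
          by (subst pmul_deg_right[where d = j]) (use xry assms deg_zero in auto)
        also have "(x \<star> r) (zs @ [a, b], path_tgt (zs', v)) =
            x (zs, path_tgt ([a, b], path_tgt (zs', v))) * r ([a, b], path_tgt (zs', v))"
          by (subst pmul_deg_left[where d = i]) (use xry assms deg_zero in auto)
        finally show ?thesis by simp
      qed
      have "rel_like (\<lambda>xs. r (xs, path_tgt (zs', v)))" by (rule rel_like_relations[OF xry(2)])
      thus "rel_like (\<lambda>xs. (x \<star> r \<star> y) (zs @ xs @ zs', v))"
        unfolding rel_like_def e by (auto simp del: One_nat_def simp: one_add_one)
    qed
  qed (auto simp: rel_like_def plus_fun_apply zero_fun_apply scl_apply)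
  ultimately show ?thesis by blast
qed

lemma sig_deg: "i < n \<Longrightarrow> sig i \<in> path_alg_deg n 2"
proof (rule degI[OF sig_PC])
  fix xs v assume "i < n" "sig i (xs, v) \<noteq> (0 :: 'a)"
  thus "length xs = 2" unfolding sig_def
    by (auto simp: sigma_eq path_elem_def fun_app split: if_splits)
qed

lemma deg_sum: "(\<And>s. s \<in> S \<Longrightarrow> f s \<in> path_alg_deg n d) \<Longrightarrow> (\<Sum>s\<in>S. f s) \<in> path_alg_deg n d"
  by (induction S rule: infinite_finite_induct) (simp_all add: deg_0 deg_add)

lemma relations_deg: "relations n \<subseteq> path_alg_deg n 2"
proof
  fix r :: "path \<Rightarrow> 'a" assume "r \<in> relations n"
  hence "r = (\<Sum>i<n. scl (r (sig_path i)) (sig i))" by (rule relations_eq)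
  moreover have "(\<Sum>i<n. scl (r (sig_path i)) (sig i)) \<in> path_alg_deg n 2"
    by (intro deg_sum deg_scl sig_deg) simp
  ultimately show "r \<in> path_alg_deg n 2" by simp
qed

lemma W_deg: "p \<le> 2 \<Longrightarrow> W n p \<subseteq> path_alg_deg n p"
  using W_0 W_1 W_2 relations_deg by (auto simp: le_Suc_eq numeral_2_eq_2)

text \<open>The two windows in the last three letters force the pattern \<open>a\<close>,
  \<open>opp a\<close>, \<open>a\<close>. One of the opposite pairs is a loop at a vertex of the arm
  and can be exchanged, up to sign, for the loop through another neighbour; then the overlapping
  window is no longer an opposite pair and the coefficient is 0.\<close>

lemma W_zero: assumes p: "3 \<le> p" shows "W n p = {0 :: path \<Rightarrow> 'f::field}"
proof -
  have S: "{x \<star> r \<star> y |x r y. x \<in> path_alg_deg n i \<and> r \<in> relations n \<and> y \<in> path_alg_deg n j} \<subseteq>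
      (path_alg_deg n (i + 2 + j) :: (path \<Rightarrow> 'f) set)" for i j
    using relations_deg by (clarify, intro deg_mult) auto
  have "w = 0" if w: "w \<in> W n p" for w :: "path \<Rightarrow> 'f"
  proof -
    have "w \<in> lin_span (path_alg n) {x \<star> r \<star> y |x r y. x \<in> path_alg_deg n 0 \<and> r \<in> relations n \<and> y \<in> path_alg_deg n (p - 2)}"
      using w p unfolding W_def by (auto dest!: bspec[of _ _ "(0, p - 2)"])
    moreover have "lin_span (path_alg n) {x \<star> r \<star> y |x r y. x \<in> path_alg_deg n 0 \<and> r \<in> relations n \<and> y \<in> path_alg_deg n (p - 2)}
       \<subseteq> (path_alg_deg n (0 + 2 + (p - 2)) :: (path \<Rightarrow> 'f) set)"
      by (rule lin_span_subset[OF S]) (auto simp: deg_add deg_0 deg_scl dest: deg_PC)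
    moreover have "0 + 2 + (p - 2) = p" using p by simp
    ultimately have wd: "w \<in> path_alg_deg n p" by (simp only: subset_iff)
    show ?thesis
    proof (intro ext, safe, rule ccontr)
      fix xs :: "arrow list" and v
      assume "w (xs, v) \<noteq> 0 (xs, v)"
      hence nz: "w (xs, v) \<noteq> 0" by (simp add: zero_fun_apply)
      hence path: "is_path n (xs, v)" using deg_PC[OF wd] by (auto simp: PC_iff)
      have len: "length xs = p" using nz deg_zero[OF wd] by blast
      define zs where "zs = take (p - 3) xs"
      have "length (drop (p - 3) xs) = 3" using len p by simp
      moreover have "\<exists>a b c. ys = [a, b, c]" if "length ys = 3" for ys :: "arrow list"
        using that by (auto simp: numeral_3_eq_3 length_Suc_conv)
      ultimately obtain a b c where "drop (p - 3) xs = [a, b, c]" by blast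
      hence xs: "xs = zs @ [a, b, c]" unfolding zs_def by (metis append_take_drop_id)
      have lz: "length zs = p - 3" using len p by (simp add: zs_def)
      have R1: "rel_like (\<lambda>ys. w (zs @ ys @ [x], v))" for x
        by (rule W_zero_aux[OF w p, of "p - 3" 1]) (use p lz in auto)
      have R2: "rel_like (\<lambda>ys. w ((zs @ [x]) @ ys @ [], v))" for x
        by (rule W_zero_aux[OF w p, of "p - 2" 0]) (use p lz in auto)
      have N1: "w (zs @ [a, b, x], v) = 0" if "b \<noteq> opp a" for a b x
        using R1[of x] that by (simp add: rel_like_def)
      have N2: "w (zs @ [x, a, b], v) = 0" if "b \<noteq> opp a" for a b x
        using R2[of x] that by (simp add: rel_like_def)
      have b: "b = opp a" using N1[of b a c] nz xs by blast
      have "c = opp b" using N2[of c b a] nz xs by blast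
      hence c: "c = a" using b by (cases a) auto
      have idx: "arrow_index a \<le> n - 2" using arrow_index_path[OF path] xs by auto
      have nz': "w (zs @ [a, opp a, a], v) \<noteq> 0" using nz unfolding xs b c .
      note r1 = R1[unfolded rel_like_def] and r2 = R2[unfolded rel_like_def]
      obtain i where a: "a = Arr i \<or> a = Star i" by (cases a) auto
      hence i: "i \<le> n - 2" using idx by auto
      consider "i = 0" | "i = 1" | "i = 2" | "3 \<le> i" by linarith
      thus False
      proof cases
        case 1
        thus ?thesis using a nz' r1[of "Arr 0"] r2[of "Star 0"] N2[of "Arr 0" "Star 1" "Arr 1"] N1[of "Arr 1" "Star 0" "Star 1"]
          by auto
      next
        case 2
        thus ?thesis using a nz' r1[of "Arr 1"] r2[of "Star 1"] N2[of "Arr 1" "Star 0" "Arr 0"] N1[of "Arr 0" "Star 1" "Star 0"]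
          by auto
      next
        case 3
        thus ?thesis using a nz' r1[of "Star 2"] r2[of "Arr 2"] N2[of "Star 2" "Star 0" "Arr 0"] N1[of "Arr 0" "Arr 2" "Star 0"]
          by auto
      next
        case 4
        have "w (zs @ [Arr (i - 1), Star (i - 1), Star i], v) = - w (zs @ [Star i, Arr i, Star i], v)"
          "w (zs @ [Arr i, Arr (i - 1), Star (i - 1)], v) = - w (zs @ [Arr i, Star i, Arr i], v)"
          using r1[of "Star i"] r2[of "Arr i"] 4 i by (simp_all del: One_nat_def)
        thus ?thesis using a nz' N2[of "Star i" "Star (i - 1)" "Arr (i - 1)"] N1[of "Arr (i - 1)" "Arr i" "Star (i - 1)"]
          by auto
      qed
    qed
  qed
  moreover have "(0 :: path \<Rightarrow> 'f) \<in> W n p"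
  proof -
    have "0 \<in> lin_span (path_alg n) {x \<star> r \<star> y |x r y. x \<in> path_alg_deg n i \<and> r \<in> relations n \<and> (y :: path \<Rightarrow> 'f) \<in> path_alg_deg n j}"
      (is "0 \<in> lin_span _ ?S") for i j
    proof (rule lin_span_closed)
      show "?S \<subseteq> PC n"
      proof
        fix z assume "z \<in> ?S"
        hence "z \<in> path_alg_deg n (i + 2 + j)" by (rule subsetD[OF S])
        thus "z \<in> PC n" by (rule deg_PC)
      qed
    qed
    thus ?thesis using p by (auto simp: W_def)
  qed
  ultimately show ?thesis by blast
qed

end

section \<open>Koszul cochains\<close>

context type_D
begin

lemma W_closed:
  "0 \<in> W n p" "x \<in> W n p \<Longrightarrow> y \<in> W n p \<Longrightarrow> x + y \<in> W n p" "x \<in> W n p \<Longrightarrow> scl c x \<in> W n p"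
  "u \<in> path_alg_deg n 0 \<Longrightarrow> x \<in> W n p \<Longrightarrow> u \<star> x \<in> W n p"
  "u \<in> path_alg_deg n 0 \<Longrightarrow> x \<in> W n p \<Longrightarrow> x \<star> u \<in> W n p"
proof -
  consider "p = 0" | "p = 1" | "p = 2" | "3 \<le> p" by linarith
  note p = this
  show "0 \<in> W n p" by (cases rule: p) (simp_all add: W_0 W_1 W_2 W_zero deg_0 relations_closed)
  show "x \<in> W n p \<Longrightarrow> y \<in> W n p \<Longrightarrow> x + y \<in> W n p"
    by (cases rule: p) (simp_all add: W_0 W_1 W_2 W_zero deg_add relations_closed)
  show "x \<in> W n p \<Longrightarrow> scl c x \<in> W n p"
    by (cases rule: p) (simp_all add: W_0 W_1 W_2 W_zero deg_scl relations_closed)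
  show "u \<in> path_alg_deg n 0 \<Longrightarrow> x \<in> W n p \<Longrightarrow> u \<star> x \<in> W n p"
    using deg_mult[of u 0 x] by (cases rule: p) (force simp: W_0 W_1 W_2 W_zero relations_bimodule)+
  show "u \<in> path_alg_deg n 0 \<Longrightarrow> x \<in> W n p \<Longrightarrow> x \<star> u \<in> W n p"
    using deg_mult[of x _ u 0] by (cases rule: p) (force simp: W_0 W_1 W_2 W_zero relations_bimodule)+
qed

lemma W_sum: "(\<And>s. s \<in> S \<Longrightarrow> f s \<in> W n p) \<Longrightarrow> (\<Sum>s\<in>S. f s) \<in> W n p"
  by (induction S rule: infinite_finite_induct) (simp_all add: W_closed)

lemma W_PC: assumes "x \<in> W n p" shows "x \<in> PC n"
proof (cases "p \<le> 2")
  case True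
  thus ?thesis using W_deg[OF True] assms deg_PC by blast
next
  case False
  hence "W n p = {0 :: path \<Rightarrow> 'a}" by (intro W_zero) simp
  thus ?thesis using assms by simp
qed

lemma arr_W: "a \<in> arrows \<Longrightarrow> arr a \<in> W n (Suc 0)"
  using arr_deg by (simp add: W_1)

text \<open>Bimodule maps \<open>W\<^sub>p \<rightarrow> A\<close>, lifted to maps with values in the path algebra.\<close>

definition bim :: "nat \<Rightarrow> ((path \<Rightarrow> 'f::field) \<Rightarrow> path \<Rightarrow> 'f) \<Rightarrow> bool" where
  "bim p F \<longleftrightarrow> (\<forall>x\<in>W n p. F x \<in> PC n) \<and> (\<forall>x\<in>W n p. \<forall>y\<in>W n p. F (x + y) \<approx> F x + F y) \<and>
     (\<forall>u\<in>path_alg_deg n 0. \<forall>x\<in>W n p. F (u \<star> x) \<approx> u \<star> F x \<and> F (x \<star> u) \<approx> F x \<star> u)"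

definition coch :: "nat \<Rightarrow> ((path \<Rightarrow> 'f::field) \<Rightarrow> path \<Rightarrow> 'f) \<Rightarrow> 'f cochain" where
  "coch p F = (\<lambda>w\<in>W n p. cl (F w))"

abbreviation maps :: "nat \<Rightarrow> ((path \<Rightarrow> 'f::field) \<Rightarrow> path \<Rightarrow> 'f) set" where
  "maps p \<equiv> W n p \<rightarrow> PC n"

lemma bimD:
  assumes "bim p F"
  shows "x \<in> W n p \<Longrightarrow> F x \<in> PC n" "x \<in> W n p \<Longrightarrow> y \<in> W n p \<Longrightarrow> F (x + y) \<approx> F x + F y"
    "u \<in> path_alg_deg n 0 \<Longrightarrow> x \<in> W n p \<Longrightarrow> F (u \<star> x) \<approx> u \<star> F x"
    "u \<in> path_alg_deg n 0 \<Longrightarrow> x \<in> W n p \<Longrightarrow> F (x \<star> u) \<approx> F x \<star> u"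
  using assms by (simp_all add: bim_def)

lemma bim_maps: "bim p F \<Longrightarrow> F \<in> maps p"
  by (simp add: bim_def)

lemma coch_apply: "w \<in> W n p \<Longrightarrow> coch p F w = cl (F w)"
  by (simp add: coch_def)

lemma coch_eq_iff: "coch p F = coch p G \<longleftrightarrow> (\<forall>w\<in>W n p. F w \<approx> G w)"
  by (auto simp: coch_def restrict_def fun_eq_iff cl_iff)

text \<open>Representatives are chosen value by value. Such a lift is additive and compatible with
  \<open>k\<close> only up to congruence, which is exactly what \<open>bim\<close> records.\<close>

lemma cochains_coch: "carrier (cochains n p) = coch p ` {F :: (path \<Rightarrow> 'f::field) \<Rightarrow> path \<Rightarrow> 'f. bim p F}"
proof (intro equalityI subsetI)
  fix f :: "'f cochain" assume f: "f \<in> carrier (cochains n p)"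
  define F where "F w = (SOME x. x \<in> PC n \<and> f w = cl x)" for w
  have F: "F w \<in> PC n" "f w = cl (F w)" if "w \<in> W n p" for w
  proof -
    have "f w \<in> carrier A" using f that by (auto simp: cochains_def)
    hence "\<exists>x. x \<in> PC n \<and> f w = cl x" by (auto simp: A_carrier)
    hence "F w \<in> PC n \<and> f w = cl (F w)" unfolding F_def by (rule someI_ex)
    thus "F w \<in> PC n" "f w = cl (F w)" by blast+
  qed
  have fl: "f (x + y) = f x \<oplus>\<^bsub>A\<^esub> f y" "u \<in> path_alg_deg n 0 \<Longrightarrow> f (u \<star> x) = cl u \<otimes>\<^bsub>A\<^esub> f x"
    "u \<in> path_alg_deg n 0 \<Longrightarrow> f (x \<star> u) = f x \<otimes>\<^bsub>A\<^esub> cl u"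
    if "x \<in> W n p" "y \<in> W n p" for x y u :: "path \<Rightarrow> 'f"
    using f that by (simp_all add: cochains_def W_0)
  have "bim p F" unfolding bim_def
  proof (intro conjI ballI)
    fix x y :: "path \<Rightarrow> 'f" assume xy: "x \<in> W n p" "y \<in> W n p"
    have "cl (F (x + y)) = f x \<oplus>\<^bsub>A\<^esub> f y"
      using fl(1)[OF xy] F(2)[OF W_closed(2)[OF xy]] by simp
    also have "\<dots> = cl (F x + F y)" unfolding F(2)[OF xy(1)] F(2)[OF xy(2)] by (rule A_add)
    finally show "F (x + y) \<approx> F x + F y" by (simp only: cl_iff)
  next
    fix u x :: "path \<Rightarrow> 'f" assume u: "u \<in> path_alg_deg n 0" and x: "x \<in> W n p"
    have "cl (F (u \<star> x)) = cl u \<otimes>\<^bsub>A\<^esub> f x"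
      using fl(2)[OF x x u] F(2)[OF W_closed(4)[OF u x]] by simp
    also have "\<dots> = cl (u \<star> F x)" unfolding F(2)[OF x] by (rule A_mult[OF deg_PC[OF u] F(1)[OF x]])
    finally show "F (u \<star> x) \<approx> u \<star> F x" by (simp only: cl_iff)
    have "cl (F (x \<star> u)) = f x \<otimes>\<^bsub>A\<^esub> cl u"
      using fl(3)[OF x x u] F(2)[OF W_closed(5)[OF u x]] by simp
    also have "\<dots> = cl (F x \<star> u)" unfolding F(2)[OF x] by (rule A_mult[OF F(1)[OF x] deg_PC[OF u]])
    finally show "F (x \<star> u) \<approx> F x \<star> u" by (simp only: cl_iff)
  qed (use F in blast)
  moreover have "f = coch p F"
    using f F by (auto simp: coch_def fun_eq_iff restrict_def cochains_def PiE_def extensional_def)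
  ultimately show "f \<in> coch p ` {F. bim p F}" by blast
next
  fix f :: "'f cochain" assume "f \<in> coch p ` {F. bim p F}"
  then obtain F where F: "bim p F" "f = coch p F" by blast
  note D = bimD[OF F(1)]
  show "f \<in> carrier (cochains n p)"
    unfolding F(2) using D
    by (auto simp: cochains_def coch_def W_closed W_0 A_add A_mult deg_PC cl_iff)
qed

lemma cochains_ops:
  "\<zero>\<^bsub>cochains n p\<^esub> = coch p (\<lambda>w. 0)"
  "coch p F \<oplus>\<^bsub>cochains n p\<^esub> coch p G = coch p (\<lambda>w. F w + G w)"
  "F \<in> maps p \<Longrightarrow> c \<odot>\<^bsub>cochains n p\<^esub> coch p F = coch p (\<lambda>w. scl c (F w))"
  by (auto simp: cochains_def coch_def fun_eq_iff A_zero A_add A_smult Pi_iff)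

text \<open>Scalars act through multiples of the unit in degree 0, so homogeneity is a case of the
  bimodule property.\<close>

lemma bim_scl: assumes "bim p F" "x \<in> W n p" shows "F (scl c x) \<approx> scl c (F x)"
proof -
  have "F (scl c (pone n) \<star> x) \<approx> scl c (pone n) \<star> F x"
    by (rule bimD(3)[OF assms(1) _ assms(2)]) (intro deg_scl pone_deg)
  thus ?thesis using assms bimD(1)[OF assms] W_PC[OF assms(2)] by (simp add: pmul_scl_left)
qed

lemma bim_zero: assumes "bim p F" shows "F 0 \<approx> 0"
  using bim_scl[OF assms W_closed(1), of 0] by simp

lemma bim_sum:
  assumes "bim p F" "\<And>s. s \<in> S \<Longrightarrow> f s \<in> W n p"
  shows "F (\<Sum>s\<in>S. f s) \<approx> (\<Sum>s\<in>S. F (f s))"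
  using assms(2)
proof (induction S rule: infinite_finite_induct)
  case (insert s S)
  hence "F (f s + (\<Sum>s\<in>S. f s)) \<approx> F (f s) + F (\<Sum>s\<in>S. f s)"
    by (intro bimD(2)[OF assms(1)] W_sum) auto
  also have "F (f s) + F (\<Sum>s\<in>S. f s) \<approx> F (f s) + (\<Sum>s\<in>S. F (f s))"
    using insert by (intro eqv_add eqv_refl) auto
  finally show ?case using insert by simp
qed (simp_all add: bim_zero[OF assms(1)])

text \<open>Vertices, arrows and the \<open>sig i\<close> for \<open>q\<close> = 0, 1, 2, and the
  empty family afterwards. The coefficients are values at paths \<open>b\<close>; each member is
  fixed by the idempotent at the target of its path, which allows that idempotent to be moved across
  a product.\<close>

lemma dual_basis:
  "\<exists>(B :: path set) w. finite B \<and>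
     (\<forall>b\<in>B. w b \<in> (W n q :: (path \<Rightarrow> 'f::field) set) \<and> vtx (path_tgt b) \<star> w b = w b \<and>
        path_tgt b < n \<and> length (fst b) = q) \<and>
     (q \<le> 2 \<or> B = {}) \<and> (\<forall>v\<in>W n q. v = (\<Sum>b\<in>B. scl (v b) (w b)))"
proof -
  consider "q = 0" | "q = 1" | "q = 2" | "3 \<le> q" by linarith
  thus ?thesis
  proof cases
    case 1
    have inj: "inj_on (\<lambda>v. ([] :: arrow list, v)) {..<n}" by (auto simp: inj_on_def)
    show ?thesis unfolding 1
      by (rule exI[of _ "(\<lambda>v. ([], v)) ` {..<n}"], rule exI[of _ "\<lambda>b. vtx (snd b)"])
         (auto simp: W_0 vtx_deg path_elem_mult sum.reindex[OF inj] simp flip: deg0_eq)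
  next
    case 2
    have inj: "inj_on (\<lambda>a. ([a], arrow_src a)) arrows" by (auto simp: inj_on_def)
    show ?thesis unfolding 2
      by (rule exI[of _ "(\<lambda>a. ([a], arrow_src a)) ` arrows"], rule exI[of _ "path_elem"])
         (auto simp: W_1[folded One_nat_def] arr_deg finite_arrows path_elem_mult arrow_tgt_less sum.reindex[OF inj]
           simp del: One_nat_def simp flip: deg1_eq)
  next
    case 3
    have s: "snd (sig_path i) = i" "path_tgt (sig_path i) = i" "length (fst (sig_path i)) = 2" if "i < n" for i
      using that n4 by (auto simp: sig_path_def)
    have inj: "inj_on sig_path {..<n}" using s(1) by (metis inj_onI lessThan_iff)
    have e: "(\<Sum>b\<in>sig_path ` {..<n}. scl (v b) (sig (snd b))) = (\<Sum>i<n. scl (v (sig_path i)) (sig i))"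
      for v :: "path \<Rightarrow> 'f"
      unfolding sum.reindex[OF inj] by (intro sum.cong) (auto simp: s)
    show ?thesis unfolding 3
      by (rule exI[of _ "sig_path ` {..<n}"], rule exI[of _ "\<lambda>b. sig (snd b)"])
         (auto simp: W_2 sig_relations s vtx_sig e relations_eq)
  next
    case 4
    thus ?thesis by (intro exI[of _ "{}"]) (simp add: W_zero)
  qed
qed

text \<open>Strips the path \<open>b\<close> from the right. On a product this evaluates the second
  factor at \<open>b\<close> and keeps the first, so the terms of a tensor can be recovered from the
  product alone.\<close>

definition contract :: "path \<Rightarrow> (path \<Rightarrow> 'f::field) \<Rightarrow> path \<Rightarrow> 'f" where
  "contract b w = (\<lambda>(xs, u). if u = path_tgt b then w (xs @ fst b, snd b) else 0)"

lemma contract_mult: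
  assumes "v \<in> path_alg_deg n (length (fst b))" "path_tgt b < n"
  shows "contract b (u \<star> v) = scl (v b) u \<star> vtx (path_tgt b)"
proof (intro ext, safe)
  fix xs :: "arrow list" and t
  have "(scl (v b) u \<star> vtx (path_tgt b)) (xs @ [], t) = scl (v b) u (xs, path_tgt ([], t)) * vtx (path_tgt b) ([], t)"
    by (subst pmul_deg_right[where d = 0]) (auto simp: path_elem_def split: if_splits)
  moreover have "(u \<star> v) (xs @ fst b, snd b) = u (xs, path_tgt (fst b, snd b)) * v (fst b, snd b)"
    by (subst pmul_deg_right[where d = "length (fst b)"]) (use assms deg_zero in auto)
  ultimately show "contract b (u \<star> v) (xs, t) = (scl (v b) u \<star> vtx (path_tgt b)) (xs, t)"
    by (auto simp: contract_def scl_apply path_elem_def)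
qed

lemma contract_sum: "contract b (\<Sum>s\<in>S. f s) = (\<Sum>s\<in>S. contract b (f s))"
proof (intro ext, safe)
  fix xs :: "arrow list" and t
  show "contract b (\<Sum>s\<in>S. f s) (xs, t) = (\<Sum>s\<in>S. contract b (f s)) (xs, t)"
    by (simp add: contract_def sum_fun_apply)
qed

text \<open>The right-hand side only depends on the sum of the products \<open>u s \<star> v s\<close>.\<close>

lemma split_well_defined:
  fixes F G :: "(path \<Rightarrow> 'f::field) \<Rightarrow> path \<Rightarrow> 'f"
  assumes F: "bim p F" and G: "bim q G"
  shows "\<exists>(B :: path set) w. \<forall>(S :: nat set) u v. (\<forall>s\<in>S. u s \<in> W n p \<and> v s \<in> W n q) \<longrightarrow>
    (\<Sum>s\<in>S. F (u s) \<star> G (v s)) \<approx> (\<Sum>b\<in>B. F (contract b (\<Sum>s\<in>S. u s \<star> v s)) \<star> G (w b))"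
proof -
  obtain B :: "path set" and w :: "path \<Rightarrow> path \<Rightarrow> 'f" where Bw: "finite B \<and>
     (\<forall>b\<in>B. w b \<in> W n q \<and> vtx (path_tgt b) \<star> w b = w b \<and> path_tgt b < n \<and> length (fst b) = q) \<and>
     (q \<le> 2 \<or> B = {}) \<and> (\<forall>v\<in>W n q. v = (\<Sum>b\<in>B. scl (v b) (w b)))"
    using dual_basis[where 'f = 'f, of q] by (elim exE)
  have B: "finite B" "b \<in> B \<Longrightarrow> w b \<in> W n q" "b \<in> B \<Longrightarrow> vtx (path_tgt b) \<star> w b = w b"
    "b \<in> B \<Longrightarrow> path_tgt b < n" "b \<in> B \<Longrightarrow> length (fst b) = q" "q \<le> 2 \<or> B = {}" for b
    using Bw by simp_all
  have W: "v = (\<Sum>b\<in>B. scl (v b) (w b))" if "v \<in> W n q" for v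
    using Bw that by blast
  have c: "contract b (u \<star> v) = scl (v b) u \<star> vtx (path_tgt b)" if "v \<in> W n q" "b \<in> B" for u v b
  proof (rule contract_mult)
    have "q \<le> 2" using B(6) that(2) by auto
    thus "v \<in> path_alg_deg n (length (fst b))" using W_deg B(5) that by auto
  qed (rule B(4)[OF that(2)])
  \<comment> \<open>The second factor is expanded in the dual family; its coefficients, and the
    idempotent at the target of \<open>b\<close>, are then moved into the argument of
    \<open>F\<close>.\<close>
  have main: "F u \<star> G v \<approx> (\<Sum>b\<in>B. F (contract b (u \<star> v)) \<star> G (w b))"
    if uv: "u \<in> W n p" "v \<in> W n q" for u v
  proof -
    have "G (\<Sum>b\<in>B. scl (v b) (w b)) \<approx> (\<Sum>b\<in>B. G (scl (v b) (w b)))"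
      by (rule bim_sum[OF G]) (intro W_closed B)
    hence "G v \<approx> (\<Sum>b\<in>B. G (scl (v b) (w b)))" using W[OF uv(2)] by simp
    also have "\<dots> \<approx> (\<Sum>b\<in>B. scl (v b) (G (w b)))"
      by (intro eqv_sum bim_scl[OF G] B)
    finally have "F u \<star> G v \<approx> F u \<star> (\<Sum>b\<in>B. scl (v b) (G (w b)))"
      by (rule eqv_left[OF _ bimD(1)[OF F uv(1)]])
    also have "\<dots> = (\<Sum>b\<in>B. scl (v b) (F u) \<star> G (w b))"
      by (simp add: pmul_sum_right pmul_scl_left pmul_scl_right)
    also have "\<dots> \<approx> (\<Sum>b\<in>B. F (contract b (u \<star> v)) \<star> G (w b))"
    proof (rule eqv_sum)
      fix b assume b: "b \<in> B"
      have P: "F u \<in> PC n" "G (w b) \<in> PC n" "vtx (path_tgt b) \<in> PC n"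
        using bimD(1)[OF F] bimD(1)[OF G] uv b B by simp_all
      have "F (scl (v b) u \<star> vtx (path_tgt b)) \<approx> F (scl (v b) u) \<star> vtx (path_tgt b)"
        by (rule bimD(4)[OF F]) (intro vtx_deg W_closed(3) uv B(4)[OF b])+
      also have "\<dots> \<approx> scl (v b) (F u) \<star> vtx (path_tgt b)"
        by (intro eqv_right bim_scl[OF F] uv P)
      finally have "F (contract b (u \<star> v)) \<star> G (w b) \<approx> scl (v b) (F u) \<star> vtx (path_tgt b) \<star> G (w b)"
        unfolding c[OF uv(2) b] by (rule eqv_right[OF _ P(2)])
      also have "\<dots> = scl (v b) (F u) \<star> (vtx (path_tgt b) \<star> G (w b))" by (simp add: pmul_assoc)
      also have "\<dots> \<approx> scl (v b) (F u) \<star> G (w b)"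
      proof (rule eqv_left)
        have "G (vtx (path_tgt b) \<star> w b) \<approx> vtx (path_tgt b) \<star> G (w b)"
          by (rule bimD(3)[OF G]) (intro vtx_deg B(2)[OF b] B(4)[OF b])+
        thus "vtx (path_tgt b) \<star> G (w b) \<approx> G (w b)" unfolding B(3)[OF b] by (rule eqv_sym)
      qed (use P in simp)
      finally show "scl (v b) (F u) \<star> G (w b) \<approx> F (contract b (u \<star> v)) \<star> G (w b)"
        by (rule eqv_sym)
    qed
    finally show ?thesis .
  qed
  show ?thesis
  proof (rule exI[of _ B], rule exI[of _ w], intro allI impI)
    fix S :: "nat set" and u v :: "nat \<Rightarrow> path \<Rightarrow> 'f"
    assume uv: "\<forall>s\<in>S. u s \<in> W n p \<and> v s \<in> W n q"
    have "(\<Sum>s\<in>S. F (u s) \<star> G (v s)) \<approx> (\<Sum>s\<in>S. \<Sum>b\<in>B. F (contract b (u s \<star> v s)) \<star> G (w b))"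
      by (intro eqv_sum main) (use uv in auto)
    also have "\<dots> = (\<Sum>b\<in>B. (\<Sum>s\<in>S. F (contract b (u s \<star> v s))) \<star> G (w b))"
      by (subst sum.swap) (simp add: pmul_sum_left)
    also have "\<dots> \<approx> (\<Sum>b\<in>B. F (contract b (\<Sum>s\<in>S. u s \<star> v s)) \<star> G (w b))"
    proof (intro eqv_sum eqv_right)
      fix b assume b: "b \<in> B"
      show "G (w b) \<in> PC n" using bimD(1)[OF G] B(2)[OF b] by blast
      have "F (\<Sum>s\<in>S. contract b (u s \<star> v s)) \<approx> (\<Sum>s\<in>S. F (contract b (u s \<star> v s)))"
      proof (rule bim_sum[OF F])
        fix s assume s: "s \<in> S"
        have "scl (v s b) (u s) \<star> vtx (path_tgt b) \<in> W n p"
          using s uv by (intro W_closed(5,3) vtx_deg B(4)[OF b]) auto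
        thus "contract b (u s \<star> v s) \<in> W n p" using c[of "v s" b "u s"] uv s b by simp
      qed
      thus "(\<Sum>s\<in>S. F (contract b (u s \<star> v s))) \<approx> F (contract b (\<Sum>s\<in>S. u s \<star> v s))"
        unfolding contract_sum by (rule eqv_sym)
    qed
    finally show "(\<Sum>s\<in>S. F (u s) \<star> G (v s)) \<approx> (\<Sum>b\<in>B. F (contract b (\<Sum>s\<in>S. u s \<star> v s)) \<star> G (w b))" .
  qed
qed

lemma path_alg_sum: "(\<And>s. s \<in> S \<Longrightarrow> f s \<in> PC n) \<Longrightarrow> (\<Oplus>\<^bsub>path_alg n\<^esub>s\<in>S. f s) = (\<Sum>s\<in>S. f s)"
  by (rule path_alg_finsum) auto

text \<open>The given sum witnesses existence for the definite description. Uniqueness is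
  \<open>split_well_defined\<close>: any other decomposition has the same sum of products and hence
  the same contracted expression.\<close>

lemma split_apply_nat:
  fixes F G :: "(path \<Rightarrow> 'f::field) \<Rightarrow> path \<Rightarrow> 'f" and m :: nat
  assumes F: "bim p F" and G: "bim q G" and uv: "\<And>j. j < m \<Longrightarrow> u j \<in> W n p" "\<And>j. j < m \<Longrightarrow> v j \<in> W n q"
  shows "split_apply n p q (coch p F) (coch q G) (\<Sum>j<m. u j \<star> v j) = cl (\<Sum>j<m. F (u j) \<star> G (v j))"
proof -
  have FG: "F x \<in> PC n" if "x \<in> W n p" for x using bimD(1)[OF F] that by blast
  have GG: "G x \<in> PC n" if "x \<in> W n q" for x using bimD(1)[OF G] that by blast
  have e: "(\<Oplus>\<^bsub>A\<^esub>j\<in>{..<m}. coch p F (u j) \<otimes>\<^bsub>A\<^esub> coch q G (v j)) = cl (\<Sum>j<m. F (u j) \<star> G (v j))"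
    if "\<And>j. j < m \<Longrightarrow> u j \<in> W n p" "\<And>j. j < m \<Longrightarrow> v j \<in> W n q" for m :: nat and u v
  proof -
    have "(\<Oplus>\<^bsub>A\<^esub>j\<in>{..<m}. coch p F (u j) \<otimes>\<^bsub>A\<^esub> coch q G (v j)) = (\<Oplus>\<^bsub>A\<^esub>j\<in>{..<m}. cl (F (u j) \<star> G (v j)))"
      using that by (intro A.finsum_cong') (auto simp: coch_apply A_mult FG GG)
    also have "\<dots> = cl (\<Sum>j<m. F (u j) \<star> G (v j))" by (rule A_finsum) (use that FG GG in auto)
    finally show ?thesis .
  qed
  have f: "(\<Oplus>\<^bsub>path_alg n\<^esub>j\<in>{..<m}. u j \<otimes>\<^bsub>path_alg n\<^esub> v j) = (\<Sum>j<m. u j \<star> v j)"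
    if "\<And>j. j < m \<Longrightarrow> u j \<in> W n p" "\<And>j. j < m \<Longrightarrow> v j \<in> W n q" for m :: nat and u v :: "nat \<Rightarrow> path \<Rightarrow> 'f"
    unfolding path_alg_simps
    by (intro path_alg_sum PC_mult n3) (auto intro: W_PC[OF that(1)] W_PC[OF that(2)])
  obtain B :: "path set" and w where B: "\<And>(S :: nat set) u v. \<forall>s\<in>S. u s \<in> W n p \<and> v s \<in> W n q \<Longrightarrow>
    (\<Sum>s\<in>S. F (u s) \<star> G (v s)) \<approx> (\<Sum>b\<in>B. F (contract b (\<Sum>s\<in>S. u s \<star> v s)) \<star> G (w b))"
    using split_well_defined[OF F G] by (elim exE) blast
  show ?thesis unfolding split_apply_def
  proof (rule the_equality)
    show "\<exists>m' u' v'. (\<forall>j<m'::nat. u' j \<in> W n p \<and> v' j \<in> W n q) \<and>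
       (\<Sum>j<m. u j \<star> v j) = (\<Oplus>\<^bsub>path_alg n\<^esub>j\<in>{..<m'}. u' j \<otimes>\<^bsub>path_alg n\<^esub> v' j) \<and>
       cl (\<Sum>j<m. F (u j) \<star> G (v j)) = (\<Oplus>\<^bsub>A\<^esub>j\<in>{..<m'}. coch p F (u' j) \<otimes>\<^bsub>A\<^esub> coch q G (v' j))"
    proof (intro exI conjI)
      show "\<forall>j<m. u j \<in> W n p \<and> v j \<in> W n q" using uv by blast
      show "(\<Sum>j<m. u j \<star> v j) = (\<Oplus>\<^bsub>path_alg n\<^esub>j\<in>{..<m}. u j \<otimes>\<^bsub>path_alg n\<^esub> v j)"
        by (rule f[OF uv, symmetric])
      show "cl (\<Sum>j<m. F (u j) \<star> G (v j)) = (\<Oplus>\<^bsub>A\<^esub>j\<in>{..<m}. coch p F (u j) \<otimes>\<^bsub>A\<^esub> coch q G (v j))"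
        by (rule e[OF uv, symmetric])
    qed
  next
    fix y assume "\<exists>m' u' v'. (\<forall>j<m'::nat. u' j \<in> W n p \<and> v' j \<in> W n q) \<and>
       (\<Sum>j<m. u j \<star> v j) = (\<Oplus>\<^bsub>path_alg n\<^esub>j\<in>{..<m'}. u' j \<otimes>\<^bsub>path_alg n\<^esub> v' j) \<and>
       y = (\<Oplus>\<^bsub>A\<^esub>j\<in>{..<m'}. coch p F (u' j) \<otimes>\<^bsub>A\<^esub> coch q G (v' j))"
    then obtain m' :: nat and u' v' where *: "(\<forall>j<m'. u' j \<in> W n p \<and> v' j \<in> W n q) \<and>
      (\<Sum>j<m. u j \<star> v j) = (\<Oplus>\<^bsub>path_alg n\<^esub>j\<in>{..<m'}. u' j \<otimes>\<^bsub>path_alg n\<^esub> v' j) \<and>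
      y = (\<Oplus>\<^bsub>A\<^esub>j\<in>{..<m'}. coch p F (u' j) \<otimes>\<^bsub>A\<^esub> coch q G (v' j))" by (elim exE)
    have uv': "u' j \<in> W n p" "v' j \<in> W n q" if "j < m'" for j using * that by simp_all
    have s: "(\<Sum>j<m. u j \<star> v j) = (\<Sum>j<m'. u' j \<star> v' j)" using conjunct1[OF conjunct2[OF *]] f[OF uv'] by simp
    have y: "y = cl (\<Sum>j<m'. F (u' j) \<star> G (v' j))" using conjunct2[OF conjunct2[OF *]] e[OF uv'] by simp
    have "(\<Sum>j<m'. F (u' j) \<star> G (v' j)) \<approx> (\<Sum>b\<in>B. F (contract b (\<Sum>j<m'. u' j \<star> v' j)) \<star> G (w b))"
      by (rule B) (use uv' in blast)
    moreover have "(\<Sum>j<m. F (u j) \<star> G (v j)) \<approx> (\<Sum>b\<in>B. F (contract b (\<Sum>j<m. u j \<star> v j)) \<star> G (w b))"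
      by (rule B) (use uv in blast)
    ultimately have "(\<Sum>j<m'. F (u' j) \<star> G (v' j)) \<approx> (\<Sum>j<m. F (u j) \<star> G (v j))"
      unfolding s by (blast intro: eqv_trans eqv_sym)
    thus "y = cl (\<Sum>j<m. F (u j) \<star> G (v j))" unfolding y by (simp add: cl_iff)
  qed
qed

text \<open>Transfers the result from initial segments of the naturals to index sets such as the set
  of arrows.\<close>

lemma split_apply_eq:
  fixes F G :: "(path \<Rightarrow> 'f::field) \<Rightarrow> path \<Rightarrow> 'f"
  assumes F: "bim p F" and G: "bim q G" and S: "finite S"
    and uv: "\<And>s. s \<in> S \<Longrightarrow> u s \<in> W n p" "\<And>s. s \<in> S \<Longrightarrow> v s \<in> W n q"
  shows "split_apply n p q (coch p F) (coch q G) (\<Sum>s\<in>S. u s \<star> v s) = cl (\<Sum>s\<in>S. F (u s) \<star> G (v s))"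
proof -
  obtain h where h: "bij_betw h {..<card S} S"
    using ex_bij_betw_nat_finite[OF S] by (auto simp: atLeast0LessThan)
  hence hS: "h j \<in> S" if "j < card S" for j using that by (auto simp: bij_betw_def)
  have "split_apply n p q (coch p F) (coch q G) (\<Sum>j<card S. u (h j) \<star> v (h j)) =
      cl (\<Sum>j<card S. F (u (h j)) \<star> G (v (h j)))"
    by (rule split_apply_nat[OF F G]) (use uv hS in auto)
  thus ?thesis
    using sum.reindex_bij_betw[OF h, of "\<lambda>s. u s \<star> v s"] sum.reindex_bij_betw[OF h, of "\<lambda>s. F (u s) \<star> G (v s)"]
    by simp
qed

end

section \<open>The Koszul differential\<close>

context type_D
begin

text \<open>Gives a canonical splitting of an element of \<open>W n 2\<close>, indexed by its first
  arrow, so that values of \<open>split_apply\<close> become explicit finite sums.\<close>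

definition tail_part :: "arrow \<Rightarrow> (path \<Rightarrow> 'f::field) \<Rightarrow> path \<Rightarrow> 'f" where
  "tail_part a w = (\<lambda>(xs, v). if path_tgt (xs, v) = arrow_src a then w (a # xs, v) else 0)"

lemma tail_part_add: "tail_part a (x + y) = tail_part a x + tail_part a y"
  by (auto simp: tail_part_def fun_app)

lemma tail_part_W:
  assumes "w \<in> W n 2" shows "tail_part a w \<in> W n (Suc 0)"
  unfolding W_1
proof (rule degI)
  have w: "w \<in> path_alg_deg n 2" using assms W_deg[of 2] by auto
  have wp: "is_path n (a # xs, v)" if "w (a # xs, v) \<noteq> 0" for xs v
    using deg_PC[OF w] that by (auto simp: PC_iff simp del: is_path.simps)
  have "{p. tail_part a w p \<noteq> 0} \<subseteq> (\<lambda>(xs, v). (tl xs, v)) ` {p. w p \<noteq> 0}"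
    by (force simp: tail_part_def split: if_splits)
  moreover have "finite {p. w p \<noteq> 0}" using deg_PC[OF w] by (simp add: PC_iff)
  ultimately have "finite {p. tail_part a w p \<noteq> 0}" using finite_surj by blast
  moreover have "is_path n p" if "tail_part a w p \<noteq> 0" for p
    using that wp by (cases p) (auto simp: tail_part_def split: if_splits)
  ultimately show "tail_part a w \<in> PC n" by (simp add: PC_iff)
  show "length xs = 1" if "tail_part a w (xs, v) \<noteq> 0" for xs v
  proof -
    have "w (a # xs, v) \<noteq> 0" using that by (auto simp: tail_part_def split: if_splits)
    thus ?thesis using deg_zero[OF w, of "a # xs" v] by auto
  qed
qed

lemma tail_part_sum:
  assumes "w \<in> W n 2" shows "w = (\<Sum>a\<in>arrows. arr a \<star> tail_part a w)"
proof (intro ext, safe)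
  have w: "w \<in> path_alg_deg n 2" using assms W_deg[of 2] by auto
  fix ys :: "arrow list" and t
  have *: "(arr a \<star> tail_part a w) (ys, t) = (if 1 \<le> length ys then
      arr a (take 1 ys, path_tgt (drop 1 ys, t)) * tail_part a w (drop 1 ys, t) else 0)" for a
    by (rule pmul_deg_left) (auto simp: path_elem_def split: if_splits)
  show "w (ys, t) = (\<Sum>a\<in>arrows. arr a \<star> tail_part a w) (ys, t)"
  proof (cases ys)
    case Nil
    thus ?thesis using deg_zero[OF w, of "[]" t] unfolding sum_fun_apply * by simp
  next
    case (Cons b zs)
    have "(\<Sum>a\<in>arrows. arr a \<star> tail_part a w) (ys, t) =
      (\<Sum>a\<in>arrows. if a = b then if path_tgt (zs, t) = arrow_src b then w (b # zs, t) else 0 else 0)"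
      unfolding sum_fun_apply * using Cons by (intro sum.cong) (auto simp: path_elem_def tail_part_def)
    also have "\<dots> = (if b \<in> arrows \<and> path_tgt (zs, t) = arrow_src b then w (b # zs, t) else 0)"
      by (simp add: finite_arrows)
    also have "\<dots> = w (b # zs, t)"
    proof -
      have "is_path n (b # zs, t)" if "w (b # zs, t) \<noteq> 0"
        using deg_PC[OF w] that by (auto simp: PC_iff simp del: is_path.simps)
      thus ?thesis by (cases "w (b # zs, t) = 0") auto
    qed
    finally show ?thesis using Cons by simp
  qed
qed

lemma bim_id: "bim (Suc 0) (\<lambda>x. x)"
  by (simp add: bim_def W_PC eqv_refl)

lemma euler_coch: "euler n = coch (Suc 0) (\<lambda>x. x)"
  by (simp add: euler_def coch_def)

lemma bim_const_zero: "bim p (\<lambda>w. 0)"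
  by (simp add: bim_def eqv_refl)

lemma bim_add: assumes "bim p F" "bim p G" shows "bim p (\<lambda>w. F w + G w)"
  unfolding bim_def
proof (intro conjI ballI)
  fix x y :: "path \<Rightarrow> 'a" assume xy: "x \<in> W n p" "y \<in> W n p"
  have "F (x + y) + G (x + y) \<approx> (F x + F y) + (G x + G y)"
    by (intro eqv_add bimD(2)[OF assms(1)] bimD(2)[OF assms(2)] xy)
  thus "F (x + y) + G (x + y) \<approx> F x + G x + (F y + G y)" by (simp add: algebra_simps)
next
  fix u x :: "path \<Rightarrow> 'a" assume ux: "u \<in> path_alg_deg n 0" "x \<in> W n p"
  show "F (u \<star> x) + G (u \<star> x) \<approx> u \<star> (F x + G x)"
    unfolding pmul_add_right by (intro eqv_add bimD(3)[OF assms(1)] bimD(3)[OF assms(2)] ux)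
  show "F (x \<star> u) + G (x \<star> u) \<approx> (F x + G x) \<star> u"
    unfolding pmul_add_left by (intro eqv_add bimD(4)[OF assms(1)] bimD(4)[OF assms(2)] ux)
qed (simp add: bimD(1)[OF assms(1)] bimD(1)[OF assms(2)])

lemma bim_smult: assumes "bim p F" shows "bim p (\<lambda>w. scl c (F w))"
  unfolding bim_def
proof (intro conjI ballI)
  fix x y :: "path \<Rightarrow> 'a" assume xy: "x \<in> W n p" "y \<in> W n p"
  show "scl c (F (x + y)) \<approx> scl c (F x) + scl c (F y)"
    using eqv_scl[OF bimD(2)[OF assms xy]] by (simp add: scl_simps)
next
  fix u x :: "path \<Rightarrow> 'a" assume ux: "u \<in> path_alg_deg n 0" "x \<in> W n p"
  show "scl c (F (u \<star> x)) \<approx> u \<star> scl c (F x)" "scl c (F (x \<star> u)) \<approx> scl c (F x) \<star> u"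
    using eqv_scl[OF bimD(3)[OF assms ux]] eqv_scl[OF bimD(4)[OF assms ux]]
    by (simp_all add: pmul_scl_left pmul_scl_right)
qed (simp add: bimD(1)[OF assms])

lemma bim_uminus: "bim p F \<Longrightarrow> bim p (\<lambda>w. - F w)"
  using bim_smult[of p F "- 1"] by (simp add: scl_minus_one)

lemma bim_diff: "bim p F \<Longrightarrow> bim p G \<Longrightarrow> bim p (\<lambda>w. F w - G w)"
  using bim_add[OF _ bim_uminus, of p F G] by simp

text \<open>The Koszul differential on lifts. Degrees 0 and 1 are the only ones with something to
  say, as \<open>W n 3\<close> is already zero; in degree 0 a cochain is multiplication by its value
  at the unit, and in degree 1 the sign turns into a plus.\<close>

definition kd :: "nat \<Rightarrow> ((path \<Rightarrow> 'f::field) \<Rightarrow> path \<Rightarrow> 'f) \<Rightarrow> (path \<Rightarrow> 'f) \<Rightarrow> path \<Rightarrow> 'f" where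
  "kd p F = (\<lambda>w. if p = 0 then F (pone n) \<star> w - w \<star> F (pone n)
     else if p = 1 then \<Sum>a\<in>arrows. F (arr a) \<star> tail_part a w + arr a \<star> F (tail_part a w)
     else 0)"

lemma kd_simps:
  "kd 0 F w = F (pone n) \<star> w - w \<star> F (pone n)"
  "kd (Suc 0) F w = (\<Sum>a\<in>arrows. F (arr a) \<star> tail_part a w + arr a \<star> F (tail_part a w))"
  "2 \<le> p \<Longrightarrow> kd p F w = 0"
  by (auto simp: kd_def)

lemma kd_linear:
  "kd p (\<lambda>w. F w + G w) w = kd p F w + kd p G w"
  "kd p (\<lambda>w. scl c (F w)) w = scl c (kd p F w)"
  by (auto simp: kd_def pmul_add_left pmul_add_right sum.distrib scl_simps scl_sum pmul_scl_left pmul_scl_right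
      algebra_simps)

lemma pone_W: "pone n \<in> W n 0"
  by (simp add: W_0 pone_deg)

lemma split_apply_0_right:
  assumes "bim p F" "bim 0 G" "w \<in> W n p"
  shows "split_apply n p 0 (coch p F) (coch 0 G) w = cl (F w \<star> G (pone n))"
  using split_apply_eq[OF assms(1,2), of "{()}" "\<lambda>_. w" "\<lambda>_. pone n"] assms(3) pone_W W_PC[OF assms(3)]
  by simp

lemma split_apply_0_left:
  assumes "bim 0 F" "bim q G" "w \<in> W n q"
  shows "split_apply n 0 q (coch 0 F) (coch q G) w = cl (F (pone n) \<star> G w)"
  using split_apply_eq[OF assms(1,2), of "{()}" "\<lambda>_. pone n" "\<lambda>_. w"] assms(3) pone_W W_PC[OF assms(3)]
  by simp

lemma split_apply_11:
  assumes "bim (Suc 0) F" "bim (Suc 0) G" "w \<in> W n 2"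
  shows "split_apply n (Suc 0) (Suc 0) (coch (Suc 0) F) (coch (Suc 0) G) w =
    cl (\<Sum>a\<in>arrows. F (arr a) \<star> G (tail_part a w))"
proof -
  have "split_apply n (Suc 0) (Suc 0) (coch (Suc 0) F) (coch (Suc 0) G) (\<Sum>a\<in>arrows. arr a \<star> tail_part a w) =
    cl (\<Sum>a\<in>arrows. F (arr a) \<star> G (tail_part a w))"
    by (rule split_apply_eq[OF assms(1,2) finite_arrows]) (intro arr_W tail_part_W assms; assumption)+
  thus ?thesis by (simp flip: tail_part_sum[OF assms(3)])
qed

text \<open>The only argument is 0, which is split as the empty sum.\<close>

lemma split_apply_high:
  assumes "bim p F" "bim q G" "3 \<le> p + q" "w \<in> W n (p + q)"
  shows "split_apply n p q (coch p F) (coch q G) w = cl 0"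
proof -
  have "w = 0" using assms(4) unfolding W_zero[OF assms(3)] by simp
  thus ?thesis using split_apply_eq[OF assms(1,2), of "{} :: unit set"] by simp
qed

lemma koszul_d_eq:
  assumes F: "bim p F"
  shows "koszul_d n p (coch p F) = coch (Suc p) (kd p F)"
proof -
  have "split_apply n p 1 (coch p F) (euler n) w \<ominus>\<^bsub>A\<^esub> ((- 1) ^ p \<odot>\<^bsub>A\<^esub> split_apply n 1 p (euler n) (coch p F) w)
      = cl (kd p F w)" if w: "w \<in> W n (Suc p)" for w
  proof -
    consider "p = 0" | "p = Suc 0" | "2 \<le> p" by linarith
    thus ?thesis
    proof cases
      case 1
      have F0: "bim 0 F" using F 1 by simp
      have w1: "w \<in> W n (Suc 0)" using w 1 by simp
      have "F (pone n) \<in> PC n" by (rule bimD(1)[OF F0 pone_W])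
      thus ?thesis
        using split_apply_0_left[OF F0 bim_id w1] split_apply_0_right[OF bim_id F0 w1] W_PC[OF w]
        by (simp add: 1 euler_coch A_smult A_minus kd_simps)
    next
      case 2
      have F1: "bim (Suc 0) F" using F 2 by simp
      have w2: "w \<in> W n 2" using w 2 by (simp add: numeral_2_eq_2)
      have P: "F (arr a) \<star> tail_part a w \<in> PC n" "arr a \<star> F (tail_part a w) \<in> PC n" if "a \<in> arrows" for a
        using that bimD(1)[OF F1] tail_part_W[OF w2] W_PC[OF tail_part_W[OF w2]]
        by (auto intro!: PC_mult arr_W)
      have S: "(\<Sum>a\<in>arrows. arr a \<star> F (tail_part a w)) \<in> PC n" by (rule PC_sum, rule P)
      have S': "(\<Sum>a\<in>arrows. F (arr a) \<star> tail_part a w) \<in> PC n" by (rule PC_sum, rule P)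
      have m: "scl (- 1) (\<Sum>a\<in>arrows. arr a \<star> F (tail_part a w)) \<in> PC n" using S by simp
      show ?thesis
        unfolding 2 euler_coch One_nat_def split_apply_11[OF F1 bim_id w2] split_apply_11[OF bim_id F1 w2]
          power_Suc power_0 mult_1_right A_smult[OF S] A_minus[OF S' m]
        by (simp add: kd_simps scl_minus_one sum.distrib)
    next
      case 3
      have "split_apply n p (Suc 0) (coch p F) (coch (Suc 0) (\<lambda>x. x)) w = cl 0"
        by (rule split_apply_high[OF F bim_id]) (use 3 w in auto)
      moreover have "split_apply n (Suc 0) p (coch (Suc 0) (\<lambda>x. x)) (coch p F) w = cl 0"
        by (rule split_apply_high[OF bim_id F]) (use 3 w in auto)
      ultimately show ?thesis using 3 by (simp add: euler_coch A_smult A_minus kd_simps)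
    qed
  qed
  thus ?thesis by (auto simp: koszul_d_def coch_def fun_eq_iff)
qed

text \<open>The canonical splitting of \<open>u \<star> x\<close> need not be \<open>u\<close> times
  that of \<open>x\<close>, so compatibility with \<open>k\<close> is not visible in the formula. It
  follows from the independence of \<open>split_apply\<close> from the splitting.\<close>

lemma bim_cup:
  fixes F G :: "(path \<Rightarrow> 'f::field) \<Rightarrow> path \<Rightarrow> 'f"
  assumes F: "bim (Suc 0) F" and G: "bim (Suc 0) G"
  shows "bim 2 (\<lambda>w. \<Sum>a\<in>arrows. F (arr a) \<star> G (tail_part a w))" (is "bim 2 ?H")
  unfolding bim_def
proof (intro conjI ballI)
  have FP: "F (arr a) \<in> PC n" if "a \<in> arrows" for a using bimD(1)[OF F arr_W] that by blast
  have H: "?H (\<Sum>a\<in>arrows. u a \<star> v a) \<approx> (\<Sum>a\<in>arrows. F (u a) \<star> G (v a))"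
    if "\<And>a. a \<in> arrows \<Longrightarrow> u a \<in> W n (Suc 0)" "\<And>a. a \<in> arrows \<Longrightarrow> v a \<in> W n (Suc 0)" "(\<Sum>a\<in>arrows. u a \<star> v a) \<in> W n 2" for u v
    unfolding cl_iff[symmetric]
    using trans[OF sym[OF split_apply_11[OF F G that(3)]] split_apply_eq[OF F G finite_arrows, of "n - 2" u v, OF that(1,2)]] .
  show "?H w \<in> PC n" if "w \<in> W n 2" for w
    by (rule PC_sum, rule PC_mult[OF n3 FP bimD(1)[OF G tail_part_W[OF that]]])
  {
    fix x y :: "path \<Rightarrow> 'f" assume xy: "x \<in> W n 2" "y \<in> W n 2"
    have "?H (x + y) \<approx> (\<Sum>a\<in>arrows. F (arr a) \<star> (G (tail_part a x) + G (tail_part a y)))"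
      unfolding tail_part_add by (intro eqv_sum eqv_left bimD(2)[OF G] tail_part_W xy FP)
    also have "\<dots> = ?H x + ?H y" by (simp add: pmul_add_right sum.distrib)
    finally show "?H (x + y) \<approx> ?H x + ?H y" .
  next
    fix u x :: "path \<Rightarrow> 'f" assume u: "u \<in> path_alg_deg n 0" and x: "x \<in> W n 2"
    note t = tail_part_W[OF x] and uP = deg_PC[OF u]
    have tP: "G (tail_part a x) \<in> PC n" for a by (rule bimD(1)[OF G t])
    have s: "u \<star> x = (\<Sum>a\<in>arrows. (u \<star> arr a) \<star> tail_part a x)"
      using arg_cong[OF tail_part_sum[OF x], of "\<lambda>z. u \<star> z"] by (simp add: pmul_sum_right pmul_assoc)
    have "?H (\<Sum>a\<in>arrows. (u \<star> arr a) \<star> tail_part a x) \<approx> (\<Sum>a\<in>arrows. F (u \<star> arr a) \<star> G (tail_part a x))"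
      by (rule H) (use W_closed(4)[OF u x] s in \<open>auto intro: W_closed(4)[OF u] arr_W t\<close>)
    also have "\<dots> \<approx> (\<Sum>a\<in>arrows. u \<star> F (arr a) \<star> G (tail_part a x))"
      by (intro eqv_sum eqv_right bimD(3)[OF F] u arr_W tP)
    also have "\<dots> = u \<star> ?H x" by (simp add: pmul_sum_right pmul_assoc)
    finally show "?H (u \<star> x) \<approx> u \<star> ?H x" unfolding s .
    have s': "x \<star> u = (\<Sum>a\<in>arrows. arr a \<star> (tail_part a x \<star> u))"
      using arg_cong[OF tail_part_sum[OF x], of "\<lambda>z. z \<star> u"] by (simp add: pmul_sum_left pmul_assoc)
    have "?H (\<Sum>a\<in>arrows. arr a \<star> (tail_part a x \<star> u)) \<approx> (\<Sum>a\<in>arrows. F (arr a) \<star> G (tail_part a x \<star> u))"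
      by (rule H) (use W_closed(5)[OF u x] s' in \<open>auto intro: W_closed(5)[OF u] arr_W t\<close>)
    also have "\<dots> \<approx> (\<Sum>a\<in>arrows. F (arr a) \<star> (G (tail_part a x) \<star> u))"
      by (intro eqv_sum eqv_left bimD(4)[OF G] u t FP)
    also have "\<dots> = ?H x \<star> u" by (simp add: pmul_sum_left pmul_assoc)
    finally show "?H (x \<star> u) \<approx> ?H x \<star> u" unfolding s' .
  }
qed

text \<open>The values at the unit of degree 0 cochains. Commuting with the vertices is what makes
  multiplication by \<open>U\<close> compatible with the bimodule structure.\<close>

definition k_central :: "(path \<Rightarrow> 'f::field) \<Rightarrow> bool" where
  "k_central U \<longleftrightarrow> U \<in> PC n \<and> (\<forall>u\<in>path_alg_deg n 0. u \<star> U \<approx> U \<star> u)"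

lemma k_centralI: assumes "U \<in> PC n" "\<And>v. v < n \<Longrightarrow> vtx v \<star> U \<approx> U \<star> vtx v" shows "k_central U"
  unfolding k_central_def
proof (intro conjI ballI)
  fix u :: "path \<Rightarrow> 'a" assume u: "u \<in> path_alg_deg n 0"
  have "(\<Sum>v<n. scl (u ([], v)) (vtx v)) \<star> U \<approx> U \<star> (\<Sum>v<n. scl (u ([], v)) (vtx v))"
    unfolding pmul_sum_left pmul_sum_right pmul_scl_left pmul_scl_right
    by (intro eqv_sum eqv_scl assms) simp
  thus "u \<star> U \<approx> U \<star> u" by (simp flip: deg0_eq[OF u])
qed (fact assms)

lemma k_centralD: "k_central U \<Longrightarrow> U \<in> PC n" "k_central U \<Longrightarrow> u \<in> path_alg_deg n 0 \<Longrightarrow> u \<star> U \<approx> U \<star> u"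
  by (auto simp: k_central_def)

lemma k_central_bim0: assumes "bim 0 F" shows "k_central (F (pone n))"
  unfolding k_central_def
proof (intro conjI ballI)
  show "F (pone n) \<in> PC n" by (rule bimD(1)[OF assms pone_W])
  fix u :: "path \<Rightarrow> 'a" assume u: "u \<in> path_alg_deg n 0"
  have "u \<star> F (pone n) \<approx> F (u \<star> pone n)" by (rule eqv_sym, rule bimD(3)[OF assms u pone_W])
  also have "u \<star> pone n = pone n \<star> u" using deg_PC[OF u] by simp
  also have "F (pone n \<star> u) \<approx> F (pone n) \<star> u" by (rule bimD(4)[OF assms u pone_W])
  finally show "u \<star> F (pone n) \<approx> F (pone n) \<star> u" .
qed

lemma bim0_eq: assumes "bim 0 F" "w \<in> W n 0" shows "F w \<approx> F (pone n) \<star> w"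
  using bimD(4)[OF assms(1) _ pone_W, of w] assms(2) W_PC[OF assms(2)] by (simp add: W_0)

lemma bim_mult_left:
  assumes U: "k_central U" and F: "bim p F" shows "bim p (\<lambda>w. U \<star> F w)"
  unfolding bim_def
proof (intro conjI ballI)
  note UP = k_centralD(1)[OF U]
  show "U \<star> F x \<in> PC n" if "x \<in> W n p" for x using UP bimD(1)[OF F that] by simp
  fix x y :: "path \<Rightarrow> 'a" assume xy: "x \<in> W n p" "y \<in> W n p"
  show "U \<star> F (x + y) \<approx> U \<star> F x + U \<star> F y"
    unfolding pmul_add_right[symmetric] by (intro eqv_left bimD(2)[OF F] xy UP)
next
  note UP = k_centralD(1)[OF U]
  fix u x :: "path \<Rightarrow> 'a" assume ux: "u \<in> path_alg_deg n 0" "x \<in> W n p"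
  have P: "F x \<in> PC n" "u \<in> PC n" using bimD(1)[OF F] ux deg_PC by blast+
  have "U \<star> F (u \<star> x) \<approx> U \<star> (u \<star> F x)" by (intro eqv_left bimD(3)[OF F] ux UP)
  also have "\<dots> = U \<star> u \<star> F x" by (simp add: pmul_assoc)
  also have "\<dots> \<approx> u \<star> U \<star> F x" by (rule eqv_right[OF eqv_sym[OF k_centralD(2)[OF U ux(1)]] P(1)])
  finally show "U \<star> F (u \<star> x) \<approx> u \<star> (U \<star> F x)" by (simp add: pmul_assoc)
  show "U \<star> F (x \<star> u) \<approx> U \<star> F x \<star> u"
    unfolding pmul_assoc by (intro eqv_left bimD(4)[OF F] ux UP)
qed

lemma bim_mult_right:
  assumes U: "k_central U" and F: "bim p F" shows "bim p (\<lambda>w. F w \<star> U)"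
  unfolding bim_def
proof (intro conjI ballI)
  note UP = k_centralD(1)[OF U]
  show "F x \<star> U \<in> PC n" if "x \<in> W n p" for x using UP bimD(1)[OF F that] by simp
  fix x y :: "path \<Rightarrow> 'a" assume xy: "x \<in> W n p" "y \<in> W n p"
  show "F (x + y) \<star> U \<approx> F x \<star> U + F y \<star> U"
    unfolding pmul_add_left[symmetric] by (intro eqv_right bimD(2)[OF F] xy UP)
next
  note UP = k_centralD(1)[OF U]
  fix u x :: "path \<Rightarrow> 'a" assume ux: "u \<in> path_alg_deg n 0" "x \<in> W n p"
  have P: "F x \<in> PC n" "u \<in> PC n" using bimD(1)[OF F] ux deg_PC by blast+
  have "F (x \<star> u) \<star> U \<approx> F x \<star> u \<star> U" by (intro eqv_right bimD(4)[OF F] ux UP)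
  also have "\<dots> = F x \<star> (u \<star> U)" by (simp add: pmul_assoc)
  also have "\<dots> \<approx> F x \<star> (U \<star> u)" by (rule eqv_left[OF k_centralD(2)[OF U ux(1)] P(1)])
  finally show "F (x \<star> u) \<star> U \<approx> F x \<star> U \<star> u" by (simp add: pmul_assoc)
  have "F (u \<star> x) \<star> U \<approx> u \<star> F x \<star> U" by (intro eqv_right bimD(3)[OF F] ux UP)
  thus "F (u \<star> x) \<star> U \<approx> u \<star> (F x \<star> U)" by (simp add: pmul_assoc)
qed

lemma bim_vid: "p \<le> 1 \<Longrightarrow> bim p (\<lambda>w. w)"
  by (simp add: bim_def W_PC eqv_refl)

lemma bim_zeu: "k_central U \<Longrightarrow> p \<le> 1 \<Longrightarrow> bim p (\<lambda>w. U \<star> w)"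
  by (rule bim_mult_left[OF _ bim_vid])

lemma bim_inner: "k_central U \<Longrightarrow> bim (Suc 0) (\<lambda>w. U \<star> w - w \<star> U)"
  by (intro bim_diff bim_mult_left bim_mult_right bim_id)

lemma bim_kd: assumes F: "bim p F" shows "bim (Suc p) (kd p F)"
proof -
  consider "p = 0" | "p = Suc 0" | "2 \<le> p" by linarith
  thus ?thesis
  proof cases
    case 1
    have F0: "bim 0 F" using F 1 by simp
    show ?thesis unfolding 1 kd_def by (simp add: bim_inner[OF k_central_bim0[OF F0]])
  next
    case 3
    thus ?thesis by (simp add: kd_def bim_const_zero)
  next
    case 2
    have F1: "bim (Suc 0) F" using F 2 by simp
    have "kd p F = (\<lambda>w. (\<Sum>a\<in>arrows. F (arr a) \<star> tail_part a w) + (\<Sum>a\<in>arrows. arr a \<star> F (tail_part a w)))"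
      unfolding 2 by (rule ext) (simp add: kd_simps sum.distrib)
    moreover have "bim 2 (\<lambda>w. (\<Sum>a\<in>arrows. F (arr a) \<star> tail_part a w) + (\<Sum>a\<in>arrows. arr a \<star> F (tail_part a w)))"
      by (intro bim_add bim_cup[OF F1 bim_id] bim_cup[OF bim_id F1])
    ultimately show ?thesis using 2 by (simp add: numeral_2_eq_2)
  qed
qed

section \<open>Koszul cohomology classes\<close>

definition bdry :: "nat \<Rightarrow> ((path \<Rightarrow> 'f::field) \<Rightarrow> path \<Rightarrow> 'f) \<Rightarrow> bool" where
  "bdry p F \<longleftrightarrow> bim p F \<and> coch p F \<in> coboundaries n p"

definition cocyc :: "nat \<Rightarrow> ((path \<Rightarrow> 'f::field) \<Rightarrow> path \<Rightarrow> 'f) \<Rightarrow> bool" where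
  "cocyc p F \<longleftrightarrow> bim p F \<and> (\<forall>w\<in>W n (Suc p). kd p F w \<approx> 0)"

definition Kc :: "nat \<Rightarrow> ((path \<Rightarrow> 'f::field) \<Rightarrow> path \<Rightarrow> 'f) \<Rightarrow> 'f cochain set" where
  "Kc p F = HK_class n p (coch p F)"

lemma bdry_0: "bdry 0 F \<longleftrightarrow> bim 0 F \<and> (\<forall>w\<in>W n 0. F w \<approx> 0)"
  by (auto simp: bdry_def coboundaries_def cochains_ops coch_eq_iff)

lemma bdry_Suc: "bdry (Suc p) F \<longleftrightarrow> bim (Suc p) F \<and> (\<exists>G. bim p G \<and> (\<forall>w\<in>W n (Suc p). F w \<approx> kd p G w))"
  by (auto simp: bdry_def coboundaries_def cochains_coch koszul_d_eq coch_eq_iff image_iff)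

lemma bdry_kd: "bim p G \<Longrightarrow> bdry (Suc p) (kd p G)"
  by (auto simp: bdry_Suc bim_kd intro: eqv_refl)

lemma bdry_bim: "bdry p F \<Longrightarrow> bim p F"
  by (simp add: bdry_def)

lemma bdry_cong:
  assumes "bdry p F" "bim p G" "\<And>w. w \<in> W n p \<Longrightarrow> G w \<approx> F w" shows "bdry p G"
proof -
  have "coch p G = coch p F" using assms(3) by (simp add: coch_eq_iff)
  thus ?thesis using assms by (simp add: bdry_def)
qed

lemma coboundaries_eq: "coboundaries n p = coch p ` {F. bdry p F}"
proof (cases p)
  case 0
  thus ?thesis by (auto simp: bdry_def coboundaries_def cochains_ops intro!: image_eqI[OF refl] bim_const_zero)
next
  case (Suc q)
  have "f \<in> coch p ` {F. bdry p F}" if "f \<in> coboundaries n p" for f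
    using that by (auto simp: coboundaries_def Suc cochains_coch koszul_d_eq bdry_kd)
  thus ?thesis by (auto simp: bdry_def)
qed

lemma bdry_zero: "bdry p (\<lambda>w. 0)"
proof (cases p)
  case (Suc q)
  have "bdry (Suc q) (kd q (\<lambda>w. 0) :: (path \<Rightarrow> 'a) \<Rightarrow> path \<Rightarrow> 'a)"
    by (intro bdry_kd bim_const_zero)
  moreover have "kd q (\<lambda>w. 0) = (\<lambda>w. 0 :: path \<Rightarrow> 'a)" by (rule ext) (simp add: kd_def)
  ultimately show ?thesis using Suc by simp
qed (simp add: bdry_0 bim_const_zero eqv_refl)

lemma bdry_add: assumes "bdry p F" "bdry p G" shows "bdry p (\<lambda>w. F w + G w)"
proof (cases p)
  case 0
  have "F w + G w \<approx> 0 + 0" if "w \<in> W n 0" for w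
    using assms that unfolding 0 bdry_0 by (intro eqv_add) auto
  thus ?thesis using assms by (simp add: 0 bdry_0 bim_add)
next
  case (Suc q)
  obtain F' where F': "bim q F'" "\<forall>w\<in>W n p. F w \<approx> kd q F' w"
    using assms(1) Suc by (auto simp: bdry_Suc)
  obtain G' where G': "bim q G'" "\<forall>w\<in>W n p. G w \<approx> kd q G' w"
    using assms(2) Suc by (auto simp: bdry_Suc)
  have "bdry p (kd q (\<lambda>w. F' w + G' w))" unfolding Suc by (intro bdry_kd bim_add F' G')
  moreover have "F w + G w \<approx> kd q (\<lambda>w. F' w + G' w) w" if "w \<in> W n p" for w
    unfolding kd_linear using F'(2) G'(2) that by (intro eqv_add) auto
  ultimately show ?thesis using bdry_cong bim_add[OF bdry_bim[OF assms(1)] bdry_bim[OF assms(2)]] by blast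
qed

lemma bdry_scl: assumes "bdry p F" shows "bdry p (\<lambda>w. scl c (F w))"
proof (cases p)
  case 0
  have "scl c (F w) \<approx> scl c 0" if "w \<in> W n 0" for w
    using assms that unfolding 0 bdry_0 by (intro eqv_scl) auto
  thus ?thesis using assms by (simp add: 0 bdry_0 bim_smult)
next
  case (Suc q)
  obtain F' where F': "bim q F'" "\<forall>w\<in>W n p. F w \<approx> kd q F' w"
    using assms(1) Suc by (auto simp: bdry_Suc)
  have "bdry p (kd q (\<lambda>w. scl c (F' w)))" unfolding Suc by (intro bdry_kd bim_smult F')
  moreover have "scl c (F w) \<approx> kd q (\<lambda>w. scl c (F' w)) w" if "w \<in> W n p" for w
    unfolding kd_linear using F'(2) that by (intro eqv_scl) auto
  ultimately show ?thesis using bdry_cong bim_smult[OF bdry_bim[OF assms]] by blast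
qed

lemma bdry_uminus: "bdry p F \<Longrightarrow> bdry p (\<lambda>w. - F w)"
  using bdry_scl[of p F "- 1"] by (simp add: scl_minus_one)

lemma bdry_high: assumes "3 \<le> p" "bim p F" shows "bdry p F"
proof (rule bdry_cong[OF bdry_zero assms(2)])
  fix w :: "path \<Rightarrow> 'a" assume "w \<in> W n p"
  hence "w = 0" unfolding W_zero[OF assms(1)] by simp
  thus "F w \<approx> 0" using bim_zero[OF assms(2)] by simp
qed

lemma Kc_eq: "Kc p F = (\<lambda>H. coch p (\<lambda>w. H w + F w)) ` {H. bdry p H}"
  by (simp add: Kc_def HK_class_def a_coset_eq coboundaries_eq image_image cochains_ops)

lemma KcI: "bdry p H \<Longrightarrow> coch p (\<lambda>w. H w + F w) \<in> Kc p F"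
  by (simp add: Kc_eq)

lemma Kc_self: "coch p F \<in> Kc p F"
  using KcI[OF bdry_zero, of p F] by simp

lemma KcE:
  assumes "f \<in> Kc p F" obtains H where "bdry p H" "f = coch p (\<lambda>w. H w + F w)"
  using assms by (auto simp: Kc_eq)

lemma Kc_iff:
  assumes "bim p F" "bim p G" shows "Kc p F = Kc p G \<longleftrightarrow> bdry p (\<lambda>w. F w - G w)"
proof
  assume "Kc p F = Kc p G"
  hence "coch p F \<in> Kc p G" using Kc_self by blast
  then obtain H where H: "bdry p H" "coch p F = coch p (\<lambda>w. H w + G w)" by (rule KcE)
  have "F w - G w \<approx> H w" if "w \<in> W n p" for w
    using H(2) that by (simp add: coch_eq_iff eqv_def algebra_simps)
  thus "bdry p (\<lambda>w. F w - G w)" using bdry_cong[OF H(1) bim_diff[OF assms]] by blast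
next
  have *: "Kc p F \<subseteq> Kc p G" if "bdry p (\<lambda>w. F w - G w)" for F G :: "(path \<Rightarrow> 'a) \<Rightarrow> path \<Rightarrow> 'a"
  proof
    fix f assume "f \<in> Kc p F"
    then obtain H where H: "bdry p H" "f = coch p (\<lambda>w. H w + F w)" by (rule KcE)
    have "f = coch p (\<lambda>w. (H w + (F w - G w)) + G w)" unfolding H(2) by simp
    thus "f \<in> Kc p G" using KcI[OF bdry_add[OF H(1) that], of G] by simp
  qed
  assume a: "bdry p (\<lambda>w. F w - G w)"
  hence "bdry p (\<lambda>w. G w - F w)" using bdry_uminus[OF a] by simp
  thus "Kc p F = Kc p G" using * a by blast
qed

lemma Kc_zero: "Kc p (\<lambda>w. 0) = coboundaries n p"
  by (auto simp: Kc_eq coboundaries_eq)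

lemma Kc_zero_iff: "bim p F \<Longrightarrow> Kc p F = coboundaries n p \<longleftrightarrow> bdry p F"
  unfolding Kc_zero[symmetric] using Kc_iff[OF _ bim_const_zero, of p F] by simp

lemma cocycles_eq: "cocycles n p = coch p ` {F. cocyc p F}"
  by (auto simp: cocycles_def cochains_coch koszul_d_eq cochains_ops coch_eq_iff cocyc_def)

lemma cocyc_bim: "cocyc p F \<Longrightarrow> bim p F"
  by (simp add: cocyc_def)

lemma HK_carrier: "carrier (HK n p) = Kc p ` {F. cocyc p F}"
  by (auto simp: HK_def quot_mod_simps cocycles_eq Kc_def HK_class_def a_coset_eq)

lemma HK_zero: "\<zero>\<^bsub>HK n p\<^esub> = coboundaries n p"
  by (simp add: HK_def quot_mod_simps)

lemma HK_add: "Kc p F \<oplus>\<^bsub>HK n p\<^esub> Kc p G = Kc p (\<lambda>w. F w + G w)"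
proof -
  have "Kc p F \<oplus>\<^bsub>HK n p\<^esub> Kc p G = (\<Union>x\<in>Kc p F. \<Union>y\<in>Kc p G. {x \<oplus>\<^bsub>cochains n p\<^esub> y})"
    by (simp add: HK_def quot_mod_simps set_add_eq)
  also have "\<dots> = Kc p (\<lambda>w. F w + G w)"
  proof safe
    fix x y assume "x \<in> Kc p F" "y \<in> Kc p G"
    then obtain H H' where H: "bdry p H" "x = coch p (\<lambda>w. H w + F w)" "bdry p H'" "y = coch p (\<lambda>w. H' w + G w)"
      by (auto simp: Kc_eq)
    have "x \<oplus>\<^bsub>cochains n p\<^esub> y = coch p (\<lambda>w. (H w + H' w) + (F w + G w))"
      unfolding H cochains_ops by (simp add: algebra_simps)
    thus "x \<oplus>\<^bsub>cochains n p\<^esub> y \<in> Kc p (\<lambda>w. F w + G w)" using KcI[OF bdry_add[OF H(1,3)], of "\<lambda>w. F w + G w"] by simp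
  next
    fix x assume "x \<in> Kc p (\<lambda>w. F w + G w)"
    then obtain H where H: "bdry p H" "x = coch p (\<lambda>w. H w + (F w + G w))" by (auto simp: Kc_eq)
    have "x = coch p (\<lambda>w. H w + F w) \<oplus>\<^bsub>cochains n p\<^esub> coch p (\<lambda>w. 0 + G w)"
      unfolding H cochains_ops by (simp add: algebra_simps)
    moreover note KcI[OF H(1), of F] KcI[OF bdry_zero, of p G]
    ultimately show "x \<in> (\<Union>x\<in>Kc p F. \<Union>y\<in>Kc p G. {x \<oplus>\<^bsub>cochains n p\<^esub> y})" by blast
  qed
  finally show ?thesis .
qed

lemma HK_smult: assumes F: "bim p F" shows "c \<odot>\<^bsub>HK n p\<^esub> Kc p F = Kc p (\<lambda>w. scl c (F w))"
proof -
  have "c \<odot>\<^bsub>HK n p\<^esub> Kc p F = (\<Union>x\<in>Kc p F. coboundaries n p +>\<^bsub>cochains n p\<^esub> (c \<odot>\<^bsub>cochains n p\<^esub> x))"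
    by (simp add: HK_def quot_mod_simps a_coset_eq)
  also have "\<dots> = (\<Union>x\<in>Kc p F. Kc p (\<lambda>w. scl c (F w)))"
  proof (intro SUP_cong refl)
    fix x assume "x \<in> Kc p F"
    then obtain H where H: "bdry p H" "x = coch p (\<lambda>w. H w + F w)" by (rule KcE)
    have B: "bim p (\<lambda>w. H w + F w)" by (intro bim_add bdry_bim H F)
    have "coboundaries n p +>\<^bsub>cochains n p\<^esub> (c \<odot>\<^bsub>cochains n p\<^esub> x) = Kc p (\<lambda>w. scl c (H w + F w))"
      unfolding H(2) cochains_ops(3)[OF bim_maps[OF B]] by (simp add: Kc_def HK_class_def)
    also have "\<dots> = Kc p (\<lambda>w. scl c (F w))"
      using bdry_scl[OF H(1), of c]
      by (simp add: Kc_iff[OF bim_smult[OF B] bim_smult[OF F]]) (simp add: scl_simps)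
    finally show "coboundaries n p +>\<^bsub>cochains n p\<^esub> (c \<odot>\<^bsub>cochains n p\<^esub> x) = Kc p (\<lambda>w. scl c (F w))" .
  qed
  also have "\<dots> = Kc p (\<lambda>w. scl c (F w))"
    using Kc_self by blast
  finally show ?thesis .
qed

end

section \<open>The higher differential\<close>

context type_D
begin

lemma coch_cong: "(\<And>w. w \<in> W n p \<Longrightarrow> F w \<approx> G w) \<Longrightarrow> coch p F = coch p G"
  by (simp add: coch_eq_iff)

lemma W_1_comm:
  assumes U: "Z \<in> PC n" and V: "V \<in> PC n" and arr: "\<And>a. a \<in> arrows \<Longrightarrow> arr a \<star> Z \<approx> V \<star> arr a" and w: "w \<in> W n (Suc 0)"
  shows "w \<star> Z \<approx> V \<star> w"
proof -
  have "(\<Sum>a\<in>arrows. scl (w ([a], arrow_src a)) (arr a)) \<star> Z \<approx> V \<star> (\<Sum>a\<in>arrows. scl (w ([a], arrow_src a)) (arr a))"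
    unfolding pmul_sum_left pmul_sum_right pmul_scl_left pmul_scl_right
    by (intro eqv_sum eqv_scl arr)
  moreover have "w = (\<Sum>a\<in>arrows. scl (w ([a], arrow_src a)) (arr a))"
    by (rule deg1_eq) (use w in \<open>simp add: W_1\<close>)
  ultimately show ?thesis by simp
qed

lemma cup_10:
  assumes E: "bim (Suc 0) E" and G: "bim 0 G"
  shows "cup n (Suc 0) 0 (coch (Suc 0) E) (coch 0 G) = coch (Suc 0) (\<lambda>w. E w \<star> G (pone n))"
proof -
  have "(- 1) ^ (Suc 0 * 0) \<odot>\<^bsub>A\<^esub> split_apply n (Suc 0) 0 (coch (Suc 0) E) (coch 0 G) w = cl (E w \<star> G (pone n))"
    if w: "w \<in> W n (Suc 0)" for w
  proof -
    have "E w \<star> G (pone n) \<in> PC n" using bimD(1)[OF E w] bimD(1)[OF G pone_W] by simp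
    thus ?thesis by (simp add: split_apply_0_right[OF E G w] A_smult)
  qed
  thus ?thesis by (auto simp: cup_def coch_def fun_eq_iff)
qed

lemma cup_11:
  assumes E: "bim (Suc 0) E" and G: "bim (Suc 0) G"
  shows "cup n (Suc 0) (Suc 0) (coch (Suc 0) E) (coch (Suc 0) G) =
    coch 2 (\<lambda>w. - (\<Sum>a\<in>arrows. E (arr a) \<star> G (tail_part a w)))"
proof -
  have "(- 1) ^ (Suc 0 * Suc 0) \<odot>\<^bsub>A\<^esub> split_apply n (Suc 0) (Suc 0) (coch (Suc 0) E) (coch (Suc 0) G) w =
      cl (- (\<Sum>a\<in>arrows. E (arr a) \<star> G (tail_part a w)))" if w: "w \<in> W n 2" for w
    unfolding split_apply_11[OF E G w] using A_smult[OF bimD(1)[OF bim_cup[OF E G] w], of "- 1"]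
    by (simp add: scl_minus_one)
  thus ?thesis by (auto simp: cup_def coch_def fun_eq_iff numeral_2_eq_2)
qed

lemma cup_high:
  assumes E: "bim (Suc 0) E" and G: "bim q G" and q: "2 \<le> q"
  shows "cup n (Suc 0) q (coch (Suc 0) E) (coch q G) = coch (Suc q) (\<lambda>w. 0)"
proof -
  have "split_apply n (Suc 0) q (coch (Suc 0) E) (coch q G) w = cl 0" if "w \<in> W n (Suc q)" for w
    by (rule split_apply_high[OF E G]) (use q that in auto)
  thus ?thesis by (auto simp: cup_def coch_def fun_eq_iff A_smult)
qed

text \<open>The product of classes is a union over representatives, so it suffices that all of them
  give the same class. The representatives of the Euler class are the identity plus commutators with
  elements that commute with \<open>k\<close>.\<close>

lemma higher_d_eqI:
  fixes F :: "(path \<Rightarrow> 'f::field) \<Rightarrow> path \<Rightarrow> 'f"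
  assumes R: "\<And>U H. k_central U \<Longrightarrow> bdry q H \<Longrightarrow>
     HK_class n (Suc q) (cup n (Suc 0) q (coch (Suc 0) (\<lambda>w. U \<star> w - w \<star> U + w)) (coch q (\<lambda>w. H w + F w))) = R"
  shows "higher_d n q (Kc q F) = R"
proof -
  have "HK_class n (Suc q) (cup n (Suc 0) q f g) = R" if f: "f \<in> Kc (Suc 0) (\<lambda>x. x)" and g: "g \<in> Kc q F" for f g
  proof -
    obtain H1 where H1: "bdry (Suc 0) H1" "f = coch (Suc 0) (\<lambda>w. H1 w + w)" using f by (rule KcE)
    obtain H where H: "bdry q H" "g = coch q (\<lambda>w. H w + F w)" using g by (rule KcE)
    obtain G where G: "bim 0 G" "\<forall>w\<in>W n (Suc 0). H1 w \<approx> kd 0 G w" using H1(1) by (auto simp: bdry_Suc)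
    have "f = coch (Suc 0) (\<lambda>w. G (pone n) \<star> w - w \<star> G (pone n) + w)"
      unfolding H1(2) using G(2) by (intro coch_cong eqv_add eqv_refl) (auto simp: kd_simps)
    thus ?thesis unfolding H(2) using R[OF k_central_bim0[OF G(1)] H(1)] by simp
  qed
  moreover have "higher_d n q (Kc q F) = (\<Union>f\<in>Kc (Suc 0) (\<lambda>x. x). \<Union>g\<in>Kc q F. HK_class n (Suc q) (cup n (Suc 0) q f g))"
    by (simp add: higher_d_def HK_cup_def euler_coch Kc_def)
  ultimately show ?thesis using Kc_self[of "Suc 0" "\<lambda>x. x"] Kc_self[of q F] by auto
qed

lemma k_central_mult: assumes "k_central U" "k_central V" shows "k_central (U \<star> V)"
proof -
  have "u \<star> (U \<star> V) \<approx> U \<star> V \<star> u" if u: "u \<in> path_alg_deg n 0" for u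
  proof -
    have "u \<star> U \<star> V \<approx> U \<star> u \<star> V" by (intro eqv_right k_centralD assms u)
    also have "\<dots> = U \<star> (u \<star> V)" by (simp add: pmul_assoc)
    also have "\<dots> \<approx> U \<star> (V \<star> u)" by (intro eqv_left k_centralD assms u)
    finally show ?thesis by (simp add: pmul_assoc)
  qed
  thus ?thesis using assms by (simp add: k_central_def)
qed

lemma kd_0_left: "k_central U \<Longrightarrow> kd 0 (\<lambda>w. U \<star> w) w = U \<star> w - w \<star> U"
  by (simp add: kd_simps k_centralD)

lemma bdry_inner: assumes "k_central U" shows "bdry (Suc 0) (\<lambda>w. U \<star> w - w \<star> U)"
  using bdry_kd[OF bim_zeu[OF assms, of 0]] kd_0_left[OF assms] by (simp add: fun_eq_iff[of "kd 0 _"] cong: if_cong)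
     (metis (no_types, lifting) ext)

text \<open>Centrality modulo the relations, tested on generators only; \<open>central_path\<close>
  extends it to all paths.\<close>

definition central :: "(path \<Rightarrow> 'f::field) \<Rightarrow> bool" where
  "central Z \<longleftrightarrow> k_central Z \<and> (\<forall>w\<in>W n (Suc 0). w \<star> Z \<approx> Z \<star> w)"

lemma centralD: "central Z \<Longrightarrow> k_central Z" "central Z \<Longrightarrow> Z \<in> PC n"
  "central Z \<Longrightarrow> w \<in> W n (Suc 0) \<Longrightarrow> w \<star> Z \<approx> Z \<star> w"
  by (auto simp: central_def k_central_def)

lemma cocyc_0: "cocyc 0 F \<longleftrightarrow> bim 0 F \<and> central (F (pone n))"
proof -
  have "F (pone n) \<star> w - w \<star> F (pone n) \<approx> 0 \<longleftrightarrow> w \<star> F (pone n) \<approx> F (pone n) \<star> w" for w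
  proof -
    have "F (pone n) \<star> w - w \<star> F (pone n) \<approx> 0 \<longleftrightarrow> F (pone n) \<star> w \<approx> w \<star> F (pone n)"
      by (simp add: eqv_def)
    thus ?thesis using eqv_sym by blast
  qed
  thus ?thesis using k_central_bim0 by (auto simp: cocyc_def central_def kd_simps)
qed

lemma cocyc_0_left: "central Z \<Longrightarrow> cocyc 0 (\<lambda>w. Z \<star> w)"
  by (simp add: cocyc_0 bim_zeu centralD)

text \<open>Replacing the Euler cocycle by \<open>U \<star> w - w \<star> U + w\<close> changes the
  product by the commutator with \<open>U \<star> Z\<close>, which is a coboundary.\<close>

lemma higher_d_0:
  assumes "cocyc 0 F"
  shows "higher_d n 0 (Kc 0 F) = Kc (Suc 0) (\<lambda>w. F (pone n) \<star> w)"
proof (rule higher_d_eqI)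
  define Z where "Z = F (pone n)"
  have F: "bim 0 F" and Z: "central Z" using assms by (auto simp: cocyc_0 Z_def)
  fix U :: "path \<Rightarrow> 'a" and H :: "(path \<Rightarrow> 'a) \<Rightarrow> path \<Rightarrow> 'a" assume U: "k_central U" and H: "bdry 0 H"
  let ?E = "\<lambda>w. U \<star> w - w \<star> U + w"
  let ?V = "\<lambda>w. ?E w \<star> (H (pone n) + F (pone n))"
  have E: "bim (Suc 0) ?E" by (intro bim_add bim_inner[OF U] bim_id)
  have HF: "bim 0 (\<lambda>w. H w + F w)" by (intro bim_add bdry_bim[OF H] F)
  have V: "bim (Suc 0) ?V" by (rule bim_mult_right[OF k_central_bim0[OF HF] E])
  have "HK_class n (Suc 0) (cup n (Suc 0) 0 (coch (Suc 0) ?E) (coch 0 (\<lambda>w. H w + F w))) = Kc (Suc 0) ?V"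
    unfolding cup_10[OF E HF] Kc_def ..
  also have "\<dots> = Kc (Suc 0) (\<lambda>w. Z \<star> w)"
  proof -
    have UZ: "k_central (U \<star> Z)" by (intro k_central_mult U centralD Z)
    have "?V w - Z \<star> w \<approx> (U \<star> Z) \<star> w - w \<star> (U \<star> Z)" if w: "w \<in> W n (Suc 0)" for w
    proof -
      have "H (pone n) + F (pone n) \<approx> 0 + Z"
        unfolding Z_def using H by (intro eqv_add eqv_refl) (simp add: bdry_0 pone_W)
      hence "?V w - Z \<star> w \<approx> ?E w \<star> Z - Z \<star> w"
        by (intro eqv_diff eqv_refl eqv_left bimD(1)[OF E w]) simp
      also have "\<dots> = U \<star> (w \<star> Z) - w \<star> U \<star> Z + (w \<star> Z - Z \<star> w)"
        by (simp add: pmul_add_left pmul_diff_left pmul_assoc)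
      also have "\<dots> \<approx> U \<star> (Z \<star> w) - w \<star> U \<star> Z + (Z \<star> w - Z \<star> w)"
        by (intro eqv_add eqv_diff eqv_refl eqv_left centralD(3)[OF Z w] k_centralD(1)[OF U])
      finally show ?thesis by (simp add: pmul_assoc)
    qed
    hence "bdry (Suc 0) (\<lambda>w. ?V w - Z \<star> w)"
      by (intro bdry_cong[OF bdry_inner[OF UZ]] bim_diff V bim_zeu centralD Z) simp_all
    moreover have "bim (Suc 0) (\<lambda>w. Z \<star> w)" by (intro bim_zeu centralD Z) simp
    ultimately show ?thesis using Kc_iff[OF V] by blast
  qed
  finally show "HK_class n (Suc 0) (cup n (Suc 0) 0 (coch (Suc 0) ?E) (coch 0 (\<lambda>w. H w + F w))) =
    Kc (Suc 0) (\<lambda>w. F (pone n) \<star> w)" unfolding Z_def .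
qed

lemma W_2_I: "w \<in> W n 2 \<Longrightarrow> w \<in> rel_ideal n"
  unfolding W_2 by (rule relations_I)

text \<open>The middle terms cancel and leave \<open>U \<star> w - w \<star> U\<close>, which lies
  in the ideal because \<open>w\<close> is a relation.\<close>

lemma inner_cocyc: assumes U: "k_central U" shows "cocyc (Suc 0) (\<lambda>w. U \<star> w - w \<star> U)"
proof -
  have "kd (Suc 0) (\<lambda>w. U \<star> w - w \<star> U) w \<approx> 0" if w: "w \<in> W n 2" for w
  proof -
    have "kd (Suc 0) (\<lambda>w. U \<star> w - w \<star> U) w = (\<Sum>a\<in>arrows. U \<star> (arr a \<star> tail_part a w) - (arr a \<star> tail_part a w) \<star> U)"
      unfolding kd_simps by (intro sum.cong refl) (simp add: pmul_diff_left pmul_diff_right pmul_assoc)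
    also have "\<dots> = U \<star> w - w \<star> U"
      using tail_part_sum[OF w] by (simp add: sum_subtractf flip: pmul_sum_left pmul_sum_right)
    also have "\<dots> \<approx> 0"
      unfolding eqv_zero by (intro I_diff I_left I_right W_2_I w k_centralD(1)[OF U])
    finally show ?thesis .
  qed
  thus ?thesis using bim_inner[OF U] by (simp add: cocyc_def numeral_2_eq_2)
qed

lemma cocyc_1_add: assumes "cocyc p F" "cocyc p G" shows "cocyc p (\<lambda>w. F w + G w)"
proof -
  have "kd p F w + kd p G w \<approx> 0 + 0" if "w \<in> W n (Suc p)" for w
    using assms that by (intro eqv_add) (auto simp: cocyc_def)
  thus ?thesis using assms by (simp add: cocyc_def kd_linear bim_add)
qed

lemma cocyc_cong:
  assumes "cocyc (Suc 0) F" "bim (Suc 0) G" "\<And>w. w \<in> W n (Suc 0) \<Longrightarrow> G w \<approx> F w"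
  shows "cocyc (Suc 0) G"
proof -
  have "kd (Suc 0) G w \<approx> 0" if w: "w \<in> W n 2" for w
  proof -
    have "kd (Suc 0) G w \<approx> kd (Suc 0) F w"
      unfolding kd_simps
      by (intro eqv_sum eqv_add eqv_left eqv_right assms(3) arr_W tail_part_W w W_PC[OF tail_part_W[OF w]] W_PC[OF arr_W])
    also have "kd (Suc 0) F w \<approx> 0" using assms(1) w by (simp add: cocyc_def numeral_2_eq_2)
    finally show ?thesis .
  qed
  thus ?thesis using assms(2) by (simp add: cocyc_def numeral_2_eq_2)
qed

lemma bdry_cocyc: assumes "bdry (Suc 0) H" shows "cocyc (Suc 0) H"
proof -
  obtain G where G: "bim 0 G" "\<forall>w\<in>W n (Suc 0). H w \<approx> kd 0 G w" using assms by (auto simp: bdry_Suc)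
  show ?thesis
    using cocyc_cong[OF inner_cocyc[OF k_central_bim0[OF G(1)]] bdry_bim[OF assms]] G(2) by (simp add: kd_simps)
qed

text \<open>Up to sign this is the differential of \<open>\<lambda>w. Y \<star> G w\<close>.\<close>

lemma inner_cup:
  assumes Y: "k_central Y" and G: "cocyc (Suc 0) G"
  shows "bdry 2 (\<lambda>w. \<Sum>a\<in>arrows. (Y \<star> arr a - arr a \<star> Y) \<star> G (tail_part a w))"
proof -
  have B: "bim (Suc 0) G" using G by (simp add: cocyc_def)
  have YP: "Y \<in> PC n" by (rule k_centralD(1)[OF Y])
  have "bdry 2 (\<lambda>w. - kd (Suc 0) (\<lambda>w. Y \<star> G w) w)"
    using bdry_uminus[OF bdry_kd[OF bim_mult_left[OF Y B]]] by (simp add: numeral_2_eq_2)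
  thus ?thesis
  proof (rule bdry_cong)
    show "bim 2 (\<lambda>w. \<Sum>a\<in>arrows. (Y \<star> arr a - arr a \<star> Y) \<star> G (tail_part a w))"
      by (rule bim_cup[OF bim_inner[OF Y] B])
    fix w :: "path \<Rightarrow> 'a" assume w: "w \<in> W n 2"
    have "kd (Suc 0) G w \<approx> 0" using G w by (simp add: cocyc_def numeral_2_eq_2)
    hence "Y \<star> kd (Suc 0) G w \<approx> Y \<star> 0" by (rule eqv_left[OF _ YP])
    hence "Y \<star> kd (Suc 0) G w - kd (Suc 0) (\<lambda>w. Y \<star> G w) w \<approx> Y \<star> 0 - kd (Suc 0) (\<lambda>w. Y \<star> G w) w"
      by (intro eqv_diff eqv_refl)
    moreover have "(\<Sum>a\<in>arrows. (Y \<star> arr a - arr a \<star> Y) \<star> G (tail_part a w)) =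
       Y \<star> kd (Suc 0) G w - kd (Suc 0) (\<lambda>w. Y \<star> G w) w"
      unfolding kd_simps pmul_sum_right sum_subtractf[symmetric]
      by (intro sum.cong refl) (simp add: pmul_diff_left pmul_add_right pmul_assoc)
    ultimately show "(\<Sum>a\<in>arrows. (Y \<star> arr a - arr a \<star> Y) \<star> G (tail_part a w)) \<approx> - kd (Suc 0) (\<lambda>w. Y \<star> G w) w"
      by simp
  qed
qed

text \<open>The inner part of a representative of the Euler class contributes a coboundary by
  \<open>inner_cup\<close>. The hypothesis \<open>E\<close> isolates the product with the identity
  cochain, which is treated by different arguments according to the characteristic.\<close>

lemma higher_d_1:
  fixes F :: "(path \<Rightarrow> 'a::field) \<Rightarrow> path \<Rightarrow> 'a"
  assumes F: "cocyc (Suc 0) F"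
    and E: "\<And>G :: (path \<Rightarrow> 'a) \<Rightarrow> path \<Rightarrow> 'a. cocyc (Suc 0) G \<Longrightarrow> bdry 2 (\<lambda>w. \<Sum>a\<in>arrows. arr a \<star> G (tail_part a w))"
  shows "higher_d n (Suc 0) (Kc (Suc 0) F) = coboundaries n 2"
proof (rule higher_d_eqI)
  fix U :: "path \<Rightarrow> 'a" and H :: "(path \<Rightarrow> 'a) \<Rightarrow> path \<Rightarrow> 'a" assume U: "k_central U" and H: "bdry (Suc 0) H"
  let ?E = "\<lambda>w. U \<star> w - w \<star> U + w" and ?G = "\<lambda>w. H w + F w"
  have bE: "bim (Suc 0) ?E" by (intro bim_add bim_inner[OF U] bim_id)
  have G: "cocyc (Suc 0) ?G" by (intro cocyc_1_add bdry_cocyc H F)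
  have bG: "bim (Suc 0) ?G" by (rule cocyc_bim[OF G])
  let ?V = "\<lambda>w. \<Sum>a\<in>arrows. ?E (arr a) \<star> ?G (tail_part a w)"
  have "?V w = (\<Sum>a\<in>arrows. (U \<star> arr a - arr a \<star> U) \<star> ?G (tail_part a w)) + (\<Sum>a\<in>arrows. arr a \<star> ?G (tail_part a w))" for w
    unfolding sum.distrib[symmetric] by (intro sum.cong refl) (simp add: pmul_add_left)
  hence "bdry 2 ?V" using bdry_add[OF inner_cup[OF U G] E[OF G]] by simp
  hence b: "bdry 2 (\<lambda>w. - ?V w)" by (rule bdry_uminus)
  have "HK_class n 2 (cup n (Suc 0) (Suc 0) (coch (Suc 0) ?E) (coch (Suc 0) ?G)) = Kc 2 (\<lambda>w. - ?V w)"
    unfolding cup_11[OF bE bG] Kc_def ..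
  also have "\<dots> = coboundaries n 2" using Kc_zero_iff[OF bdry_bim[OF b]] b by simp
  finally show "HK_class n (Suc (Suc 0)) (cup n (Suc 0) (Suc 0) (coch (Suc 0) ?E) (coch (Suc 0) ?G)) = coboundaries n 2"
    by (simp add: numeral_2_eq_2)
qed

lemma higher_d_high:
  assumes F: "bim q F" and q: "2 \<le> q"
  shows "higher_d n q (Kc q F) = coboundaries n (Suc q)"
proof (rule higher_d_eqI)
  fix U :: "path \<Rightarrow> 'a" and H :: "(path \<Rightarrow> 'a) \<Rightarrow> path \<Rightarrow> 'a" assume U: "k_central U" and H: "bdry q H"
  have "bim (Suc 0) (\<lambda>w. U \<star> w - w \<star> U + w)" "bim q (\<lambda>w. H w + F w)"
    by (intro bim_add bim_inner[OF U] bim_id bdry_bim[OF H] F)+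
  thus "HK_class n (Suc q) (cup n (Suc 0) q (coch (Suc 0) (\<lambda>w. U \<star> w - w \<star> U + w)) (coch q (\<lambda>w. H w + F w))) = coboundaries n (Suc q)"
    by (simp add: cup_high q flip: Kc_def Kc_zero)
qed

section \<open>Criteria for computing higher cohomology\<close>

lemma HK_zero_add: "X \<in> carrier (HK n p) \<Longrightarrow> coboundaries n p \<oplus>\<^bsub>HK n p\<^esub> X = X"
  by (auto simp: HK_carrier HK_add simp flip: Kc_zero)

lemma cocyc_zero: "cocyc p (\<lambda>w. 0)"
proof -
  have "kd p (\<lambda>w. 0) w = 0" for w :: "path \<Rightarrow> 'a" by (simp add: kd_def)
  thus ?thesis by (simp add: cocyc_def bim_const_zero eqv_refl)
qed

lemma cocyc_diff: assumes "cocyc p F" "cocyc p G" shows "cocyc p (\<lambda>w. F w - G w)"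
proof -
  have "cocyc p (\<lambda>w. scl (- 1) (G w))"
  proof -
    have "scl (- 1) (kd p G w) \<approx> scl (- 1) 0" if "w \<in> W n (Suc p)" for w
      using assms that by (intro eqv_scl) (auto simp: cocyc_def)
    thus ?thesis using assms by (simp add: cocyc_def kd_linear bim_smult)
  qed
  from cocyc_1_add[OF assms(1) this] show ?thesis by (simp add: scl_minus_one)
qed

text \<open>If zero is the only higher coboundary, every coset is a singleton and the passage to the
  quotient is a bijection on cocycles.\<close>

lemma HK_hi_eqI:
  assumes "higher_coboundaries n p = {coboundaries n p :: 'f::field cochain set}"
    and U: "U = (higher_cocycles n p :: 'f cochain set set)"
  shows "HK_hi_eq n p U"
proof -
  have *: "higher_coboundaries n p +>\<^bsub>HK n p\<^esub> X = {X}" if "X \<in> U" for X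
  proof -
    have "X \<in> carrier (HK n p)" using that U by (simp add: higher_cocycles_def)
    thus ?thesis by (simp add: a_coset_eq assms(1) HK_zero_add)
  qed
  have "carrier (HK_hi n p) = (\<lambda>X. higher_coboundaries n p +>\<^bsub>HK n p\<^esub> X) ` U"
    by (simp add: HK_hi_def quot_mod_simps a_coset_eq U)
  moreover have "inj_on (\<lambda>X. higher_coboundaries n p +>\<^bsub>HK n p\<^esub> X) U"
    by (rule inj_onI) (simp add: *)
  ultimately show ?thesis unfolding HK_hi_eq_def bij_betw_def using U by simp
qed

text \<open>Translating all of \<open>HK n p\<close> by a cocycle gives all of it back, so there is
  one coset; the second hypothesis provides a cocycle to form it.\<close>

lemma HK_hi_zeroI:
  assumes B: "higher_coboundaries n p = (carrier (HK n p) :: 'f::field cochain set set)"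
    and Z: "(coboundaries n p :: 'f cochain set) \<in> higher_cocycles n p"
  shows "carrier (HK_hi n p :: ('f, 'f cochain set set) module) = {\<zero>\<^bsub>HK_hi n p\<^esub>}"
proof -
  have e: "(\<lambda>h. h \<oplus>\<^bsub>HK n p\<^esub> X) ` carrier (HK n p) = carrier (HK n p)" if X: "X \<in> higher_cocycles n p" for X :: "'f cochain set"
  proof -
    obtain F where F: "cocyc p F" "X = Kc p F" using X by (auto simp: higher_cocycles_def HK_carrier)
    show ?thesis unfolding HK_carrier image_image F(2) HK_add
    proof safe
      fix G :: "(path \<Rightarrow> 'f) \<Rightarrow> path \<Rightarrow> 'f" assume G: "cocyc p G"
      thus "Kc p (\<lambda>w. G w + F w) \<in> Kc p ` {F. cocyc p F}" using cocyc_1_add F(1) by blast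
      show "Kc p G \<in> (\<lambda>x. Kc p (\<lambda>w. x w + F w)) ` {F. cocyc p F}"
        by (rule image_eqI[where x = "\<lambda>w. G w - F w"]) (simp_all add: cocyc_diff G F)
    qed
  qed
  have "(\<lambda>X. (\<lambda>h. h \<oplus>\<^bsub>HK n p\<^esub> X) ` carrier (HK n p)) ` higher_cocycles n p =
      (\<lambda>X. carrier (HK n p) :: 'f cochain set set) ` (higher_cocycles n p :: 'f cochain set set)"
    by (rule image_cong[OF refl]) (rule e)
  hence "carrier (HK_hi n p) = (\<lambda>X. carrier (HK n p) :: 'f cochain set set) ` (higher_cocycles n p :: 'f cochain set set)"
    by (simp add: HK_hi_def quot_mod_simps a_coset_eq B)
  thus ?thesis using Z by (auto simp: HK_hi_def quot_mod_simps B)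
qed

lemma cob_carrier: "coboundaries n p \<in> carrier (HK n p)"
  using cocyc_zero[of p] by (auto simp: HK_carrier simp flip: Kc_zero)

lemma higher_coboundaries_zeroI:
  fixes p :: nat
  assumes "p \<noteq> 0 \<Longrightarrow> \<forall>F :: (path \<Rightarrow> 'f::field) \<Rightarrow> path \<Rightarrow> 'f. cocyc (p - 1) F \<longrightarrow> higher_d n (p - 1) (Kc (p - 1) F) = coboundaries n p"
  shows "higher_coboundaries n p = {coboundaries n p :: 'f cochain set}"
proof (cases p)
  case 0
  thus ?thesis by (simp add: higher_coboundaries_def HK_zero)
next
  case (Suc q)
  have "higher_d n q X = coboundaries n p" if "X \<in> carrier (HK n q)" for X :: "'f cochain set"
    using that assms Suc by (auto simp: HK_carrier)
  moreover obtain X0 where "X0 \<in> (carrier (HK n q) :: 'f cochain set set)" using cob_carrier by blast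
  ultimately show ?thesis unfolding higher_coboundaries_def Suc nat.case by force
qed

lemma higher_cocycles_allI:
  assumes "\<And>F :: (path \<Rightarrow> 'f::field) \<Rightarrow> path \<Rightarrow> 'f. cocyc p F \<Longrightarrow> higher_d n p (Kc p F) = coboundaries n (Suc p)"
  shows "higher_cocycles n p = (carrier (HK n p) :: 'f cochain set set)"
  using assms by (auto simp: higher_cocycles_def HK_carrier HK_zero)

section \<open>Characteristic two\<close>

text \<open>Exactly one end of each arrow has odd height, so the commutator with the sum of these
  vertices is the arrow or its negative, depending on the direction. In characteristic two the sign
  disappears.\<close>

lemma euler_inner:
  assumes two: "(2 :: 'f::field) = 0"
  shows "\<exists>Y :: path \<Rightarrow> 'f. k_central Y \<and> (\<forall>a\<in>arrows. Y \<star> arr a - arr a \<star> Y = arr a)"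
proof (intro exI conjI ballI)
  define L where "L = {v. v < n \<and> odd (lev v)}"
  let ?Y = "\<Sum>v\<in>L. vtx v :: path \<Rightarrow> 'f"
  have fin: "finite L" by (simp add: L_def)
  have c: "(\<Sum>v\<in>L. if v = u then x else 0) = (if u \<in> L then x else 0)" for u and x :: "path \<Rightarrow> 'f"
    using fin by simp
  show "k_central ?Y"
  proof (rule k_centralI)
    show "?Y \<in> PC n" by (rule PC_sum) (simp add: L_def)
    fix u assume "u < n"
    have "vtx u \<star> ?Y = ?Y \<star> vtx u"
      unfolding pmul_sum_left pmul_sum_right by (intro sum.cong refl) (auto simp: path_elem_mult)
    thus "vtx u \<star> ?Y \<approx> ?Y \<star> vtx u" by (simp add: eqv_refl)
  qed
  fix a assume a: "a \<in> arrows"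
  have "?Y \<star> arr a = (\<Sum>v\<in>L. if v = arrow_tgt a then arr a else 0)"
    unfolding pmul_sum_left by (intro sum.cong refl) (simp add: path_elem_mult)
  hence l: "?Y \<star> arr a = (if arrow_tgt a \<in> L then arr a else 0)" unfolding c .
  have "arr a \<star> ?Y = (\<Sum>v\<in>L. if v = arrow_src a then arr a else 0)"
    unfolding pmul_sum_right by (intro sum.cong refl) (auto simp: path_elem_mult)
  hence r: "arr a \<star> ?Y = (if arrow_src a \<in> L then arr a else 0)" unfolding c .
  have n: "arrow_tgt a < n" "arrow_src a < n" using a by (simp_all add: arrow_tgt_less arrow_src_less)
  have "odd (lev (arrow_tgt a)) \<noteq> odd (lev (arrow_src a))"
    using lev_arrow[of a] by auto
  hence "arrow_tgt a \<in> L \<longleftrightarrow> arrow_src a \<notin> L" using n by (simp add: L_def)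
  moreover have "- arr a = (arr a :: path \<Rightarrow> 'f)"
  proof -
    have "(1 :: 'f) + 1 = 0" using two by simp
    hence "(- 1 :: 'f) = 1" by (metis add_eq_0_iff)
    hence "scl (- 1) (arr a :: path \<Rightarrow> 'f) = scl 1 (arr a)" by (simp only:)
    thus ?thesis unfolding scl_minus_one scl_basic(2) .
  qed
  ultimately show "?Y \<star> arr a - arr a \<star> ?Y = arr a" unfolding l r by auto
qed

text \<open>In degree 0 the image is the class of \<open>Z \<star> w\<close>, which is the
  commutator with \<open>Z \<star> Y\<close>. In degree 1 the identity cochain agrees on arrows with
  the commutator with \<open>Y\<close>, and \<open>inner_cup\<close> applies.\<close>

lemma higher_d_char_two:
  fixes F :: "(path \<Rightarrow> 'f::field) \<Rightarrow> path \<Rightarrow> 'f"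
  assumes two: "(2 :: 'f) = 0" and F: "cocyc p F"
  shows "higher_d n p (Kc p F) = coboundaries n (Suc p)"
proof -
  obtain Y :: "path \<Rightarrow> 'f" where Y: "k_central Y" "\<And>a. a \<in> arrows \<Longrightarrow> Y \<star> arr a - arr a \<star> Y = arr a"
    using euler_inner[OF two] by blast
  consider "p = 0" | "p = Suc 0" | "2 \<le> p" by linarith
  thus ?thesis
  proof cases
    case 1
    define Z where "Z = F (pone n)"
    have Z: "central Z" using F 1 by (simp add: cocyc_0 Z_def)
    have ZY: "k_central (Z \<star> Y)" by (intro k_central_mult Y centralD Z)
    have b: "bim (Suc 0) (\<lambda>w. Z \<star> w)" by (intro bim_zeu centralD Z) simp
    have "Z \<star> w \<approx> Z \<star> Y \<star> w - w \<star> (Z \<star> Y)" if w: "w \<in> W n (Suc 0)" for w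
    proof -
      have YP: "Y \<in> PC n" by (rule k_centralD(1)[OF Y(1)])
      have wP: "w \<in> PC n" by (rule W_PC[OF w])
      have "(\<Sum>a\<in>arrows. scl (w ([a], arrow_src a)) (arr a)) =
          Y \<star> (\<Sum>a\<in>arrows. scl (w ([a], arrow_src a)) (arr a)) - (\<Sum>a\<in>arrows. scl (w ([a], arrow_src a)) (arr a)) \<star> Y"
        unfolding pmul_sum_left pmul_sum_right pmul_scl_left pmul_scl_right sum_subtractf[symmetric] scl_simps(2)[symmetric]
        by (intro sum.cong refl) (simp add: Y(2))
      moreover have "w = (\<Sum>a\<in>arrows. scl (w ([a], arrow_src a)) (arr a))"
        by (rule deg1_eq) (use w in \<open>simp add: W_1\<close>)
      ultimately have "w = Y \<star> w - w \<star> Y" by simp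
      hence Zw: "Z \<star> w = Z \<star> Y \<star> w - Z \<star> w \<star> Y" by (metis pmul_assoc pmul_diff_right)
      have "Z \<star> Y \<star> w - w \<star> Z \<star> Y \<approx> Z \<star> Y \<star> w - Z \<star> w \<star> Y"
        by (intro eqv_diff eqv_refl eqv_right centralD(3)[OF Z w] YP)
      hence "Z \<star> Y \<star> w - w \<star> Z \<star> Y \<approx> Z \<star> w" by (subst Zw)
      from eqv_sym[OF this] show ?thesis by (simp add: pmul_assoc)
    qed
    hence "bdry (Suc 0) (\<lambda>w. Z \<star> w)" using bdry_cong[OF bdry_inner[OF ZY] b] by blast
    thus ?thesis using higher_d_0[of F] F 1 Kc_zero_iff[OF b] by (simp add: Z_def)
  next
    case 2
    show ?thesis unfolding 2
    proof (subst higher_d_1)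
      show "cocyc (Suc 0) F" using F 2 by simp
      fix G :: "(path \<Rightarrow> 'f) \<Rightarrow> path \<Rightarrow> 'f" assume G: "cocyc (Suc 0) G"
      have "(\<Sum>a\<in>arrows. (Y \<star> arr a - arr a \<star> Y) \<star> G (tail_part a w)) = (\<Sum>a\<in>arrows. arr a \<star> G (tail_part a w))" for w
        by (intro sum.cong refl) (simp add: Y(2))
      thus "bdry 2 (\<lambda>w. \<Sum>a\<in>arrows. arr a \<star> G (tail_part a w))"
        using inner_cup[OF Y(1) G] by simp
    qed (simp add: numeral_2_eq_2)
  next
    case 3
    thus ?thesis using higher_d_high cocyc_bim[OF F] by blast
  qed
qed

lemma char_two:
  assumes two: "(2 :: 'f::field) = 0"
  shows "HK_hi_eq n p (carrier (HK n p :: ('f, 'f cochain set) module))"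
proof (rule HK_hi_eqI)
  show "higher_coboundaries n p = {coboundaries n p :: 'f cochain set}"
    by (rule higher_coboundaries_zeroI) (use higher_d_char_two[OF two, of "p - 1"] in auto)
  show "carrier (HK n p) = (higher_cocycles n p :: 'f cochain set set)"
    by (rule higher_cocycles_allI[symmetric]) (rule higher_d_char_two[OF two])
qed

section \<open>First Koszul cohomology away from characteristic two\<close>

text \<open>\<open>kd\<close> is computed with the canonical splitting, whereas the relations are
  given as sums of products of two arrows. Independence of the splitting allows the latter to be
  used; a list of coefficients and arrow pairs describes such a sum.\<close>

lemma kd_leib:
  fixes F :: "(path \<Rightarrow> 'f::field) \<Rightarrow> path \<Rightarrow> 'f" and L :: "('f \<times> arrow \<times> arrow) list"
  assumes F: "bim (Suc 0) F" and L: "\<And>c a b. (c, a, b) \<in> set L \<Longrightarrow> a \<in> arrows \<and> b \<in> arrows"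
    and w: "w \<in> W n 2" "w = (\<Sum>s<length L. case L ! s of (c, a, b) \<Rightarrow> scl c (arr a \<star> arr b))"
  shows "kd (Suc 0) F w \<approx> (\<Sum>s<length L. case L ! s of (c, a, b) \<Rightarrow> scl c (leib (\<lambda>a. F (arr a)) a b))"
proof -
  define u v :: "nat \<Rightarrow> path \<Rightarrow> 'f" where "u s = (case L ! s of (c, a, b) \<Rightarrow> scl c (arr a))"
    and "v s = (case L ! s of (c, a, b) \<Rightarrow> arr b)" for s
  have La: "a \<in> arrows" "b \<in> arrows" if "s < length L" "L ! s = (c, a, b)" for s c a b
    using L nth_mem[OF that(1)] that(2) by metis+
  have uv: "u s \<in> W n (Suc 0)" "v s \<in> W n (Suc 0)" if "s \<in> {..<length L}" for s
    using La[of s] that by (auto simp: u_def v_def split: prod.splits intro!: W_closed(3) arr_W)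
  have w': "w = (\<Sum>s<length L. u s \<star> v s)"
    unfolding w(2) by (intro sum.cong refl) (auto simp: u_def v_def pmul_scl_left split: prod.splits)
  have FP: "F x \<in> PC n" if "x \<in> W n (Suc 0)" for x using bimD(1)[OF F that] .
  have e1: "(\<Sum>a\<in>arrows. F (arr a) \<star> tail_part a w) \<approx> (\<Sum>s<length L. F (u s) \<star> v s)"
    unfolding cl_iff[symmetric] split_apply_11[OF F bim_id w(1), symmetric]
    unfolding w' by (rule split_apply_eq[OF F bim_id _ uv]) auto
  have e2: "(\<Sum>a\<in>arrows. arr a \<star> F (tail_part a w)) \<approx> (\<Sum>s<length L. u s \<star> F (v s))"
    unfolding cl_iff[symmetric] split_apply_11[OF bim_id F w(1), symmetric]
    unfolding w' by (rule split_apply_eq[OF bim_id F _ uv]) auto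
  have "kd (Suc 0) F w \<approx> (\<Sum>s<length L. F (u s) \<star> v s) + (\<Sum>s<length L. u s \<star> F (v s))"
    unfolding kd_simps sum.distrib by (intro eqv_add e1 e2)
  also have "\<dots> \<approx> (\<Sum>s<length L. case L ! s of (c, a, b) \<Rightarrow> scl c (leib (\<lambda>a. F (arr a)) a b))"
    unfolding sum.distrib[symmetric]
  proof (rule eqv_sum)
    fix s assume s: "s \<in> {..<length L}"
    obtain c a b where Ls: "L ! s = (c, a, b)" by (cases "L ! s") auto
    have ab: "a \<in> arrows" "b \<in> arrows" using La s Ls by blast+
    have "F (u s) \<star> v s + u s \<star> F (v s) \<approx> scl c (F (arr a)) \<star> arr b + scl c (arr a) \<star> F (arr b)"
      unfolding u_def v_def Ls prod.case
      by (intro eqv_add eqv_refl eqv_right bim_scl[OF F] arr_W ab W_PC[OF arr_W[OF ab(2)]])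
    thus "F (u s) \<star> v s + u s \<star> F (v s) \<approx> (case L ! s of (c, a, b) \<Rightarrow> scl c (leib (\<lambda>a. F (arr a)) a b))"
      by (simp add: Ls leib_def scl_simps pmul_scl_left)
  qed
  finally show ?thesis .
qed

lemma cocyc_derivation_rels:
  fixes F :: "(path \<Rightarrow> 'f::field) \<Rightarrow> path \<Rightarrow> 'f"
  assumes F: "cocyc (Suc 0) F" shows "derivation_rels (\<lambda>a. F (arr a))"
proof -
  let ?l = "leib (\<lambda>a. F (arr a))"
  have main: "(\<Sum>s<length L. case L ! s of (c, a, b) \<Rightarrow> scl c (?l a b)) \<in> rel_ideal n"
    if "i < n" "\<And>c a b. (c, a, b) \<in> set L \<Longrightarrow> a \<in> arrows \<and> b \<in> arrows"
      "sigma n i = (\<Sum>s<length L. case L ! s of (c, a, b) \<Rightarrow> scl c (arr a \<star> arr b))"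
    for i and L :: "('f \<times> arrow \<times> arrow) list"
  proof -
    have w: "sigma n i \<in> (W n 2 :: (path \<Rightarrow> 'f) set)"
      unfolding W_2 relations_def using lin_span_incl[OF sigma_subset] that(1) by blast
    have "kd (Suc 0) F (sigma n i) \<approx> (\<Sum>s<length L. case L ! s of (c, a, b) \<Rightarrow> scl c (?l a b))"
      by (rule kd_leib[OF cocyc_bim[OF F] that(2) w that(3)])
    moreover have "kd (Suc 0) F (sigma n i) \<approx> 0" using F w by (simp add: cocyc_def numeral_2_eq_2)
    ultimately show ?thesis using eqv_zero eqv_I' by blast
  qed
  have e: "Suc (n - 2) = n - Suc 0" "n - 2 \<noteq> 0" "\<not> n - Suc 0 \<le> n - 2" "\<not> n - Suc 0 \<le> Suc 0" "n - Suc 0 \<noteq> 2"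
    using n4 by auto
  show ?thesis unfolding derivation_rels_def
  proof (intro conjI allI impI)
    fix i :: nat assume i: "i \<le> 1"
    have "- ?l (Star i) (Arr i) \<in> rel_ideal n"
      using main[of i "[(- 1, Star i, Arr i)]"] i n4 by (auto simp: sigma_eq path_elem_mult scl_minus_one)
    thus "?l (Star i) (Arr i) \<in> rel_ideal n" using I_minus by fastforce
  next
    have "sigma n 2 = arr (Arr 0) \<star> arr (Star 0) + arr (Arr 1) \<star> arr (Star 1) - (arr (Star 2) \<star> arr (Arr 2) :: path \<Rightarrow> 'f)"
      using n4 by (simp add: sigma_eq path_elem_mult) (simp add: numeral_2_eq_2)
    hence "(\<Sum>s<length [(1, Arr 0, Star 0), (1, Arr 1, Star 1), (- 1 :: 'f, Star 2, Arr 2)].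
        case [(1, Arr 0, Star 0), (1, Arr 1, Star 1), (- 1, Star 2, Arr 2)] ! s of (c, a, b) \<Rightarrow> scl c (?l a b)) \<in> rel_ideal n"
      by (intro main[of 2]) (use n4 in \<open>auto simp: scl_minus_one\<close>)
    thus "?l (Arr 0) (Star 0) + ?l (Arr 1) (Star 1) - ?l (Star 2) (Arr 2) \<in> rel_ideal n"
      by (simp add: scl_minus_one)
  next
    fix i assume i: "3 \<le> i" "i \<le> n - 2"
    have "sigma n i = arr (Arr (i - 1)) \<star> arr (Star (i - 1)) - (arr (Star i) \<star> arr (Arr i) :: path \<Rightarrow> 'f)"
      using n4 i by (simp add: sigma_eq path_elem_mult)
    hence "(\<Sum>s<length [(1, Arr (i - 1), Star (i - 1)), (- 1 :: 'f, Star i, Arr i)].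
        case [(1, Arr (i - 1), Star (i - 1)), (- 1, Star i, Arr i)] ! s of (c, a, b) \<Rightarrow> scl c (?l a b)) \<in> rel_ideal n"
      by (intro main[of i]) (use n4 i in \<open>auto simp: scl_minus_one\<close>)
    thus "?l (Arr (i - 1)) (Star (i - 1)) - ?l (Star i) (Arr i) \<in> rel_ideal n"
      by (simp add: scl_minus_one)
  next
    have "sigma n (n - 1) = arr (Arr (n - 2)) \<star> (arr (Star (n - 2)) :: path \<Rightarrow> 'f)"
      using e n4 by (simp add: sigma_eq path_elem_mult)
    thus "?l (Arr (n - 2)) (Star (n - 2)) \<in> rel_ideal n"
      using main[of "n - 1" "[(1, Arr (n - 2), Star (n - 2))]"] n4 by auto
  qed
qed


text \<open>The decomposition of derivations controls only the cells between the ends of each arrow.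
  The bimodule property confines \<open>G (arr a)\<close> to that corner, so nothing is
  lost.\<close>

lemma bim_corner:
  assumes G: "bim (Suc 0) G" and a: "a \<in> arrows"
  shows "G (arr a) \<approx> vtx (arrow_tgt a) \<star> G (arr a) \<star> vtx (arrow_src a)"
proof -
  have v: "vtx (arrow_tgt a) \<in> path_alg_deg n 0" "vtx (arrow_src a) \<in> path_alg_deg n 0"
    using a by (auto intro!: vtx_deg simp: arrow_tgt_less arrow_src_less)
  have e: "arr a = vtx (arrow_tgt a) \<star> (arr a \<star> vtx (arrow_src a))"
    by (simp add: path_elem_mult)
  have aW: "arr a \<star> vtx (arrow_src a) \<in> W n (Suc 0)" by (intro W_closed v arr_W a)
  have "G (vtx (arrow_tgt a) \<star> (arr a \<star> vtx (arrow_src a))) \<approx> vtx (arrow_tgt a) \<star> G (arr a \<star> vtx (arrow_src a))"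
    by (rule bimD(3)[OF G v(1) aW])
  also have "\<dots> \<approx> vtx (arrow_tgt a) \<star> (G (arr a) \<star> vtx (arrow_src a))"
    by (intro eqv_left bimD(4)[OF G v(2) arr_W] a deg_PC[OF v(1)])
  finally show ?thesis unfolding e[symmetric] pmul_assoc .
qed

lemma corner_zero:
  assumes D: "D \<in> PC n" "D \<approx> vtx s \<star> D \<star> vtx t" "s < n" "t < n" and q: "\<And>l. quo n s t l (coord n D s t l)"
  shows "D \<approx> 0"
proof -
  have "coord n (vtx s \<star> D \<star> vtx t) i j l = (if i = s \<and> j = t then coord n D i j l else 0)" for i j l
    using D by (simp add: coord_vtx_left coord_vtx_right)
  hence "vtx s \<star> D \<star> vtx t \<approx> 0" using D q by (subst eqv_iff) auto
  thus ?thesis by (rule eqv_trans[OF D(2)])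
qed

lemma bim_arr_zero:
  assumes G: "bim (Suc 0) G" and z: "\<And>a. a \<in> arrows \<Longrightarrow> G (arr a) \<approx> 0" and w: "w \<in> W n (Suc 0)"
  shows "G w \<approx> 0"
proof -
  have e: "w = (\<Sum>a\<in>arrows. scl (w ([a], arrow_src a)) (arr a))"
    by (rule deg1_eq) (use w in \<open>simp add: W_1\<close>)
  have "G (\<Sum>a\<in>arrows. scl (w ([a], arrow_src a)) (arr a)) \<approx> (\<Sum>a\<in>arrows. G (scl (w ([a], arrow_src a)) (arr a)))"
    by (intro bim_sum[OF G] W_closed arr_W)
  also have "\<dots> \<approx> (\<Sum>a\<in>arrows. scl (w ([a], arrow_src a)) (G (arr a)))"
    by (intro eqv_sum bim_scl[OF G] arr_W)
  also have "\<dots> \<approx> (\<Sum>a\<in>arrows. scl (w ([a], arrow_src a)) 0)" by (intro eqv_sum eqv_scl z)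
  finally show ?thesis unfolding e[symmetric] by simp
qed

lemma cocyc_1_decomposition:
  fixes F :: "(path \<Rightarrow> 'f::field) \<Rightarrow> path \<Rightarrow> 'f"
  assumes two: "(2 :: 'f) \<noteq> 0" and F: "cocyc (Suc 0) F"
  shows "\<exists>U Z. k_central U \<and> central Z \<and> (\<forall>w\<in>W n (Suc 0). F w \<approx> Z \<star> w + (U \<star> w - w \<star> U))"
proof -
  have FP: "F (arr a) \<in> PC n" if "a \<in> arrows" for a
    using bimD(1)[OF cocyc_bim[OF F] arr_W] that by blast
  obtain U Z :: "path \<Rightarrow> 'f" where UZ: "U \<in> PC n" "Z \<in> PC n"
    "\<And>v. v < n \<Longrightarrow> vtx v \<star> U \<approx> U \<star> vtx v" "\<And>v. v < n \<Longrightarrow> vtx v \<star> Z \<approx> Z \<star> vtx v"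
    "\<And>a. a \<in> arrows \<Longrightarrow> arr a \<star> Z \<approx> Z \<star> arr a"
    "\<And>a l. a \<in> arrows \<Longrightarrow> quo n (arrow_tgt a) (arrow_src a) l
         (coord n (F (arr a) - Z \<star> arr a - (U \<star> arr a - arr a \<star> U)) (arrow_tgt a) (arrow_src a) l)"
    using derivation_decomposition[OF two, of "\<lambda>a. F (arr a)"] FP cocyc_derivation_rels[OF F] by auto
  have U: "k_central U" by (rule k_centralI[OF UZ(1,3)])
  have Z': "k_central Z" by (rule k_centralI[OF UZ(2,4)])
  have Z: "central Z" unfolding central_def using Z' W_1_comm[OF UZ(2,2,5)] by blast
  let ?G = "\<lambda>w. F w - Z \<star> w - (U \<star> w - w \<star> U)"
  have G: "bim (Suc 0) ?G"
    by (intro bim_diff bim_inner[OF U] cocyc_bim[OF F] bim_mult_left[OF Z'] bim_mult_left[OF U] bim_mult_right[OF U] bim_id)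
  have "?G (arr a) \<approx> 0" if a: "a \<in> arrows" for a
    by (rule corner_zero[OF bimD(1)[OF G arr_W[OF a]] bim_corner[OF G a]])
       (use a UZ(6)[OF a] in \<open>simp_all add: arrow_tgt_less arrow_src_less\<close>)
  hence g: "?G w \<approx> 0" if "w \<in> W n (Suc 0)" for w using bim_arr_zero[OF G _ that] by blast
  have "F w \<approx> Z \<star> w + (U \<star> w - w \<star> U)" if "w \<in> W n (Suc 0)" for w
    using g[OF that] by (simp add: eqv_def algebra_simps)
  thus ?thesis using U Z by blast
qed

text \<open>The central part of \<open>G\<close> contributes \<open>Z \<star> w\<close>, which
  vanishes on relations, and so does the term \<open>w \<star> U\<close> of the inner part. The
  remaining sum is half of a Leibniz rule, namely that of the differential of
  \<open>U \<star> w\<close>.\<close>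

lemma euler_cup:
  fixes G :: "(path \<Rightarrow> 'f::field) \<Rightarrow> path \<Rightarrow> 'f"
  assumes two: "(2 :: 'f) \<noteq> 0" and G: "cocyc (Suc 0) G"
  shows "bdry 2 (\<lambda>w. \<Sum>a\<in>arrows. arr a \<star> G (tail_part a w))"
proof -
  obtain U Z where U: "k_central U" and Z: "central Z"
    and e: "\<And>w. w \<in> W n (Suc 0) \<Longrightarrow> G w \<approx> Z \<star> w + (U \<star> w - w \<star> U)"
    using cocyc_1_decomposition[OF two G] by blast
  have "bdry 2 (kd (Suc 0) (\<lambda>w. U \<star> w))"
    using bdry_kd[OF bim_zeu[OF U, of "Suc 0"]] by (simp add: numeral_2_eq_2)
  thus ?thesis
  proof (rule bdry_cong)
    show "bim 2 (\<lambda>w. \<Sum>a\<in>arrows. arr a \<star> G (tail_part a w))"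
      by (rule bim_cup[OF bim_id cocyc_bim[OF G]])
    fix w :: "path \<Rightarrow> 'f" assume w: "w \<in> W n 2"
    note t = tail_part_W[OF w] and s = tail_part_sum[OF w]
    have UP: "U \<in> PC n" and ZP: "Z \<in> PC n" using U Z by (auto dest: k_centralD centralD)
    have "(\<Sum>a\<in>arrows. arr a \<star> G (tail_part a w)) \<approx>
        (\<Sum>a\<in>arrows. arr a \<star> (Z \<star> tail_part a w + (U \<star> tail_part a w - tail_part a w \<star> U)))"
      by (intro eqv_sum eqv_left e t PC_arr) auto
    also have "\<dots> = (\<Sum>a\<in>arrows. arr a \<star> Z \<star> tail_part a w) + (\<Sum>a\<in>arrows. arr a \<star> (U \<star> tail_part a w))
        - (\<Sum>a\<in>arrows. arr a \<star> tail_part a w) \<star> U"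
      by (simp add: pmul_add_right pmul_diff_right sum.distrib sum_subtractf pmul_sum_left pmul_assoc)
    also have "\<dots> \<approx> (\<Sum>a\<in>arrows. Z \<star> arr a \<star> tail_part a w) + (\<Sum>a\<in>arrows. arr a \<star> (U \<star> tail_part a w))
        - (\<Sum>a\<in>arrows. arr a \<star> tail_part a w) \<star> U"
      by (intro eqv_diff eqv_add eqv_refl eqv_sum eqv_right centralD(3)[OF Z] arr_W W_PC[OF t])
    also have "\<dots> = Z \<star> w + (\<Sum>a\<in>arrows. arr a \<star> (U \<star> tail_part a w)) - w \<star> U"
      using s by (simp add: pmul_assoc flip: pmul_sum_right)
    \<comment> \<open>Both \<open>Z \<star> w\<close> and \<open>U \<star> w\<close> are zero in
      \<open>A\<close>; the exchange supplies the missing half of the differential.\<close>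
    also have "\<dots> \<approx> U \<star> w + (\<Sum>a\<in>arrows. arr a \<star> (U \<star> tail_part a w)) - 0"
    proof -
      have "Z \<star> w - U \<star> w \<in> rel_ideal n" "w \<star> U - 0 \<in> rel_ideal n"
        using I_left[OF W_2_I[OF w] ZP] I_left[OF W_2_I[OF w] UP] I_right[OF W_2_I[OF w] UP] I_diff by auto
      thus ?thesis by (intro eqv_diff eqv_add eqv_refl) (simp_all add: eqv_def)
    qed
    also have "\<dots> = kd (Suc 0) (\<lambda>w. U \<star> w) w"
      using s by (simp add: kd_simps sum.distrib pmul_assoc flip: pmul_sum_right)
    finally show "(\<Sum>a\<in>arrows. arr a \<star> G (tail_part a w)) \<approx> kd (Suc 0) (\<lambda>w. U \<star> w) w" .
  qed
qed

lemma higher_d_1_zero: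
  fixes F :: "(path \<Rightarrow> 'f::field) \<Rightarrow> path \<Rightarrow> 'f"
  assumes "(2 :: 'f) \<noteq> 0" "cocyc (Suc 0) F"
  shows "higher_d n (Suc 0) (Kc (Suc 0) F) = coboundaries n 2"
  by (rule higher_d_1[OF assms(2) euler_cup[OF assms(1)]])

text \<open>Each half of the Leibniz sum gives \<open>Z \<star> w\<close>, a multiple of a
  relation.\<close>

lemma central_cocyc: assumes Z: "central Z" shows "cocyc (Suc 0) (\<lambda>w. Z \<star> w)"
proof -
  have "kd (Suc 0) (\<lambda>w. Z \<star> w) w \<approx> 0" if w: "w \<in> W n 2" for w
  proof -
    note t = tail_part_W[OF w] and s = tail_part_sum[OF w]
    have "kd (Suc 0) (\<lambda>w. Z \<star> w) w = (\<Sum>a\<in>arrows. Z \<star> arr a \<star> tail_part a w + arr a \<star> Z \<star> tail_part a w)"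
      by (simp add: kd_simps pmul_assoc)
    also have "\<dots> \<approx> (\<Sum>a\<in>arrows. Z \<star> arr a \<star> tail_part a w + Z \<star> arr a \<star> tail_part a w)"
      by (intro eqv_add eqv_refl eqv_sum eqv_right centralD(3)[OF Z] arr_W W_PC[OF t])
    also have "\<dots> = Z \<star> w + Z \<star> w"
    proof -
      have "(\<Sum>a\<in>arrows. Z \<star> arr a \<star> tail_part a w) = Z \<star> w"
        using s by (simp add: pmul_assoc flip: pmul_sum_right)
      thus ?thesis unfolding sum.distrib by (simp only:)
    qed
    also have "\<dots> \<approx> 0" unfolding eqv_zero
      by (intro I_add I_left W_2_I w centralD(2)[OF Z])
    finally show ?thesis .
  qed
  thus ?thesis using bim_zeu[OF centralD(1)[OF Z]] by (simp add: cocyc_def numeral_2_eq_2)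
qed

lemma higher_coboundaries_1:
  assumes two: "(2 :: 'f::field) \<noteq> 0"
  shows "higher_coboundaries n (Suc 0) = (carrier (HK n (Suc 0)) :: 'f cochain set set)"
proof (intro equalityI subsetI)
  fix X :: "'f cochain set" assume "X \<in> higher_coboundaries n (Suc 0)"
  then obtain F :: "(path \<Rightarrow> 'f) \<Rightarrow> path \<Rightarrow> 'f" where F: "cocyc 0 F" "X = higher_d n 0 (Kc 0 F)"
    by (auto simp: higher_coboundaries_def HK_carrier)
  have "central (F (pone n))" using F(1) by (simp add: cocyc_0)
  thus "X \<in> carrier (HK n (Suc 0))" unfolding F(2) higher_d_0[OF F(1)] HK_carrier
    using central_cocyc by blast
next
  fix X :: "'f cochain set" assume "X \<in> carrier (HK n (Suc 0))"
  then obtain F :: "(path \<Rightarrow> 'f) \<Rightarrow> path \<Rightarrow> 'f" where F: "cocyc (Suc 0) F" "X = Kc (Suc 0) F"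
    by (auto simp: HK_carrier)
  obtain U Z where U: "k_central U" and Z: "central Z"
    and e: "\<And>w. w \<in> W n (Suc 0) \<Longrightarrow> F w \<approx> Z \<star> w + (U \<star> w - w \<star> U)"
    using cocyc_1_decomposition[OF two F(1)] by blast
  have bz: "bim (Suc 0) (\<lambda>w. Z \<star> w)" by (intro bim_zeu centralD Z) simp
  have "F w - Z \<star> w \<approx> U \<star> w - w \<star> U" if "w \<in> W n (Suc 0)" for w
    using e[OF that] by (simp add: eqv_def algebra_simps)
  hence "bdry (Suc 0) (\<lambda>w. F w - Z \<star> w)"
    using bdry_cong[OF bdry_inner[OF U] bim_diff[OF cocyc_bim[OF F(1)] bz]] by blast
  hence "X = Kc (Suc 0) (\<lambda>w. Z \<star> w)" using Kc_iff[OF cocyc_bim[OF F(1)] bz] F(2) by blast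
  also have "\<dots> = higher_d n 0 (Kc 0 (\<lambda>w. Z \<star> w))"
    using higher_d_0[OF cocyc_0_left[OF Z]] centralD(2)[OF Z] by simp
  finally show "X \<in> higher_coboundaries n (Suc 0)"
    using cocyc_0_left[OF Z] by (auto simp: higher_coboundaries_def HK_carrier)
qed

section \<open>Higher cohomology in positive degrees\<close>

lemma hi_1:
  assumes two: "(2 :: 'f::field) \<noteq> 0"
  shows "carrier (HK_hi n (Suc 0) :: ('f, 'f cochain set set) module) = {\<zero>\<^bsub>HK_hi n (Suc 0)\<^esub>}"
proof (rule HK_hi_zeroI[OF higher_coboundaries_1[OF two]])
  have "higher_cocycles n (Suc 0) = (carrier (HK n (Suc 0)) :: 'f cochain set set)"
    by (rule higher_cocycles_allI) (use higher_d_1_zero[OF two] in \<open>simp add: numeral_2_eq_2\<close>)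
  thus "(coboundaries n (Suc 0) :: 'f cochain set) \<in> higher_cocycles n (Suc 0)" by (simp add: cob_carrier)
qed

lemma hi_2:
  assumes two: "(2 :: 'f::field) \<noteq> 0"
  shows "HK_hi_eq n 2 (carrier (HK n 2 :: ('f, 'f cochain set) module))"
proof (rule HK_hi_eqI)
  show "higher_coboundaries n 2 = {coboundaries n 2 :: 'f cochain set}"
    by (rule higher_coboundaries_zeroI) (use higher_d_1_zero[OF two] in auto)
  show "carrier (HK n 2) = (higher_cocycles n 2 :: 'f cochain set set)"
    by (rule higher_cocycles_allI[symmetric]) (intro higher_d_high cocyc_bim, simp_all)
qed

lemma hi_3:
  assumes p: "3 \<le> p"
  shows "carrier (HK_hi n p :: ('f::field, 'f cochain set set) module) = {\<zero>\<^bsub>HK_hi n p\<^esub>}"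
proof (rule HK_hi_zeroI)
  have "Kc p F = coboundaries n p" if "cocyc p F" for F :: "(path \<Rightarrow> 'f) \<Rightarrow> path \<Rightarrow> 'f"
    using bdry_high[OF p cocyc_bim[OF that]] Kc_zero_iff[OF cocyc_bim[OF that]] by blast
  hence "carrier (HK n p) = {coboundaries n p :: 'f cochain set}"
    using cob_carrier[of p] by (auto simp: HK_carrier)
  moreover have "higher_coboundaries n p = {coboundaries n p :: 'f cochain set}"
  proof (rule higher_coboundaries_zeroI, intro allI impI)
    fix F :: "(path \<Rightarrow> 'f) \<Rightarrow> path \<Rightarrow> 'f" assume "cocyc (p - 1) F"
    thus "higher_d n (p - 1) (Kc (p - 1) F) = coboundaries n p"
      using higher_d_high[OF cocyc_bim, of "p - 1" F] p by simp
  qed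
  ultimately show "higher_coboundaries n p = (carrier (HK n p) :: 'f cochain set set)" by simp
  have "higher_cocycles n p = (carrier (HK n p) :: 'f cochain set set)"
    by (rule higher_cocycles_allI) (intro higher_d_high cocyc_bim, use p in simp_all)
  thus "(coboundaries n p :: 'f cochain set) \<in> higher_cocycles n p" by (simp add: cob_carrier)
qed

section \<open>The socle\<close>

definition deg_part :: "nat \<Rightarrow> (path \<Rightarrow> 'f::field) \<Rightarrow> path \<Rightarrow> 'f" where
  "deg_part d x = (\<lambda>(xs, v). if length xs = d then x (xs, v) else 0)"

lemma deg_part_deg: assumes "x \<in> PC n" shows "deg_part d x \<in> path_alg_deg n d"
proof (rule degI)
  have "{p. deg_part d x p \<noteq> 0} \<subseteq> {p. x p \<noteq> 0}" by (auto simp: deg_part_def split: if_splits)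
  thus "deg_part d x \<in> PC n"
    using assms by (auto simp: PC_iff deg_part_def split: if_splits intro: finite_subset)
qed (auto simp: deg_part_def split: if_splits)

lemma coord_deg_part: "coord n (deg_part d x) i j l = (if l = d then coord n x i j l else 0)"
  by (auto simp: coord_def deg_part_def paths_def fun_app intro!: sum.cong sum.neutral)

lemma coord_deg: assumes "x \<in> path_alg_deg n d" "l \<noteq> d" shows "coord n x i j l = 0"
  using assms deg_zero[OF assms(1)] by (auto simp: coord_def paths_def fun_app intro!: sum.neutral)

lemma eqv_zero_iff: "x \<in> PC n \<Longrightarrow> x \<approx> 0 \<longleftrightarrow> (\<forall>i j l. quo n i j l (coord n x i j l))"
  by (subst eqv_iff) auto

text \<open>Beyond this length one of the two full-range conditions of \<open>quo\<close> holds in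
  every cell: which one depends on the end with the greater height.\<close>

lemma deg_high: assumes x: "x \<in> path_alg_deg n d" and d: "2 * (n - 2) < d" shows "x \<approx> 0"
  unfolding eqv_zero_iff[OF deg_PC[OF x]]
proof (intro allI)
  fix i j l
  show "quo n i j l (coord n x i j l)"
  proof (cases "l = d")
    case True
    thus ?thesis using d n4 by (intro quo_full) auto
  qed (simp add: coord_deg[OF x])
qed

text \<open>Coordinates see the length, so being represented in a single degree means that the
  coordinates of all other lengths belong to the ideal; the homogeneous component is then a
  representative.\<close>

lemma top_iff:
  assumes "Z \<in> PC n"
  shows "(\<exists>Z'\<in>path_alg_deg n d. Z \<approx> Z') \<longleftrightarrow> (\<forall>i j l. l \<noteq> d \<longrightarrow> quo n i j l (coord n Z i j l))"
proof
  assume "\<exists>Z'\<in>path_alg_deg n d. Z \<approx> Z'"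
  then obtain Z' where Z': "Z' \<in> path_alg_deg n d" "Z \<approx> Z'" by blast
  show "\<forall>i j l. l \<noteq> d \<longrightarrow> quo n i j l (coord n Z i j l)"
  proof (intro allI impI)
    fix i j l assume "l \<noteq> d"
    thus "quo n i j l (coord n Z i j l)"
      using Z'(2) coord_deg[OF Z'(1)] by (simp add: eqv_iff[OF assms deg_PC[OF Z'(1)]]) (metis diff_zero)
  qed
next
  assume q: "\<forall>i j l. l \<noteq> d \<longrightarrow> quo n i j l (coord n Z i j l)"
  have "Z \<approx> deg_part d Z"
    using q by (subst eqv_iff[OF assms deg_PC[OF deg_part_deg[OF assms]]]) (auto simp: coord_deg_part)
  thus "\<exists>Z'\<in>path_alg_deg n d. Z \<approx> Z'" using deg_part_deg[OF assms] by blast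
qed

text \<open>One direction is \<open>inner_central\<close>. For the other, an element of degree
  \<open>2 * (n - 2)\<close> times an arrow exceeds the last nonzero degree of \<open>A\<close>, so
  the cochain itself vanishes.\<close>

lemma bdry_central_iff:
  fixes Z :: "path \<Rightarrow> 'f::field"
  assumes two: "(2 :: 'f) \<noteq> 0" and Z: "central Z"
  shows "bdry (Suc 0) (\<lambda>w. Z \<star> w) \<longleftrightarrow> (\<exists>Z'\<in>path_alg_deg n (2 * (n - 2)). Z \<approx> Z')"
proof
  note ZP = centralD(2)[OF Z]
  have bz: "bim (Suc 0) (\<lambda>w. Z \<star> w)" by (intro bim_zeu centralD Z) simp
  {
    assume "bdry (Suc 0) (\<lambda>w. Z \<star> w)"
    then obtain G where G: "bim 0 G" "\<forall>w\<in>W n (Suc 0). Z \<star> w \<approx> kd 0 G w" by (auto simp: bdry_Suc)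
    define U where "U = G (pone n)"
    have U: "k_central U" unfolding U_def by (rule k_central_bim0[OF G(1)])
    have "arr a \<star> Z \<approx> U \<star> arr a - arr a \<star> U" if a: "a \<in> arrows" for a
      using eqv_trans[OF centralD(3)[OF Z arr_W[OF a]] bspec[OF G(2) arr_W[OF a]]] by (simp add: kd_simps U_def)
    moreover have "vtx v \<star> Z \<approx> Z \<star> vtx v" if "v < n" for v
      by (intro k_centralD vtx_deg that centralD Z)
    moreover have "arr a \<star> Z \<approx> Z \<star> arr a" if "a \<in> arrows" for a by (rule centralD(3)[OF Z arr_W[OF that]])
    ultimately have "quo n i j l (coord n Z i j l)" if "l \<noteq> 2 * (n - 2)" for i j l
      using inner_central[OF two ZP k_centralD(1)[OF U]] that by auto
    thus "\<exists>Z'\<in>path_alg_deg n (2 * (n - 2)). Z \<approx> Z'" unfolding top_iff[OF ZP] by blast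
  next
    assume "\<exists>Z'\<in>path_alg_deg n (2 * (n - 2)). Z \<approx> Z'"
    then obtain Z' where Z': "Z' \<in> path_alg_deg n (2 * (n - 2))" "Z \<approx> Z'" by blast
    have "Z \<star> w \<approx> 0" if w: "w \<in> W n (Suc 0)" for w
    proof (rule eqv_trans)
      show "Z \<star> w \<approx> Z' \<star> w" by (rule eqv_right[OF Z'(2) W_PC[OF w]])
      show "Z' \<star> w \<approx> 0"
        by (rule deg_high[OF deg_mult[OF Z'(1)]]) (use w in \<open>auto simp: W_1\<close>)
    qed
    thus "bdry (Suc 0) (\<lambda>w. Z \<star> w)" using bdry_cong[OF bdry_zero bz] by blast
  }
qed

definition K0 :: "(path \<Rightarrow> 'f::field) \<Rightarrow> 'f cochain set" where
  "K0 Z = Kc 0 (\<lambda>w. Z \<star> w)"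

definition top_central :: "(path \<Rightarrow> 'f::field) set" where
  "top_central = {Z \<in> path_alg_deg n (2 * (n - 2)). central Z}"

lemma K0_eq_iff:
  assumes "k_central Z" "k_central Z'" shows "K0 Z = K0 Z' \<longleftrightarrow> Z \<approx> Z'"
proof -
  have "K0 Z = K0 Z' \<longleftrightarrow> bdry 0 (\<lambda>w. Z \<star> w - Z' \<star> w)"
    unfolding K0_def by (intro Kc_iff bim_zeu assms) simp_all
  also have "\<dots> \<longleftrightarrow> Z \<approx> Z'"
  proof
    assume "bdry 0 (\<lambda>w. Z \<star> w - Z' \<star> w)"
    hence "Z \<star> pone n - Z' \<star> pone n \<approx> 0" by (simp add: bdry_0 pone_W)
    thus "Z \<approx> Z'" using assms by (simp add: k_centralD eqv_def)
  next
    assume e: "Z \<approx> Z'"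
    have "Z \<star> w - Z' \<star> w \<approx> 0" if "w \<in> W n 0" for w
      using eqv_right[OF e W_PC[OF that]] by (simp add: eqv_def)
    thus "bdry 0 (\<lambda>w. Z \<star> w - Z' \<star> w)" using assms by (simp add: bdry_0 bim_diff bim_zeu)
  qed
  finally show ?thesis .
qed

lemma k_central_cong: assumes "k_central Z" "Z \<approx> Z'" "Z' \<in> PC n" shows "k_central Z'"
proof -
  have "u \<star> Z' \<approx> Z' \<star> u" if u: "u \<in> path_alg_deg n 0" for u
  proof -
    have "u \<star> Z' \<approx> u \<star> Z" by (rule eqv_left[OF eqv_sym[OF assms(2)] deg_PC[OF u]])
    also have "\<dots> \<approx> Z \<star> u" by (rule k_centralD(2)[OF assms(1) u])
    also have "\<dots> \<approx> Z' \<star> u" by (rule eqv_right[OF assms(2) deg_PC[OF u]])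
    finally show ?thesis .
  qed
  thus ?thesis using assms(3) by (simp add: k_central_def)
qed

lemma central_cong: assumes "central Z" "Z \<approx> Z'" "Z' \<in> PC n" shows "central Z'"
proof -
  have "w \<star> Z' \<approx> Z' \<star> w" if w: "w \<in> W n (Suc 0)" for w
  proof -
    have "w \<star> Z' \<approx> w \<star> Z" by (rule eqv_left[OF eqv_sym[OF assms(2)] W_PC[OF w]])
    also have "\<dots> \<approx> Z \<star> w" by (rule centralD(3)[OF assms(1) w])
    also have "\<dots> \<approx> Z' \<star> w" by (rule eqv_right[OF assms(2) W_PC[OF w]])
    finally show ?thesis .
  qed
  thus ?thesis using k_central_cong[OF centralD(1)[OF assms(1)] assms(2,3)] by (simp add: central_def)
qed

lemma Kc_0_cong:
  assumes F: "cocyc 0 F" and Z: "Z \<in> PC n" "F (pone n) \<approx> Z" shows "Kc 0 F = K0 Z" "central Z"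
proof -
  have b: "bim 0 F" and c: "central (F (pone n))" using F by (auto simp: cocyc_0)
  show Zc: "central Z" by (rule central_cong[OF c Z(2,1)])
  have "F w - Z \<star> w \<approx> 0" if w: "w \<in> W n 0" for w
    using eqv_trans[OF bim0_eq[OF b w] eqv_right[OF Z(2) W_PC[OF w]]] by (simp add: eqv_def)
  hence "bdry 0 (\<lambda>w. F w - Z \<star> w)" by (simp add: bdry_0 bim_diff b bim_zeu centralD Zc)
  thus "Kc 0 F = K0 Z" unfolding K0_def using Kc_iff[OF b] bim_zeu[OF centralD(1)[OF Zc]] by blast
qed

lemma higher_cocycles_0:
  assumes two: "(2 :: 'f::field) \<noteq> 0"
  shows "higher_cocycles n 0 = (K0 ` top_central :: 'f cochain set set)"
proof (intro equalityI subsetI)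
  fix X :: "'f cochain set" assume "X \<in> higher_cocycles n 0"
  then obtain F :: "(path \<Rightarrow> 'f) \<Rightarrow> path \<Rightarrow> 'f" where F: "cocyc 0 F" "X = Kc 0 F"
    "higher_d n 0 X = coboundaries n (Suc 0)"
    by (auto simp: higher_cocycles_def HK_carrier HK_zero)
  have c: "central (F (pone n))" using F(1) by (simp add: cocyc_0)
  have bz: "bim (Suc 0) (\<lambda>w. F (pone n) \<star> w)" by (intro bim_zeu centralD c) simp
  have "bdry (Suc 0) (\<lambda>w. F (pone n) \<star> w)"
    using F(3) unfolding F(2) higher_d_0[OF F(1)] Kc_zero_iff[OF bz] .
  then obtain Z where Z: "Z \<in> path_alg_deg n (2 * (n - 2))" "F (pone n) \<approx> Z"
    unfolding bdry_central_iff[OF two c] by blast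
  show "X \<in> K0 ` top_central"
    using Kc_0_cong[OF F(1) deg_PC[OF Z(1)] Z(2)] Z(1) F(2) by (auto simp: top_central_def)
next
  fix X :: "'f cochain set" assume "X \<in> K0 ` top_central"
  then obtain Z where Z: "Z \<in> path_alg_deg n (2 * (n - 2))" "central Z" "X = K0 Z"
    by (auto simp: top_central_def)
  have bz: "bim (Suc 0) (\<lambda>w. Z \<star> w)" by (intro bim_zeu centralD Z) simp
  have "bdry (Suc 0) (\<lambda>w. Z \<star> w)" unfolding bdry_central_iff[OF two Z(2)] using Z(1) eqv_refl by blast
  hence "higher_d n 0 X = coboundaries n (Suc 0)"
    unfolding Z(3) K0_def higher_d_0[OF cocyc_0_left[OF Z(2)]]
    using Kc_zero_iff[OF bz] centralD(2)[OF Z(2)] by simp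
  thus "X \<in> higher_cocycles n 0"
    using cocyc_0_left[OF Z(2)] by (auto simp: higher_cocycles_def HK_carrier HK_zero Z(3) K0_def)
qed

lemma HK_deg_top: "HK_deg n 0 (2 * (n - 2)) = (K0 ` top_central :: 'f::field cochain set set)"
proof (intro equalityI subsetI)
  fix X :: "'f cochain set" assume "X \<in> HK_deg n 0 (2 * (n - 2))"
  then obtain F :: "(path \<Rightarrow> 'f) \<Rightarrow> path \<Rightarrow> 'f" where F: "cocyc 0 F" "X = Kc 0 F"
    "coch 0 F ` W n 0 \<subseteq> preproj_deg n (2 * (n - 2))"
    by (auto simp: HK_deg_def cocycles_eq Kc_def)
  have "cl (F (pone n)) \<in> preproj_deg n (2 * (n - 2))"
    using F(3) pone_W coch_apply[OF pone_W, of F] by force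
  then obtain Z where Z: "Z \<in> path_alg_deg n (2 * (n - 2))" "F (pone n) \<approx> Z"
    by (auto simp: preproj_deg_def cl_iff)
  show "X \<in> K0 ` top_central"
    using Kc_0_cong[OF F(1) deg_PC[OF Z(1)] Z(2)] Z(1) F(2) by (auto simp: top_central_def)
next
  fix X :: "'f cochain set" assume "X \<in> K0 ` top_central"
  then obtain Z where Z: "Z \<in> path_alg_deg n (2 * (n - 2))" "central Z" "X = K0 Z"
    by (auto simp: top_central_def)
  have "coch 0 (\<lambda>w. Z \<star> w) w \<in> preproj_deg n (2 * (n - 2))" if w: "w \<in> W n 0" for w
    using deg_mult[OF Z(1), of w 0] w by (auto simp: coch_apply[OF w] preproj_deg_def W_0)
  hence "coch 0 (\<lambda>w. Z \<star> w) ` W n 0 \<subseteq> preproj_deg n (2 * (n - 2))" by blast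
  thus "X \<in> HK_deg n 0 (2 * (n - 2))"
    using cocyc_0_left[OF Z(2)] unfolding Z(3) K0_def Kc_def HK_deg_def cocycles_eq by blast
qed

lemma hi_0:
  assumes two: "(2 :: 'f::field) \<noteq> 0"
  shows "HK_hi_eq n 0 (HK_deg n 0 (2 * (n - 2)) :: 'f cochain set set)"
  by (rule HK_hi_eqI) (simp_all add: higher_coboundaries_def HK_zero HK_deg_top higher_cocycles_0[OF two])


section \<open>The socle elements as a basis of the top degree of the centre\<close>

abbreviation end_of :: "nat \<Rightarrow> nat" where
  "end_of i \<equiv> path_tgt (socle_word n i, i)"

definition soc :: "nat \<Rightarrow> path \<Rightarrow> 'f::field" where
  "soc i = (if i = 0 then - path_elem (socle_word n i, i) else path_elem (socle_word n i, i))"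

lemma soc_path:
  assumes "i < n"
  shows "is_path n (socle_word n i, i)" "length (socle_word n i) = 2 * (n - 2)"
    "end_of i = (if i \<le> 1 \<and> odd n then 1 - i else i)"
  using socle_word_props[OF assms] by blast+

lemma soc_deg: assumes "i < n" shows "soc i \<in> path_alg_deg n (2 * (n - 2))"
proof -
  have "path_elem (socle_word n i, i) \<in> path_alg_deg n (2 * (n - 2))"
    by (rule deg_path') (fact soc_path[OF assms])+
  thus ?thesis using deg_scl[of _ _ "- 1"] by (auto simp: soc_def scl_minus_one)
qed

lemma soc_PC: "i < n \<Longrightarrow> soc i \<in> PC n"
  by (rule deg_PC[OF soc_deg])

lemma socle_elem_cl: "i < n \<Longrightarrow> socle_elem n i = cl (soc i)"
  using soc_path(1)[of i] by (auto simp: socle_elem_def soc_def A_uminus PC_path_elem)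

lemma coord_soc:
  assumes "i < n"
  shows "\<exists>e b. (e = 1 \<or> e = - 1) \<and> (\<forall>s j l. coord n (soc i :: path \<Rightarrow> 'f::field) s j l =
    (if s = end_of i \<and> j = i \<and> l = 2 * (n - 2) then (\<lambda>c. e * unit_val b c) else 0))"
proof -
  obtain b where b: "val (socle_word n i, i) = (unit_val b :: bool \<Rightarrow> 'f)"
    using socle_word_props[OF assms] by blast
  have p: "(socle_word n i, i) \<in> paths n s j l \<longleftrightarrow> s = end_of i \<and> j = i \<and> l = 2 * (n - 2)" for s j l
    using soc_path(1,2)[OF assms] by (auto simp: paths_def)
  define e :: 'f where "e = (if i = 0 then - 1 else 1)"
  have s: "soc i = scl e (path_elem (socle_word n i, i))" by (simp add: soc_def e_def scl_minus_one)
  have "coord n (soc i :: path \<Rightarrow> 'f) s j l =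
    (if s = end_of i \<and> j = i \<and> l = 2 * (n - 2) then (\<lambda>c. e * unit_val b c) else 0)" for s j l
    unfolding s coord_scl coord_path_elem p b by (simp add: fun_app)
  thus ?thesis by (intro exI[of _ e] exI[of _ b]) (simp add: e_def)
qed

text \<open>Distinct socle elements have distinct sources and so occupy different cells. In its cell
  \<open>soc i\<close> is a unit vector up to sign, and \<open>quo\<close> contains no nonzero
  multiple of it.\<close>

lemma soc_independent:
  fixes c :: "nat \<Rightarrow> 'f::field"
  assumes I: "finite I" "I \<subseteq> {..<n}" and z: "(\<Sum>i\<in>I. scl (c i) (soc i)) \<approx> 0" and i: "i \<in> I"
  shows "c i = 0"
proof -
  have iI: "k < n" if "k \<in> I" for k using I that by auto
  obtain e b where eb: "e = 1 \<or> e = - 1" and co: "\<And>s j l. coord n (soc i :: path \<Rightarrow> 'f) s j l =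
    (if s = end_of i \<and> j = i \<and> l = 2 * (n - 2) then (\<lambda>c. e * unit_val b c) else 0)"
    using coord_soc[OF iI[OF i], where 'f = 'f] by blast
  have P: "(\<Sum>i\<in>I. scl (c i) (soc i)) \<in> PC n" by (intro PC_sum PC_scl soc_PC iI)
  have "coord n (\<Sum>i\<in>I. scl (c i) (soc i)) (end_of i) i (2 * (n - 2)) =
     (\<Sum>k\<in>I. if k = i then (\<lambda>x. c i * (e * unit_val b x)) else 0)"
    unfolding coord_sum
  proof (intro sum.cong refl)
    fix k assume k: "k \<in> I"
    obtain e' b' where co': "\<And>s j l. coord n (soc k :: path \<Rightarrow> 'f) s j l =
      (if s = end_of k \<and> j = k \<and> l = 2 * (n - 2) then (\<lambda>c. e' * unit_val b' c) else 0)"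
      using coord_soc[OF iI[OF k], where 'f = 'f] by blast
    show "coord n (scl (c k) (soc k)) (end_of i) i (2 * (n - 2)) = (if k = i then (\<lambda>x. c i * (e * unit_val b x)) else 0)"
      by (cases "k = i") (simp add: coord_scl co, simp add: coord_scl co')
  qed
  also have "\<dots> = (\<lambda>x. c i * (e * unit_val b x))" using I(1) i by simp
  finally have co2: "coord n (\<Sum>i\<in>I. scl (c i) (soc i)) (end_of i) i (2 * (n - 2)) = (\<lambda>x. c i * (e * unit_val b x))" .
  have "quo n (end_of i) i (2 * (n - 2)) (\<lambda>x. c i * (e * unit_val b x))"
    using z unfolding eqv_zero_iff[OF P] co2[symmetric] by blast
  moreover have "lev (end_of i) = lev i" unfolding soc_path(3)[OF iI[OF i]] by (auto simp: lev_def)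
  ultimately show ?thesis using eb n4 by (cases b) (auto simp: quo_def)
qed

text \<open>In the top degree every cell of loops is at most one-dimensional in \<open>A\<close>: on
  the arm the diagonal is divided out, and at 0 and 1 there is one admissible colour if
  \<open>n\<close> is even and none if \<open>n\<close> is odd. Cells that are not loops vanish by
  commutation with the vertices.\<close>

lemma top_central_spanned:
  fixes Z :: "path \<Rightarrow> 'f::field"
  assumes Z: "Z \<in> path_alg_deg n (2 * (n - 2))" and c: "k_central Z"
  shows "\<exists>c :: nat \<Rightarrow> 'f. Z \<approx> (\<Sum>i\<in>{i. i < n \<and> end_of i = i}. scl (c i) (soc i))"
proof -
  let ?d = "2 * (n - 2)" and ?I = "{i. i < n \<and> end_of i = i}"
  note ZP = deg_PC[OF Z]
  have ex: "\<forall>i\<in>?I. \<exists>a. quo n i i ?d (coord n Z i i ?d - (\<lambda>x. a * coord n (soc i) i i ?d x))"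
  proof
    fix i assume i: "i \<in> ?I"
    hence iI: "i < n" "end_of i = i" by auto
    obtain e b where eb: "e = 1 \<or> e = - 1" and co: "\<And>s j l. coord n (soc i :: path \<Rightarrow> 'f) s j l =
      (if s = end_of i \<and> j = i \<and> l = ?d then (\<lambda>c. e * unit_val b c) else 0)"
      using coord_soc[OF iI(1), where 'f = 'f] by blast
    have co1: "coord n (soc i :: path \<Rightarrow> 'f) i i ?d = (\<lambda>c. e * unit_val b c)" using co iI by simp
    have ee: "e * (e * x) = x" for x using eb by auto
    define v where "v = coord n Z i i ?d"
    show "\<exists>a. quo n i i ?d (coord n Z i i ?d - (\<lambda>x. a * coord n (soc i) i i ?d x))"
    proof (cases "2 \<le> i")
      case True
      have l: "2 * n < ?d + lev i + lev i + 2" using True n4 by (auto simp: lev_def)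
      \<comment> \<open>Modulo the diagonal a vector is determined by the difference of its
        coordinates; the sign \<open>e\<close> is its own inverse.\<close>
      show ?thesis unfolding co1 v_def[symmetric] quo_def
        by (rule exI[of _ "e * (v b - v (\<not> b))"]) (use l in \<open>cases b; simp add: fun_app algebra_simps ee\<close>)
    next
      case False
      have sv: "x = 0 \<or> sub i i ?d x \<Longrightarrow> c \<noteq> (i = 1) \<Longrightarrow> x c = 0" for x :: "bool \<Rightarrow> 'f" and c
        using False sub_tgt[of i i ?d x c] by (auto simp: compat_def fun_app)
      have b: "b = (i = 1)"
      proof (rule ccontr)
        assume "b \<noteq> (i = 1)"
        from sv[OF coord_sub[OF soc_PC[OF iI(1)]] this] show False using eb unfolding co1 by auto
      qed
      have "v (\<not> b) = 0" unfolding v_def using sv[OF coord_sub[OF ZP]] b by auto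
      thus ?thesis unfolding co1 v_def[symmetric] quo_def
        by (intro exI[of _ "e * v b"]) (cases b; simp add: fun_app algebra_simps ee)
    qed
  qed
  from bchoice[OF ex] obtain a where a: "\<forall>i\<in>?I. quo n i i ?d (coord n Z i i ?d - (\<lambda>x. a i * coord n (soc i) i i ?d x))" ..
  let ?S = "\<Sum>i\<in>?I. scl (a i) (soc i)"
  have SP: "?S \<in> PC n" by (intro PC_sum PC_scl soc_PC) auto
  have cS: "coord n ?S i j l = (if i = j \<and> i \<in> ?I \<and> l = ?d then (\<lambda>x. a i * coord n (soc i) i i ?d x) else 0)" for i j l
  proof -
    have "coord n ?S i j l = (\<Sum>k\<in>?I. if k = i then (if i = j \<and> l = ?d then (\<lambda>x. a i * coord n (soc i) i i ?d x) else 0) else 0)"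
      unfolding coord_sum
    proof (intro sum.cong refl)
      fix k assume k: "k \<in> ?I"
      hence k': "k < n" "end_of k = k" by auto
      obtain e' b' where co': "\<And>s j l. coord n (soc k :: path \<Rightarrow> 'f) s j l =
        (if s = end_of k \<and> j = k \<and> l = ?d then (\<lambda>c. e' * unit_val b' c) else 0)"
        using coord_soc[OF k'(1), where 'f = 'f] by blast
      show "coord n (scl (a k) (soc k)) i j l =
          (if k = i then (if i = j \<and> l = ?d then (\<lambda>x. a i * coord n (soc i) i i ?d x) else 0) else 0)"
      proof -
        have e: "coord n (soc k :: path \<Rightarrow> 'f) i j l = (if k = i \<and> i = j \<and> l = ?d then coord n (soc k) k k ?d else 0)"
          unfolding co' k'(2) by auto
        show ?thesis unfolding coord_scl e by (cases "k = i") simp_all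
      qed
    qed
    also have "\<dots> = (if i \<in> ?I then if i = j \<and> l = ?d then (\<lambda>x. a i * coord n (soc i) i i ?d x) else 0 else 0)"
      by (rule sum.delta) simp
    finally show ?thesis by (auto simp only: split: if_splits)
  qed
  have "Z \<approx> ?S" unfolding eqv_iff[OF ZP SP]
  proof (intro allI)
    fix i j l
    consider "l \<noteq> ?d" | "l = ?d" "i = j" "i \<in> ?I" | "l = ?d" "i = j" "i \<notin> ?I" "i < n"
      | "l = ?d" "i \<noteq> j" "i < n" | "l = ?d" "\<not> i < n" by blast
    thus "quo n i j l (coord n Z i j l - coord n ?S i j l)"
    proof cases
      case 1
      thus ?thesis by (simp add: cS coord_deg[OF Z])
    next
      case 2
      thus ?thesis using bspec[OF a 2(3)] by (simp add: cS)
    next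
      case 3
      hence i: "i \<le> 1" "odd n" using soc_path(3)[of i] by (auto split: if_splits)
      have "coord n Z i i ?d = 0"
      proof (rule ccontr)
        assume nz: "coord n Z i i ?d \<noteq> 0"
        hence s: "sub i i ?d (coord n Z i i ?d)" using coord_sub[OF ZP] by blast
        \<comment> \<open>A loop of this length has \<open>n - 2\<close> starred arrows. As this
          number is odd, source and target would need different colours, which is impossible at 0 or
          1.\<close>
        have "odd (nstars i i ?d)" using i n4 by (auto simp: nstars_def)
        hence "coord n Z i i ?d x = 0" for x
          using sub_tgt[OF s, of x] sub_src[OF s, of x] i by (cases x; cases "i = 1") (auto simp: compat_def)
        thus False using nz by (auto simp: fun_app)
      qed
      thus ?thesis using 3 by (simp add: cS)
    next
      case 4
      have "vtx i \<star> Z \<approx> Z \<star> vtx i" by (rule k_centralD(2)[OF c vtx_deg]) fact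
      hence "quo n i j l (coord n (vtx i \<star> Z) i j l - coord n (Z \<star> vtx i) i j l)"
        using ZP 4 by (simp add: eqv_iff)
      thus ?thesis using 4 ZP by (simp add: cS coord_vtx_left coord_vtx_right)
    next
      case 5
      hence "coord n Z i j l = 0" using coord_range(1)[OF ZP _ n3] by blast
      thus ?thesis using 5 by (simp add: cS)
    qed
  qed
  thus ?thesis by blast
qed

text \<open>Products with arrows lie beyond the top degree on both sides, so only commutation with
  the vertices is at stake, and this is the condition of being a loop.\<close>

lemma soc_central: assumes "i < n" "end_of i = i" shows "central (soc i :: path \<Rightarrow> 'f::field)"
  unfolding central_def
proof (intro conjI ballI)
  have v: "vtx v \<star> soc i = (soc i \<star> vtx v :: path \<Rightarrow> 'f)" for v
    using assms(2) by (auto simp: soc_def pmul_minus_left pmul_minus_right path_elem_mult)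
  show "k_central (soc i :: path \<Rightarrow> 'f)"
    by (rule k_centralI[OF soc_PC[OF assms(1)]]) (simp add: v eqv_refl)
  fix w :: "path \<Rightarrow> 'f" assume w: "w \<in> W n (Suc 0)"
  have w1: "w \<in> path_alg_deg n 1" using w by (simp add: W_1)
  have "w \<star> soc i \<approx> 0" by (rule deg_high[OF deg_mult[OF w1 soc_deg[OF assms(1)]]]) simp
  moreover have "soc i \<star> w \<approx> 0" by (rule deg_high[OF deg_mult[OF soc_deg[OF assms(1)] w1]]) simp
  ultimately show "w \<star> soc i \<approx> soc i \<star> w" using eqv_trans eqv_sym by blast
qed

lemma central_path:
  fixes Z :: "path \<Rightarrow> 'f::field"
  assumes Z: "central Z" shows "is_path n (xs, v) \<Longrightarrow> Z \<star> path_elem (xs, v) \<approx> path_elem (xs, v) \<star> Z"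
proof (induction xs)
  case Nil
  thus ?case using k_centralD(2)[OF centralD(1)[OF Z] vtx_deg] eqv_sym by auto
next
  case (Cons a xs)
  have a: "a \<in> arrows" "arrow_src a = path_tgt (xs, v)" "is_path n (xs, v)" using Cons.prems by auto
  have e: "path_elem (a # xs, v) = arr a \<star> path_elem (xs, v)" using a(2) by (simp add: path_elem_mult)
  have "Z \<star> arr a \<star> path_elem (xs, v) \<approx> arr a \<star> Z \<star> path_elem (xs, v)"
    by (intro eqv_right eqv_sym[OF centralD(3)[OF Z arr_W[OF a(1)]]] PC_path_elem a)
  also have "\<dots> = arr a \<star> (Z \<star> path_elem (xs, v))" by (simp add: pmul_assoc)
  also have "\<dots> \<approx> arr a \<star> (path_elem (xs, v) \<star> Z)"
    by (rule eqv_left[OF Cons.IH[OF a(3)] PC_arr]) (use a in simp)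
  finally show ?case unfolding e by (simp add: pmul_assoc)
qed

lemma cl_centre_iff:
  fixes z :: "path \<Rightarrow> 'f::field"
  assumes z: "z \<in> PC n" shows "cl z \<in> centre n \<longleftrightarrow> central z"
proof
  assume "cl z \<in> centre n"
  hence *: "z \<star> x \<approx> x \<star> z" if "x \<in> PC n" for x
    using that z by (simp add: centre_def A_carrier A_mult cl_iff)
  show "central z" unfolding central_def k_central_def
    using z *[OF deg_PC] *[OF W_PC] eqv_sym by blast
next
  assume c: "central z"
  have "z \<star> x \<approx> x \<star> z" if "x \<in> PC n" for x
    using that
  proof (induction rule: PC_induct)
    case (step a p x)
    obtain xs v where p: "p = (xs, v)" by (cases p)
    have "scl a (z \<star> path_elem p) + z \<star> x \<approx> scl a (path_elem p \<star> z) + x \<star> z"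
      using step p by (intro eqv_add eqv_scl central_path[OF c, of xs v, folded p]) auto
    thus ?case by (simp add: pmul_add_left pmul_add_right pmul_scl_left pmul_scl_right)
  qed (simp add: eqv_refl)
  thus "cl z \<in> centre n" using z by (auto simp: centre_def A_carrier A_mult cl_iff)
qed

lemma HK0_of_central_cl: "z \<in> PC n \<Longrightarrow> HK0_of_central n (cl z) = K0 z"
  by (auto simp: HK0_of_central_def K0_def Kc_def coch_def A_mult W_PC intro!: arg_cong[of _ _ "HK_class n 0"] ext)

lemma top_central_closed:
  "0 \<in> top_central" "Z \<in> top_central \<Longrightarrow> Z' \<in> top_central \<Longrightarrow> Z + Z' \<in> top_central"
  "Z \<in> top_central \<Longrightarrow> scl c Z \<in> top_central"
proof -
  show "0 \<in> top_central"
    by (simp add: top_central_def deg_0 central_def k_central_def eqv_refl)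
  show "Z + Z' \<in> top_central" if "Z \<in> top_central" "Z' \<in> top_central"
    using that unfolding top_central_def central_def k_central_def
    by (auto intro: deg_add eqv_add simp: pmul_add_left pmul_add_right)
  show "scl c Z \<in> top_central" if "Z \<in> top_central"
    using that unfolding top_central_def central_def k_central_def
    by (auto intro: deg_scl eqv_scl simp: pmul_scl_left pmul_scl_right)
qed

lemma top_central_k: "Z \<in> top_central \<Longrightarrow> k_central Z" "Z \<in> top_central \<Longrightarrow> Z \<in> PC n"
  by (auto simp: top_central_def dest: centralD)

abbreviation topHK :: "('f::field, 'f cochain set) module" where
  "topHK \<equiv> (HK n 0)\<lparr>carrier := HK_deg n 0 (2 * (n - 2))\<rparr>"

lemma topHK_ops:
  "carrier topHK = K0 ` top_central" "\<zero>\<^bsub>topHK\<^esub> = K0 0"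
  "K0 Z \<oplus>\<^bsub>topHK\<^esub> K0 Z' = K0 (Z + Z')"
  "k_central Z \<Longrightarrow> c \<odot>\<^bsub>topHK\<^esub> K0 Z = K0 (scl c Z)"
  using HK_smult[OF bim_zeu, of Z 0 c]
  by (auto simp: HK_deg_top K0_def HK_zero HK_add pmul_add_left pmul_scl_left simp flip: Kc_zero)

lemma topHK_abelian_group: "abelian_group (topHK :: ('f::field, 'f cochain set) module)"
proof (rule abelian_groupI)
  fix x :: "'f cochain set" assume "x \<in> carrier topHK"
  then obtain Z where Z: "Z \<in> top_central" "x = K0 Z" unfolding topHK_ops by blast
  have "K0 (scl (- 1) Z) \<in> carrier topHK" unfolding topHK_ops by (intro imageI top_central_closed Z)
  moreover have "K0 (scl (- 1) Z) \<oplus>\<^bsub>topHK\<^esub> x = \<zero>\<^bsub>topHK\<^esub>"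
    unfolding Z(2) topHK_ops by (simp add: scl_minus_one)
  ultimately show "\<exists>y\<in>carrier topHK. y \<oplus>\<^bsub>topHK\<^esub> x = \<zero>\<^bsub>topHK\<^esub>" by blast
next
  fix x y z :: "'f cochain set"
  assume "x \<in> carrier topHK" "y \<in> carrier topHK" "z \<in> carrier topHK"
  then obtain X Y Z where "x = K0 X" "y = K0 Y" "z = K0 Z" unfolding topHK_ops by blast
  thus "x \<oplus>\<^bsub>topHK\<^esub> y \<oplus>\<^bsub>topHK\<^esub> z = x \<oplus>\<^bsub>topHK\<^esub> (y \<oplus>\<^bsub>topHK\<^esub> z)"
    by (simp only: topHK_ops add.assoc)
next
  fix x y :: "'f cochain set" assume xy: "x \<in> carrier topHK" "y \<in> carrier topHK"
  then obtain X Y where XY: "X \<in> top_central" "Y \<in> top_central" "x = K0 X" "y = K0 Y" unfolding topHK_ops by blast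
  show "x \<oplus>\<^bsub>topHK\<^esub> y = y \<oplus>\<^bsub>topHK\<^esub> x" unfolding XY topHK_ops by (simp only: add.commute)
  show "x \<oplus>\<^bsub>topHK\<^esub> y \<in> carrier topHK" unfolding XY topHK_ops by (intro imageI top_central_closed XY)
next
  fix x :: "'f cochain set" assume "x \<in> carrier topHK"
  then obtain X where X: "x = K0 X" unfolding topHK_ops by blast
  show "\<zero>\<^bsub>topHK\<^esub> \<oplus>\<^bsub>topHK\<^esub> x = x" unfolding X topHK_ops by simp
next
  show "\<zero>\<^bsub>topHK\<^esub> \<in> carrier (topHK :: ('f, 'f cochain set) module)"
    unfolding topHK_ops by (intro imageI top_central_closed)
qed

lemma topHK_module: "Module.module class_ring (topHK :: ('f::field, 'f cochain set) module)"
proof (rule moduleI)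
  show "cring (class_ring :: 'f ring)" by (rule class_cring.is_cring)
  show "abelian_group (topHK :: ('f, 'f cochain set) module)" by (rule topHK_abelian_group)
next
  fix a b :: 'f and x :: "'f cochain set" assume "x \<in> carrier topHK"
  then obtain X where X: "X \<in> top_central" "x = K0 X" unfolding topHK_ops by blast
  note k = top_central_k(1)[OF X(1)] and ks = top_central_k(1)[OF top_central_closed(3)[OF X(1)]]
  show "a \<odot>\<^bsub>topHK\<^esub> x \<in> carrier topHK"
    unfolding X(2) topHK_ops(4)[OF k] unfolding topHK_ops by (intro imageI top_central_closed X)
  show "(a \<oplus>\<^bsub>class_ring\<^esub> b) \<odot>\<^bsub>topHK\<^esub> x = a \<odot>\<^bsub>topHK\<^esub> x \<oplus>\<^bsub>topHK\<^esub> b \<odot>\<^bsub>topHK\<^esub> x"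
    unfolding X(2) topHK_ops(3) topHK_ops(4)[OF k] by (simp add: scl_simps)
  show "(a \<otimes>\<^bsub>class_ring\<^esub> b) \<odot>\<^bsub>topHK\<^esub> x = a \<odot>\<^bsub>topHK\<^esub> (b \<odot>\<^bsub>topHK\<^esub> x)"
    unfolding X(2) topHK_ops(4)[OF k] topHK_ops(4)[OF ks] by (simp add: scl_simps)
  show "\<one>\<^bsub>class_ring\<^esub> \<odot>\<^bsub>topHK\<^esub> x = x"
    unfolding X(2) topHK_ops(4)[OF k] by simp
next
  fix a :: 'f and x y :: "'f cochain set" assume "x \<in> carrier topHK" "y \<in> carrier topHK"
  then obtain X Y where X: "X \<in> top_central" "x = K0 X" and Y: "Y \<in> top_central" "y = K0 Y" unfolding topHK_ops by blast
  note k = top_central_k(1)[OF X(1)] top_central_k(1)[OF Y(1)] top_central_k(1)[OF top_central_closed(2)[OF X(1) Y(1)]]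
  show "a \<odot>\<^bsub>topHK\<^esub> (x \<oplus>\<^bsub>topHK\<^esub> y) = a \<odot>\<^bsub>topHK\<^esub> x \<oplus>\<^bsub>topHK\<^esub> a \<odot>\<^bsub>topHK\<^esub> y"
    unfolding X(2) Y(2) topHK_ops(3) topHK_ops(4)[OF k(1)] topHK_ops(4)[OF k(2)] topHK_ops(4)[OF k(3)] scl_simps(1) ..
qed

lemma top_central_sum: "(\<And>i. i \<in> I \<Longrightarrow> f i \<in> top_central) \<Longrightarrow> (\<Sum>i\<in>I. f i) \<in> top_central"
  by (induction I rule: infinite_finite_induct) (simp_all add: top_central_closed)

lemma topHK_finsum:
  assumes "finite I" "\<And>i. i \<in> I \<Longrightarrow> f i \<in> top_central"
  shows "(\<Oplus>\<^bsub>topHK\<^esub>i\<in>I. K0 (f i)) = (K0 (\<Sum>i\<in>I. f i) :: 'f::field cochain set)"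
proof -
  interpret M: abelian_group "topHK :: ('f, 'f cochain set) module" by (rule topHK_abelian_group)
  show ?thesis using assms
  proof (induction I rule: finite_induct)
    case empty
    show ?case by (simp only: M.finsum_empty topHK_ops sum.empty)
  next
    case (insert i I)
    have "(\<Oplus>\<^bsub>topHK\<^esub>i\<in>insert i I. K0 (f i)) = K0 (f i) \<oplus>\<^bsub>topHK\<^esub> (\<Oplus>\<^bsub>topHK\<^esub>i\<in>I. K0 (f i))"
      using insert by (intro M.finsum_insert) (auto simp only: topHK_ops Pi_iff insert_iff intro!: imageI)
    thus ?case using insert by (simp only: topHK_ops sum.insert[OF insert(1,2)] insert_iff simp_thms)
  qed
qed

text \<open>The index set is given by centrality in \<open>A\<close>, while spanning is known for
  the socle elements that are loops; \<open>soc_central\<close> places the loops in the index set.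
  Independence needs only the cells of the individual elements.\<close>

lemma socle_basis:
  defines "I \<equiv> {i. i < n \<and> (socle_elem n i :: (path \<Rightarrow> 'f::field) set) \<in> centre n}"
  defines "h \<equiv> \<lambda>i. HK0_of_central n (socle_elem n i) :: 'f cochain set"
  shows "inj_on h I \<and> lin_basis topHK (h ` I)"
proof
  have I: "finite I" "I \<subseteq> {..<n}" by (auto simp: I_def)
  have iI: "i < n" if "i \<in> I" for i using I that by auto
  have h: "h i = K0 (soc i)" if "i \<in> I" for i
    using iI[OF that] by (simp add: h_def socle_elem_cl HK0_of_central_cl soc_PC)
  have top: "soc i \<in> (top_central :: (path \<Rightarrow> 'f) set)" if "i \<in> I" for i
    using that soc_deg[of i] by (auto simp: I_def top_central_def socle_elem_cl cl_centre_iff soc_PC)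
  show inj: "inj_on h I"
  proof (rule inj_onI, rule ccontr)
    fix i j assume ij: "i \<in> I" "j \<in> I" "h i = h j" "i \<noteq> j"
    have "soc i \<approx> (soc j :: path \<Rightarrow> 'f)"
      using ij h K0_eq_iff[OF top_central_k(1)[OF top[OF ij(1)]] top_central_k(1)[OF top[OF ij(2)]]] by simp
    hence "(\<Sum>k\<in>{i, j}. scl (if k = i then 1 else - 1) (soc k :: path \<Rightarrow> 'f)) \<approx> 0"
      using ij(4) by (simp add: scl_minus_one eqv_def)
    from soc_independent[OF _ _ this, of i] show False using iI ij by auto
  qed
  interpret V: vectorspace class_ring "topHK :: ('f, 'f cochain set) module"
    by (simp add: vectorspace_def topHK_module class_field)
  have hc: "h ` I \<subseteq> carrier topHK" unfolding topHK_ops using h top by auto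
  have lc: "V.lincomb a (h ` I) = K0 (\<Sum>i\<in>I. scl (a (h i)) (soc i))" for a :: "'f cochain set \<Rightarrow> 'f"
  proof -
    have "V.lincomb a (h ` I) = (\<Oplus>\<^bsub>topHK\<^esub>i\<in>I. a (h i) \<odot>\<^bsub>topHK\<^esub> h i)"
      unfolding V.lincomb_def
    proof (rule V.finsum_reindex[OF _ inj], rule Pi_I)
      fix v assume "v \<in> h ` I"
      hence "v \<in> carrier topHK" using hc by blast
      thus "a v \<odot>\<^bsub>topHK\<^esub> v \<in> carrier topHK" by (rule V.smult_closed[rotated]) simp
    qed
    also have "\<dots> = (\<Oplus>\<^bsub>topHK\<^esub>i\<in>I. K0 (scl (a (h i)) (soc i)))"
    proof (rule V.finsum_cong')
      show "(\<lambda>i. K0 (scl (a (h i)) (soc i))) \<in> I \<rightarrow> carrier topHK"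
        unfolding topHK_ops by (auto intro!: imageI top_central_closed top)
      show "a (h i) \<odot>\<^bsub>topHK\<^esub> h i = K0 (scl (a (h i)) (soc i))" if "i \<in> I" for i
        using topHK_ops(4)[OF top_central_k(1)[OF top[OF that]], of "a (h i)"] h[OF that] by simp
    qed simp
    also have "\<dots> = K0 (\<Sum>i\<in>I. scl (a (h i)) (soc i))"
      by (rule topHK_finsum[OF I(1)]) (intro top_central_closed top)
    finally show ?thesis .
  qed
  have T: "(\<Sum>i\<in>I. scl (c i) (soc i)) \<in> (top_central :: (path \<Rightarrow> 'f) set)" for c
    by (intro top_central_sum top_central_closed top)
  have "V.lin_indpt (h ` I)"
  proof (rule V.finite_lin_indpt2[OF finite_imageI[OF I(1)] hc])
    fix a :: "'f cochain set \<Rightarrow> 'f" assume "V.lincomb a (h ` I) = \<zero>\<^bsub>topHK\<^esub>"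
    hence "K0 (\<Sum>i\<in>I. scl (a (h i)) (soc i)) = K0 0" unfolding lc topHK_ops .
    hence "(\<Sum>i\<in>I. scl (a (h i)) (soc i)) \<approx> 0"
      by (rule iffD1[OF K0_eq_iff[OF top_central_k(1)[OF T] top_central_k(1)[OF top_central_closed(1)]]])
    hence "a (h i) = 0" if "i \<in> I" for i
      using soc_independent[OF I, of "\<lambda>i. a (h i)"] that by blast
    thus "\<forall>v\<in>h ` I. a v = \<zero>\<^bsub>class_ring\<^esub>" by auto
  qed
  moreover have "V.span (h ` I) = carrier topHK"
  proof
    show "V.span (h ` I) \<subseteq> carrier topHK" by (rule V.span_is_subset2[OF hc])
    show "carrier topHK \<subseteq> V.span (h ` I)"
    proof
      fix x :: "'f cochain set" assume "x \<in> carrier topHK"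
      then obtain Z where Z: "Z \<in> top_central" "x = K0 Z" unfolding topHK_ops by blast
      let ?J = "{i. i < n \<and> end_of i = i}"
      obtain c where c: "Z \<approx> (\<Sum>i\<in>?J. scl (c i) (soc i))"
        using top_central_spanned[of Z] Z top_central_k(1)[OF Z(1)] by (auto simp: top_central_def)
      have J: "?J \<subseteq> I" using soc_central[where 'f = 'f] by (auto simp: I_def socle_elem_cl cl_centre_iff soc_PC)
      \<comment> \<open>Linear combinations are indexed by classes, so the coefficients are
        transported along the inverse of \<open>h\<close>; indices that are not loops receive the
        value 0.\<close>
      define a where "a v = (let i = inv_into I h v in if i \<in> ?J then c i else 0)" for v
      have "(\<Sum>i\<in>I. scl (a (h i)) (soc i)) = (\<Sum>i\<in>?J. scl (c i) (soc i :: path \<Rightarrow> 'f))"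
        by (rule sum.mono_neutral_cong_right[OF I(1) J]) (use J inj in \<open>auto simp: a_def subset_iff\<close>)
      hence "Z \<approx> (\<Sum>i\<in>I. scl (a (h i)) (soc i))" using c by (simp only:)
      hence "x = V.lincomb a (h ` I)"
        unfolding lc Z(2) by (rule iffD2[OF K0_eq_iff[OF top_central_k(1)[OF Z(1)] top_central_k(1)[OF T]]])
      thus "x \<in> V.span (h ` I)"
        unfolding V.finite_span[OF finite_imageI[OF I(1)] hc] by (auto simp: class_ring_simps)
    qed
  qed
  ultimately show "V.basis (h ` I)" unfolding V.basis_def using hc by blast
qed

end

theorem proposition6p11:
  fixes n :: nat
  assumes "n \<ge> 4"
  shows "(CHAR('f::field) = 2 \<longrightarrow>
            (\<forall>p. HK_hi_eq n p (carrier (HK n p :: ('f, 'f cochain set) module)))) \<and>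
         (CHAR('f) \<noteq> 2 \<longrightarrow>
            HK_hi_eq n 0 (HK_deg n 0 (2 * (n - 2)) :: 'f cochain set set) \<and>
            inj_on (\<lambda>i. HK0_of_central n (socle_elem n i) :: 'f cochain set)
              {i. i < n \<and> (socle_elem n i :: (path \<Rightarrow> 'f) set) \<in> centre n} \<and>
            lin_basis ((HK n 0)\<lparr>carrier := HK_deg n 0 (2 * (n - 2))\<rparr>)
              ((\<lambda>i. HK0_of_central n (socle_elem n i) :: 'f cochain set) `
                {i. i < n \<and> (socle_elem n i :: (path \<Rightarrow> 'f) set) \<in> centre n}) \<and>
            HK_hi_eq n 2 (carrier (HK n 2 :: ('f, 'f cochain set) module)) \<and>
            (\<forall>p. p \<noteq> 0 \<and> p \<noteq> 2 \<longrightarrow>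
               carrier (HK_hi n p :: ('f, 'f cochain set set) module) = {\<zero>\<^bsub>HK_hi n p\<^esub>}))"
proof (intro conjI impI)
  interpret type_D n by unfold_locales (rule assms)
  {
    assume "CHAR('f) = 2"
    hence two: "(2 :: 'f) = 0" using of_nat_CHAR[where 'a = 'f] by simp
    show "\<forall>p. HK_hi_eq n p (carrier (HK n p :: ('f, 'f cochain set) module))"
      using char_two[OF two] by blast
  }
  assume char: "CHAR('f) \<noteq> 2"
  have two: "(2 :: 'f) \<noteq> 0"
  proof
    assume "(2 :: 'f) = 0"
    hence "CHAR('f) dvd 2" using of_nat_eq_0_iff_char_dvd[where 'a = 'f, of 2] by simp
    hence "CHAR('f) = 1" using char by (metis dvd_imp_le le_antisym less_2_cases_iff nat_less_le
      not_one_less_zero dvd_0_left_iff zero_neq_numeral pos2 not_less_eq_eq One_nat_def)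
    thus False using CHAR_not_1'[where 'a = 'f] by simp
  qed
  show "HK_hi_eq n 0 (HK_deg n 0 (2 * (n - 2)) :: 'f cochain set set)" by (rule hi_0[OF two])
  show "inj_on (\<lambda>i. HK0_of_central n (socle_elem n i) :: 'f cochain set)
      {i. i < n \<and> (socle_elem n i :: (path \<Rightarrow> 'f) set) \<in> centre n}"
    and "lin_basis ((HK n 0)\<lparr>carrier := HK_deg n 0 (2 * (n - 2))\<rparr>)
      ((\<lambda>i. HK0_of_central n (socle_elem n i) :: 'f cochain set) `
        {i. i < n \<and> (socle_elem n i :: (path \<Rightarrow> 'f) set) \<in> centre n})"
    using socle_basis[where 'f = 'f] by blast+
  show "HK_hi_eq n 2 (carrier (HK n 2 :: ('f, 'f cochain set) module))" by (rule hi_2[OF two])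
  show "\<forall>p. p \<noteq> 0 \<and> p \<noteq> 2 \<longrightarrow>
      carrier (HK_hi n p :: ('f, 'f cochain set set) module) = {\<zero>\<^bsub>HK_hi n p\<^esub>}"
  proof (intro allI impI)
    fix p :: nat assume "p \<noteq> 0 \<and> p \<noteq> 2"
    then consider "p = Suc 0" | "3 \<le> p" by linarith
    thus "carrier (HK_hi n p :: ('f, 'f cochain set set) module) = {\<zero>\<^bsub>HK_hi n p\<^esub>}"
      using hi_1[OF two] hi_3 by cases auto
  qed
qed

end
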